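(* In the setting described in the context, let $\hat u_0(\mathbf z)\in H^1_0(D_{\mathrm{ref}})$ be the weak solution of $$-\operatorname{div}\big(\mathbf A_s(\mathbf z)\nabla\hat u_0(\mathbf z)\big)=f_{\mathrm{ref}}(\mathbf z)\ \text{ in }D_{\mathrm{ref}},\qquad \hat u_0(\mathbf z)=0\ \text{ on }\partial D_{\mathrm{ref}},$$ and let $\hat u_\varepsilon(\mathbf y,\mathbf z)\in H^1_0(D_{\mathrm{ref}})$ be the weak solution of $$-\operatorname{div}\big((\mathbf A_s(\mathbf z)+\varepsilon\mathbf A_r(\mathbf y,\mathbf z))\nabla\hat u_\varepsilon(\mathbf y,\mathbf z)\big)=f_{\mathrm{ref}}(\mathbf z)\ \text{ in }D_{\mathrm{ref}},\qquad \hat u_\varepsilon(\mathbf y,\mathbf z)=0\ \text{ on }\partial D_{\mathrm{ref}}.$$ Then, for $\varepsilon>0$ sufficiently small, $$\mathbb E[\hat u_\varepsilon]=\mathbb E[\hat u_0]+\mathcal O(\varepsilon^2)\quad\text{in }H^1_0(D_{\mathrm{ref}}),\qquad \mathbb V[\hat u_\varepsilon]=\mathbb V[\hat u_0]+\mathcal O(\varepsilon^2)\quad\text{in }W^{1,1}_0(D_{\mathrm{ref}}).$$ That is, there exist $\varepsilon_0>0$ and $C>0$ such that for all $0<\varepsilon\le\varepsilon_0$ one has $\|\mathbb E[\hat u_\varepsilon]-\mathbb E[\hat u_0]\|_{H^1_0(D_{\mathrm{ref}})}\le C\varepsilon^2$ and $\|\mathbb V[\hat u_\varepsilon]-\mathbb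 V[\hat u_0]\|_{W^{1,1}(D_{\mathrm{ref}})}\le C\varepsilon^2$, with $\mathbb V[\hat u_\varepsilon]-\mathbb V[\hat u_0]\in W^{1,1}_0(D_{\mathrm{ref}})$.
   Context: Reference domain: $D_{\mathrm{ref}}\subset\mathbb R^d$, $d\in\mathbb N$, is a bounded domain with Lipschitz boundary. Parameters: $\Gamma=[-1,1]$; $\mathbf y=(y_1,\dots,y_N)\in\Gamma^N$ and $\mathbf z=(z_1,\dots,z_M)\in\Gamma^M$ are the values of two mutually independent families of independent, identically distributed, centered random variables, with product probability densities $\rho_X(\mathbf y)=\prod_{k=1}^N\rho_{X,k}(y_k)$ and $\rho_Y(\mathbf z)=\prod_{k=1}^M\rho_{Y,k}(z_k)$ with respect to Lebesgue measure, so that $\int_\Gamma y_k\rho_{X,k}(y_k)\,dy_k=0$ and $\int_\Gamma z_k\rho_{Y,k}(z_k)\,dz_k=0$ for all $k$. "Almost every" $\mathbf y$, $\mathbf z$ is meant with respect to $\rho_X\,d\mathbf y$, $\rho_Y\,d\mathbf z$. Random domain: $\mathbf V(\mathbf X,\mathbf z)=\mathbb E[\mathbf V](\mathbf X)+\sum_{k=1}^M\sqrt{\mu_k}\,\boldsymbol\varphi_k(\mathbf X)z_k$ (a truncated Karhunen–Loève expansion; $\mu_k\ge0$, $\mathbb E[\mathbf V],\boldsymbol\varphi_k\in C^1(\overline{D_{\mathrm{ref}}};\mathbb R^d)$). For almost every $\mathbf z$, $\mathbf V(\cdot,\mathbf z)$ is a $C^1$-diffeomorphism of $\overline{D_{\mathrm{ref}}}$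 onto its image, with $D(\mathbf z)=\mathbf V(D_{\mathrm{ref}},\mathbf z)$, $\det\mathbf V'>0$, and $\|\mathbf V(\cdot,\mathbf z)\|_{C^1(\overline{D_{\mathrm{ref}}};\mathbb R^d)}\le C_{\mathrm{uni}}$, $\|\mathbf V(\cdot,\mathbf z)^{-1}\|_{C^1(\overline{D(\mathbf z)};\mathbb R^d)}\le C_{\mathrm{uni}}$ with $C_{\mathrm{uni}}$ independent of $\mathbf z$. Here $\mathbf V'$ is the Jacobian with respect to $\mathbf X$. The hold-all domain is $\mathcal D=\bigcup_{\mathbf z\in\Gamma^M}\mathbf V(D_{\mathrm{ref}},\mathbf z)$. Diffusion coefficient: $a(\mathbf x,\mathbf y)=a_s(\mathbf x)+\varepsilon a_r(\mathbf x,\mathbf y)$, where $a_s$ is a deterministic real-analytic function on $\mathcal D$ (real-analytic on an open neighbourhood of $\mathcal D$) with $0<\underline a\le a_s\le\overline a<\infty$ on $\mathcal D$, and $a_r(\mathbf x,\mathbf y)=\sum_{k=1}^N\sqrt{\lambda_k}\,\psi_k(\mathbf x)y_k$ (a truncated Karhunen–Loève expansion; $\lambda_k\ge0$, $\psi_k\in L^\infty(\mathcal D)$), with $\|a_r(\cdot,\mathbf y)\|_{L^\infty(D(\mathbf z))}\le1$ for almost every $(\mathbf y,\mathbf z)$. No smoothness of the $\psi_k$ is assumed. Load: $f\in L^2(\mathcal D)$. Transported data on $D_{\mathrm{ref}}$: $\mathbf A_s(\mathbf X,\mathbf z)=a_s(\mathbf V(\mathbf X,\mathbf z))\,(\mathbf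 V'^\top\mathbf V')^{-1}(\mathbf X,\mathbf z)\,\det\mathbf V'(\mathbf X,\mathbf z)$, $\mathbf A_r(\mathbf X,\mathbf y,\mathbf z)=a_r(\mathbf V(\mathbf X,\mathbf z),\mathbf y)\,(\mathbf V'^\top\mathbf V')^{-1}(\mathbf X,\mathbf z)\,\det\mathbf V'(\mathbf X,\mathbf z)$, $f_{\mathrm{ref}}(\mathbf X,\mathbf z)=f(\mathbf V(\mathbf X,\mathbf z))\,\det\mathbf V'(\mathbf X,\mathbf z)$. Expectation and variance: for $v=v(\mathbf X,\mathbf y,\mathbf z)$, $\mathbb E[v](\mathbf X)=\int_{\Gamma^N}\int_{\Gamma^M}v(\mathbf X,\mathbf y,\mathbf z)\rho_X(\mathbf y)\rho_Y(\mathbf z)\,d\mathbf z\,d\mathbf y$ (Bochner integral) and $\mathbb V[v](\mathbf X)=\int_{\Gamma^N}\int_{\Gamma^M}\big(v(\mathbf X,\mathbf y,\mathbf z)-\mathbb E[v](\mathbf X)\big)^2\rho_X(\mathbf y)\rho_Y(\mathbf z)\,d\mathbf z\,d\mathbf y$; functions of $\mathbf z$ only are regarded as constant in $\mathbf y$. *)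

theory Defs
  imports "HOL-Analysis.Analysis" "HOL-Probability.Essential_Supremum"
begin

subsection \<open>Lebesgue spaces, test functions and Sobolev spaces\<close>

text \<open>
  Elements of function spaces over \<open>D\<close> are represented by total functions, of which only the
  values on \<open>D\<close> matter, up to null sets; norms on them are thus seminorms.
\<close>

definition Lp :: "real \<Rightarrow> (real^'d) set \<Rightarrow> (real^'d \<Rightarrow> 'b::euclidean_space) set" where
  "Lp p D = {u. u \<in> borel_measurable (lebesgue_on D)
                \<and> integrable (lebesgue_on D) (\<lambda>x. norm (u x) powr p)}"

definition Linf_norm :: "(real^'d) set \<Rightarrow> (real^'d \<Rightarrow> real) \<Rightarrow> ereal" where
  "Linf_norm D u = esssup (lebesgue_on D) (\<lambda>x. ereal \<bar>u x\<bar>)"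

definition Linf :: "(real^'d) set \<Rightarrow> (real^'d \<Rightarrow> real) set" where
  "Linf D = {u. u \<in> borel_measurable (lebesgue_on D) \<and> Linf_norm D u < \<infinity>}"

definition partial_deriv :: "'d \<Rightarrow> (real^'d \<Rightarrow> real) \<Rightarrow> real^'d \<Rightarrow> real" where
  "partial_deriv i g x = frechet_derivative g (at x) (axis i 1)"

primrec k_times_cont_diff :: "nat \<Rightarrow> (real^'d \<Rightarrow> real) \<Rightarrow> bool" where
  "k_times_cont_diff 0 g \<longleftrightarrow> continuous_on UNIV g"
| "k_times_cont_diff (Suc k) g \<longleftrightarrow>
     (\<forall>x. g differentiable (at x)) \<and> (\<forall>i. k_times_cont_diff k (partial_deriv i g))"

definition test_functions :: "(real^'d) set \<Rightarrow> (real^'d \<Rightarrow> real) set" where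
  "test_functions D = {\<phi>. (\<forall>k. k_times_cont_diff k \<phi>)
     \<and> compact (closure {x. \<phi> x \<noteq> 0}) \<and> closure {x. \<phi> x \<noteq> 0} \<subseteq> D}"

definition has_weak_gradient ::
    "(real^'d) set \<Rightarrow> (real^'d \<Rightarrow> real) \<Rightarrow> (real^'d \<Rightarrow> real^'d) \<Rightarrow> bool" where
  "has_weak_gradient D u g \<longleftrightarrow>
     (\<forall>K. compact K \<and> K \<subseteq> D \<longrightarrow> u absolutely_integrable_on K \<and> g absolutely_integrable_on K)
     \<and> (\<forall>\<phi>\<in>test_functions D. \<forall>i.
          (LINT x|lebesgue_on D. u x * partial_deriv i \<phi> x)
            = - (LINT x|lebesgue_on D. g x $ i * \<phi> x))"

definition weak_grad :: "(real^'d) set \<Rightarrow> (real^'d \<Rightarrow> real) \<Rightarrow> real^'d \<Rightarrow> real^'d" where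
  "weak_grad D u = (SOME g. has_weak_gradient D u g)"

definition W1p :: "real \<Rightarrow> (real^'d) set \<Rightarrow> (real^'d \<Rightarrow> real) set" where
  "W1p p D = {u \<in> Lp p D. \<exists>g\<in>Lp p D. has_weak_gradient D u g}"

definition W1p_norm :: "real \<Rightarrow> (real^'d) set \<Rightarrow> (real^'d \<Rightarrow> real) \<Rightarrow> real" where
  "W1p_norm p D u = ((LINT x|lebesgue_on D. \<bar>u x\<bar> powr p)
                     + (LINT x|lebesgue_on D. norm (weak_grad D u x) powr p)) powr (1 / p)"

definition W1p_0 :: "real \<Rightarrow> (real^'d) set \<Rightarrow> (real^'d \<Rightarrow> real) set" where
  "W1p_0 p D = {u \<in> W1p p D. \<exists>\<phi>. (\<forall>n::nat. \<phi> n \<in> test_functions D)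
                  \<and> (\<lambda>n. W1p_norm p D (\<lambda>x. u x - \<phi> n x)) \<longlonglongrightarrow> 0}"

abbreviation H1_0 :: "(real^'d) set \<Rightarrow> (real^'d \<Rightarrow> real) set" where
  "H1_0 \<equiv> W1p_0 2"

definition weak_dirichlet_solution ::
    "(real^'d) set \<Rightarrow> (real^'d \<Rightarrow> real^'d^'d) \<Rightarrow> (real^'d \<Rightarrow> real) \<Rightarrow> (real^'d \<Rightarrow> real) \<Rightarrow> bool" where
  "weak_dirichlet_solution D A F u \<longleftrightarrow> u \<in> H1_0 D
     \<and> (\<forall>v\<in>H1_0 D.
          (LINT x|lebesgue_on D. (A x *v weak_grad D u x) \<bullet> weak_grad D v x)
            = (LINT x|lebesgue_on D. F x * v x))"


subsection \<open>Bochner integrals with values in Sobolev spaces, mean and variance\<close>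

text \<open>
  The library's Bochner integral needs a Banach space as a type, whereas \<open>W1p p D\<close> depends on
  the term \<open>D\<close>. So the textbook definition is spelled out: \<open>v\<close> is an almost
  everywhere limit of simple functions \<open>s n\<close> whose \<open>L\<^sup>1\<close> distance to \<open>v\<close> tends to zero, and the
  integral is the limit of the integrals of the \<open>s n\<close>. The almost everywhere convergence
  cannot be dropped: \<open>nn_integral\<close> of a nonmeasurable function is only a lower integral.
  For simple \<open>s n\<close>, the inner real integral is the finite sum defining the integral of \<open>s n\<close>,
  evaluated at a point.
\<close>

definition has_W1p_integral ::
    "real \<Rightarrow> (real^'d) set \<Rightarrow> 'w measure \<Rightarrow> ('w \<Rightarrow> real^'d \<Rightarrow> real) \<Rightarrow> (real^'d \<Rightarrow> real) \<Rightarrow> bool" where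
  "has_W1p_integral p D P v m \<longleftrightarrow> m \<in> W1p p D \<and> (AE w in P. v w \<in> W1p p D)
     \<and> (\<exists>s :: nat \<Rightarrow> 'w \<Rightarrow> real^'d \<Rightarrow> real.
          (\<forall>n. simple_function P (s n) \<and> (\<forall>w\<in>space P. s n w \<in> W1p p D)
               \<and> emeasure P {w \<in> space P. s n w \<noteq> (\<lambda>x. 0)} \<noteq> \<infinity>)
          \<and> (AE w in P. (\<lambda>n. W1p_norm p D (\<lambda>x. v w x - s n w x)) \<longlonglongrightarrow> 0)
          \<and> (\<lambda>n. \<integral>\<^sup>+w. ennreal (W1p_norm p D (\<lambda>x. v w x - s n w x)) \<partial>P) \<longlonglongrightarrow> 0
          \<and> (\<lambda>n. W1p_norm p D (\<lambda>x. m x - (\<integral>w. s n w x \<partial>P))) \<longlonglongrightarrow> 0)"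

definition W1p_integrable ::
    "real \<Rightarrow> (real^'d) set \<Rightarrow> 'w measure \<Rightarrow> ('w \<Rightarrow> real^'d \<Rightarrow> real) \<Rightarrow> bool" where
  "W1p_integrable p D P v \<longleftrightarrow> (\<exists>m. has_W1p_integral p D P v m)"

definition W1p_integral ::
    "real \<Rightarrow> (real^'d) set \<Rightarrow> 'w measure \<Rightarrow> ('w \<Rightarrow> real^'d \<Rightarrow> real) \<Rightarrow> real^'d \<Rightarrow> real" where
  "W1p_integral p D P v = (SOME m. has_W1p_integral p D P v m)"

definition mean_field ::
    "(real^'d) set \<Rightarrow> 'w measure \<Rightarrow> ('w \<Rightarrow> real^'d \<Rightarrow> real) \<Rightarrow> real^'d \<Rightarrow> real" where
  "mean_field D P v = W1p_integral 2 D P v"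

definition sq_deviation ::
    "(real^'d) set \<Rightarrow> 'w measure \<Rightarrow> ('w \<Rightarrow> real^'d \<Rightarrow> real) \<Rightarrow> 'w \<Rightarrow> real^'d \<Rightarrow> real" where
  "sq_deviation D P v w x = (v w x - mean_field D P v x)\<^sup>2"

definition variance_field ::
    "(real^'d) set \<Rightarrow> 'w measure \<Rightarrow> ('w \<Rightarrow> real^'d \<Rightarrow> real) \<Rightarrow> real^'d \<Rightarrow> real" where
  "variance_field D P v = W1p_integral 1 D P (sq_deviation D P v)"

definition has_mean_and_variance ::
    "(real^'d) set \<Rightarrow> 'w measure \<Rightarrow> ('w \<Rightarrow> real^'d \<Rightarrow> real) \<Rightarrow> bool" where
  "has_mean_and_variance D P v \<longleftrightarrow> W1p_integrable 2 D P v \<and> W1p_integrable 1 D P (sq_deviation D P v)"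


subsection \<open>Domains and regularity of the data\<close>

text \<open>
  Near each boundary point, in suitable Cartesian coordinates with last axis \<open>e\<close>, the set is
  the part of a ball that lies above the graph of a Lipschitz function on the hyperplane
  orthogonal to \<open>e\<close>.
\<close>

definition lipschitz_boundary :: "(real^'d) set \<Rightarrow> bool" where
  "lipschitz_boundary D \<longleftrightarrow> (\<forall>x\<in>frontier D. \<exists>r>0. \<exists>e L \<gamma>.
     norm e = 1 \<and> L-lipschitz_on {h. h \<bullet> e = 0} \<gamma>
     \<and> D \<inter> ball x r = {w \<in> ball x r. \<gamma> (w - (w \<bullet> e) *\<^sub>R e) < w \<bullet> e})"

definition bounded_lipschitz_domain :: "(real^'d) set \<Rightarrow> bool" where
  "bounded_lipschitz_domain D \<longleftrightarrow>
     open D \<and> connected D \<and> D \<noteq> {} \<and> bounded D \<and> lipschitz_boundary D"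

text \<open>\<open>C1_closure U\<close> is \<open>C\<^sup>1\<close> of the closure of the open set \<open>U\<close>: the derivative in \<open>U\<close> extends
  continuously to the closure.\<close>

definition C1_closure :: "(real^'d) set \<Rightarrow> (real^'d \<Rightarrow> real^'d) set" where
  "C1_closure U = {g. continuous_on (closure U) g
     \<and> (\<exists>g' :: real^'d \<Rightarrow> ((real^'d) \<Rightarrow>\<^sub>L (real^'d)). continuous_on (closure U) g'
          \<and> (\<forall>x\<in>U. (g has_derivative blinfun_apply (g' x)) (at x)))}"

text \<open>By continuity, the suprema over \<open>U\<close> agree with those over the closure of \<open>U\<close>.\<close>

definition C1_norm :: "(real^'d) set \<Rightarrow> (real^'d \<Rightarrow> real^'d) \<Rightarrow> real" where
  "C1_norm U g = (SUP x\<in>U. norm (g x)) + (SUP x\<in>U. onorm (frechet_derivative g (at x)))"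

text \<open>If \<open>U\<close> is open and bounded and \<open>W\<close> is continuous and injective on its closure, then \<open>W ` U\<close>
  is open (invariance of domain) and has closure \<open>W ` closure U\<close> (compactness).\<close>

definition C1_diffeo_closure :: "(real^'d) set \<Rightarrow> (real^'d \<Rightarrow> real^'d) \<Rightarrow> bool" where
  "C1_diffeo_closure U W \<longleftrightarrow> inj_on W (closure U) \<and> W \<in> C1_closure U
     \<and> inv_into (closure U) W \<in> C1_closure (W ` U)"

text \<open>Multi-indices are functions \<open>\<alpha> :: 'd \<Rightarrow> nat\<close>; \<open>has_sum\<close> is absolute convergence here.\<close>

definition real_analytic_on :: "(real^'d) set \<Rightarrow> (real^'d \<Rightarrow> real) \<Rightarrow> bool" where
  "real_analytic_on U g \<longleftrightarrow> (\<forall>x\<in>U. \<exists>r>0. \<exists>c :: ('d \<Rightarrow> nat) \<Rightarrow> real.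
     \<forall>h\<in>ball 0 r. ((\<lambda>\<alpha>. c \<alpha> * (\<Prod>i\<in>UNIV. (h $ i) ^ \<alpha> i)) has_sum g (x + h)) UNIV)"


subsection \<open>Random parameters and transported data\<close>

definition parameter_box :: "(real^'k) set" where
  "parameter_box = {t. \<forall>k. t $ k \<in> {-1..1}}"

text \<open>Marginal densities on \<open>[-1, 1]\<close> of independent, identically distributed, centred variables.\<close>

definition iid_centred_densities :: "('k \<Rightarrow> real \<Rightarrow> real) \<Rightarrow> bool" where
  "iid_centred_densities \<rho> \<longleftrightarrow>
     (\<forall>k. \<rho> k \<in> borel_measurable borel \<and> (\<forall>t\<in>{-1..1}. 0 \<le> \<rho> k t)
          \<and> set_integrable lborel {-1..1} (\<rho> k)
          \<and> (LBINT t:{-1..1}. \<rho> k t) = 1 \<and> (LBINT t:{-1..1}. t * \<rho> k t) = 0)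
     \<and> (\<forall>k l. AE t in lborel. t \<in> {-1..1} \<longrightarrow> \<rho> k t = \<rho> l t)"

definition parameter_law :: "('k \<Rightarrow> real \<Rightarrow> real) \<Rightarrow> (real^'k) measure" where
  "parameter_law \<rho> = density lborel
     (\<lambda>t. ennreal (indicator parameter_box t * (\<Prod>k\<in>UNIV. \<rho> k (t $ k))))"

definition kl_expansion ::
    "('x \<Rightarrow> 'b::real_vector) \<Rightarrow> ('k::finite \<Rightarrow> real) \<Rightarrow> ('k \<Rightarrow> 'x \<Rightarrow> 'b) \<Rightarrow> real^'k \<Rightarrow> 'x \<Rightarrow> 'b" where
  "kl_expansion m \<sigma> \<eta> t x = m x + (\<Sum>k\<in>UNIV. (sqrt (\<sigma> k) * t $ k) *\<^sub>R \<eta> k x)"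

definition hold_all :: "(real^'m \<Rightarrow> real^'d \<Rightarrow> real^'d) \<Rightarrow> (real^'d) set \<Rightarrow> (real^'d) set" where
  "hold_all V D = (\<Union>z\<in>parameter_box. V z ` D)"

definition transported_coeff ::
    "(real^'d \<Rightarrow> real^'d) \<Rightarrow> (real^'d \<Rightarrow> real) \<Rightarrow> real^'d \<Rightarrow> real^'d^'d" where
  "transported_coeff W a X =
     (let J = jacobian W (at X) in (a (W X) * det J) *\<^sub>R matrix_inv (transpose J ** J))"

definition transported_load ::
    "(real^'d \<Rightarrow> real^'d) \<Rightarrow> (real^'d \<Rightarrow> real) \<Rightarrow> real^'d \<Rightarrow> real" where
  "transported_load W f X = f (W X) * det (jacobian W (at X))"

end

theory Submission
  imports Defs "HOL-Computational_Algebra.Polynomial" "HOL-Probability.Probability_Measure"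
begin

text \<open>
  Let \<open>w = u\<^sub>\<epsilon> - u\<^sub>0\<close>. Uniform ellipticity gives \<open>\<parallel>w\<parallel> = O(\<epsilon>)\<close> in \<open>H\<^sup>1\<^sub>0\<close>, uniformly in the parameters.
  Subtracting the two equations for fixed \<open>z\<close> leaves
  \<open>\<integral> A\<^sub>s \<nabla>w \<bullet> \<nabla>v = - \<epsilon> \<integral> A\<^sub>r \<nabla>u\<^sub>0 \<bullet> \<nabla>v - \<epsilon> \<integral> A\<^sub>r \<nabla>w \<bullet> \<nabla>v\<close>. The first term on the right is linear in
  the centred variable \<open>y\<close>, because \<open>u\<^sub>0\<close> does not depend on \<open>y\<close>, so it disappears in the mean over \<open>y\<close>,
  and the second is \<open>O(\<epsilon>\<^sup>2)\<close>. Hence the mean of \<open>w\<close> over \<open>y\<close> is \<open>O(\<epsilon>\<^sup>2)\<close> for every \<open>z\<close>, and so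
  is \<open>h = E[w]\<close>. With \<open>b = u\<^sub>0 - E[u\<^sub>0]\<close>, the difference of the squared deviations is
  \<open>2wb - 2hb + (w - h)\<^sup>2\<close>; as \<open>b\<close> does not depend on \<open>y\<close>, the mean of \<open>wb\<close> is again \<open>O(\<epsilon>\<^sup>2)\<close>.

  Existence of the Bochner integrals rests on the fact that \<open>u\<^sub>\<epsilon>(y, z)\<close> depends continuously
  on \<open>(y, z)\<close> in \<open>H\<^sup>1\<^sub>0\<close>, although \<open>\<psi>\<^sub>k\<close> and \<open>f\<close> are merely measurable: composition with a convergent sequence of
  diffeomorphisms of uniformly bounded distortion is continuous in \<open>L\<^sup>2\<close>. Norms of integrals are
  estimated by duality, with functionals that attain the norm up to a constant factor.
\<close>

text \<open>The Sobolev spaces depend on the term \<open>D\<close>, so no function here is an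
  element of a Banach space type: functions are total, \<open>weak_grad\<close> is an arbitrary
  representative and norms are seminorms. Linear identities for gradients hold only almost
  everywhere, and the two spaces are treated together through an exponent \<open>p\<close> in {1,
  2}. Solutions are given for almost every parameter only, by families without any assumed
  measurability. So a bounded Borel set \<open>G\<close> of full measure is fixed on which all
  hypotheses hold; continuity relative to \<open>G\<close> yields measurability, and finite nets
  inside \<open>G\<close> yield the simple functions of the Bochner integral. The equation can be
  averaged over y only at fixed z, because the geometric factor depends on z. Constants must be
  uniform in z, so preimage measures and ellipticity are bounded in terms of one distortion constant
  \<open>L\<close>. The threshold for \<epsilon> is half the lower bound of the coefficient, which
  preserves ellipticity, capped by 1 to absorb \<epsilon>^2 into \<epsilon> in the variance.\<close>

section \<open>Square-integrable functions and the Cauchy-Schwarz inequality\<close>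

definition square_integrable :: "'a measure \<Rightarrow> ('a \<Rightarrow> 'b::euclidean_space) \<Rightarrow> bool" where
  "square_integrable M u \<longleftrightarrow> u \<in> borel_measurable M \<and> integrable M (\<lambda>x. (norm (u x))\<^sup>2)"

definition l2_norm :: "'a measure \<Rightarrow> ('a \<Rightarrow> 'b::euclidean_space) \<Rightarrow> real" where
  "l2_norm M u = sqrt (LINT x|M. (norm (u x))\<^sup>2)"

lemma square_integrable_measurable: "square_integrable M u \<Longrightarrow> u \<in> borel_measurable M"
  by (simp add: square_integrable_def)

lemma square_integrable_norm2: "square_integrable M u \<Longrightarrow> integrable M (\<lambda>x. (norm (u x))\<^sup>2)"
  by (simp add: square_integrable_def)

lemma l2_norm_nonneg [simp]: "0 \<le> l2_norm M u"
  by (simp add: l2_norm_def)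

lemma l2_norm_power2: "(l2_norm M u)\<^sup>2 = (LINT x|M. (norm (u x))\<^sup>2)"
  by (simp add: l2_norm_def)

lemma square_integrable_bound:
  assumes "square_integrable M u" "v \<in> borel_measurable M"
    and "AE x in M. norm (v x) \<le> c * norm (u x)"
  shows "square_integrable M v"
proof -
  have "integrable M (\<lambda>x. (norm (v x))\<^sup>2)"
  proof (rule Bochner_Integration.integrable_bound)
    show "integrable M (\<lambda>x. c\<^sup>2 * (norm (u x))\<^sup>2)"
      using assms(1) by (simp add: square_integrable_def)
    show "(\<lambda>x. (norm (v x))\<^sup>2) \<in> borel_measurable M" using assms(2) by measurable
    show "AE x in M. norm ((norm (v x))\<^sup>2) \<le> norm (c\<^sup>2 * (norm (u x))\<^sup>2)"
      using assms(3)
    proof eventually_elim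
      case (elim x)
      have "(norm (v x))\<^sup>2 \<le> (c * norm (u x))\<^sup>2" using elim by (intro power_mono) auto
      then show ?case by (simp add: power_mult_distrib)
    qed
  qed
  then show ?thesis using assms(2) by (simp add: square_integrable_def)
qed

lemma l2_norm_mono:
  assumes "square_integrable M u" "v \<in> borel_measurable M" "0 \<le> c"
    and "AE x in M. norm (v x) \<le> c * norm (u x)"
  shows "l2_norm M v \<le> c * l2_norm M u"
proof -
  have v: "square_integrable M v" using assms square_integrable_bound by blast
  have "(LINT x|M. (norm (v x))\<^sup>2) \<le> (LINT x|M. c\<^sup>2 * (norm (u x))\<^sup>2)"
  proof (rule integral_mono_AE)
    show "AE x in M. (norm (v x))\<^sup>2 \<le> c\<^sup>2 * (norm (u x))\<^sup>2"
      using assms(4)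
    proof eventually_elim
      case (elim x)
      have "(norm (v x))\<^sup>2 \<le> (c * norm (u x))\<^sup>2" using elim by (intro power_mono) auto
      then show ?case by (simp add: power_mult_distrib)
    qed
  qed (use assms(1) v in \<open>auto simp: square_integrable_def\<close>)
  then have "(l2_norm M v)\<^sup>2 \<le> (c * l2_norm M u)\<^sup>2"
    by (simp add: l2_norm_power2 power_mult_distrib)
  then show ?thesis by (rule power2_le_imp_le) (simp add: assms(3))
qed

lemma square_integrable_scaleR:
  "square_integrable M u \<Longrightarrow> square_integrable M (\<lambda>x. c *\<^sub>R u x)"
  by (rule square_integrable_bound[where c="\<bar>c\<bar>"]) (auto simp: square_integrable_def)

lemma square_integrable_mult:
  fixes u :: "'a \<Rightarrow> real"
  shows "square_integrable M u \<Longrightarrow> square_integrable M (\<lambda>x. c * u x)"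
  using square_integrable_scaleR[of M u c] by simp

lemma square_integrable_norm_mult:
  assumes "square_integrable M u" "square_integrable M v"
  shows "integrable M (\<lambda>x. norm (u x) * norm (v x))"
proof (rule Bochner_Integration.integrable_bound)
  show "integrable M (\<lambda>x. (norm (u x))\<^sup>2 + (norm (v x))\<^sup>2)"
    using assms by (simp add: square_integrable_def)
  show "(\<lambda>x. norm (u x) * norm (v x)) \<in> borel_measurable M"
    using assms[THEN square_integrable_measurable] by measurable
  show "AE x in M. norm (norm (u x) * norm (v x)) \<le> norm ((norm (u x))\<^sup>2 + (norm (v x))\<^sup>2)"
  proof (rule AE_I2)
    fix x
    have nn: "0 \<le> norm (u x) * norm (v x)" by simp
    have "0 \<le> (norm (u x) - norm (v x))\<^sup>2" by simp
    then have "2 * (norm (u x) * norm (v x)) \<le> (norm (u x))\<^sup>2 + (norm (v x))\<^sup>2"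
      by (simp add: power2_diff)
    then have "norm (u x) * norm (v x) \<le> (norm (u x))\<^sup>2 + (norm (v x))\<^sup>2"
      using nn by linarith
    then show "norm (norm (u x) * norm (v x)) \<le> norm ((norm (u x))\<^sup>2 + (norm (v x))\<^sup>2)"
      using nn by simp
  qed
qed

lemma integrable_square_integrable_bound:
  fixes h :: "'a \<Rightarrow> 'c::euclidean_space"
  assumes "square_integrable M u" "square_integrable M v" "h \<in> borel_measurable M"
    and "AE x in M. norm (h x) \<le> c * (norm (u x) * norm (v x))"
  shows "integrable M h"
proof (rule Bochner_Integration.integrable_bound)
  show "integrable M (\<lambda>x. c * (norm (u x) * norm (v x)))"
    using square_integrable_norm_mult[OF assms(1,2)] by simp
  show "AE x in M. norm (h x) \<le> norm (c * (norm (u x) * norm (v x)))"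
    using assms(4) by eventually_elim (metis abs_ge_self order_trans real_norm_def)
qed (fact assms(3))

text \<open>Young's inequality with weights \<open>b / (2 * a)\<close> and
  \<open>a / (2 * b)\<close>, for which both terms integrate to half of \<open>a * b\<close>. The
  weights divide by the norms, so a vanishing norm is treated separately: then one factor is zero
  almost everywhere.\<close>

lemma l2_norm_Cauchy_Schwarz:
  assumes u: "square_integrable M u" and v: "square_integrable M v"
  shows "(LINT x|M. norm (u x) * norm (v x)) \<le> l2_norm M u * l2_norm M v"
proof (cases "l2_norm M u = 0 \<or> l2_norm M v = 0")
  case True
  have "AE x in M. u x = 0 \<or> v x = 0"
  proof (cases "l2_norm M u = 0")
    case True
    then have "(LINT x|M. (norm (u x))\<^sup>2) = 0" by (simp add: l2_norm_def)
    then have "AE x in M. (norm (u x))\<^sup>2 = 0"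
      using integral_nonneg_eq_0_iff_AE[OF square_integrable_norm2[OF u]] by simp
    then show ?thesis by eventually_elim simp
  next
    case False
    then have "(LINT x|M. (norm (v x))\<^sup>2) = 0" using True by (simp add: l2_norm_def)
    then have "AE x in M. (norm (v x))\<^sup>2 = 0"
      using integral_nonneg_eq_0_iff_AE[OF square_integrable_norm2[OF v]] by simp
    then show ?thesis by eventually_elim simp
  qed
  then have "AE x in M. norm (u x) * norm (v x) = 0" by eventually_elim auto
  then have "(LINT x|M. norm (u x) * norm (v x)) = 0" by (rule integral_eq_zero_AE)
  then show ?thesis by simp
next
  case False
  define a b where "a = l2_norm M u" and "b = l2_norm M v"
  have a: "0 < a" and b: "0 < b" using False by (auto simp: a_def b_def less_le)
  have "(LINT x|M. norm (u x) * norm (v x))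
      \<le> (LINT x|M. (b / (2 * a)) * (norm (u x))\<^sup>2 + (a / (2 * b)) * (norm (v x))\<^sup>2)"
  proof (rule integral_mono)
    show "norm (u x) * norm (v x) \<le> (b / (2 * a)) * (norm (u x))\<^sup>2 + (a / (2 * b)) * (norm (v x))\<^sup>2" for x
    proof -
      have "0 \<le> (b * norm (u x) - a * norm (v x))\<^sup>2" by simp
      then have "2 * (a * b) * (norm (u x) * norm (v x)) \<le> b\<^sup>2 * (norm (u x))\<^sup>2 + a\<^sup>2 * (norm (v x))\<^sup>2"
        by (simp add: power2_diff power_mult_distrib algebra_simps)
      then have "norm (u x) * norm (v x) \<le> (b\<^sup>2 * (norm (u x))\<^sup>2 + a\<^sup>2 * (norm (v x))\<^sup>2) / (2 * (a * b))"
        using a b by (simp add: field_simps)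
      also have "\<dots> = (b / (2 * a)) * (norm (u x))\<^sup>2 + (a / (2 * b)) * (norm (v x))\<^sup>2"
        using a b by (simp add: field_simps power2_eq_square)
      finally show ?thesis .
    qed
  qed (use u v square_integrable_norm_mult in \<open>auto simp: square_integrable_def\<close>)
  also have "\<dots> = (b / (2 * a)) * a\<^sup>2 + (a / (2 * b)) * b\<^sup>2"
    using u v by (simp add: a_def b_def l2_norm_power2 square_integrable_def)
  also have "\<dots> = a * b" using a b by (simp add: field_simps power2_eq_square)
  finally show ?thesis by (simp add: a_def b_def)
qed

lemma l2_norm_bilinear_bound:
  fixes h :: "'a \<Rightarrow> 'c::euclidean_space"
  assumes "square_integrable M u" "square_integrable M v" "h \<in> borel_measurable M" "0 \<le> c"
    and "AE x in M. norm (h x) \<le> c * (norm (u x) * norm (v x))"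
  shows "norm (LINT x|M. h x) \<le> c * (l2_norm M u * l2_norm M v)"
proof -
  have "norm (LINT x|M. h x) \<le> (LINT x|M. c * (norm (u x) * norm (v x)))"
  proof -
    have "norm (LINT x|M. h x) \<le> (LINT x|M. norm (h x))" by simp
    also have "\<dots> \<le> (LINT x|M. c * (norm (u x) * norm (v x)))"
      using integrable_square_integrable_bound[OF assms(1,2,3,5)] square_integrable_norm_mult[OF assms(1,2)]
      by (intro integral_mono_AE assms(5)) auto
    finally show ?thesis .
  qed
  also have "\<dots> = c * (LINT x|M. norm (u x) * norm (v x))" by simp
  also have "\<dots> \<le> c * (l2_norm M u * l2_norm M v)"
    using l2_norm_Cauchy_Schwarz[OF assms(1,2)] assms(4) by (rule mult_left_mono)
  finally show ?thesis .
qed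

lemma square_integrable_add:
  assumes u: "square_integrable M u" and v: "square_integrable M v"
  shows "square_integrable M (\<lambda>x. u x + v x)"
proof -
  have "integrable M (\<lambda>x. (norm (u x + v x))\<^sup>2)"
  proof (rule Bochner_Integration.integrable_bound)
    show "integrable M (\<lambda>x. (norm (u x))\<^sup>2 + 2 * (norm (u x) * norm (v x)) + (norm (v x))\<^sup>2)"
      using u v square_integrable_norm_mult[OF u v] by (auto simp: square_integrable_def)
    show "(\<lambda>x. (norm (u x + v x))\<^sup>2) \<in> borel_measurable M"
      using u[THEN square_integrable_measurable] v[THEN square_integrable_measurable] by measurable
    show "AE x in M. norm ((norm (u x + v x))\<^sup>2)
        \<le> norm ((norm (u x))\<^sup>2 + 2 * (norm (u x) * norm (v x)) + (norm (v x))\<^sup>2)"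
    proof (rule AE_I2)
      fix x
      have "(norm (u x + v x))\<^sup>2 \<le> (norm (u x) + norm (v x))\<^sup>2"
        by (intro power_mono norm_triangle_ineq norm_ge_zero)
      then show "norm ((norm (u x + v x))\<^sup>2)
          \<le> norm ((norm (u x))\<^sup>2 + 2 * (norm (u x) * norm (v x)) + (norm (v x))\<^sup>2)"
        by (simp add: power2_sum algebra_simps)
    qed
  qed
  moreover have "(\<lambda>x. u x + v x) \<in> borel_measurable M"
    using u[THEN square_integrable_measurable] v[THEN square_integrable_measurable] by measurable
  ultimately show ?thesis by (simp add: square_integrable_def)
qed

lemma square_integrable_diff:
  "square_integrable M u \<Longrightarrow> square_integrable M v \<Longrightarrow> square_integrable M (\<lambda>x. u x - v x)"
  using square_integrable_add[of M u "\<lambda>x. (-1) *\<^sub>R v x"] square_integrable_scaleR[of M v "-1"] by simp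

lemma l2_norm_triangle:
  assumes u: "square_integrable M u" and v: "square_integrable M v"
  shows "l2_norm M (\<lambda>x. u x + v x) \<le> l2_norm M u + l2_norm M v"
proof (rule power2_le_imp_le)
  have "(l2_norm M (\<lambda>x. u x + v x))\<^sup>2
      \<le> (LINT x|M. (norm (u x))\<^sup>2 + 2 * (norm (u x) * norm (v x)) + (norm (v x))\<^sup>2)"
    unfolding l2_norm_power2
  proof (rule integral_mono)
    show "(norm (u x + v x))\<^sup>2 \<le> (norm (u x))\<^sup>2 + 2 * (norm (u x) * norm (v x)) + (norm (v x))\<^sup>2" for x
    proof -
      have "(norm (u x + v x))\<^sup>2 \<le> (norm (u x) + norm (v x))\<^sup>2"
        by (intro power_mono norm_triangle_ineq norm_ge_zero)
      then show ?thesis by (simp add: power2_sum algebra_simps)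
    qed
  qed (use square_integrable_add[OF u v] u v square_integrable_norm_mult[OF u v] in
        \<open>simp_all add: square_integrable_def\<close>)
  also have "\<dots> = (l2_norm M u)\<^sup>2 + 2 * (LINT x|M. norm (u x) * norm (v x)) + (l2_norm M v)\<^sup>2"
    using u v square_integrable_norm_mult[OF u v] by (simp add: square_integrable_def l2_norm_power2)
  also have "\<dots> \<le> (l2_norm M u + l2_norm M v)\<^sup>2"
    using l2_norm_Cauchy_Schwarz[OF u v] by (simp add: power2_sum)
  finally show "(l2_norm M (\<lambda>x. u x + v x))\<^sup>2 \<le> (l2_norm M u + l2_norm M v)\<^sup>2" .
qed simp

lemma l2_norm_cong_AE:
  assumes "u \<in> borel_measurable M" "v \<in> borel_measurable M" "AE x in M. u x = v x"
  shows "l2_norm M u = l2_norm M v"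
proof -
  have "(LINT x|M. (norm (u x))\<^sup>2) = (LINT x|M. (norm (v x))\<^sup>2)"
    using assms(3) by (intro integral_cong_AE) (use assms in \<open>auto elim!: eventually_mono\<close>)
  then show ?thesis by (simp add: l2_norm_def)
qed

lemma l2_norm_scaleR: "l2_norm M (\<lambda>x. c *\<^sub>R u x) = \<bar>c\<bar> * l2_norm M u"
  by (simp add: l2_norm_def power_mult_distrib real_sqrt_mult)

lemma square_integrable_imp_integrable:
  assumes "finite_measure M" "square_integrable M u"
  shows "integrable M u"
proof -
  have u: "u \<in> borel_measurable M" using assms(2) by (simp add: square_integrable_def)
  show ?thesis
  proof (rule Bochner_Integration.integrable_bound[OF _ u])
    show "integrable M (\<lambda>x. 1 + (norm (u x))\<^sup>2)"
      using assms by (simp add: square_integrable_def finite_measure.integrable_const)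
    show "AE x in M. norm (u x) \<le> norm (1 + (norm (u x))\<^sup>2)"
    proof (rule AE_I2)
      fix x
      have "0 \<le> (norm (u x) - 1)\<^sup>2" by simp
      then have "2 * norm (u x) \<le> 1 + (norm (u x))\<^sup>2" by (simp add: power2_diff)
      moreover have "0 \<le> norm (u x)" by simp
      ultimately have "norm (u x) \<le> 1 + (norm (u x))\<^sup>2" by linarith
      then show "norm (u x) \<le> norm (1 + (norm (u x))\<^sup>2)" by simp
    qed
  qed
qed

lemma square_integrable_bounded:
  assumes "finite_measure M" "u \<in> borel_measurable M" "AE x in M. norm (u x) \<le> c"
  shows "square_integrable M u"
proof -
  interpret finite_measure M by fact
  have "square_integrable M (\<lambda>x. 1::real)" by (simp add: square_integrable_def)
  then show ?thesis by (rule square_integrable_bound[where c=c]) (use assms(2,3) in auto)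
qed

text \<open>The elementary bound \<open>t \<le> \<delta> + t\<^sup>p / \<delta>\<close> for \<open>p \<in> {1, 2}\<close> makes the rapidly converging
  subsequence of the Riesz--Fischer argument absolutely summable for both exponents at once.\<close>

lemma Lp_complete:
  fixes u :: "nat \<Rightarrow> 'a \<Rightarrow> 'b::euclidean_space" and p :: nat
  assumes p: "p \<in> {1, 2}"
    and [measurable]: "\<And>n. u n \<in> borel_measurable M"
    and Cauchy: "\<And>e. 0 < e \<Longrightarrow>
      \<exists>N. \<forall>m\<ge>N. \<forall>n\<ge>N. (\<integral>\<^sup>+x. ennreal (norm (u m x - u n x) ^ p) \<partial>M) \<le> ennreal e"
  shows "\<exists>v\<in>borel_measurable M. (\<lambda>n. \<integral>\<^sup>+x. ennreal (norm (u n x - v x) ^ p) \<partial>M) \<longlonglongrightarrow> 0"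
proof -
  have "\<exists>N. \<forall>m\<ge>N. \<forall>n\<ge>N. (\<integral>\<^sup>+x. ennreal (norm (u m x - u n x) ^ p) \<partial>M) \<le> ennreal ((1/4)^k)" for k :: nat
    by (rule Cauchy) simp
  then obtain N where N: "\<And>k m n. N k \<le> m \<Longrightarrow> N k \<le> n \<Longrightarrow>
      (\<integral>\<^sup>+x. ennreal (norm (u m x - u n x) ^ p) \<partial>M) \<le> ennreal ((1/4)^k)"
    by metis
  \<comment> \<open>Dominates \<open>N j\<close> for all \<open>j \<le> k\<close> at once, so both
    \<open>r k\<close> and \<open>r (Suc k)\<close> lie beyond \<open>N k\<close>. The summand
    \<open>k\<close> drives \<open>r\<close> to infinity, which the final estimate relies
    on.\<close>
  define r where "r k = (\<Sum>i\<le>k. N i) + k" for k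
  have r_ge: "N j \<le> r k" if "j \<le> k" for j k
    using member_le_sum[of j "{..k}" N] that by (simp add: r_def)
  \<comment> \<open>The integral of its \<open>p\<close>-th power is at most \<open>(1/4)^k\<close>;
    this leaves room for the weight \<open>2^k\<close>, that is, for \<delta> = (1/2)^k in the
    elementary bound.\<close>
  define d where "d k x = norm (u (r (Suc k)) x - u (r k) x)" for k x
  have d_meas [measurable]: "d k \<in> borel_measurable M" for k unfolding d_def by measurable
  have "(\<integral>\<^sup>+x. (\<Sum>k. ennreal (2^k * d k x ^ p)) \<partial>M) = (\<Sum>k. \<integral>\<^sup>+x. ennreal (2^k * d k x ^ p) \<partial>M)"
    by (rule nn_integral_suminf) measurable
  also have "\<dots> \<le> (\<Sum>k. ennreal ((1/2)^k))"
  proof (rule suminf_le)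
    fix k
    have "(\<integral>\<^sup>+x. ennreal (2^k * d k x ^ p) \<partial>M) = ennreal (2^k) * (\<integral>\<^sup>+x. ennreal (d k x ^ p) \<partial>M)"
      by (subst nn_integral_cmult[symmetric]) (auto simp: ennreal_mult' d_def)
    also have "\<dots> \<le> ennreal (2^k) * ennreal ((1/4)^k)"
      unfolding d_def by (intro mult_left_mono N r_ge) auto
    also have "\<dots> = ennreal ((1/2)^k)"
      by (simp add: ennreal_mult'[symmetric] power_mult_distrib[symmetric])
    finally show "(\<integral>\<^sup>+x. ennreal (2^k * d k x ^ p) \<partial>M) \<le> ennreal ((1/2)^k)" .
  qed auto
  also have "\<dots> < \<infinity>"
  proof -
    have "(\<Sum>k. ennreal ((1/2)^k)) \<noteq> top"
      by (rule ennreal_suminf_neq_top) (auto intro: summable_geometric)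
    then show ?thesis by (simp only: less_top infinity_ennreal_def)
  qed
  finally have "(\<integral>\<^sup>+x. (\<Sum>k. ennreal (2^k * d k x ^ p)) \<partial>M) \<noteq> \<infinity>" by simp
  then have AE1: "AE x in M. (\<Sum>k. ennreal (2^k * d k x ^ p)) \<noteq> \<infinity>"
    by (intro nn_integral_noteq_infinite) measurable
  define v where "v x = lim (\<lambda>k. u (r k) x)" for x
  have v_meas [measurable]: "v \<in> borel_measurable M"
    unfolding v_def by (rule borel_measurable_lim_metric) measurable
  have AE2: "AE x in M. (\<lambda>k. u (r k) x) \<longlonglongrightarrow> v x"
    using AE1
  proof eventually_elim
    case (elim x)
    have "summable (\<lambda>k. 2^k * d k x ^ p)"
      using elim by (intro summable_suminf_not_top) (auto simp: d_def)
    then have "summable (\<lambda>k. (1/2)^k + 2^k * d k x ^ p)"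
      by (intro summable_add summable_geometric) auto
    then have "summable (\<lambda>k. d k x)"
    proof (rule summable_comparison_test'[where N=0])
      fix k
      have key: "t \<le> s + t^p / s" if "0 < s" "s \<le> 1" "0 \<le> t" for t s :: real
      proof (cases "t \<le> s")
        case True
        moreover have "0 \<le> t^p / s" using that by simp
        ultimately show ?thesis by linarith
      next
        case False
        then have "t * s \<le> t^p" using p that
          by (auto simp: power2_eq_square mult_left_le intro: mult_left_mono)
        then have "t \<le> t^p / s" using that by (simp add: pos_le_divide_eq)
        then show ?thesis using that by simp
      qed
      have "d k x \<le> (1/2)^k + d k x ^ p / (1/2)^k"
        by (rule key) (auto simp: d_def power_le_one)
      then show "norm (d k x) \<le> (1/2)^k + 2^k * d k x ^ p"
        by (simp add: d_def power_divide field_simps)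
    qed
    then have "summable (\<lambda>k. u (r (Suc k)) x - u (r k) x)"
      unfolding d_def by (rule summable_norm_cancel)
    then have "convergent (\<lambda>n. \<Sum>k<n. u (r (Suc k)) x - u (r k) x)"
      by (simp add: summable_iff_convergent)
    then have "convergent (\<lambda>n. u (r n) x - u (r 0) x)"
      by (simp only: sum_lessThan_telescope[of "\<lambda>k. u (r k) x"])
    then have "convergent (\<lambda>n. u (r 0) x + (u (r n) x - u (r 0) x))"
      by (intro convergent_add convergent_const)
    then show ?case by (simp add: v_def convergent_LIMSEQ_iff)
  qed
  have "(\<lambda>n. \<integral>\<^sup>+x. ennreal (norm (u n x - v x) ^ p) \<partial>M) \<longlonglongrightarrow> 0"
  proof (rule order_tendstoI)
    fix a :: ennreal assume "0 < a"
    then obtain e where e: "0 < e" "ennreal e < a"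
    proof -
      obtain b where b: "0 < b" "b < a" using dense[OF \<open>0 < a\<close>] by blast
      then have "b < top" using order_less_le_trans top_greatest by blast
      then obtain e where "b = ennreal e" "0 \<le> e" by (cases b) auto
      with b that show thesis by (auto simp: ennreal_less_zero_iff)
    qed
    obtain K where K: "\<And>m n. K \<le> m \<Longrightarrow> K \<le> n \<Longrightarrow>
        (\<integral>\<^sup>+x. ennreal (norm (u m x - u n x) ^ p) \<partial>M) \<le> ennreal e"
      using Cauchy[OF e(1)] by blast
    have "(\<integral>\<^sup>+x. ennreal (norm (u n x - v x) ^ p) \<partial>M) \<le> ennreal e" if "K \<le> n" for n
    proof -
      have "(\<integral>\<^sup>+x. ennreal (norm (u n x - v x) ^ p) \<partial>M)
          = (\<integral>\<^sup>+x. liminf (\<lambda>k. ennreal (norm (u n x - u (r k) x) ^ p)) \<partial>M)"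
      proof (rule nn_integral_cong_AE)
        show "AE x in M. ennreal (norm (u n x - v x) ^ p)
            = liminf (\<lambda>k. ennreal (norm (u n x - u (r k) x) ^ p))"
          using AE2
        proof eventually_elim
          case (elim x)
          have "(\<lambda>k. ennreal (norm (u n x - u (r k) x) ^ p)) \<longlonglongrightarrow> ennreal (norm (u n x - v x) ^ p)"
            by (intro tendsto_intros elim)
          then show ?case using lim_imp_Liminf[OF sequentially_bot] by metis
        qed
      qed
      \<comment> \<open>Fatou's lemma along the subsequence converts the Cauchy bound into a bound
        against the limit for the whole sequence.\<close>
      also have "\<dots> \<le> liminf (\<lambda>k. \<integral>\<^sup>+x. ennreal (norm (u n x - u (r k) x) ^ p) \<partial>M)"
        by (rule nn_integral_liminf) measurable
      also have "\<dots> \<le> limsup (\<lambda>k. \<integral>\<^sup>+x. ennreal (norm (u n x - u (r k) x) ^ p) \<partial>M)"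
        by (rule Liminf_le_Limsup) simp
      also have "\<dots> \<le> ennreal e"
      proof (rule Limsup_bounded)
        show "\<forall>\<^sub>F k in sequentially. (\<integral>\<^sup>+x. ennreal (norm (u n x - u (r k) x) ^ p) \<partial>M) \<le> ennreal e"
          using eventually_ge_at_top[of K]
        proof eventually_elim
          case (elim k)
          then have "K \<le> r k" by (simp add: r_def)
          then show ?case using K that by blast
        qed
      qed
      finally show ?thesis .
    qed
    then show "\<forall>\<^sub>F n in sequentially. (\<integral>\<^sup>+x. ennreal (norm (u n x - v x) ^ p) \<partial>M) < a"
      using e(2) eventually_sequentially order_le_less_trans by blast
  qed simp
  then show ?thesis using v_meas by blast
qed

section \<open>Test functions\<close>

definition smooth :: "(real^'d \<Rightarrow> real) \<Rightarrow> bool" where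
  "smooth g \<longleftrightarrow> (\<forall>k. k_times_cont_diff k g)"

lemma smooth_differentiable: "smooth g \<Longrightarrow> g differentiable (at x)"
  unfolding smooth_def using k_times_cont_diff.simps(2)[of 0 g] by blast

lemma smooth_partial_deriv: "smooth g \<Longrightarrow> smooth (partial_deriv i g)"
  unfolding smooth_def using k_times_cont_diff.simps(2) by blast

lemma smooth_continuous_on: "smooth g \<Longrightarrow> continuous_on A g"
  unfolding smooth_def using k_times_cont_diff.simps(1) continuous_on_subset by blast

text \<open>A coinduction principle: \<open>k_times_cont_diff\<close> descends through partial
  derivatives, so a class of differentiable functions that is closed under them consists of smooth
  functions. Continuity at the last level comes from differentiability.\<close>

lemma smooth_coinduct:
  assumes "f \<in> S" and diff: "\<And>f x. f \<in> S \<Longrightarrow> f differentiable (at x)"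
    and part: "\<And>f i. f \<in> S \<Longrightarrow> partial_deriv i f \<in> S"
  shows "smooth f"
proof -
  have "\<forall>f\<in>S. k_times_cont_diff k f" for k
  proof (induction k)
    case 0
    show ?case
      by (auto intro!: differentiable_imp_continuous_on simp: differentiable_on_def diff)
  next
    case (Suc k)
    then show ?case using diff part by simp
  qed
  then show ?thesis using assms(1) by (simp add: smooth_def)
qed

lemma partial_deriv_eq:
  "(f has_derivative f') (at x) \<Longrightarrow> partial_deriv i f x = f' (axis i 1)"
  unfolding partial_deriv_def by (metis frechet_derivative_at)

lemma smooth_has_derivative:
  assumes "smooth g"
  shows "(g has_derivative (\<lambda>h. \<Sum>i\<in>UNIV. partial_deriv i g x * h $ i)) (at x)"
proof -
  have d: "(g has_derivative frechet_derivative g (at x)) (at x)"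
    using smooth_differentiable[OF assms] by (simp add: frechet_derivative_works[symmetric])
  then have lin: "linear (frechet_derivative g (at x))" by (rule has_derivative_linear)
  have "frechet_derivative g (at x) h = (\<Sum>i\<in>UNIV. partial_deriv i g x * h $ i)" for h
  proof -
    have "h = (\<Sum>i\<in>UNIV. h $ i *\<^sub>R axis i 1)"
      by (simp add: scalar_mult_eq_scaleR[symmetric] basis_expansion)
    then have "frechet_derivative g (at x) h = frechet_derivative g (at x) (\<Sum>i\<in>UNIV. h $ i *\<^sub>R axis i 1)"
      by simp
    also have "\<dots> = (\<Sum>i\<in>UNIV. h $ i * partial_deriv i g x)"
      by (simp add: linear_sum[OF lin] linear_cmul[OF lin] partial_deriv_def)
    finally show ?thesis by (simp add: mult.commute)
  qed
  then have "frechet_derivative g (at x) = (\<lambda>h. \<Sum>i\<in>UNIV. partial_deriv i g x * h $ i)" by (rule ext)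
  then show ?thesis using d by simp
qed

text \<open>The derivative of a product is a sum of products, so the products alone do not form a
  class invariant under partial derivatives. Closing under both operations gives one to which
  \<open>smooth_coinduct\<close> applies.\<close>

inductive_set smooth_algebra :: "(real^'d \<Rightarrow> real) set" where
  base: "smooth f \<Longrightarrow> f \<in> smooth_algebra"
| add: "f \<in> smooth_algebra \<Longrightarrow> g \<in> smooth_algebra \<Longrightarrow> (\<lambda>x. f x + g x) \<in> smooth_algebra"
| mult: "f \<in> smooth_algebra \<Longrightarrow> g \<in> smooth_algebra \<Longrightarrow> (\<lambda>x. f x * g x) \<in> smooth_algebra"

lemma partial_deriv_add:
  assumes "\<And>x. f differentiable (at x)" "\<And>x. g differentiable (at x)"
  shows "partial_deriv i (\<lambda>x. f x + g x) = (\<lambda>x. partial_deriv i f x + partial_deriv i g x)"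
proof
  fix x
  have "((\<lambda>x. f x + g x) has_derivative
      (\<lambda>h. frechet_derivative f (at x) h + frechet_derivative g (at x) h)) (at x)"
    using assms by (intro derivative_intros) (simp_all add: frechet_derivative_works[symmetric])
  from partial_deriv_eq[OF this]
  show "partial_deriv i (\<lambda>x. f x + g x) x = partial_deriv i f x + partial_deriv i g x"
    by (simp add: partial_deriv_def)
qed

lemma partial_deriv_mult:
  assumes "\<And>x. f differentiable (at x)" "\<And>x. g differentiable (at x)"
  shows "partial_deriv i (\<lambda>x. f x * g x) = (\<lambda>x. f x * partial_deriv i g x + partial_deriv i f x * g x)"
proof
  fix x
  have "((\<lambda>x. f x * g x) has_derivative
      (\<lambda>h. f x * frechet_derivative g (at x) h + frechet_derivative f (at x) h * g x)) (at x)"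
    using assms by (intro has_derivative_mult) (simp_all add: frechet_derivative_works[symmetric])
  from partial_deriv_eq[OF this]
  show "partial_deriv i (\<lambda>x. f x * g x) x = f x * partial_deriv i g x + partial_deriv i f x * g x"
    by (simp add: partial_deriv_def)
qed

lemma smooth_algebra_diff: "f \<in> smooth_algebra \<Longrightarrow> f differentiable (at x)"
  by (induction arbitrary: x rule: smooth_algebra.induct)
    (auto intro: smooth_differentiable differentiable_add differentiable_mult)

lemma smooth_algebra_smooth: "f \<in> smooth_algebra \<Longrightarrow> smooth f"
proof (rule smooth_coinduct[of f smooth_algebra])
  show "partial_deriv i f \<in> smooth_algebra" if "f \<in> smooth_algebra" for f i
    using that
  proof induction
    case (base f)
    then show ?case by (intro smooth_algebra.base smooth_partial_deriv)
  next
    case (add f g)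
    then show ?case
      by (subst partial_deriv_add) (auto intro: smooth_algebra_diff smooth_algebra.add)
  next
    case (mult f g)
    then show ?case
      by (subst partial_deriv_mult) (auto intro: smooth_algebra_diff smooth_algebra.add smooth_algebra.mult)
  qed
qed (auto intro: smooth_algebra_diff)

lemma smooth_add: "smooth f \<Longrightarrow> smooth g \<Longrightarrow> smooth (\<lambda>x. f x + g x)"
  by (rule smooth_algebra_smooth[OF smooth_algebra.add[OF smooth_algebra.base smooth_algebra.base]])

lemma smooth_mult: "smooth f \<Longrightarrow> smooth g \<Longrightarrow> smooth (\<lambda>x. f x * g x)"
  by (rule smooth_algebra_smooth[OF smooth_algebra.mult[OF smooth_algebra.base smooth_algebra.base]])

lemma smooth_const: "smooth (\<lambda>x. c)"
proof (rule smooth_coinduct[of _ "range (\<lambda>c x. c)"])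
  show "partial_deriv i f \<in> range (\<lambda>c x. c)" if "f \<in> range (\<lambda>c x. c)" for f :: "real^'d \<Rightarrow> real" and i
    using that by (auto simp: partial_deriv_def fun_eq_iff)
qed auto

lemma smooth_coord: "smooth (\<lambda>x::real^'d. x $ j)"
proof (rule smooth_coinduct[of _ "insert (\<lambda>x. x $ j) (range (\<lambda>c x. c))"])
  have d: "((\<lambda>x::real^'d. x $ j) has_derivative (\<lambda>h. h $ j)) (at x)" for x
    by (rule bounded_linear_imp_has_derivative[OF bounded_linear_vec_nth])
  show "f differentiable (at x)" if "f \<in> insert (\<lambda>x. x $ j) (range (\<lambda>c x. c))" for f :: "real^'d \<Rightarrow> real" and x
    using that d differentiable_def by auto
  show "partial_deriv i f \<in> insert (\<lambda>x. x $ j) (range (\<lambda>c x. c))"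
    if f: "f \<in> insert (\<lambda>x. x $ j) (range (\<lambda>c x. c))" for f :: "real^'d \<Rightarrow> real" and i
  proof (cases "f = (\<lambda>x. x $ j)")
    case True
    have "partial_deriv i f = (\<lambda>x. axis i 1 $ j)"
      unfolding True by (rule ext) (rule partial_deriv_eq[OF d])
    then show ?thesis by simp
  next
    case False
    then obtain c where "f = (\<lambda>x. c)" using f by blast
    then have "partial_deriv i f = (\<lambda>x. 0)"
      by (intro ext) (simp add: partial_deriv_def)
    then show ?thesis by simp
  qed
qed auto

lemma smooth_prod: "finite I \<Longrightarrow> (\<And>i. i \<in> I \<Longrightarrow> smooth (f i)) \<Longrightarrow> smooth (\<lambda>x. \<Prod>i\<in>I. f i x)"
  by (induction I rule: finite_induct) (auto intro: smooth_const smooth_mult)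

subsection \<open>Bump functions\<close>

text \<open>The functions P(1/t) exp(-1/t), extended by zero to t \<le> 0. The polynomial is carried
  along because differentiation changes it and leaves the shape alone; P = 1 is the classical flat
  function.\<close>

definition flat_fun :: "real poly \<Rightarrow> real \<Rightarrow> real" where
  "flat_fun P t = (if 0 < t then poly P (inverse t) * exp (- inverse t) else 0)"

lemma poly_div_exp_tendsto_0: "((\<lambda>s. poly P s / exp s) \<longlongrightarrow> (0::real)) at_top"
proof -
  have "((\<lambda>s. \<Sum>i\<le>degree P. coeff P i * (s ^ i / exp s)) \<longlongrightarrow> (\<Sum>i\<le>degree P. coeff P i * 0)) at_top"
    by (intro tendsto_sum tendsto_mult tendsto_const tendsto_power_div_exp_0)
  then show ?thesis by (simp add: poly_altdef sum_divide_distrib)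
qed

text \<open>With s = 1/t, differentiation turns P(s) exp(-s) into s^2 (P - P')(s) exp(-s), hence the
  factor \<open>[:0, 0, 1:]\<close>. At 0 the right difference quotient is s P(s) exp(-s), which
  vanishes as s tends to infinity.\<close>

lemma flat_fun_DERIV:
  "(flat_fun P has_real_derivative flat_fun ([:0, 0, 1:] * (P - pderiv P)) t) (at t)"
proof -
  consider "0 < t" | "t < 0" | "t = 0" by linarith
  then show ?thesis
  proof cases
    case 1
    have "((\<lambda>t. poly P (inverse t) * exp (- inverse t)) has_real_derivative
        flat_fun ([:0, 0, 1:] * (P - pderiv P)) t) (at t)"
    proof -
      have "((\<lambda>t. poly P (inverse t)) has_real_derivative
          poly (pderiv P) (inverse t) * (- (inverse t ^ Suc (Suc 0)))) (at t)"
        using 1 by (intro DERIV_chain2[OF poly_DERIV DERIV_inverse]) simp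
      moreover have "((\<lambda>t. exp (- inverse t)) has_real_derivative
          exp (- inverse t) * inverse t ^ Suc (Suc 0)) (at t)"
        using 1 by (auto intro!: derivative_eq_intros)
      ultimately show ?thesis
        by (rule DERIV_cong[OF DERIV_mult]) (use 1 in \<open>simp add: flat_fun_def algebra_simps power2_eq_square\<close>)
    qed
    then show ?thesis
      by (rule has_field_derivative_transform_within_open[where S="{0<..}"])
        (use 1 in \<open>auto simp: flat_fun_def\<close>)
  next
    case 2
    have "((\<lambda>t. 0) has_real_derivative 0) (at t)" by simp
    then have "(flat_fun P has_real_derivative 0) (at t)"
      by (rule has_field_derivative_transform_within_open[where S="{..<0}"])
        (use 2 in \<open>auto simp: flat_fun_def\<close>)
    then show ?thesis using 2 by (simp add: flat_fun_def)
  next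
    case 3
    have "((\<lambda>h. (flat_fun P (0 + h) - flat_fun P 0) / h) \<longlongrightarrow> 0) (at 0)"
    proof (rule filterlim_split_at)
      show "((\<lambda>h. (flat_fun P (0 + h) - flat_fun P 0) / h) \<longlongrightarrow> 0) (at_left 0)"
      proof (rule Lim_transform_eventually[OF tendsto_const])
        show "\<forall>\<^sub>F h in at_left 0. 0 = (flat_fun P (0 + h) - flat_fun P 0) / h"
          by (auto simp: eventually_at_filter flat_fun_def intro!: always_eventually)
      qed
      have "((\<lambda>h. poly ([:0, 1:] * P) (inverse h) / exp (inverse h)) \<longlongrightarrow> (0::real)) (at_right 0)"
        by (rule filterlim_compose[OF poly_div_exp_tendsto_0 filterlim_inverse_at_top_right])
      then show "((\<lambda>h. (flat_fun P (0 + h) - flat_fun P 0) / h) \<longlongrightarrow> 0) (at_right 0)"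
      proof (rule Lim_transform_eventually)
        show "\<forall>\<^sub>F h in at_right 0. poly ([:0, 1:] * P) (inverse h) / exp (inverse h)
            = (flat_fun P (0 + h) - flat_fun P 0) / h"
          by (auto simp: eventually_at_filter flat_fun_def exp_minus field_simps intro!: always_eventually)
      qed
    qed
    then show ?thesis using 3 by (simp add: DERIV_def flat_fun_def)
  qed
qed

lemma smooth_flat_fun: "smooth (\<lambda>x::real^'d. flat_fun P (c * x $ j + d))"
proof -
  define S where "S = {\<lambda>x::real^'d. c0 * flat_fun P (c * x $ j + d) | c0 P. True}"
  have der: "((\<lambda>x::real^'d. c0 * flat_fun P (c * x $ j + d)) has_derivative
      (\<lambda>h. c0 * ((c * h $ j) * flat_fun ([:0, 0, 1:] * (P - pderiv P)) (c * x $ j + d)))) (at x)" for c0 P x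
  proof -
    have "((\<lambda>x::real^'d. c * x $ j + d) has_derivative (\<lambda>h. c * h $ j)) (at x)"
      by (auto intro!: derivative_eq_intros bounded_linear_imp_has_derivative[OF bounded_linear_vec_nth])
    then show ?thesis
      by (intro has_derivative_mult_right DERIV_compose_FDERIV[OF flat_fun_DERIV])
  qed
  show ?thesis
  proof (rule smooth_coinduct[of _ S])
    show "(\<lambda>x. flat_fun P (c * x $ j + d)) \<in> S"
      unfolding S_def by (rule CollectI, rule exI[of _ 1], rule exI[of _ P]) simp
    show "f differentiable (at x)" if "f \<in> S" for f x
      using that der unfolding S_def differentiable_def by blast
    show "partial_deriv i f \<in> S" if fS: "f \<in> S" for f i
    proof -
      obtain c0 P where f: "f = (\<lambda>x. c0 * flat_fun P (c * x $ j + d))"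
        using fS unfolding S_def by blast
      have "partial_deriv i f = (\<lambda>x. (c0 * (c * axis i 1 $ j)) *
          flat_fun ([:0, 0, 1:] * (P - pderiv P)) (c * x $ j + d))"
        unfolding f by (rule ext, subst partial_deriv_eq[OF der]) simp
      then show ?thesis unfolding S_def by blast
    qed
  qed
qed

text \<open>Each coordinate contributes one flat profile per face, steepened by the factor
  \<open>Suc n\<close>, so the bumps are positive exactly on the open box and converge to its
  indicator. The arguments are written in the affine form of \<open>smooth_flat_fun\<close>.\<close>

definition box_bump :: "real^'d \<Rightarrow> real^'d \<Rightarrow> nat \<Rightarrow> real^'d \<Rightarrow> real" where
  "box_bump a b n x = (\<Prod>i\<in>UNIV. flat_fun 1 (real (Suc n) * x $ i + (- real (Suc n) * a $ i))
                              * flat_fun 1 ((- real (Suc n)) * x $ i + real (Suc n) * b $ i))"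

lemma flat_fun_1_bounds: "0 \<le> flat_fun 1 t" "flat_fun 1 t \<le> 1"
  by (auto simp: flat_fun_def)

lemma box_bump_bounds: "0 \<le> box_bump a b n x" "box_bump a b n x \<le> 1"
  unfolding box_bump_def
  by (auto intro!: prod_nonneg prod_le_1 mult_le_one simp: flat_fun_1_bounds)

lemma smooth_box_bump: "smooth (box_bump a b n)"
  unfolding box_bump_def by (intro smooth_prod smooth_mult smooth_flat_fun) auto

lemma box_bump_nonzero: "box_bump a b n x \<noteq> 0 \<longleftrightarrow> x \<in> box a b"
proof -
  have *: "flat_fun 1 t \<noteq> 0 \<longleftrightarrow> 0 < t" for t by (simp add: flat_fun_def)
  have 1: "0 < real (Suc n) * x $ i + (- real (Suc n) * a $ i) \<longleftrightarrow> a $ i < x $ i" for i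
  proof -
    have "real (Suc n) * x $ i + (- real (Suc n) * a $ i) = real (Suc n) * (x $ i - a $ i)"
      by (simp add: algebra_simps)
    then show ?thesis by (metis diff_gt_0_iff_gt of_nat_0_less_iff zero_less_Suc zero_less_mult_pos zero_less_mult_iff)
  qed
  have 2: "0 < (- real (Suc n)) * x $ i + real (Suc n) * b $ i \<longleftrightarrow> x $ i < b $ i" for i
  proof -
    have "(- real (Suc n)) * x $ i + real (Suc n) * b $ i = real (Suc n) * (b $ i - x $ i)"
      by (simp add: algebra_simps)
    then show ?thesis by (metis diff_gt_0_iff_gt of_nat_0_less_iff zero_less_Suc zero_less_mult_pos zero_less_mult_iff)
  qed
  show ?thesis
    unfolding box_bump_def prod_zero_iff[OF finite] mem_box_cart using * 1 2 by auto
qed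

lemma box_bump_tendsto: "(\<lambda>n. box_bump a b n x) \<longlonglongrightarrow> indicator (box a b) x"
proof (cases "x \<in> box a b")
  case True
  have flat: "(\<lambda>n. flat_fun 1 (real (Suc n) * t)) \<longlonglongrightarrow> 1" if "0 < t" for t
  proof -
    have "(\<lambda>n. exp (- (inverse (real (Suc n)) * inverse t))) \<longlonglongrightarrow> exp (- (0 * inverse t))"
      by (intro tendsto_intros LIMSEQ_inverse_real_of_nat)
    then show ?thesis using that by (simp add: flat_fun_def del: of_nat_Suc)
  qed
  have "(\<lambda>n. box_bump a b n x) \<longlonglongrightarrow> (\<Prod>i\<in>(UNIV::'a set). 1 * 1)"
    unfolding box_bump_def
  proof (intro tendsto_prod tendsto_mult)
    fix i
    have "0 < x $ i - a $ i" "0 < b $ i - x $ i" using True by (auto simp: mem_box_cart)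
    then show "(\<lambda>n. flat_fun 1 (real (Suc n) * x $ i + (- real (Suc n) * a $ i))) \<longlonglongrightarrow> 1"
      "(\<lambda>n. flat_fun 1 ((- real (Suc n)) * x $ i + real (Suc n) * b $ i)) \<longlonglongrightarrow> 1"
      using flat[of "x $ i - a $ i"] flat[of "b $ i - x $ i"]
      by (simp_all add: algebra_simps del: of_nat_Suc)
  qed
  then show ?thesis using True by simp
next
  case False
  then have "box_bump a b n x = 0" for n using box_bump_nonzero by blast
  then show ?thesis using False by simp
qed

lemma box_bump_test_function:
  assumes "cbox a b \<subseteq> D"
  shows "box_bump a b n \<in> test_functions D"
proof -
  have "{x. box_bump a b n x \<noteq> 0} = box a b" by (auto simp: box_bump_nonzero)
  moreover have "closure (box a b) \<subseteq> cbox a b"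
    by (intro closure_minimal box_subset_cbox closed_cbox)
  moreover have "compact (closure (box a b))" using bounded_box by (simp add: compact_closure)
  ultimately show ?thesis
    using assms smooth_box_bump[of a b n, unfolded smooth_def] unfolding test_functions_def by auto
qed

subsection \<open>Closure properties of test functions\<close>

lemma test_functionsI:
  assumes "smooth \<phi>" "compact K" "K \<subseteq> D" "\<And>x. x \<notin> K \<Longrightarrow> \<phi> x = 0"
  shows "\<phi> \<in> test_functions D"
proof -
  have "{x. \<phi> x \<noteq> 0} \<subseteq> K" using assms(4) by blast
  then have "closure {x. \<phi> x \<noteq> 0} \<subseteq> K" using assms(2) by (simp add: closure_minimal compact_imp_closed)
  moreover from this have "compact (closure {x. \<phi> x \<noteq> 0})"
    using assms(2) by (meson bounded_subset closed_closure compact_eq_bounded_closed)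
  ultimately show ?thesis using assms(1,3) unfolding test_functions_def smooth_def by auto
qed

text \<open>The compact set is the closed support. Its complement is open, so the function vanishes
  near each point there and its derivatives vanish as well.\<close>

lemma test_functionsE:
  assumes "\<phi> \<in> test_functions D"
  obtains K where "smooth \<phi>" "compact K" "K \<subseteq> D" "\<And>x. x \<notin> K \<Longrightarrow> \<phi> x = 0"
    "\<And>x i. x \<notin> K \<Longrightarrow> partial_deriv i \<phi> x = 0"
proof
  let ?K = "closure {x. \<phi> x \<noteq> 0}"
  show "smooth \<phi>" "compact ?K" "?K \<subseteq> D" using assms by (auto simp: test_functions_def smooth_def)
  show 0: "\<phi> x = 0" if "x \<notin> ?K" for x
    using contra_subsetD[OF closure_subset that] by simp
  show "partial_deriv i \<phi> x = 0" if "x \<notin> ?K" for x i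
  proof -
    have "((\<lambda>x. 0) has_derivative (\<lambda>h. 0)) (at x)" by simp
    then have "(\<phi> has_derivative (\<lambda>h. 0)) (at x)"
    proof (rule has_derivative_transform_within_open)
      show "open (- ?K)" "x \<in> - ?K" using that by auto
      show "0 = \<phi> y" if "y \<in> - ?K" for y using 0[of y] that by simp
    qed
    then show ?thesis using partial_deriv_eq by fastforce
  qed
qed

lemma test_functions_smooth: "\<phi> \<in> test_functions D \<Longrightarrow> smooth \<phi>"
  by (auto simp: test_functions_def smooth_def)

lemma test_functions_partial_deriv:
  "\<phi> \<in> test_functions D \<Longrightarrow> partial_deriv i \<phi> \<in> test_functions D"
  by (elim test_functionsE, rule test_functionsI) (auto intro: smooth_partial_deriv)

lemma test_functions_add:
  assumes "\<phi> \<in> test_functions D" "\<psi> \<in> test_functions D"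
  shows "(\<lambda>x. \<phi> x + \<psi> x) \<in> test_functions D"
proof -
  obtain K where K: "smooth \<phi>" "compact K" "K \<subseteq> D" "\<And>x. x \<notin> K \<Longrightarrow> \<phi> x = 0"
    using test_functionsE[OF assms(1)] by metis
  obtain L where L: "smooth \<psi>" "compact L" "L \<subseteq> D" "\<And>x. x \<notin> L \<Longrightarrow> \<psi> x = 0"
    using test_functionsE[OF assms(2)] by metis
  show ?thesis by (rule test_functionsI[where K="K \<union> L"]) (use K L in \<open>auto intro: smooth_add\<close>)
qed

lemma test_functions_smooth_mult:
  assumes "\<phi> \<in> test_functions D" "smooth \<psi>"
  shows "(\<lambda>x. \<psi> x * \<phi> x) \<in> test_functions D"
  using assms(1) by (elim test_functionsE, intro test_functionsI) (auto intro: smooth_mult assms)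

lemma test_functions_mult:
  "\<phi> \<in> test_functions D \<Longrightarrow> \<psi> \<in> test_functions D \<Longrightarrow> (\<lambda>x. \<phi> x * \<psi> x) \<in> test_functions D"
  using test_functions_smooth_mult test_functions_smooth by blast

lemma test_functions_cmult: "\<phi> \<in> test_functions D \<Longrightarrow> (\<lambda>x. c * \<phi> x) \<in> test_functions D"
  using test_functions_smooth_mult smooth_const by blast

lemma test_functions_zero: "(\<lambda>x. 0) \<in> test_functions D"
  by (rule test_functionsI[of _ "{}"]) (auto intro: smooth_const)

lemma test_functions_bounded:
  assumes "\<phi> \<in> test_functions D"
  obtains B where "0 < B" "\<And>x. \<bar>\<phi> x\<bar> \<le> B"
proof -
  obtain K where K: "smooth \<phi>" "compact K" "\<And>x. x \<notin> K \<Longrightarrow> \<phi> x = 0"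
    using test_functionsE[OF assms] by metis
  have "bounded (\<phi> ` K)"
    by (intro compact_imp_bounded compact_continuous_image smooth_continuous_on K)
  then obtain B where B: "\<And>x. x \<in> K \<Longrightarrow> norm (\<phi> x) \<le> B" by (auto simp: bounded_iff)
  show thesis
  proof
    show "0 < \<bar>B\<bar> + 1" by simp
    show "\<bar>\<phi> x\<bar> \<le> \<bar>B\<bar> + 1" for x
      using B[of x] K(3)[of x] by (cases "x \<in> K") auto
  qed
qed

lemma smooth_borel_measurable [measurable_dest]: "smooth \<phi> \<Longrightarrow> \<phi> \<in> borel_measurable borel"
  by (intro borel_measurable_continuous_onI smooth_continuous_on)

lemma test_functions_borel: "\<phi> \<in> test_functions D \<Longrightarrow> \<phi> \<in> borel_measurable borel"
  by (intro smooth_borel_measurable test_functions_smooth)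

subsection \<open>Integration by parts\<close>

text \<open>The integrals of the difference quotients vanish by translation invariance.\<close>

lemma integral_partial_deriv_lborel:
  assumes "\<phi> \<in> test_functions D"
  shows "(LINT x|lborel. partial_deriv i \<phi> x) = 0"
proof -
  obtain K where K: "smooth \<phi>" "compact K" "\<And>x. x \<notin> K \<Longrightarrow> \<phi> x = 0"
    using test_functionsE[OF assms] by metis
  obtain B where B: "0 < B" "\<And>x. \<bar>partial_deriv i \<phi> x\<bar> \<le> B"
    using test_functions_bounded[OF test_functions_partial_deriv[OF assms]] by metis
  obtain R where R: "\<And>x. x \<in> K \<Longrightarrow> norm x \<le> R"
    using compact_imp_bounded[OF K(2)] by (auto simp: bounded_iff)
  define q where "q n x = real (Suc n) * (\<phi> (x + inverse (real (Suc n)) *\<^sub>R axis i 1) - \<phi> x)" for n x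
  have [measurable]: "\<phi> \<in> borel_measurable borel" "partial_deriv i \<phi> \<in> borel_measurable borel"
    using K(1) smooth_partial_deriv smooth_borel_measurable by auto
  have int: "integrable lborel \<phi>"
  proof -
    have "integrable lborel (\<lambda>x. indicator K x *\<^sub>R \<phi> x)"
      by (rule borel_integrable_compact[OF K(2) smooth_continuous_on[OF K(1)]])
    also have "(\<lambda>x. indicator K x *\<^sub>R \<phi> x) = \<phi>" using K(3) by (auto simp: indicator_def fun_eq_iff)
    finally show ?thesis .
  qed
  have trans: "integrable lborel (\<lambda>x. \<phi> (x + t))" "(LINT x|lborel. \<phi> (x + t)) = (LINT x|lborel. \<phi> x)" for t
  proof -
    have "integrable (distr lborel borel ((+) t)) \<phi>" using int by (simp add: lborel_distr_plus)
    then show "integrable lborel (\<lambda>x. \<phi> (x + t))"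
      by (subst (asm) integrable_distr_eq) (auto simp: add.commute)
    have "(LINT x|distr lborel borel ((+) t). \<phi> x) = (LINT x|lborel. \<phi> (x + t))"
      by (subst integral_distr) (auto simp: add.commute)
    then show "(LINT x|lborel. \<phi> (x + t)) = (LINT x|lborel. \<phi> x)" by (simp add: lborel_distr_plus)
  qed
  have q0: "(LINT x|lborel. q n x) = 0" for n
    unfolding q_def using int trans by simp
  have der_line: "((\<lambda>s. \<phi> (x + s *\<^sub>R axis i 1)) has_real_derivative partial_deriv i \<phi> (x + s *\<^sub>R axis i 1)) (at s)" for x s
  proof -
    have "((\<lambda>s. \<phi> (x + s *\<^sub>R axis i 1)) has_derivative
        (\<lambda>h. \<Sum>j\<in>UNIV. partial_deriv j \<phi> (x + s *\<^sub>R axis i 1) * (h *\<^sub>R axis i (1::real)) $ j)) (at s)"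
      by (rule has_derivative_compose[OF _ smooth_has_derivative[OF K(1)]])
        (auto intro!: derivative_eq_intros)
    moreover have "(\<Sum>j\<in>UNIV. partial_deriv j \<phi> (x + s *\<^sub>R axis i 1) * (h *\<^sub>R axis i (1::real)) $ j)
        = partial_deriv i \<phi> (x + s *\<^sub>R axis i 1) * h" for h
      by (simp add: axis_def if_distrib cong: if_cong)
    ultimately show ?thesis by (simp add: has_field_derivative_def)
  qed
  \<comment> \<open>The steps are at most 1, so every difference quotient vanishes off the ball of
    radius \<open>R + 1\<close>; inside, the mean value theorem bounds it by the bound
    \<open>B\<close> of the derivative.\<close>
  have "(\<lambda>n. LINT x|lborel. q n x) \<longlonglongrightarrow> (LINT x|lborel. partial_deriv i \<phi> x)"
  proof (rule integral_dominated_convergence[where w="\<lambda>x. B * indicator (cball 0 (R + 1)) x"])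
    show "integrable lborel (\<lambda>x. B * indicator (cball 0 (R + 1)) x :: real)"
      using emeasure_bounded_finite[of "cball 0 (R + 1)"]
      by (intro integrable_mult_right integrable_real_indicator) auto
    show "AE x in lborel. (\<lambda>n. q n x) \<longlonglongrightarrow> partial_deriv i \<phi> x"
    proof (rule AE_I2)
      fix x
      have "((\<lambda>h. (\<phi> (x + h *\<^sub>R axis i 1) - \<phi> x) / h) \<longlongrightarrow> partial_deriv i \<phi> x) (at 0)"
        using der_line[of x 0] by (simp add: DERIV_def)
      moreover have "filterlim (\<lambda>n. inverse (real (Suc n))) (at 0) sequentially"
        by (intro filterlim_atI LIMSEQ_inverse_real_of_nat always_eventually) auto
      ultimately have "(\<lambda>n. (\<phi> (x + inverse (real (Suc n)) *\<^sub>R axis i 1) - \<phi> x) / inverse (real (Suc n)))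
          \<longlonglongrightarrow> partial_deriv i \<phi> x"
        by (rule filterlim_compose)
      then show "(\<lambda>n. q n x) \<longlonglongrightarrow> partial_deriv i \<phi> x"
        by (simp add: q_def field_simps del: of_nat_Suc)
    qed
    show "AE x in lborel. norm (q n x) \<le> B * indicator (cball 0 (R + 1)) x" for n
    proof (rule AE_I2)
      fix x
      let ?e = "inverse (real (Suc n))"
      have e: "0 < ?e" "?e \<le> 1" by (auto simp: inverse_le_1_iff)
      show "norm (q n x) \<le> B * indicator (cball 0 (R + 1)) x"
      proof (cases "x \<in> cball 0 (R + 1)")
        case True
        obtain s where "\<phi> (x + ?e *\<^sub>R axis i 1) - \<phi> (x + 0 *\<^sub>R axis i 1) = (?e - 0) * partial_deriv i \<phi> (x + s *\<^sub>R axis i 1)"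
          using MVT2[OF e(1), of "\<lambda>s. \<phi> (x + s *\<^sub>R axis i 1)" "\<lambda>s. partial_deriv i \<phi> (x + s *\<^sub>R axis i 1)"] der_line
          by blast
        then have "q n x = partial_deriv i \<phi> (x + s *\<^sub>R axis i 1)"
          unfolding q_def by (simp del: of_nat_Suc)
        then show ?thesis using B(2) True by simp
      next
        case False
        then have n: "R + 1 < norm x" by simp
        have "norm x \<le> norm (x + ?e *\<^sub>R axis i 1) + norm (?e *\<^sub>R axis i (1::real))"
          using norm_triangle_ineq4[of "x + ?e *\<^sub>R axis i 1" "?e *\<^sub>R axis i 1"] by simp
        also have "norm (?e *\<^sub>R axis i (1::real)) \<le> 1" using e by (simp)
        finally have "x + ?e *\<^sub>R axis i 1 \<notin> K" "x \<notin> K" using R[of x] R[of "x + ?e *\<^sub>R axis i 1"] n by linarith+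
        then show ?thesis using K(3) False by (simp add: q_def)
      qed
    qed
  qed (simp_all add: q_def)
  then have "(\<lambda>n. 0) \<longlonglongrightarrow> (LINT x|lborel. partial_deriv i \<phi> x)" by (simp only: q0)
  from LIMSEQ_unique[OF this tendsto_const] show ?thesis .
qed

lemma integral_lebesgue_on_test:
  assumes "open D" "h \<in> borel_measurable borel" "\<And>x. x \<notin> D \<Longrightarrow> h x = (0::real)"
  shows "(LINT x|lebesgue_on D. h x) = (LINT x|lborel. h x)"
proof -
  have "(LINT x|lebesgue_on D. h x) = (LINT x|lebesgue. indicator D x *\<^sub>R h x)"
    using assms(1) by (intro integral_restrict_space) auto
  also have "(\<lambda>x. indicator D x *\<^sub>R h x) = h" using assms(3) by (auto simp: indicator_def fun_eq_iff)
  also have "(LINT x|lebesgue. h x) = (LINT x|lborel. h x)" by (rule integral_completion) (use assms in auto)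
  finally show ?thesis .
qed

lemma integral_partial_deriv:
  assumes "open D" "\<phi> \<in> test_functions D"
  shows "(LINT x|lebesgue_on D. partial_deriv i \<phi> x) = 0"
proof -
  have "partial_deriv i \<phi> x = 0" if "x \<notin> D" for x
    using assms(2) that by (elim test_functionsE) blast
  then show ?thesis
    using integral_lebesgue_on_test[OF assms(1)] integral_partial_deriv_lborel[OF assms(2)]
      test_functions_borel[OF test_functions_partial_deriv[OF assms(2)]] by metis
qed

lemma borel_lebesgue_on: "h \<in> borel_measurable borel \<Longrightarrow> h \<in> borel_measurable (lebesgue_on D)"
  by (simp add: measurable_completion measurable_restrict_space1)

lemma test_function_integrable:
  fixes \<phi> :: "real^'d \<Rightarrow> real"
  assumes "open D" "\<phi> \<in> test_functions D"
  shows "integrable (lebesgue_on D) \<phi>"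
proof -
  obtain K where K: "smooth \<phi>" "compact K" "K \<subseteq> D" "\<And>x. x \<notin> K \<Longrightarrow> \<phi> x = 0"
    using test_functionsE[OF assms(2)] by metis
  have "integrable lborel (\<lambda>x. indicator K x *\<^sub>R \<phi> x)"
    by (rule borel_integrable_compact[OF K(2) smooth_continuous_on[OF K(1)]])
  also have "(\<lambda>x. indicator K x *\<^sub>R \<phi> x) = (\<lambda>x. indicator D x *\<^sub>R \<phi> x)"
    using K(3,4) by (auto simp: indicator_def fun_eq_iff)
  finally have "integrable lebesgue (\<lambda>x. indicator D x *\<^sub>R \<phi> x)"
    using integrable_completion[of "\<lambda>x. indicator D x *\<^sub>R \<phi> x" lborel] assms(1) smooth_borel_measurable[OF K(1)]
    by auto
  then show ?thesis using assms(1) by (subst integrable_restrict_space) auto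
qed

text \<open>The derivative of the product has integral zero; one factor of compact support makes the
  product a test function.\<close>

lemma integration_by_parts:
  assumes D: "open D" and \<phi>: "\<phi> \<in> test_functions D" and \<psi>: "smooth \<psi>"
  shows "(LINT x|lebesgue_on D. \<psi> x * partial_deriv i \<phi> x)
    = - (LINT x|lebesgue_on D. partial_deriv i \<psi> x * \<phi> x)"
proof -
  have "(LINT x|lebesgue_on D. \<psi> x * partial_deriv i \<phi> x + partial_deriv i \<psi> x * \<phi> x) = 0"
    using integral_partial_deriv[OF D test_functions_smooth_mult[OF \<phi> \<psi>], of i]
    by (subst (asm) partial_deriv_mult) (auto intro: smooth_differentiable \<psi> test_functions_smooth[OF \<phi>])
  moreover have "integrable (lebesgue_on D) (\<lambda>x. \<psi> x * partial_deriv i \<phi> x)"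
    "integrable (lebesgue_on D) (\<lambda>x. partial_deriv i \<psi> x * \<phi> x)"
    using \<phi> \<psi> by (auto intro!: test_function_integrable[OF D] test_functions_smooth_mult
        test_functions_partial_deriv smooth_partial_deriv)
  ultimately show ?thesis by simp
qed

subsection \<open>Uniqueness of weak gradients\<close>

text \<open>A Dynkin argument: open boxes are stable under intersection and generate the Borel sets,
  and the vanishing total integral supplies the step to complements. The vanishing is then used on
  the sets where a Borel representative is positive or negative; completion carries the result
  back.\<close>

lemma AE_zero_if_box_integrals_zero:
  fixes H :: "real^'d \<Rightarrow> real"
  assumes H: "integrable lebesgue H" "(LINT x|lebesgue. H x) = 0"
    and box: "\<And>c d. (LINT x|lebesgue. indicator (box c d) x * H x) = 0"
  shows "AE x in lebesgue. H x = 0"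
proof -
  obtain H' where H' [measurable]: "H' \<in> borel_measurable lborel" and eq: "AE x in lborel. H x = H' x"
    using completion_ex_borel_measurable_real[of H lborel] H(1) by auto
  have eq': "AE x in lebesgue. H x = H' x" using eq by (rule AE_completion)
  have int': "integrable lborel H'"
  proof -
    have "integrable lebesgue H'" using H(1) eq' by (subst integrable_cong_AE[symmetric]) (auto simp: measurable_completion)
    then show ?thesis by (simp add: integrable_completion)
  qed
  have ind: "integrable lborel (\<lambda>x. indicator A x * H' x)" if "A \<in> sets borel" for A
    using integrable_mult_indicator[OF _ int', of A] that by simp
  have trans: "(LINT x|lebesgue. indicator A x * H x) = (LINT x|lborel. indicator A x * H' x)" if [measurable]: "A \<in> sets borel" for A
  proof -
    have "(LINT x|lebesgue. indicator A x * H x) = (LINT x|lebesgue. indicator A x * H' x)"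
    proof (rule integral_cong_AE)
      show "AE x in lebesgue. indicator A x * H x = indicator A x * H' x" using eq' by eventually_elim simp
      have "H \<in> borel_measurable lebesgue" using H(1) by simp
      moreover have "(indicator A :: _ \<Rightarrow> real) \<in> borel_measurable lebesgue" by (rule measurable_completion) simp
      ultimately show "(\<lambda>x. indicator A x * H x) \<in> borel_measurable lebesgue" by measurable
    qed (rule measurable_completion, measurable)
    also have "\<dots> = (LINT x|lborel. indicator A x * H' x)" by (rule integral_completion) measurable
    finally show ?thesis .
  qed
  have zero: "(LINT x|lborel. indicator A x * H' x) = 0" if "A \<in> sets borel" for A :: "(real^'d) set"
  proof -
    let ?G = "range (\<lambda>(a, b). box a b :: (real^'d) set)"
    have sb: "sets borel = sigma_sets UNIV ?G" by (subst borel_eq_box) (simp add: sets_measure_of)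
    have st: "Int_stable ?G"
    proof (rule Int_stableI)
      fix A B assume "A \<in> ?G" "B \<in> ?G"
      then obtain a b c d :: "real^'d" where ab: "A = box a b" "B = box c d" by auto
      have "A \<inter> B = box (\<chi> i. max (a $ i) (c $ i)) (\<chi> i. min (b $ i) (d $ i))"
        by (auto simp: ab mem_box_cart)
      then show "A \<inter> B \<in> ?G" by auto
    qed
    have UN: "(LINT x|lborel. H' x) = 0"
      using trans[of UNIV] H(2) by simp
    have "Int_stable ?G" "?G \<subseteq> Pow UNIV" "A \<in> sigma_sets UNIV ?G" using st that by (simp_all add: sb)
    then show ?thesis
    proof (induction rule: sigma_sets_induct_disjoint)
      fix A assume "A \<in> ?G"
      then obtain c d where A: "A = box c d" by auto
      show "(LINT x|lborel. indicator A x * H' x) = 0"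
        unfolding A using trans[of "box c d"] box[of c d] by (simp add: borel_open)
    next
      show "(LINT x|lborel. indicator {} x * H' x) = 0" by simp
    next
      fix A assume A: "A \<in> sigma_sets UNIV ?G" "(LINT x|lborel. indicator A x * H' x) = 0"
      then have "A \<in> sets borel" by (simp only: sb)
      have "(LINT x|lborel. indicator (UNIV - A) x * H' x) = (LINT x|lborel. H' x - indicator A x * H' x)"
        by (rule Bochner_Integration.integral_cong) (auto simp: indicator_def)
      also have "\<dots> = 0" using int' ind[OF \<open>A \<in> sets borel\<close>] A(2) UN by simp
      finally show "(LINT x|lborel. indicator (UNIV - A) x * H' x) = 0" .
    next
      fix A :: "nat \<Rightarrow> (real^'d) set"
      assume A: "disjoint_family A" "range A \<subseteq> sigma_sets UNIV ?G"
        "\<And>i. (LINT x|lborel. indicator (A i) x * H' x) = 0"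
      then have [measurable]: "A i \<in> sets borel" for i by (simp only: sb) blast
      have "(LINT x:(\<Union>i. A i)|lborel. H' x) = (\<Sum>i. LINT x:A i|lborel. H' x)"
        using A(1) by (intro lebesgue_integral_countable_add)
          (auto simp: disjoint_family_on_def set_integrable_def intro!: ind)
      then show "(LINT x|lborel. indicator (\<Union>i. A i) x * H' x) = 0"
        using A(3) by (simp add: set_lebesgue_integral_def)
    qed
  qed
  have pos: "AE x in lborel. indicator {x. 0 < H' x} x * H' x = 0"
    using zero[of "{x. 0 < H' x}"] ind[of "{x. 0 < H' x}"]
    by (subst integral_nonneg_eq_0_iff_AE[symmetric]) (auto simp: indicator_def)
  have neg: "AE x in lborel. - (indicator {x. H' x < 0} x * H' x) = 0"
    using zero[of "{x. H' x < 0}"] ind[of "{x. H' x < 0}"]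
    by (subst integral_nonneg_eq_0_iff_AE[symmetric]) (auto simp: indicator_def)
  have "AE x in lborel. H' x = 0"
    using pos neg by eventually_elim (auto simp: indicator_def split: if_splits)
  then have "AE x in lborel. H x = 0" using eq by eventually_elim simp
  then show ?thesis by (rule AE_completion)
qed

text \<open>The fundamental lemma of the calculus of variations. The bumps converge boundedly to
  indicators, so all integrals over boxes with closure in \<open>D\<close> vanish and
  \<open>h\<close> is zero almost everywhere on each of them. Countably many closed boxes exhaust
  \<open>D\<close>, and their boundaries are negligible.\<close>

lemma AE_zero_if_test_integrals_zero:
  fixes h :: "real^'d \<Rightarrow> real"
  assumes D: "open D" and h: "\<And>K. compact K \<Longrightarrow> K \<subseteq> D \<Longrightarrow> h absolutely_integrable_on K"
    and zero: "\<And>\<phi>. \<phi> \<in> test_functions D \<Longrightarrow> (LINT x|lebesgue_on D. h x * \<phi> x) = 0"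
  shows "AE x in lebesgue_on D. h x = 0"
proof -
  have boxes: "(LINT x|lebesgue. indicator (box a b) x * h x) = 0" if ab: "cbox a b \<subseteq> D" for a b
  proof -
    have int: "integrable lebesgue (\<lambda>x. indicator (cbox a b) x * h x)"
      using h[OF compact_cbox ab] by (simp add: set_integrable_def)
    have eq: "(LINT x|lebesgue. box_bump a b n x * (indicator (cbox a b) x * h x)) = 0" for n
    proof -
      have "(LINT x|lebesgue. box_bump a b n x * (indicator (cbox a b) x * h x))
          = (LINT x|lebesgue. indicator D x *\<^sub>R (h x * box_bump a b n x))"
      proof (rule Bochner_Integration.integral_cong)
        fix x
        show "box_bump a b n x * (indicator (cbox a b) x * h x) = indicator D x *\<^sub>R (h x * box_bump a b n x)"
        proof (cases "x \<in> box a b")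
          case True
          then have "x \<in> cbox a b" "x \<in> D" using ab box_subset_cbox by blast+
          then show ?thesis by simp
        next
          case False
          then have "box_bump a b n x = 0" using box_bump_nonzero by blast
          then show ?thesis by simp
        qed
      qed simp
      also have "\<dots> = (LINT x|lebesgue_on D. h x * box_bump a b n x)"
        using D by (intro integral_restrict_space[symmetric]) auto
      finally show ?thesis using zero[OF box_bump_test_function[OF ab]] by simp
    qed
    have "(\<lambda>n. LINT x|lebesgue. box_bump a b n x * (indicator (cbox a b) x * h x))
        \<longlonglongrightarrow> (LINT x|lebesgue. indicator (box a b) x * (indicator (cbox a b) x * h x))"
    proof (rule integral_dominated_convergence[where w="\<lambda>x. norm (indicator (cbox a b) x * h x)"])
      have b: "box_bump a b n \<in> borel_measurable lebesgue" for n
        by (rule measurable_completion) (simp add: smooth_borel_measurable smooth_box_bump)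
      have i: "(indicator (box a b) :: _ \<Rightarrow> real) \<in> borel_measurable lebesgue"
        by (rule measurable_completion) simp
      have m: "(\<lambda>x. indicator (cbox a b) x * h x) \<in> borel_measurable lebesgue" using int by blast
      show "(\<lambda>x. box_bump a b n x * (indicator (cbox a b) x * h x)) \<in> borel_measurable lebesgue" for n
        using b m by (rule borel_measurable_times)
      show "(\<lambda>x. indicator (box a b) x * (indicator (cbox a b) x * h x)) \<in> borel_measurable lebesgue"
        using i m by (rule borel_measurable_times)
      show "integrable lebesgue (\<lambda>x. norm (indicator (cbox a b) x * h x))" using int by (rule integrable_norm)
      show "AE x in lebesgue. (\<lambda>n. box_bump a b n x * (indicator (cbox a b) x * h x))
          \<longlonglongrightarrow> indicator (box a b) x * (indicator (cbox a b) x * h x)"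
        by (intro AE_I2 tendsto_mult box_bump_tendsto tendsto_const)
      show "AE x in lebesgue. norm (box_bump a b n x * (indicator (cbox a b) x * h x))
          \<le> norm (indicator (cbox a b) x * h x)" for n
      proof (rule AE_I2)
        fix x
        have "\<bar>box_bump a b n x\<bar> \<le> 1" using box_bump_bounds[of a b n x] by simp
        then show "norm (box_bump a b n x * (indicator (cbox a b) x * h x)) \<le> norm (indicator (cbox a b) x * h x)"
          unfolding real_norm_def abs_mult[of "box_bump a b n x"] by (intro mult_left_le_one_le) auto
      qed
    qed
    then have "(LINT x|lebesgue. indicator (box a b) x * (indicator (cbox a b) x * h x)) = 0"
      by (simp only: eq) (metis LIMSEQ_unique tendsto_const)
    moreover have "(\<lambda>x. indicator (box a b) x * (indicator (cbox a b) x * h x)) = (\<lambda>x. indicator (box a b) x * h x)"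
      using box_subset_cbox[of a b] by (auto simp: indicator_def fun_eq_iff)
    ultimately show ?thesis by simp
  qed
  have cb: "AE x in lebesgue. x \<in> cbox a b \<longrightarrow> h x = 0" if ab: "cbox a b \<subseteq> D" for a b
  proof -
    have "AE x in lebesgue. indicator (box a b) x * h x = 0"
    proof (rule AE_zero_if_box_integrals_zero)
      have "integrable lebesgue (\<lambda>x. indicator (cbox a b) x * h x)"
        using h[OF compact_cbox ab] by (simp add: set_integrable_def)
      then have "integrable lebesgue (\<lambda>x. indicator (box a b) x *\<^sub>R (indicator (cbox a b) x * h x))"
        by (intro integrable_mult_indicator) auto
      also have "(\<lambda>x. indicator (box a b) x *\<^sub>R (indicator (cbox a b) x * h x)) = (\<lambda>x. indicator (box a b) x * h x)"
        using box_subset_cbox[of a b] by (auto simp: indicator_def fun_eq_iff)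
      finally show "integrable lebesgue (\<lambda>x. indicator (box a b) x * h x)" .
      show "(LINT x|lebesgue. indicator (box a b) x * h x) = 0" by (rule boxes[OF ab])
      fix c d :: "real^'d"
      \<comment> \<open>The corners of the intersection of the two boxes; the closed box they span
        stays inside \<open>cbox a b\<close>, hence inside \<open>D\<close>.\<close>
      let ?p = "\<chi> i. max (a $ i) (c $ i)" and ?q = "\<chi> i. min (b $ i) (d $ i)"
      have "(\<lambda>x. indicator (box c d) x * (indicator (box a b) x * h x)) = (\<lambda>x. indicator (box ?p ?q) x * h x)"
        by (auto simp: indicator_def fun_eq_iff mem_box_cart)
      moreover have "(LINT x|lebesgue. indicator (box ?p ?q) x * h x) = 0"
      proof (rule boxes)
        show "cbox ?p ?q \<subseteq> D" using ab by (force simp: mem_box_cart)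
      qed
      ultimately show "(LINT x|lebesgue. indicator (box c d) x * (indicator (box a b) x * h x)) = 0" by simp
    qed
    moreover have "AE x in lebesgue. x \<notin> cbox a b - box a b"
      using AE_not_in[of "cbox a b - box a b" lebesgue] negligible_frontier_interval[of a b]
      by (simp only: negligible_iff_null_sets)
    ultimately show ?thesis by eventually_elim auto
  qed
  obtain \<D> where \<D>: "countable \<D>" "\<D> \<subseteq> Pow D" "\<And>X. X \<in> \<D> \<Longrightarrow> \<exists>a b. X = cbox a b" "\<Union>\<D> = D"
    using open_countable_Union_open_cbox[OF D] by metis
  have "AE x in lebesgue. \<forall>X\<in>\<D>. x \<in> X \<longrightarrow> h x = 0"
  proof (subst AE_ball_countable[OF \<D>(1)], intro ballI)
    fix X assume "X \<in> \<D>"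
    then obtain a b where "X = cbox a b" "cbox a b \<subseteq> D" using \<D>(2,3) by blast
    then show "AE x in lebesgue. x \<in> X \<longrightarrow> h x = 0" using cb by simp
  qed
  then have "AE x in lebesgue. x \<in> D \<longrightarrow> h x = 0" using \<D>(4) by (auto elim!: eventually_mono)
  then show ?thesis using D by (subst AE_restrict_space_iff) auto
qed

text \<open>Makes the arbitrary choice in \<open>weak_grad\<close> immaterial up to null sets. Each
  component of the difference is annihilated by all test functions.\<close>

lemma has_weak_gradient_unique:
  fixes u :: "real^'d \<Rightarrow> real" and g g' :: "real^'d \<Rightarrow> real^'d"
  assumes D: "open D" and g: "has_weak_gradient D u g" and g': "has_weak_gradient D u g'"
  shows "AE x in lebesgue_on D. g x = g' x"
proof -
  have ci: "(\<lambda>x. k x $ i) absolutely_integrable_on K" if "k absolutely_integrable_on K"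
    for k :: "real^'d \<Rightarrow> real^'d" and K i
    using absolutely_integrable_component[OF that, of "axis i 1"] by (simp add: cart_eq_inner_axis)
  have "AE x in lebesgue_on D. g x $ i - g' x $ i = 0" for i :: 'd
  proof (rule AE_zero_if_test_integrals_zero[OF D])
    fix K :: "(real^'d) set" assume "compact K" "K \<subseteq> D"
    then show "(\<lambda>x. g x $ i - g' x $ i) absolutely_integrable_on K"
      using g g' by (intro set_integral_diff ci) (auto simp: has_weak_gradient_def)
  next
    fix \<phi> :: "real^'d \<Rightarrow> real" assume \<phi>: "\<phi> \<in> test_functions D"
    have int: "integrable (lebesgue_on D) (\<lambda>x. k x $ i * \<phi> x)" if k: "has_weak_gradient D u k" for k
    proof -
      obtain K where K: "smooth \<phi>" "compact K" "K \<subseteq> D" "\<And>x. x \<notin> K \<Longrightarrow> \<phi> x = 0"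
        using test_functionsE[OF \<phi>] by metis
      obtain B where B: "0 < B" "\<And>x. \<bar>\<phi> x\<bar> \<le> B" using test_functions_bounded[OF \<phi>] by metis
      have ik: "integrable lebesgue (\<lambda>x. indicator K x * k x $ i)"
        using ci[of K k] k K(2,3) by (auto simp: has_weak_gradient_def set_integrable_def)
      have "integrable lebesgue (\<lambda>x. \<phi> x * (indicator K x * k x $ i))"
      proof (rule Bochner_Integration.integrable_bound)
        show "integrable lebesgue (\<lambda>x. B * (indicator K x * k x $ i))" using ik by simp
        have "\<phi> \<in> borel_measurable lebesgue" using smooth_borel_measurable[OF K(1)] by (simp add: measurable_completion)
        then show "(\<lambda>x. \<phi> x * (indicator K x * k x $ i)) \<in> borel_measurable lebesgue"
          using borel_measurable_integrable[OF ik] by (rule borel_measurable_times)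
        show "AE x in lebesgue. norm (\<phi> x * (indicator K x * k x $ i)) \<le> norm (B * (indicator K x * k x $ i))"
          unfolding norm_mult using B by (intro AE_I2 mult_right_mono) (auto simp: abs_of_pos)
      qed
      also have "(\<lambda>x. \<phi> x * (indicator K x * k x $ i)) = (\<lambda>x. indicator D x *\<^sub>R (k x $ i * \<phi> x))"
        using K(3,4) by (auto simp: indicator_def fun_eq_iff)
      finally show ?thesis using D by (subst integrable_restrict_space) auto
    qed
    have "(LINT x|lebesgue_on D. u x * partial_deriv i \<phi> x) = - (LINT x|lebesgue_on D. g x $ i * \<phi> x)"
      "(LINT x|lebesgue_on D. u x * partial_deriv i \<phi> x) = - (LINT x|lebesgue_on D. g' x $ i * \<phi> x)"
      using g g' \<phi> unfolding has_weak_gradient_def by blast+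
    then have "(LINT x|lebesgue_on D. g x $ i * \<phi> x) = (LINT x|lebesgue_on D. g' x $ i * \<phi> x)" by simp
    then show "(LINT x|lebesgue_on D. (g x $ i - g' x $ i) * \<phi> x) = 0"
      using int[OF g] int[OF g'] by (simp add: left_diff_distrib)
  qed
  then have "AE x in lebesgue_on D. \<forall>i\<in>UNIV. g x $ i - g' x $ i = 0"
    by (subst AE_ball_countable) auto
  then show ?thesis by (auto elim!: eventually_mono simp: vec_eq_iff)
qed

section \<open>Sobolev spaces on bounded open sets\<close>

text \<open>Completeness of Lebesgue measure. It makes the chosen weak gradient measurable, which is
  tied to a measurable witness only up to a null set.\<close>

lemma borel_measurable_AE_lebesgue_on:
  fixes f g :: "real^'d \<Rightarrow> 'b::euclidean_space"
  assumes S: "S \<in> sets lebesgue" and f: "f \<in> borel_measurable (lebesgue_on S)"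
    and eq: "AE x in lebesgue_on S. f x = g x"
  shows "g \<in> borel_measurable (lebesgue_on S)"
proof -
  have "(\<lambda>x. if x \<in> S then f x else 0) \<in> borel_measurable lebesgue"
    using f S by (simp add: borel_measurable_if)
  moreover have "AE x in lebesgue. (if x \<in> S then f x else 0) = (if x \<in> S then g x else 0)"
    using eq S by (subst (asm) AE_restrict_space_iff) (auto elim!: eventually_mono)
  ultimately have "(\<lambda>x. if x \<in> S then g x else 0) \<in> borel_measurable lebesgue"
    by (rule borel_measurable_AE)
  then show ?thesis using S by (simp add: borel_measurable_if)
qed

locale bounded_open_set =
  fixes D :: "(real^'d) set"
  assumes D_open: "open D" and D_bounded: "bounded D"
begin

abbreviation M :: "(real^'d) measure" where "M \<equiv> lebesgue_on D"

lemma D_sets [simp]: "D \<in> sets lebesgue"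
  by (rule sets_completionI_sets) (use D_open in simp)

lemma finite_M: "finite_measure M"
  using D_bounded by (intro finite_measure_lebesgue_on bounded_set_imp_lmeasurable) auto

lemma borel_M: "h \<in> borel_measurable borel \<Longrightarrow> h \<in> borel_measurable M"
  by (rule borel_lebesgue_on)

lemma bounded_mult_integrable:
  fixes h :: "real^'d \<Rightarrow> real" and k :: "real^'d \<Rightarrow> 'b::euclidean_space"
  assumes "integrable M k" "h \<in> borel_measurable M" "AE x in M. \<bar>h x\<bar> \<le> B"
  shows "integrable M (\<lambda>x. h x *\<^sub>R k x)"
proof (rule Bochner_Integration.integrable_bound)
  show "integrable M (\<lambda>x. B *\<^sub>R k x)" using assms(1) by simp
  show "(\<lambda>x. h x *\<^sub>R k x) \<in> borel_measurable M" using assms by measurable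
  show "AE x in M. norm (h x *\<^sub>R k x) \<le> norm (B *\<^sub>R k x)"
    using assms(3) by eventually_elim (auto intro!: mult_right_mono)
qed

lemma integrable_absolutely_integrable_on:
  fixes u :: "real^'d \<Rightarrow> 'b::euclidean_space"
  assumes "integrable M u" "compact K" "K \<subseteq> D"
  shows "u absolutely_integrable_on K"
proof -
  have "set_integrable lebesgue D u"
    using assms(1) by (simp add: set_integrable_def integrable_restrict_space)
  then show ?thesis
    by (rule set_integrable_subset)
      (use assms compact_imp_closed in \<open>auto intro!: sets_completionI_sets borel_closed\<close>)
qed

lemma integrable_vec_nth:
  fixes g :: "real^'d \<Rightarrow> real^'e"
  shows "integrable M g \<Longrightarrow> integrable M (\<lambda>x. g x $ i)"
  by (rule integrable_bounded_linear[OF bounded_linear_vec_nth])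

lemma test_mult_integrable:
  fixes k :: "real^'d \<Rightarrow> real"
  assumes "integrable M k" "\<phi> \<in> test_functions D"
  shows "integrable M (\<lambda>x. k x * \<phi> x)"
proof -
  obtain B where "\<And>x. \<bar>\<phi> x\<bar> \<le> B" using test_functions_bounded[OF assms(2)] by metis
  then have "integrable M (\<lambda>x. \<phi> x *\<^sub>R k x)"
    using assms by (intro bounded_mult_integrable[where B=B] borel_M test_functions_borel) auto
  then show ?thesis by (simp add: mult.commute)
qed

lemma has_weak_gradient_add:
  assumes "integrable M u" "integrable M v" "integrable M g" "integrable M h"
    and "has_weak_gradient D u g" "has_weak_gradient D v h"
  shows "has_weak_gradient D (\<lambda>x. u x + v x) (\<lambda>x. g x + h x)"
  unfolding has_weak_gradient_def
proof (intro conjI allI impI ballI)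
  fix K :: "(real^'d) set" assume "compact K \<and> K \<subseteq> D"
  then show "(\<lambda>x. u x + v x) absolutely_integrable_on K" "(\<lambda>x. g x + h x) absolutely_integrable_on K"
    using assms by (auto intro!: integrable_absolutely_integrable_on)
next
  fix \<phi> i assume \<phi>: "\<phi> \<in> test_functions D"
  note t = test_mult_integrable[OF _ \<phi>] test_mult_integrable[OF _ test_functions_partial_deriv[OF \<phi>]]
  show "(LINT x|M. (u x + v x) * partial_deriv i \<phi> x) = - (LINT x|M. (g x + h x) $ i * \<phi> x)"
  proof -
    have "(LINT x|M. (u x + v x) * partial_deriv i \<phi> x)
        = (LINT x|M. u x * partial_deriv i \<phi> x) + (LINT x|M. v x * partial_deriv i \<phi> x)"
      using assms(1,2) t(2) by (simp add: ring_distribs)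
    also have "\<dots> = - (LINT x|M. g x $ i * \<phi> x) + - (LINT x|M. h x $ i * \<phi> x)"
    proof -
      have "(LINT x|M. u x * partial_deriv i \<phi> x) = - (LINT x|M. g x $ i * \<phi> x)"
        using assms(5) \<phi> unfolding has_weak_gradient_def by blast
      moreover have "(LINT x|M. v x * partial_deriv i \<phi> x) = - (LINT x|M. h x $ i * \<phi> x)"
        using assms(6) \<phi> unfolding has_weak_gradient_def by blast
      ultimately show ?thesis by simp
    qed
    also have "\<dots> = - (LINT x|M. (g x + h x) $ i * \<phi> x)"
      using t(1)[OF integrable_vec_nth[OF assms(3)], of i] t(1)[OF integrable_vec_nth[OF assms(4)], of i]
      by (simp add: ring_distribs)
    finally show ?thesis .
  qed
qed

lemma has_weak_gradient_cmult:
  assumes "has_weak_gradient D u g"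
  shows "has_weak_gradient D (\<lambda>x. c * u x) (\<lambda>x. c *\<^sub>R g x)"
  using assms unfolding has_weak_gradient_def
  by (auto simp: mult.assoc absolutely_integrable_scaleR_left intro: set_integrable_mult_right)

text \<open>Test functions and their derivatives are bounded, so convergence in L^1 of functions and
  gradients passes through both sides of the defining identity. On a bounded set this covers L^2
  convergence too.\<close>

lemma has_weak_gradient_limit:
  assumes un: "\<And>n. integrable M (u n)" "\<And>n. integrable M (g n)" "\<And>n. has_weak_gradient D (u n) (g n)"
    and lim: "integrable M v" "integrable M h"
    and conv: "(\<lambda>n. LINT x|M. norm (u n x - v x)) \<longlonglongrightarrow> 0" "(\<lambda>n. LINT x|M. norm (g n x - h x)) \<longlonglongrightarrow> 0"
  shows "has_weak_gradient D v h"
  unfolding has_weak_gradient_def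
proof (intro conjI allI impI ballI)
  fix K :: "(real^'d) set" assume "compact K \<and> K \<subseteq> D"
  then show "v absolutely_integrable_on K" "h absolutely_integrable_on K"
    using lim by (auto intro!: integrable_absolutely_integrable_on)
next
  fix \<phi> i assume \<phi>: "\<phi> \<in> test_functions D"
  have key: "(\<lambda>n. LINT x|M. w n x * \<psi> x) \<longlonglongrightarrow> (LINT x|M. l x * \<psi> x)"
    if w: "\<And>n. integrable M (w n)" "integrable M l" "(\<lambda>n. LINT x|M. \<bar>w n x - l x\<bar>) \<longlonglongrightarrow> 0"
      and \<psi>: "\<psi> \<in> test_functions D" for w :: "nat \<Rightarrow> real^'d \<Rightarrow> real" and l \<psi>
  proof -
    obtain B where B: "0 < B" "\<And>x. \<bar>\<psi> x\<bar> \<le> B" using test_functions_bounded[OF \<psi>] by metis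
    have "(\<lambda>n. (LINT x|M. w n x * \<psi> x) - (LINT x|M. l x * \<psi> x)) \<longlonglongrightarrow> 0"
    proof (rule Lim_null_comparison)
      show "(\<lambda>n. B * (LINT x|M. \<bar>w n x - l x\<bar>)) \<longlonglongrightarrow> 0" using tendsto_mult_left[OF w(3), of B] by simp
      have "norm ((LINT x|M. w n x * \<psi> x) - (LINT x|M. l x * \<psi> x)) \<le> B * (LINT x|M. \<bar>w n x - l x\<bar>)" for n
      proof -
        have "(LINT x|M. w n x * \<psi> x) - (LINT x|M. l x * \<psi> x) = (LINT x|M. (w n x - l x) * \<psi> x)"
          using test_mult_integrable[OF w(1) \<psi>] test_mult_integrable[OF w(2) \<psi>] by (simp add: left_diff_distrib)
        also have "norm \<dots> \<le> (LINT x|M. norm ((w n x - l x) * \<psi> x))" by (rule integral_norm_bound)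
        also have "\<dots> \<le> (LINT x|M. B * \<bar>w n x - l x\<bar>)"
        proof (rule integral_mono)
          show "integrable M (\<lambda>x. norm ((w n x - l x) * \<psi> x))"
            using w by (intro integrable_norm test_mult_integrable \<psi>) auto
          show "integrable M (\<lambda>x. B * \<bar>w n x - l x\<bar>)" using w by simp
          show "norm ((w n x - l x) * \<psi> x) \<le> B * \<bar>w n x - l x\<bar>" for x
            using B(2)[of x] by (simp add: abs_mult mult.commute mult_right_mono)
        qed
        finally show ?thesis by simp
      qed
      then show "\<forall>\<^sub>F n in sequentially. norm ((LINT x|M. w n x * \<psi> x) - (LINT x|M. l x * \<psi> x))
          \<le> B * (LINT x|M. \<bar>w n x - l x\<bar>)" by simp
    qed
    then show ?thesis by (simp add: Lim_null[symmetric])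
  qed
  have "(\<lambda>n. LINT x|M. \<bar>g n x $ i - h x $ i\<bar>) \<longlonglongrightarrow> 0"
  proof (rule Lim_null_comparison[OF always_eventually conv(2)], rule allI)
    fix n
    have "(LINT x|M. \<bar>g n x $ i - h x $ i\<bar>) \<le> (LINT x|M. norm (g n x - h x))"
    proof (rule integral_mono)
      show "integrable M (\<lambda>x. \<bar>g n x $ i - h x $ i\<bar>)" using integrable_vec_nth[OF un(2)] integrable_vec_nth[OF lim(2)]
        by (intro integrable_abs Bochner_Integration.integrable_diff)
      show "integrable M (\<lambda>x. norm (g n x - h x))" using un(2) lim(2) by simp
      show "\<bar>g n x $ i - h x $ i\<bar> \<le> norm (g n x - h x)" for x
        using component_le_norm_cart[of "g n x - h x" i] by simp
    qed
    then show "norm (LINT x|M. \<bar>g n x $ i - h x $ i\<bar>) \<le> (LINT x|M. norm (g n x - h x))" by simp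
  qed
  then have "(\<lambda>n. LINT x|M. g n x $ i * \<phi> x) \<longlonglongrightarrow> (LINT x|M. h x $ i * \<phi> x)"
    using un(2) lim(2) \<phi> by (intro key) (auto intro: integrable_vec_nth)
  then have "(\<lambda>n. - (LINT x|M. g n x $ i * \<phi> x)) \<longlonglongrightarrow> - (LINT x|M. h x $ i * \<phi> x)" by (rule tendsto_minus)
  moreover have "(\<lambda>n. LINT x|M. u n x * partial_deriv i \<phi> x) \<longlonglongrightarrow> (LINT x|M. v x * partial_deriv i \<phi> x)"
    using un(1) lim(1) \<phi> conv(1) by (intro key) (auto intro: test_functions_partial_deriv)
  moreover have "(LINT x|M. u n x * partial_deriv i \<phi> x) = - (LINT x|M. g n x $ i * \<phi> x)" for n
    using un(3)[of n] \<phi> by (simp only: has_weak_gradient_def)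
  ultimately show "(LINT x|M. v x * partial_deriv i \<phi> x) = - (LINT x|M. h x $ i * \<phi> x)"
    using LIMSEQ_unique by simp
qed

subsection \<open>The spaces for p = 1 and p = 2\<close>

lemma norm_powr_real:
  "p \<in> {1, 2} \<Longrightarrow> norm z powr real p = norm z ^ p"
  by (rule powr_realpow') auto

lemma Lp_iff:
  fixes p :: nat and u :: "real^'d \<Rightarrow> 'b::euclidean_space"
  assumes "p \<in> {1, 2}"
  shows "u \<in> Lp (real p) D \<longleftrightarrow> u \<in> borel_measurable M \<and> integrable M (\<lambda>x. norm (u x) ^ p)"
  unfolding Lp_def mem_Collect_eq norm_powr_real[OF assms] by (rule refl)

lemma Lp1_iff: "u \<in> Lp 1 D \<longleftrightarrow> integrable M (u :: real^'d \<Rightarrow> 'b::euclidean_space)"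
  using Lp_iff[of 1 u] integrable_norm_iff[of u M] by auto

lemma Lp2_iff: "u \<in> Lp 2 D \<longleftrightarrow> square_integrable M (u :: real^'d \<Rightarrow> 'b::euclidean_space)"
  using Lp_iff[of 2 u] by (simp add: square_integrable_def)

text \<open>A natural exponent allows \<open>root p\<close> and ordinary powers, so that one
  development serves H^1 for the mean and W^{1,1} for the variance.\<close>

definition lp_norm :: "nat \<Rightarrow> (real^'d \<Rightarrow> 'b::euclidean_space) \<Rightarrow> real" where
  "lp_norm p u = root p (LINT x|M. norm (u x) ^ p)"

lemma lp_norm_nonneg [simp]: "0 \<le> lp_norm p u"
  by (cases "p = 0") (auto simp: lp_norm_def)

lemma lp_norm_1: "lp_norm 1 u = (LINT x|M. norm (u x))"
  by (simp add: lp_norm_def)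

lemma lp_norm_2: "lp_norm 2 u = l2_norm M u"
  by (simp add: lp_norm_def l2_norm_def sqrt_def)

lemma lp_norm_power: "p \<in> {1, 2} \<Longrightarrow> lp_norm p u ^ p = (LINT x|M. norm (u x) ^ p)"
  by (auto simp: lp_norm_def)

lemma Lp_add:
  fixes u v :: "real^'d \<Rightarrow> 'b::euclidean_space"
  assumes "p \<in> {1, 2::nat}" "u \<in> Lp (real p) D" "v \<in> Lp (real p) D"
  shows "(\<lambda>x. u x + v x) \<in> Lp (real p) D"
  using assms by (auto simp: Lp1_iff Lp2_iff intro: square_integrable_add)

lemma Lp_scaleR:
  fixes u :: "real^'d \<Rightarrow> 'b::euclidean_space"
  assumes "p \<in> {1, 2::nat}" "u \<in> Lp (real p) D"
  shows "(\<lambda>x. c *\<^sub>R u x) \<in> Lp (real p) D"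
  using assms by (auto simp: Lp1_iff Lp2_iff intro: square_integrable_scaleR)

lemma Lp_diff:
  fixes u v :: "real^'d \<Rightarrow> 'b::euclidean_space"
  assumes "p \<in> {1, 2::nat}" "u \<in> Lp (real p) D" "v \<in> Lp (real p) D"
  shows "(\<lambda>x. u x - v x) \<in> Lp (real p) D"
  using assms by (auto simp: Lp1_iff Lp2_iff intro: square_integrable_diff)

lemma Lp_integrable:
  fixes u :: "real^'d \<Rightarrow> 'b::euclidean_space"
  assumes "p \<in> {1, 2::nat}" "u \<in> Lp (real p) D"
  shows "integrable M u"
  using assms by (auto simp: Lp1_iff Lp2_iff intro: square_integrable_imp_integrable[OF finite_M])

lemma Lp_measurable: "u \<in> Lp q D \<Longrightarrow> u \<in> borel_measurable M"
  by (simp add: Lp_def)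

lemma Lp_cong_AE:
  fixes u v :: "real^'d \<Rightarrow> 'b::euclidean_space"
  assumes u: "u \<in> Lp q D" and eq: "AE x in M. u x = v x"
  shows "v \<in> Lp q D"
proof -
  have v: "v \<in> borel_measurable M"
    using borel_measurable_AE_lebesgue_on[OF D_sets Lp_measurable[OF u] eq] .
  have "integrable M (\<lambda>x. norm (v x) powr q)"
    using u v eq by (subst integrable_cong_AE[where g="\<lambda>x. norm (u x) powr q"])
      (auto simp: Lp_def elim!: eventually_mono)
  then show ?thesis using v by (simp add: Lp_def)
qed

lemma lp_norm_triangle:
  fixes u v :: "real^'d \<Rightarrow> 'b::euclidean_space"
  assumes "p \<in> {1, 2::nat}" "u \<in> Lp (real p) D" "v \<in> Lp (real p) D"
  shows "lp_norm p (\<lambda>x. u x + v x) \<le> lp_norm p u + lp_norm p v"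
proof (cases "p = 1")
  case True
  then have i: "integrable M u" "integrable M v" using assms by (simp_all add: Lp1_iff)
  have "(LINT x|M. norm (u x + v x)) \<le> (LINT x|M. norm (u x) + norm (v x))"
    using i by (intro integral_mono) (auto intro: norm_triangle_ineq)
  then show ?thesis using i True by (simp add: lp_norm_1[simplified])
next
  case False
  then show ?thesis using assms l2_norm_triangle[of M u v] by (auto simp: lp_norm_2 Lp2_iff)
qed

lemma lp_norm_scaleR:
  assumes "p \<in> {1, 2::nat}"
  shows "lp_norm p (\<lambda>x. c *\<^sub>R u x) = \<bar>c\<bar> * lp_norm p u"
  using assms by (auto simp: lp_norm_2 l2_norm_scaleR lp_norm_1[simplified])

lemma lp_norm_cong_AE:
  fixes u v :: "real^'d \<Rightarrow> 'b::euclidean_space"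
  assumes "u \<in> borel_measurable M" "v \<in> borel_measurable M" "AE x in M. u x = v x"
  shows "lp_norm p u = lp_norm p v"
proof -
  have "(LINT x|M. norm (u x) ^ p) = (LINT x|M. norm (v x) ^ p)"
    using assms by (intro integral_cong_AE) (auto elim!: eventually_mono)
  then show ?thesis by (simp add: lp_norm_def)
qed

lemma weak_grad_eqI:
  assumes "has_weak_gradient D u g"
  shows "AE x in M. weak_grad D u x = g x"
proof -
  have "has_weak_gradient D u (weak_grad D u)"
    unfolding weak_grad_def using assms by (rule someI[of "has_weak_gradient D u"])
  then show ?thesis using has_weak_gradient_unique[OF D_open] assms by blast
qed

lemma W1p_I: "u \<in> Lp q D \<Longrightarrow> g \<in> Lp q D \<Longrightarrow> has_weak_gradient D u g \<Longrightarrow> u \<in> W1p q D"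
  by (auto simp: W1p_def)

text \<open>The gradient picked by \<open>weak_grad\<close> need not be the witness hidden in
  \<open>W1p\<close>; uniqueness up to null sets transfers the integrability of the witness to
  it.\<close>

lemma W1p_D:
  assumes "u \<in> W1p q D"
  shows "u \<in> Lp q D" "weak_grad D u \<in> Lp q D" "has_weak_gradient D u (weak_grad D u)"
proof -
  obtain g where g: "u \<in> Lp q D" "g \<in> Lp q D" "has_weak_gradient D u g"
    using assms by (auto simp: W1p_def)
  show "u \<in> Lp q D" by (rule g)
  show "has_weak_gradient D u (weak_grad D u)" unfolding weak_grad_def using g(3) by (rule someI[of "has_weak_gradient D u"])
  show "weak_grad D u \<in> Lp q D"
    using g(2) by (rule Lp_cong_AE) (use weak_grad_eqI[OF g(3)] in \<open>auto elim!: eventually_mono\<close>)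
qed

context
  fixes p :: nat
  assumes p: "p \<in> {1, 2}"
begin

lemma W1p_integrable_fun:
  assumes "u \<in> W1p (real p) D"
  shows "integrable M u" "integrable M (weak_grad D u)"
  using W1p_D[OF assms] Lp_integrable[OF p] by auto

lemma W1p_add:
  assumes "u \<in> W1p (real p) D" "v \<in> W1p (real p) D"
  shows "(\<lambda>x. u x + v x) \<in> W1p (real p) D"
    "AE x in M. weak_grad D (\<lambda>x. u x + v x) x = weak_grad D u x + weak_grad D v x"
proof -
  have *: "has_weak_gradient D (\<lambda>x. u x + v x) (\<lambda>x. weak_grad D u x + weak_grad D v x)"
    using assms by (intro has_weak_gradient_add W1p_integrable_fun W1p_D(3)) auto
  then show "(\<lambda>x. u x + v x) \<in> W1p (real p) D"
    using assms by (intro W1p_I[OF Lp_add[OF p] Lp_add[OF p]]) (auto intro: W1p_D)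
  show "AE x in M. weak_grad D (\<lambda>x. u x + v x) x = weak_grad D u x + weak_grad D v x"
    using * by (rule weak_grad_eqI)
qed

lemma W1p_cmult:
  assumes "u \<in> W1p (real p) D"
  shows "(\<lambda>x. c * u x) \<in> W1p (real p) D" "AE x in M. weak_grad D (\<lambda>x. c * u x) x = c *\<^sub>R weak_grad D u x"
proof -
  have *: "has_weak_gradient D (\<lambda>x. c * u x) (\<lambda>x. c *\<^sub>R weak_grad D u x)"
    by (rule has_weak_gradient_cmult[OF W1p_D(3)[OF assms]])
  then show "(\<lambda>x. c * u x) \<in> W1p (real p) D"
    using W1p_D[OF assms] Lp_scaleR[OF p, of u c] by (intro W1p_I[OF _ Lp_scaleR[OF p]]) auto
  show "AE x in M. weak_grad D (\<lambda>x. c * u x) x = c *\<^sub>R weak_grad D u x"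
    using * by (rule weak_grad_eqI)
qed

lemma W1p_diff:
  assumes "u \<in> W1p (real p) D" "v \<in> W1p (real p) D"
  shows "(\<lambda>x. u x - v x) \<in> W1p (real p) D"
    "AE x in M. weak_grad D (\<lambda>x. u x - v x) x = weak_grad D u x - weak_grad D v x"
proof -
  have eq: "(\<lambda>x. u x - v x) = (\<lambda>x. u x + (-1) * v x)" by auto
  show "(\<lambda>x. u x - v x) \<in> W1p (real p) D" unfolding eq by (intro W1p_add W1p_cmult assms)
  show "AE x in M. weak_grad D (\<lambda>x. u x - v x) x = weak_grad D u x - weak_grad D v x"
    unfolding eq using W1p_add(2)[OF assms(1) W1p_cmult(1)[OF assms(2), of "-1"]] W1p_cmult(2)[OF assms(2), of "-1"]
    by eventually_elim simp
qed

lemma W1p_norm_eq: "W1p_norm (real p) D u = root p (lp_norm p u ^ p + lp_norm p (weak_grad D u) ^ p)"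
proof -
  have e: "\<bar>u x\<bar> powr real p = norm (u x) ^ p" for x using norm_powr_real[OF p, of "u x"] by simp
  have "0 \<le> (LINT x|M. norm (u x) ^ p) + (LINT x|M. norm (weak_grad D u x) ^ p)" by simp
  then show ?thesis
    unfolding W1p_norm_def e norm_powr_real[OF p] lp_norm_power[OF p] using p
    by (auto simp: powr_half_sqrt sqrt_def)
qed

lemma W1p_norm_nonneg: "0 \<le> W1p_norm q D u"
  by (simp add: W1p_norm_def)

lemma W1p_norm_power: "W1p_norm (real p) D u ^ p = (LINT x|M. norm (u x) ^ p) + (LINT x|M. norm (weak_grad D u x) ^ p)"
proof -
  have "0 \<le> lp_norm p u ^ p + lp_norm p (weak_grad D u) ^ p" by simp
  then have "W1p_norm (real p) D u ^ p = lp_norm p u ^ p + lp_norm p (weak_grad D u) ^ p"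
    unfolding W1p_norm_eq using p by auto
  then show ?thesis by (simp only: lp_norm_power[OF p])
qed

lemma lp_norm_le_W1p_norm: "lp_norm p u \<le> W1p_norm (real p) D u"
  "lp_norm p (weak_grad D u) \<le> W1p_norm (real p) D u"
proof -
  have "lp_norm p u ^ p \<le> W1p_norm (real p) D u ^ p" "lp_norm p (weak_grad D u) ^ p \<le> W1p_norm (real p) D u ^ p"
    unfolding W1p_norm_power lp_norm_power[OF p] by simp_all
  then show "lp_norm p u \<le> W1p_norm (real p) D u" "lp_norm p (weak_grad D u) \<le> W1p_norm (real p) D u"
    using p W1p_norm_nonneg by (auto dest!: power_mono_iff[THEN iffD1, rotated -1] intro: power2_le_imp_le)
qed

lemma W1p_norm_le_lp_norm: "W1p_norm (real p) D u \<le> lp_norm p u + lp_norm p (weak_grad D u)"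
  using p sqrt_sum_squares_le_sum[of "lp_norm p u" "lp_norm p (weak_grad D u)"]
  unfolding W1p_norm_eq by (auto simp: sqrt_def[symmetric])

text \<open>Minkowski's inequality twice: in L^p for the function and for its gradient, and then in
  the plane for the pair of their norms.\<close>

lemma W1p_norm_triangle:
  assumes "u \<in> W1p (real p) D" "v \<in> W1p (real p) D"
  shows "W1p_norm (real p) D (\<lambda>x. u x + v x) \<le> W1p_norm (real p) D u + W1p_norm (real p) D v"
proof -
  let ?a = "lp_norm p u" and ?b = "lp_norm p v"
  let ?c = "lp_norm p (weak_grad D u)" and ?d = "lp_norm p (weak_grad D v)"
  have 1: "lp_norm p (\<lambda>x. u x + v x) \<le> ?a + ?b"
    by (rule lp_norm_triangle[OF p]) (auto intro: W1p_D assms)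
  have "lp_norm p (weak_grad D (\<lambda>x. u x + v x)) = lp_norm p (\<lambda>x. weak_grad D u x + weak_grad D v x)"
    by (rule lp_norm_cong_AE[OF _ _ W1p_add(2)[OF assms]])
      (use W1p_D(2)[OF W1p_add(1)[OF assms]] W1p_D(2)[OF assms(1)] W1p_D(2)[OF assms(2)] in \<open>auto dest!: Lp_measurable\<close>)
  also have "\<dots> \<le> ?c + ?d" by (rule lp_norm_triangle[OF p]) (auto intro: W1p_D assms)
  finally have 2: "lp_norm p (weak_grad D (\<lambda>x. u x + v x)) \<le> ?c + ?d" .
  have "W1p_norm (real p) D (\<lambda>x. u x + v x) \<le> root p ((?a + ?b) ^ p + (?c + ?d) ^ p)"
    unfolding W1p_norm_eq using 1 2 p by (intro real_root_le_mono add_mono power_mono) auto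
  also have "\<dots> \<le> root p (?a ^ p + ?c ^ p) + root p (?b ^ p + ?d ^ p)"
    using p real_sqrt_sum_squares_triangle_ineq[of ?a ?b ?c ?d] by (auto simp: sqrt_def[symmetric])
  finally show ?thesis unfolding W1p_norm_eq .
qed

lemma W1p_norm_cmult:
  assumes "u \<in> W1p (real p) D"
  shows "W1p_norm (real p) D (\<lambda>x. c * u x) = \<bar>c\<bar> * W1p_norm (real p) D u"
proof -
  have 1: "lp_norm p (\<lambda>x. c * u x) = \<bar>c\<bar> * lp_norm p u" using lp_norm_scaleR[OF p, of c u] by simp
  have "lp_norm p (weak_grad D (\<lambda>x. c * u x)) = lp_norm p (\<lambda>x. c *\<^sub>R weak_grad D u x)"
    by (rule lp_norm_cong_AE[OF _ _ W1p_cmult(2)[OF assms]])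
      (use W1p_D(2)[OF W1p_cmult(1)[OF assms]] W1p_D(2)[OF assms(1)] in \<open>auto dest!: Lp_measurable\<close>)
  then have 2: "lp_norm p (weak_grad D (\<lambda>x. c * u x)) = \<bar>c\<bar> * lp_norm p (weak_grad D u)"
    using lp_norm_scaleR[OF p] by simp
  have "0 < p" using p by auto
  then show ?thesis
    unfolding W1p_norm_eq 1 2 power_mult_distrib distrib_left[symmetric] real_root_mult
    by (simp add: real_root_pos2)
qed

lemma W1p_norm_minus:
  assumes "u \<in> W1p (real p) D" "v \<in> W1p (real p) D"
  shows "W1p_norm (real p) D (\<lambda>x. u x - v x) = W1p_norm (real p) D (\<lambda>x. v x - u x)"
  using W1p_norm_cmult[OF W1p_diff(1)[OF assms], of "-1"] by simp

lemma W1p_norm_triangle_diff: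
  assumes "u \<in> W1p (real p) D" "v \<in> W1p (real p) D" "w \<in> W1p (real p) D"
  shows "W1p_norm (real p) D (\<lambda>x. u x - w x) \<le> W1p_norm (real p) D (\<lambda>x. u x - v x) + W1p_norm (real p) D (\<lambda>x. v x - w x)"
  using W1p_norm_triangle[OF W1p_diff(1)[OF assms(1,2)] W1p_diff(1)[OF assms(2,3)]] by simp

lemma test_function_W1p:
  assumes \<phi>: "\<phi> \<in> test_functions D"
  shows "\<phi> \<in> W1p (real p) D" "AE x in M. weak_grad D \<phi> x = (\<chi> i. partial_deriv i \<phi> x)"
proof -
  have bdd: "u \<in> Lp (real p) D" if "u \<in> borel_measurable borel" "\<And>x. norm (u x) \<le> B"
    for u :: "real^'d \<Rightarrow> 'c::euclidean_space" and B
  proof -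
    have "square_integrable M u" using that by (intro square_integrable_bounded[OF finite_M, of _ B] borel_M) auto
    then show ?thesis using p square_integrable_imp_integrable[OF finite_M] by (auto simp: Lp1_iff Lp2_iff)
  qed
  obtain B where B: "\<And>x. \<bar>\<phi> x\<bar> \<le> B" using test_functions_bounded[OF \<phi>] by metis
  have "\<forall>i. \<exists>B. \<forall>x. \<bar>partial_deriv i \<phi> x\<bar> \<le> B"
    using test_functions_bounded[OF test_functions_partial_deriv[OF \<phi>]] by metis
  then obtain C where C: "\<And>i x. \<bar>partial_deriv i \<phi> x\<bar> \<le> C i" by metis
  have 1: "\<phi> \<in> Lp (real p) D" using B by (intro bdd[of _ B] test_functions_borel[OF \<phi>]) simp
  have 2: "(\<lambda>x. \<chi> i. partial_deriv i \<phi> x) \<in> Lp (real p) D"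
  proof (rule bdd[of _ "\<Sum>i\<in>UNIV. C i"])
    show "norm (\<chi> i. partial_deriv i \<phi> x) \<le> (\<Sum>i\<in>UNIV. C i)" for x
      using norm_le_l1_cart[of "\<chi> i. partial_deriv i \<phi> x"] C by (auto intro!: sum_mono elim: order_trans)
    show "(\<lambda>x. \<chi> i. partial_deriv i \<phi> x) \<in> borel_measurable borel"
      by (intro borel_measurable_continuous_onI continuous_on_vec_lambda smooth_continuous_on
          smooth_partial_deriv test_functions_smooth[OF \<phi>])
  qed
  have 3: "has_weak_gradient D \<phi> (\<lambda>x. \<chi> i. partial_deriv i \<phi> x)"
    unfolding has_weak_gradient_def
  proof (intro conjI allI impI ballI)
    fix K :: "(real^'d) set" assume "compact K \<and> K \<subseteq> D"
    then show "\<phi> absolutely_integrable_on K" "(\<lambda>x. \<chi> i. partial_deriv i \<phi> x) absolutely_integrable_on K"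
      using Lp_integrable[OF p 1] Lp_integrable[OF p 2] by (auto intro!: integrable_absolutely_integrable_on)
  next
    fix \<psi> i assume \<psi>: "\<psi> \<in> test_functions D"
    then show "(LINT x|M. \<phi> x * partial_deriv i \<psi> x) = - (LINT x|M. (\<chi> i. partial_deriv i \<phi> x) $ i * \<psi> x)"
      using integration_by_parts[OF D_open \<psi> test_functions_smooth[OF \<phi>], of i] by simp
  qed
  show "\<phi> \<in> W1p (real p) D" using 1 2 3 by (rule W1p_I)
  show "AE x in M. weak_grad D \<phi> x = (\<chi> i. partial_deriv i \<phi> x)" using 3 by (rule weak_grad_eqI)
qed

lemma W1p_zero: "(\<lambda>x. 0) \<in> W1p (real p) D" "W1p_norm (real p) D (\<lambda>x. 0) = 0"
  using test_function_W1p(1)[OF test_functions_zero] W1p_norm_cmult[of "\<lambda>x. 0" 0] by simp_all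

lemma W1p_0_D: "u \<in> W1p_0 (real p) D \<Longrightarrow> u \<in> W1p (real p) D"
  by (simp add: W1p_0_def)

lemma W1p_0_I:
  assumes "u \<in> W1p (real p) D" "\<And>e. 0 < e \<Longrightarrow> \<exists>\<phi>\<in>test_functions D. W1p_norm (real p) D (\<lambda>x. u x - \<phi> x) < e"
  shows "u \<in> W1p_0 (real p) D"
proof -
  have "\<forall>n::nat. \<exists>\<phi>. \<phi> \<in> test_functions D \<and> W1p_norm (real p) D (\<lambda>x. u x - \<phi> x) < inverse (real (Suc n))"
    using assms(2)[of "inverse (real (Suc n))" for n] by fastforce
  then obtain \<phi> where \<phi>: "\<And>n. \<phi> n \<in> test_functions D"
      "\<And>n. W1p_norm (real p) D (\<lambda>x. u x - \<phi> n x) < inverse (real (Suc n))" by metis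
  have "(\<lambda>n. W1p_norm (real p) D (\<lambda>x. u x - \<phi> n x)) \<longlonglongrightarrow> 0"
  proof (rule Lim_null_comparison[OF always_eventually LIMSEQ_inverse_real_of_nat], rule allI)
    show "norm (W1p_norm (real p) D (\<lambda>x. u x - \<phi> n x)) \<le> inverse (real (Suc n))" for n
      using \<phi>(2)[of n] W1p_norm_nonneg[of "real p" "\<lambda>x. u x - \<phi> n x"] by simp
  qed
  then show ?thesis using assms(1) \<phi>(1) by (auto simp: W1p_0_def)
qed

lemma W1p_0_approx:
  assumes "u \<in> W1p_0 (real p) D" "0 < e"
  shows "\<exists>\<phi>\<in>test_functions D. W1p_norm (real p) D (\<lambda>x. u x - \<phi> x) < e"
proof -
  obtain \<phi> where \<phi>: "\<And>n::nat. \<phi> n \<in> test_functions D" "(\<lambda>n. W1p_norm (real p) D (\<lambda>x. u x - \<phi> n x)) \<longlonglongrightarrow> 0"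
    using assms(1) by (auto simp: W1p_0_def)
  have "\<forall>\<^sub>F n in sequentially. W1p_norm (real p) D (\<lambda>x. u x - \<phi> n x) < e"
    using order_tendstoD(2)[OF \<phi>(2) assms(2)] .
  then show ?thesis using \<phi>(1) eventually_happens' sequentially_bot by blast
qed

lemma W1p_0_test: "\<phi> \<in> test_functions D \<Longrightarrow> \<phi> \<in> W1p_0 (real p) D"
  by (rule W1p_0_I) (auto intro!: test_function_W1p bexI[of _ \<phi>] simp: W1p_zero)

lemma W1p_0_add:
  assumes "u \<in> W1p_0 (real p) D" "v \<in> W1p_0 (real p) D"
  shows "(\<lambda>x. u x + v x) \<in> W1p_0 (real p) D"
proof (rule W1p_0_I)
  note W = assms[THEN W1p_0_D]
  show "(\<lambda>x. u x + v x) \<in> W1p (real p) D" by (rule W1p_add(1)[OF W])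
  fix e :: real assume e: "0 < e"
  obtain \<phi> where \<phi>: "\<phi> \<in> test_functions D" "W1p_norm (real p) D (\<lambda>x. u x - \<phi> x) < e / 2"
    using W1p_0_approx[OF assms(1), of "e/2"] e by auto
  obtain \<psi> where \<psi>: "\<psi> \<in> test_functions D" "W1p_norm (real p) D (\<lambda>x. v x - \<psi> x) < e / 2"
    using W1p_0_approx[OF assms(2), of "e/2"] e by auto
  have "W1p_norm (real p) D (\<lambda>x. (u x - \<phi> x) + (v x - \<psi> x)) < e"
    using W1p_norm_triangle[OF W1p_diff(1)[OF W(1) test_function_W1p(1)[OF \<phi>(1)]]
        W1p_diff(1)[OF W(2) test_function_W1p(1)[OF \<psi>(1)]]] \<phi>(2) \<psi>(2) by linarith
  then have "W1p_norm (real p) D (\<lambda>x. (u x + v x) - (\<phi> x + \<psi> x)) < e" by (simp add: algebra_simps)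
  then show "\<exists>\<theta>\<in>test_functions D. W1p_norm (real p) D (\<lambda>x. (u x + v x) - \<theta> x) < e"
    using test_functions_add[OF \<phi>(1) \<psi>(1)] by (intro bexI)
qed

lemma W1p_0_cmult:
  assumes "u \<in> W1p_0 (real p) D"
  shows "(\<lambda>x. c * u x) \<in> W1p_0 (real p) D"
proof (rule W1p_0_I)
  note W = assms[THEN W1p_0_D]
  show "(\<lambda>x. c * u x) \<in> W1p (real p) D" by (rule W1p_cmult(1)[OF W])
  fix e :: real assume e: "0 < e"
  obtain \<phi> where \<phi>: "\<phi> \<in> test_functions D" "W1p_norm (real p) D (\<lambda>x. u x - \<phi> x) < e / (\<bar>c\<bar> + 1)"
    using W1p_0_approx[OF assms, of "e / (\<bar>c\<bar> + 1)"] e by auto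
  have "W1p_norm (real p) D (\<lambda>x. c * (u x - \<phi> x)) = \<bar>c\<bar> * W1p_norm (real p) D (\<lambda>x. u x - \<phi> x)"
    by (rule W1p_norm_cmult[OF W1p_diff(1)[OF W test_function_W1p(1)[OF \<phi>(1)]]])
  also have "\<dots> \<le> (\<bar>c\<bar> + 1) * W1p_norm (real p) D (\<lambda>x. u x - \<phi> x)"
    by (intro mult_right_mono W1p_norm_nonneg) simp
  also have "\<dots> < e" using \<phi>(2) by (simp add: pos_less_divide_eq mult.commute)
  finally have "W1p_norm (real p) D (\<lambda>x. c * u x - c * \<phi> x) < e" by (simp add: algebra_simps)
  then show "\<exists>\<theta>\<in>test_functions D. W1p_norm (real p) D (\<lambda>x. c * u x - \<theta> x) < e"
    using test_functions_cmult[OF \<phi>(1)] by (intro bexI)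
qed

lemma W1p_0_diff:
  assumes "u \<in> W1p_0 (real p) D" "v \<in> W1p_0 (real p) D"
  shows "(\<lambda>x. u x - v x) \<in> W1p_0 (real p) D"
  using W1p_0_add[OF assms(1) W1p_0_cmult[OF assms(2), of "-1"]] by simp

lemma W1p_0_zero: "(\<lambda>x. 0) \<in> W1p_0 (real p) D"
  by (rule W1p_0_test[OF test_functions_zero])

lemma W1p_0_closed:
  assumes "u \<in> W1p (real p) D" "\<And>e. 0 < e \<Longrightarrow> \<exists>v\<in>W1p_0 (real p) D. W1p_norm (real p) D (\<lambda>x. u x - v x) < e"
  shows "u \<in> W1p_0 (real p) D"
proof (rule W1p_0_I[OF assms(1)])
  fix e :: real assume e: "0 < e"
  obtain v where v: "v \<in> W1p_0 (real p) D" "W1p_norm (real p) D (\<lambda>x. u x - v x) < e / 2"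
    using assms(2)[of "e/2"] e by auto
  obtain \<phi> where \<phi>: "\<phi> \<in> test_functions D" "W1p_norm (real p) D (\<lambda>x. v x - \<phi> x) < e / 2"
    using W1p_0_approx[OF v(1), of "e/2"] e by auto
  have "W1p_norm (real p) D (\<lambda>x. u x - \<phi> x) < e"
    using W1p_norm_triangle_diff[OF assms(1) W1p_0_D[OF v(1)] test_function_W1p(1)[OF \<phi>(1)]] v(2) \<phi>(2) by linarith
  then show "\<exists>\<phi>\<in>test_functions D. W1p_norm (real p) D (\<lambda>x. u x - \<phi> x) < e" using \<phi>(1) by blast
qed

section \<open>Completeness of the Sobolev spaces\<close>

lemma Lp_complete_M:
  fixes u :: "nat \<Rightarrow> real^'d \<Rightarrow> 'b::euclidean_space"
  assumes u: "\<And>n. u n \<in> Lp (real p) D"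
    and Cauchy: "\<And>e. 0 < e \<Longrightarrow> \<exists>N. \<forall>m\<ge>N. \<forall>n\<ge>N. lp_norm p (\<lambda>x. u m x - u n x) < e"
  shows "\<exists>v\<in>Lp (real p) D. (\<lambda>n. lp_norm p (\<lambda>x. u n x - v x)) \<longlonglongrightarrow> 0"
proof -
  have p0: "0 < p" using p by auto
  have m: "u n \<in> borel_measurable M" for n using u by (rule Lp_measurable)
  have nn: "(\<integral>\<^sup>+x. ennreal (norm (w x) ^ p) \<partial>M) = ennreal (lp_norm p w ^ p)" if "w \<in> Lp (real p) D" for w :: "real^'d \<Rightarrow> 'b"
    unfolding lp_norm_power[OF p] using that by (intro nn_integral_eq_integral) (auto simp: Lp_iff[OF p])
  have "\<exists>v\<in>borel_measurable M. (\<lambda>n. \<integral>\<^sup>+x. ennreal (norm (u n x - v x) ^ p) \<partial>M) \<longlonglongrightarrow> 0"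
  proof (rule Lp_complete[OF p m])
    fix e :: real assume e: "0 < e"
    obtain N where N: "\<And>m n. N \<le> m \<Longrightarrow> N \<le> n \<Longrightarrow> lp_norm p (\<lambda>x. u m x - u n x) < root p e"
      using Cauchy[of "root p e"] e p0 by (auto simp: real_root_gt_zero)
    have "(\<integral>\<^sup>+x. ennreal (norm (u m x - u n x) ^ p) \<partial>M) \<le> ennreal e" if "N \<le> m" "N \<le> n" for m n
    proof -
      have "lp_norm p (\<lambda>x. u m x - u n x) ^ p \<le> root p e ^ p"
        using N[OF that] by (intro power_mono) auto
      also have "\<dots> = e" using e p0 by (simp add: real_root_pow_pos)
      finally show ?thesis using nn[OF Lp_diff[OF p u u]] by (simp add: ennreal_leI)
    qed
    then show "\<exists>N. \<forall>m\<ge>N. \<forall>n\<ge>N. (\<integral>\<^sup>+x. ennreal (norm (u m x - u n x) ^ p) \<partial>M) \<le> ennreal e" by blast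
  qed
  then obtain v where v: "v \<in> borel_measurable M"
      "(\<lambda>n. \<integral>\<^sup>+x. ennreal (norm (u n x - v x) ^ p) \<partial>M) \<longlonglongrightarrow> 0" by blast
  \<comment> \<open>A single index at finite distance suffices to place the limit in
    \<open>Lp\<close>, by subtraction.\<close>
  have fin: "\<forall>\<^sub>F n in sequentially. (\<integral>\<^sup>+x. ennreal (norm (u n x - v x) ^ p) \<partial>M) < 1"
    using order_tendstoD(2)[OF v(2)] by simp
  then obtain n where n: "(\<integral>\<^sup>+x. ennreal (norm (u n x - v x) ^ p) \<partial>M) < 1"
    using eventually_happens' sequentially_bot by blast
  have "(\<lambda>x. u n x - v x) \<in> Lp (real p) D"
    unfolding Lp_iff[OF p]
  proof
    show "(\<lambda>x. u n x - v x) \<in> borel_measurable M" using m v(1) by measurable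
    then show "integrable M (\<lambda>x. norm (u n x - v x) ^ p)"
      using n by (intro integrableI_bounded) (auto simp: less_top[symmetric] intro: less_trans)
  qed
  from Lp_diff[OF p u this, of n] have vL: "v \<in> Lp (real p) D" by simp
  have "(\<lambda>n. lp_norm p (\<lambda>x. u n x - v x) ^ p) \<longlonglongrightarrow> 0"
    using v(2) unfolding nn[OF Lp_diff[OF p u vL]] by (subst (asm) ennreal_0[symmetric], subst (asm) tendsto_ennreal_iff) auto
  then have "(\<lambda>n. root p (lp_norm p (\<lambda>x. u n x - v x) ^ p)) \<longlonglongrightarrow> root p 0"
    by (rule tendsto_real_root)
  then have "(\<lambda>n. lp_norm p (\<lambda>x. u n x - v x)) \<longlonglongrightarrow> 0" using p0 by (simp add: real_root_power_cancel)
  then show ?thesis using vL by blast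
qed

lemma lp_norm_1_le:
  obtains C where "0 < C" "\<And>u :: real^'d \<Rightarrow> 'b::euclidean_space. u \<in> Lp (real p) D \<Longrightarrow> (LINT x|M. norm (u x)) \<le> C * lp_norm p u"
proof (cases "p = 1")
  case True
  then show thesis by (intro that[of 1]) (auto simp: lp_norm_1[simplified])
next
  case False
  then have p2: "p = 2" using p by simp
  let ?C = "l2_norm M (\<lambda>x. 1::real) + 1"
  show thesis
  proof (rule that[of ?C])
    show "0 < ?C" using l2_norm_nonneg[of M "\<lambda>x. 1::real"] by linarith
    fix u :: "real^'d \<Rightarrow> 'b" assume "u \<in> Lp (real p) D"
    then have u: "square_integrable M u" using p2 by (simp add: Lp2_iff)
    have "square_integrable M (\<lambda>x. 1::real)" by (rule square_integrable_bounded[OF finite_M, where c=1]) auto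
    from l2_norm_Cauchy_Schwarz[OF u this]
    have "(LINT x|M. norm (u x)) \<le> l2_norm M (\<lambda>x. 1::real) * l2_norm M u" by (simp add: mult.commute)
    also have "\<dots> \<le> ?C * l2_norm M u" by (intro mult_right_mono) auto
    finally show "(LINT x|M. norm (u x)) \<le> ?C * lp_norm p u" using p2 by (simp add: lp_norm_2)
  qed
qed

text \<open>The weak gradient is a closed operator: if functions and gradients converge separately
  in L^p, the limit of the gradients is the gradient of the limit, and convergence holds in the
  Sobolev norm.\<close>

lemma W1p_limitI:
  assumes un: "\<And>n. u n \<in> W1p (real p) D" and v: "v \<in> Lp (real p) D" "h \<in> Lp (real p) D"
    and conv: "(\<lambda>n. lp_norm p (\<lambda>x. u n x - v x)) \<longlonglongrightarrow> 0" "(\<lambda>n. lp_norm p (\<lambda>x. weak_grad D (u n) x - h x)) \<longlonglongrightarrow> 0"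
  shows "v \<in> W1p (real p) D" "AE x in M. weak_grad D v x = h x"
    "(\<lambda>n. W1p_norm (real p) D (\<lambda>x. v x - u n x)) \<longlonglongrightarrow> 0"
proof -
  obtain C where C: "0 < C" "\<And>u :: real^'d \<Rightarrow> real. u \<in> Lp (real p) D \<Longrightarrow> (LINT x|M. norm (u x)) \<le> C * lp_norm p u"
    using lp_norm_1_le by metis
  obtain C' where C': "0 < C'" "\<And>u :: real^'d \<Rightarrow> real^'d. u \<in> Lp (real p) D \<Longrightarrow> (LINT x|M. norm (u x)) \<le> C' * lp_norm p u"
    using lp_norm_1_le by metis
  have wg: "has_weak_gradient D v h"
  proof (rule has_weak_gradient_limit)
    show "integrable M (u n)" "integrable M (weak_grad D (u n))" for n using W1p_integrable_fun[OF un] by auto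
    show "has_weak_gradient D (u n) (weak_grad D (u n))" for n by (rule W1p_D(3)[OF un])
    show "integrable M v" "integrable M h" using v by (auto intro: Lp_integrable[OF p])
    show "(\<lambda>n. LINT x|M. norm (u n x - v x)) \<longlonglongrightarrow> 0"
    proof (rule Lim_null_comparison)
      show "\<forall>\<^sub>F n in sequentially. norm (LINT x|M. norm (u n x - v x)) \<le> C * lp_norm p (\<lambda>x. u n x - v x)"
        using C(2)[OF Lp_diff[OF p W1p_D(1)[OF un] v(1)]] by simp
      show "(\<lambda>n. C * lp_norm p (\<lambda>x. u n x - v x)) \<longlonglongrightarrow> 0" using tendsto_mult_left[OF conv(1), of C] by simp
    qed
    show "(\<lambda>n. LINT x|M. norm (weak_grad D (u n) x - h x)) \<longlonglongrightarrow> 0"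
    proof (rule Lim_null_comparison)
      show "\<forall>\<^sub>F n in sequentially. norm (LINT x|M. norm (weak_grad D (u n) x - h x)) \<le> C' * lp_norm p (\<lambda>x. weak_grad D (u n) x - h x)"
        using C'(2)[OF Lp_diff[OF p W1p_D(2)[OF un] v(2)]] by simp
      show "(\<lambda>n. C' * lp_norm p (\<lambda>x. weak_grad D (u n) x - h x)) \<longlonglongrightarrow> 0" using tendsto_mult_left[OF conv(2), of C'] by simp
    qed
  qed
  show vW: "v \<in> W1p (real p) D" using v wg by (rule W1p_I)
  show vh: "AE x in M. weak_grad D v x = h x" using wg by (rule weak_grad_eqI)
  show "(\<lambda>n. W1p_norm (real p) D (\<lambda>x. v x - u n x)) \<longlonglongrightarrow> 0"
  proof (rule Lim_null_comparison)
    show "(\<lambda>n. lp_norm p (\<lambda>x. u n x - v x) + lp_norm p (\<lambda>x. weak_grad D (u n) x - h x)) \<longlonglongrightarrow> 0"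
      using tendsto_add[OF conv] by simp
    have "W1p_norm (real p) D (\<lambda>x. v x - u n x) \<le> lp_norm p (\<lambda>x. u n x - v x) + lp_norm p (\<lambda>x. weak_grad D (u n) x - h x)" for n
    proof -
      have "W1p_norm (real p) D (\<lambda>x. v x - u n x) = W1p_norm (real p) D (\<lambda>x. u n x - v x)"
        by (rule W1p_norm_minus[OF vW un])
      also have "\<dots> \<le> lp_norm p (\<lambda>x. u n x - v x) + lp_norm p (weak_grad D (\<lambda>x. u n x - v x))"
        by (rule W1p_norm_le_lp_norm)
      also have "lp_norm p (weak_grad D (\<lambda>x. u n x - v x)) = lp_norm p (\<lambda>x. weak_grad D (u n) x - h x)"
      proof (rule lp_norm_cong_AE)
        show "weak_grad D (\<lambda>x. u n x - v x) \<in> borel_measurable M"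
          by (rule Lp_measurable[OF W1p_D(2)[OF W1p_diff(1)[OF un vW]]])
        show "(\<lambda>x. weak_grad D (u n) x - h x) \<in> borel_measurable M"
          using Lp_measurable[OF W1p_D(2)[OF un]] Lp_measurable[OF v(2)] by measurable
        show "AE x in M. weak_grad D (\<lambda>x. u n x - v x) x = weak_grad D (u n) x - h x"
          using W1p_diff(2)[OF un vW] vh by eventually_elim simp
      qed
      finally show ?thesis .
    qed
    then show "\<forall>\<^sub>F n in sequentially. norm (W1p_norm (real p) D (\<lambda>x. v x - u n x))
        \<le> lp_norm p (\<lambda>x. u n x - v x) + lp_norm p (\<lambda>x. weak_grad D (u n) x - h x)"
      using W1p_norm_nonneg by simp
  qed
qed

text \<open>A Cauchy sequence is split into two Cauchy sequences in L^p, one of functions and one of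
  gradients. Their limits are tied together by \<open>W1p_limitI\<close>, and the limit stays in the
  closure of the test functions.\<close>

lemma W1p_0_complete:
  assumes u: "\<And>n. u n \<in> W1p_0 (real p) D"
    and Cauchy: "\<And>e. 0 < e \<Longrightarrow> \<exists>N. \<forall>m\<ge>N. \<forall>n\<ge>N. W1p_norm (real p) D (\<lambda>x. u m x - u n x) < e"
  shows "\<exists>v\<in>W1p_0 (real p) D. (\<lambda>n. W1p_norm (real p) D (\<lambda>x. v x - u n x)) \<longlonglongrightarrow> 0"
proof -
  note W = W1p_0_D[OF u]
  have gd: "lp_norm p (\<lambda>x. weak_grad D (u m) x - weak_grad D (u n) x) = lp_norm p (weak_grad D (\<lambda>x. u m x - u n x))" for m n
  proof (rule lp_norm_cong_AE[OF _ Lp_measurable[OF W1p_D(2)[OF W1p_diff(1)[OF W W]]]])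
    show "(\<lambda>x. weak_grad D (u m) x - weak_grad D (u n) x) \<in> borel_measurable M"
      using Lp_measurable[OF W1p_D(2)[OF W]] by measurable
    show "AE x in M. weak_grad D (u m) x - weak_grad D (u n) x = weak_grad D (\<lambda>x. u m x - u n x) x"
      using W1p_diff(2)[OF W[of m] W[of n]] by eventually_elim simp
  qed
  obtain v where v: "v \<in> Lp (real p) D" "(\<lambda>n. lp_norm p (\<lambda>x. u n x - v x)) \<longlonglongrightarrow> 0"
  proof -
    have "\<exists>v\<in>Lp (real p) D. (\<lambda>n. lp_norm p (\<lambda>x. u n x - v x)) \<longlonglongrightarrow> 0"
    proof (rule Lp_complete_M[OF W1p_D(1)[OF W]])
      fix e :: real assume "0 < e"
      from Cauchy[OF this] obtain N where
        N: "\<And>m n. N \<le> m \<Longrightarrow> N \<le> n \<Longrightarrow> W1p_norm (real p) D (\<lambda>x. u m x - u n x) < e" by blast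
      show "\<exists>N. \<forall>m\<ge>N. \<forall>n\<ge>N. lp_norm p (\<lambda>x. u m x - u n x) < e"
        using N le_less_trans[OF lp_norm_le_W1p_norm(1)] by (intro exI[of _ N]) simp
    qed
    with that show thesis by blast
  qed
  obtain h where h: "h \<in> Lp (real p) D" "(\<lambda>n. lp_norm p (\<lambda>x. weak_grad D (u n) x - h x)) \<longlonglongrightarrow> 0"
  proof -
    have "\<exists>h\<in>Lp (real p) D. (\<lambda>n. lp_norm p (\<lambda>x. weak_grad D (u n) x - h x)) \<longlonglongrightarrow> 0"
    proof (rule Lp_complete_M[OF W1p_D(2)[OF W]])
      fix e :: real assume "0 < e"
      from Cauchy[OF this] obtain N where
        N: "\<And>m n. N \<le> m \<Longrightarrow> N \<le> n \<Longrightarrow> W1p_norm (real p) D (\<lambda>x. u m x - u n x) < e" by blast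
      show "\<exists>N. \<forall>m\<ge>N. \<forall>n\<ge>N. lp_norm p (\<lambda>x. weak_grad D (u m) x - weak_grad D (u n) x) < e"
        unfolding gd using N le_less_trans[OF lp_norm_le_W1p_norm(2)] by (intro exI[of _ N]) simp
    qed
    with that show thesis by blast
  qed
  note lim = W1p_limitI[OF W v(1) h(1) v(2) h(2)]
  have "v \<in> W1p_0 (real p) D"
  proof (rule W1p_0_closed[OF lim(1)])
    fix e :: real assume "0 < e"
    then have "\<forall>\<^sub>F n in sequentially. W1p_norm (real p) D (\<lambda>x. v x - u n x) < e"
      using order_tendstoD(2)[OF lim(3)] by blast
    then show "\<exists>w\<in>W1p_0 (real p) D. W1p_norm (real p) D (\<lambda>x. v x - w x) < e"
      using u eventually_happens' sequentially_bot by blast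
  qed
  then show ?thesis using lim(3) by blast
qed

end

section \<open>The two exponents made explicit\<close>

lemmas H1_D = W1p_D(1)[of _ 2, unfolded Lp2_iff] W1p_D(2)[of _ 2, unfolded Lp2_iff] W1p_D(3)[of _ 2]
lemmas W11_D = W1p_D(1)[of _ 1, unfolded Lp1_iff] W1p_D(2)[of _ 1, unfolded Lp1_iff] W1p_D(3)[of _ 1]
lemmas H1_add = W1p_add[of 2, simplified]
lemmas H1_diff = W1p_diff[of 2, simplified]
lemmas H1_cmult = W1p_cmult[of 2, simplified]
lemmas H1_0_D = W1p_0_D[of 2, simplified]
lemmas H1_0_diff = W1p_0_diff[of 2, simplified]
lemmas H1_norm_triangle = W1p_norm_triangle[of 2, simplified]
lemmas W11_add = W1p_add[of 1, simplified]
lemmas W11_cmult = W1p_cmult[of 1, simplified]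
lemmas W11_0_D = W1p_0_D[of 1, simplified]

lemma l2_norm_le_H1_norm: "l2_norm M u \<le> W1p_norm 2 D u" "l2_norm M (weak_grad D u) \<le> W1p_norm 2 D u"
  using lp_norm_le_W1p_norm[of 2 u] by (simp_all add: lp_norm_2)

lemma H1_norm_le: "W1p_norm 2 D u \<le> l2_norm M u + l2_norm M (weak_grad D u)"
  using W1p_norm_le_lp_norm[of 2 u] by (simp add: lp_norm_2)

lemma W11_norm_eq: "W1p_norm 1 D u = (LINT x|M. \<bar>u x\<bar>) + (LINT x|M. norm (weak_grad D u x))"
  using W1p_norm_power[of 1 u] by simp

lemma W1p_norm_ge_0 [simp]: "0 \<le> W1p_norm q D u"
  by (simp add: W1p_norm_def)

lemma l2_norm_weak_grad_diff:
  assumes "u \<in> W1p 2 D" "v \<in> W1p 2 D"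
  shows "l2_norm M (\<lambda>x. weak_grad D u x - weak_grad D v x) = l2_norm M (weak_grad D (\<lambda>x. u x - v x))"
proof (rule l2_norm_cong_AE)
  show "(\<lambda>x. weak_grad D u x - weak_grad D v x) \<in> borel_measurable M"
    using H1_D(2)[OF assms(1), THEN square_integrable_measurable] H1_D(2)[OF assms(2), THEN square_integrable_measurable]
    by measurable
  show "weak_grad D (\<lambda>x. u x - v x) \<in> borel_measurable M"
    by (rule square_integrable_measurable[OF H1_D(2)[OF H1_diff(1)[OF assms]]])
  show "AE x in M. weak_grad D u x - weak_grad D v x = weak_grad D (\<lambda>x. u x - v x) x"
    using H1_diff(2)[OF assms] by eventually_elim simp
qed

subsection \<open>Products\<close>

lemma integrable_scaleR_square_integrable:
  fixes a :: "real^'d \<Rightarrow> real" and b :: "real^'d \<Rightarrow> 'b::euclidean_space"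
  assumes "square_integrable M a" "square_integrable M b"
  shows "integrable M (\<lambda>x. a x *\<^sub>R b x)" "(LINT x|M. norm (a x *\<^sub>R b x)) \<le> l2_norm M a * l2_norm M b"
proof -
  have [measurable]: "a \<in> borel_measurable M" "b \<in> borel_measurable M"
    using assms by (simp_all add: square_integrable_def)
  show "integrable M (\<lambda>x. a x *\<^sub>R b x)"
    by (rule integrable_square_integrable_bound[OF assms, where c=1]) auto
  show "(LINT x|M. norm (a x *\<^sub>R b x)) \<le> l2_norm M a * l2_norm M b"
    using l2_norm_Cauchy_Schwarz[OF assms] by simp
qed

text \<open>The difference of products is split as \<open>(an - a) bn + a (bn - b)\<close>, with
  Cauchy-Schwarz on each part; the norms of \<open>bn\<close> are bounded because they
  converge.\<close>

lemma scaleR_l2_tendsto: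
  fixes a :: "real^'d \<Rightarrow> real" and b :: "real^'d \<Rightarrow> 'b::euclidean_space"
  assumes a: "\<And>n. square_integrable M (an n)" "square_integrable M a"
    and b: "\<And>n. square_integrable M (bn n)" "square_integrable M b"
    and conv: "(\<lambda>n. l2_norm M (\<lambda>x. an n x - a x)) \<longlonglongrightarrow> 0" "(\<lambda>n. l2_norm M (\<lambda>x. bn n x - b x)) \<longlonglongrightarrow> 0"
  shows "(\<lambda>n. LINT x|M. norm (an n x *\<^sub>R bn n x - a x *\<^sub>R b x)) \<longlonglongrightarrow> 0"
proof (rule Lim_null_comparison)
  let ?A = "\<lambda>n. l2_norm M (\<lambda>x. an n x - a x)" and ?B = "\<lambda>n. l2_norm M (\<lambda>x. bn n x - b x)"
  have "(\<lambda>n. ?A n * (l2_norm M b + ?B n) + l2_norm M a * ?B n) \<longlonglongrightarrow> 0 * (l2_norm M b + 0) + l2_norm M a * 0"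
    by (intro tendsto_intros conv)
  then show "(\<lambda>n. ?A n * (l2_norm M b + ?B n) + l2_norm M a * ?B n) \<longlonglongrightarrow> 0" by simp
  have "(LINT x|M. norm (an n x *\<^sub>R bn n x - a x *\<^sub>R b x)) \<le> ?A n * (l2_norm M b + ?B n) + l2_norm M a * ?B n" for n
  proof -
    have da: "square_integrable M (\<lambda>x. an n x - a x)" by (intro square_integrable_diff a)
    have db: "square_integrable M (\<lambda>x. bn n x - b x)" by (intro square_integrable_diff b)
    have "(LINT x|M. norm (an n x *\<^sub>R bn n x - a x *\<^sub>R b x))
        \<le> (LINT x|M. norm ((an n x - a x) *\<^sub>R bn n x) + norm (a x *\<^sub>R (bn n x - b x)))"
    proof (rule integral_mono)
      show "integrable M (\<lambda>x. norm (an n x *\<^sub>R bn n x - a x *\<^sub>R b x))"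
        by (intro integrable_norm Bochner_Integration.integrable_diff integrable_scaleR_square_integrable a b)
      show "integrable M (\<lambda>x. norm ((an n x - a x) *\<^sub>R bn n x) + norm (a x *\<^sub>R (bn n x - b x)))"
        by (intro integrable_norm Bochner_Integration.integrable_add integrable_scaleR_square_integrable(1) a b da db)
      show "norm (an n x *\<^sub>R bn n x - a x *\<^sub>R b x) \<le> norm ((an n x - a x) *\<^sub>R bn n x) + norm (a x *\<^sub>R (bn n x - b x))" for x
        using norm_triangle_ineq[of "(an n x - a x) *\<^sub>R bn n x" "a x *\<^sub>R (bn n x - b x)"]
        by (simp add: scaleR_left_diff_distrib scaleR_right_diff_distrib)
    qed
    also have "\<dots> = (LINT x|M. norm ((an n x - a x) *\<^sub>R bn n x)) + (LINT x|M. norm (a x *\<^sub>R (bn n x - b x)))"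
      by (intro Bochner_Integration.integral_add integrable_norm integrable_scaleR_square_integrable(1) a b da db)
    also have "\<dots> \<le> ?A n * l2_norm M (bn n) + l2_norm M a * ?B n"
      by (intro add_mono integrable_scaleR_square_integrable(2) a b da db)
    also have "l2_norm M (bn n) \<le> l2_norm M b + ?B n"
      using l2_norm_triangle[OF b(2) db] by simp
    finally show ?thesis by (simp add: mult_left_mono add_mono)
  qed
  then show "\<forall>\<^sub>F n in sequentially. norm (LINT x|M. norm (an n x *\<^sub>R bn n x - a x *\<^sub>R b x))
      \<le> ?A n * (l2_norm M b + ?B n) + l2_norm M a * ?B n" by simp
qed

lemma H1_0_seq:
  assumes "u \<in> H1_0 D"
  shows "\<exists>\<phi>. (\<forall>n::nat. \<phi> n \<in> test_functions D) \<and>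
    (\<lambda>n. l2_norm M (\<lambda>x. \<phi> n x - u x)) \<longlonglongrightarrow> 0 \<and>
    (\<lambda>n. l2_norm M (\<lambda>x. weak_grad D (\<phi> n) x - weak_grad D u x)) \<longlonglongrightarrow> 0"
proof -
  obtain \<phi> where \<phi>: "\<And>n::nat. \<phi> n \<in> test_functions D" "(\<lambda>n. W1p_norm 2 D (\<lambda>x. u x - \<phi> n x)) \<longlonglongrightarrow> 0"
    using assms by (auto simp: W1p_0_def)
  have W: "\<phi> n \<in> W1p 2 D" for n using test_function_W1p(1)[of 2, OF _ \<phi>(1)] by simp
  have eq: "W1p_norm 2 D (\<lambda>x. u x - \<phi> n x) = W1p_norm 2 D (\<lambda>x. \<phi> n x - u x)" for n
    using W1p_norm_minus[of 2 u "\<phi> n"] W[of n] H1_0_D[OF assms] by simp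
  show ?thesis
  proof (intro exI[of _ \<phi>] conjI allI)
    show "\<phi> n \<in> test_functions D" for n by (rule \<phi>)
    show "(\<lambda>n. l2_norm M (\<lambda>x. \<phi> n x - u x)) \<longlonglongrightarrow> 0"
      by (rule Lim_null_comparison[OF _ \<phi>(2)]) (simp add: eq l2_norm_le_H1_norm)
    show "(\<lambda>n. l2_norm M (\<lambda>x. weak_grad D (\<phi> n) x - weak_grad D u x)) \<longlonglongrightarrow> 0"
      by (rule Lim_null_comparison[OF _ \<phi>(2)])
        (simp add: eq l2_norm_weak_grad_diff[OF W H1_0_D[OF assms]] l2_norm_le_H1_norm)
  qed
qed

text \<open>The weak gradient of \<open>u\<close> is tested with the product of
  \<open>\<psi>\<close> and \<open>\<phi>\<close>, again a test function; expanding its derivative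
  yields the product rule.\<close>

lemma has_weak_gradient_test_mult:
  assumes u: "square_integrable M u" "square_integrable M g" "has_weak_gradient D u g"
    and \<psi>: "\<psi> \<in> test_functions D"
  shows "has_weak_gradient D (\<lambda>x. u x * \<psi> x) (\<lambda>x. u x *\<^sub>R (\<chi> i. partial_deriv i \<psi> x) + \<psi> x *\<^sub>R g x)"
proof -
  have W: "\<psi> \<in> W1p 2 D" and G: "AE x in M. weak_grad D \<psi> x = (\<chi> i. partial_deriv i \<psi> x)"
    using test_function_W1p[of 2, OF _ \<psi>] by simp_all
  have s\<psi>: "square_integrable M (\<lambda>x. \<chi> i. partial_deriv i \<psi> x)"
    using Lp_cong_AE[OF W1p_D(2)[OF W] G] by (simp add: Lp2_iff)
  have i1: "integrable M (\<lambda>x. u x * \<psi> x)"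
    using integrable_scaleR_square_integrable(1)[OF u(1) H1_D(1)[OF W]] by simp
  have i2: "integrable M (\<lambda>x. u x *\<^sub>R (\<chi> i. partial_deriv i \<psi> x) + \<psi> x *\<^sub>R g x)"
    by (intro Bochner_Integration.integrable_add integrable_scaleR_square_integrable u s\<psi> H1_D(1)[OF W])
  have iu: "integrable M u" "integrable M g"
    using u by (auto intro: square_integrable_imp_integrable[OF finite_M])
  show ?thesis
    unfolding has_weak_gradient_def
  proof (intro conjI allI impI ballI)
    fix K :: "(real^'d) set" assume "compact K \<and> K \<subseteq> D"
    then show "(\<lambda>x. u x * \<psi> x) absolutely_integrable_on K"
      "(\<lambda>x. u x *\<^sub>R (\<chi> i. partial_deriv i \<psi> x) + \<psi> x *\<^sub>R g x) absolutely_integrable_on K"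
      using i1 i2 by (auto intro!: integrable_absolutely_integrable_on)
  next
    fix \<phi> i assume \<phi>: "\<phi> \<in> test_functions D"
    have t1: "(\<lambda>x. \<psi> x * partial_deriv i \<phi> x) \<in> test_functions D"
      and t2: "(\<lambda>x. partial_deriv i \<psi> x * \<phi> x) \<in> test_functions D"
      and t3: "(\<lambda>x. \<psi> x * \<phi> x) \<in> test_functions D"
      by (intro test_functions_mult test_functions_partial_deriv \<phi> \<psi>)+
    note i = test_mult_integrable[OF iu(1) t1] test_mult_integrable[OF iu(1) t2]
      test_mult_integrable[OF integrable_vec_nth[OF iu(2), of i] t3]
    have "(LINT x|M. u x * partial_deriv i (\<lambda>x. \<psi> x * \<phi> x) x) = - (LINT x|M. g x $ i * (\<psi> x * \<phi> x))"
      using u(3) t3 unfolding has_weak_gradient_def by blast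
    moreover have "partial_deriv i (\<lambda>x. \<psi> x * \<phi> x) = (\<lambda>x. \<psi> x * partial_deriv i \<phi> x + partial_deriv i \<psi> x * \<phi> x)"
      by (rule partial_deriv_mult) (auto intro: smooth_differentiable test_functions_smooth \<phi> \<psi>)
    ultimately have "(LINT x|M. u x * (\<psi> x * partial_deriv i \<phi> x)) + (LINT x|M. u x * (partial_deriv i \<psi> x * \<phi> x))
        = - (LINT x|M. g x $ i * (\<psi> x * \<phi> x))"
      using i(1,2) by (simp add: distrib_left)
    moreover have "(LINT x|M. (u x *\<^sub>R (\<chi> i. partial_deriv i \<psi> x) + \<psi> x *\<^sub>R g x) $ i * \<phi> x)
        = (LINT x|M. u x * (partial_deriv i \<psi> x * \<phi> x) + g x $ i * (\<psi> x * \<phi> x))"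
      by (intro Bochner_Integration.integral_cong) (auto simp: algebra_simps)
    ultimately show "(LINT x|M. u x * \<psi> x * partial_deriv i \<phi> x)
        = - (LINT x|M. (u x *\<^sub>R (\<chi> i. partial_deriv i \<psi> x) + \<psi> x *\<^sub>R g x) $ i * \<phi> x)"
      using i(2,3) by (simp add: mult.assoc)
  qed
qed

text \<open>Approximating one factor by test functions reduces the product rule to
  \<open>has_weak_gradient_test_mult\<close>; the passage to the limit takes place in L^1, where the
  product lives. This is why only the factor \<open>v\<close> is taken from \<open>H1_0\<close>. The
  constant 3 counts one term for the function and two for the gradient.\<close>

lemma H1_mult:
  assumes u: "u \<in> W1p 2 D" and v: "v \<in> H1_0 D"
  shows "(\<lambda>x. u x * v x) \<in> W1p 1 D"
    and "AE x in M. weak_grad D (\<lambda>x. u x * v x) x = u x *\<^sub>R weak_grad D v x + v x *\<^sub>R weak_grad D u x"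
    and "W1p_norm 1 D (\<lambda>x. u x * v x) \<le> 3 * (W1p_norm 2 D u * W1p_norm 2 D v)"
proof -
  note U = H1_D[OF u] and V = H1_D[OF H1_0_D[OF v]]
  obtain \<psi> where \<psi>: "\<And>n::nat. \<psi> n \<in> test_functions D" "(\<lambda>n. l2_norm M (\<lambda>x. \<psi> n x - v x)) \<longlonglongrightarrow> 0"
    "(\<lambda>n. l2_norm M (\<lambda>x. weak_grad D (\<psi> n) x - weak_grad D v x)) \<longlonglongrightarrow> 0"
    using H1_0_seq[OF v] by blast
  have W\<psi>: "\<psi> n \<in> W1p 2 D" for n
    using test_function_W1p(1)[of 2] \<psi>(1) by simp
  note S\<psi> = H1_D[OF W\<psi>]
  let ?g = "\<lambda>x. u x *\<^sub>R weak_grad D v x + v x *\<^sub>R weak_grad D u x"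
  have wg: "has_weak_gradient D (\<lambda>x. u x * \<psi> n x) (\<lambda>x. u x *\<^sub>R (\<chi> i. partial_deriv i (\<psi> n) x) + \<psi> n x *\<^sub>R weak_grad D u x)" for n
    by (rule has_weak_gradient_test_mult[OF U \<psi>(1)])
  have gt: "AE x in M. weak_grad D (\<lambda>x. u x * \<psi> n x) x = u x *\<^sub>R weak_grad D (\<psi> n) x + \<psi> n x *\<^sub>R weak_grad D u x" for n
    using weak_grad_eqI[OF wg[of n]] test_function_W1p(2)[of 2, OF _ \<psi>(1)[of n], simplified]
    by eventually_elim simp
  have uv: "(\<lambda>x. u x * v x) \<in> Lp 1 D" unfolding Lp1_iff using integrable_scaleR_square_integrable(1)[OF U(1) V(1)] by simp
  have g: "?g \<in> Lp 1 D" unfolding Lp1_iff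
    by (intro Bochner_Integration.integrable_add integrable_scaleR_square_integrable U V)
  have gn: "(\<lambda>x. u x *\<^sub>R weak_grad D (\<psi> n) x + \<psi> n x *\<^sub>R weak_grad D u x) \<in> Lp 1 D" for n unfolding Lp1_iff
    by (intro Bochner_Integration.integrable_add integrable_scaleR_square_integrable U S\<psi>)
  have Wt: "(\<lambda>x. u x * \<psi> n x) \<in> W1p 1 D" for n
  proof (rule W1p_I[OF _ _ wg])
    show "(\<lambda>x. u x * \<psi> n x) \<in> Lp 1 D"
      unfolding Lp1_iff using integrable_scaleR_square_integrable(1)[OF U(1) S\<psi>(1)] by simp
    show "(\<lambda>x. u x *\<^sub>R (\<chi> i. partial_deriv i (\<psi> n) x) + \<psi> n x *\<^sub>R weak_grad D u x) \<in> Lp 1 D"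
      by (rule Lp_cong_AE[OF gn[of n]])
        (use test_function_W1p(2)[of 2, OF _ \<psi>(1)[of n], simplified] in \<open>auto elim!: eventually_mono\<close>)
  qed
  have cu: "(\<lambda>n::nat. l2_norm M (\<lambda>x. u x - u x)) \<longlonglongrightarrow> 0"
    "(\<lambda>n::nat. l2_norm M (\<lambda>x. weak_grad D u x - weak_grad D u x)) \<longlonglongrightarrow> 0"
    by (simp_all add: l2_norm_def)
  have c1: "(\<lambda>n. lp_norm 1 (\<lambda>x. u x * \<psi> n x - u x * v x)) \<longlonglongrightarrow> 0"
    unfolding lp_norm_1 using scaleR_l2_tendsto[OF U(1) U(1) S\<psi>(1) V(1) cu(1) \<psi>(2)] by simp
  have c2: "(\<lambda>n. lp_norm 1 (\<lambda>x. weak_grad D (\<lambda>x. u x * \<psi> n x) x - ?g x)) \<longlonglongrightarrow> 0"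
    unfolding lp_norm_1
  proof (rule Lim_null_comparison)
    let ?a = "\<lambda>n. LINT x|M. norm (u x *\<^sub>R weak_grad D (\<psi> n) x - u x *\<^sub>R weak_grad D v x)"
    let ?b = "\<lambda>n. LINT x|M. norm (\<psi> n x *\<^sub>R weak_grad D u x - v x *\<^sub>R weak_grad D u x)"
    have "(\<lambda>n. ?a n + ?b n) \<longlonglongrightarrow> 0 + 0"
      by (intro tendsto_add scaleR_l2_tendsto U S\<psi> V cu \<psi>)
    then show "(\<lambda>n. ?a n + ?b n) \<longlonglongrightarrow> 0" by simp
    have "(LINT x|M. norm (weak_grad D (\<lambda>x. u x * \<psi> n x) x - ?g x)) \<le> ?a n + ?b n" for n
    proof -
      have "(LINT x|M. norm (weak_grad D (\<lambda>x. u x * \<psi> n x) x - ?g x))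
         \<le> (LINT x|M. norm (u x *\<^sub>R weak_grad D (\<psi> n) x - u x *\<^sub>R weak_grad D v x)
              + norm (\<psi> n x *\<^sub>R weak_grad D u x - v x *\<^sub>R weak_grad D u x))"
      proof (rule integral_mono_AE)
        show "integrable M (\<lambda>x. norm (weak_grad D (\<lambda>x. u x * \<psi> n x) x - ?g x))"
          using W11_D(2)[OF Wt[of n]] g[unfolded Lp1_iff] by (intro integrable_norm Bochner_Integration.integrable_diff)
        show "integrable M (\<lambda>x. norm (u x *\<^sub>R weak_grad D (\<psi> n) x - u x *\<^sub>R weak_grad D v x)
              + norm (\<psi> n x *\<^sub>R weak_grad D u x - v x *\<^sub>R weak_grad D u x))"
          by (intro integrable_norm Bochner_Integration.integrable_add Bochner_Integration.integrable_diff
              integrable_scaleR_square_integrable(1) S\<psi> U V)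
        show "AE x in M. norm (weak_grad D (\<lambda>x. u x * \<psi> n x) x - ?g x)
            \<le> norm (u x *\<^sub>R weak_grad D (\<psi> n) x - u x *\<^sub>R weak_grad D v x)
              + norm (\<psi> n x *\<^sub>R weak_grad D u x - v x *\<^sub>R weak_grad D u x)"
          using gt[of n]
        proof eventually_elim
          case (elim x)
          show ?case unfolding elim
            using norm_triangle_ineq[of "u x *\<^sub>R weak_grad D (\<psi> n) x - u x *\<^sub>R weak_grad D v x"
                "\<psi> n x *\<^sub>R weak_grad D u x - v x *\<^sub>R weak_grad D u x"] by (simp add: algebra_simps)
        qed
      qed
      also have "\<dots> = ?a n + ?b n"
        by (intro Bochner_Integration.integral_add integrable_norm Bochner_Integration.integrable_diff
              integrable_scaleR_square_integrable(1) S\<psi> U V)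
      finally show ?thesis .
    qed
    then show "\<forall>\<^sub>F n in sequentially. norm (LINT x|M. norm (weak_grad D (\<lambda>x. u x * \<psi> n x) x - ?g x)) \<le> ?a n + ?b n"
      by simp
  qed
  have one: "(1::nat) \<in> {1, 2}" by simp
  note lim = W1p_limitI[OF one, of "\<lambda>n x. u x * \<psi> n x", unfolded of_nat_1, OF Wt uv g c1 c2]
  show "(\<lambda>x. u x * v x) \<in> W1p 1 D" by (rule lim(1))
  show AE: "AE x in M. weak_grad D (\<lambda>x. u x * v x) x = ?g x" by (rule lim(2))
  have "(LINT x|M. norm (weak_grad D (\<lambda>x. u x * v x) x)) = (LINT x|M. norm (?g x))"
    using AE W11_D(2)[OF lim(1)] g[unfolded Lp1_iff] by (intro integral_cong_AE) auto
  also have "\<dots> \<le> (LINT x|M. norm (u x *\<^sub>R weak_grad D v x) + norm (v x *\<^sub>R weak_grad D u x))"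
    by (intro integral_mono integrable_norm Bochner_Integration.integrable_add
        integrable_scaleR_square_integrable(1) U V norm_triangle_ineq)
  also have "\<dots> = (LINT x|M. norm (u x *\<^sub>R weak_grad D v x)) + (LINT x|M. norm (v x *\<^sub>R weak_grad D u x))"
    by (intro Bochner_Integration.integral_add integrable_norm integrable_scaleR_square_integrable(1) U V)
  also have "\<dots> \<le> l2_norm M u * l2_norm M (weak_grad D v) + l2_norm M v * l2_norm M (weak_grad D u)"
    by (intro add_mono integrable_scaleR_square_integrable(2) U V)
  also have "\<dots> \<le> W1p_norm 2 D u * W1p_norm 2 D v + W1p_norm 2 D v * W1p_norm 2 D u"
    by (intro add_mono mult_mono l2_norm_le_H1_norm) auto
  finally have 1: "(LINT x|M. norm (weak_grad D (\<lambda>x. u x * v x) x)) \<le> 2 * (W1p_norm 2 D u * W1p_norm 2 D v)" by simp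
  have "(LINT x|M. \<bar>u x * v x\<bar>) \<le> l2_norm M u * l2_norm M v"
    using integrable_scaleR_square_integrable(2)[OF U(1) V(1)] by simp
  also have "\<dots> \<le> W1p_norm 2 D u * W1p_norm 2 D v" by (intro mult_mono l2_norm_le_H1_norm) auto
  finally show "W1p_norm 1 D (\<lambda>x. u x * v x) \<le> 3 * (W1p_norm 2 D u * W1p_norm 2 D v)"
    using 1 by (simp add: W11_norm_eq)
qed

text \<open>Both factors are approximated at once, since products of test functions are test
  functions. This is what gives the squared deviations, and with them the variance, zero boundary
  values.\<close>

lemma H1_0_mult:
  assumes u: "u \<in> H1_0 D" and v: "v \<in> H1_0 D"
  shows "(\<lambda>x. u x * v x) \<in> W1p_0 1 D"
proof -
  note W = H1_0_D[OF u] H1_0_D[OF v]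
  obtain \<phi> where \<phi>: "\<And>n::nat. \<phi> n \<in> test_functions D" "(\<lambda>n. W1p_norm 2 D (\<lambda>x. u x - \<phi> n x)) \<longlonglongrightarrow> 0"
    using u by (auto simp: W1p_0_def)
  obtain \<psi> where \<psi>: "\<And>n::nat. \<psi> n \<in> test_functions D" "(\<lambda>n. W1p_norm 2 D (\<lambda>x. v x - \<psi> n x)) \<longlonglongrightarrow> 0"
    using v by (auto simp: W1p_0_def)
  have H: "\<phi> n \<in> H1_0 D" "\<psi> n \<in> H1_0 D" for n using W1p_0_test[of 2] \<phi>(1) \<psi>(1) by simp_all
  have "(\<lambda>n. W1p_norm 1 D (\<lambda>x. u x * v x - \<phi> n x * \<psi> n x)) \<longlonglongrightarrow> 0"
  proof (rule Lim_null_comparison)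
    let ?a = "\<lambda>n. W1p_norm 2 D (\<lambda>x. u x - \<phi> n x)" and ?b = "\<lambda>n. W1p_norm 2 D (\<lambda>x. v x - \<psi> n x)"
    have "(\<lambda>n. 3 * (?a n * (W1p_norm 2 D v + ?b n)) + 3 * (W1p_norm 2 D u * ?b n))
        \<longlonglongrightarrow> 3 * (0 * (W1p_norm 2 D v + 0)) + 3 * (W1p_norm 2 D u * 0)"
      by (intro tendsto_intros \<phi> \<psi>)
    then show "(\<lambda>n. 3 * (?a n * (W1p_norm 2 D v + ?b n)) + 3 * (W1p_norm 2 D u * ?b n)) \<longlonglongrightarrow> 0" by simp
    have "W1p_norm 1 D (\<lambda>x. u x * v x - \<phi> n x * \<psi> n x) \<le> 3 * (?a n * (W1p_norm 2 D v + ?b n)) + 3 * (W1p_norm 2 D u * ?b n)" for n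
    proof -
      have dv: "(\<lambda>x. v x - \<psi> n x) \<in> H1_0 D" and du: "(\<lambda>x. u x - \<phi> n x) \<in> W1p 2 D"
        using H1_0_diff[OF v H(2)] H1_diff(1)[OF W(1) H1_0_D[OF H(1)]] by auto
      have "(\<lambda>x. u x * v x - \<phi> n x * \<psi> n x) = (\<lambda>x. (u x - \<phi> n x) * \<psi> n x + u x * (v x - \<psi> n x))"
        by (auto simp: algebra_simps)
      then have "W1p_norm 1 D (\<lambda>x. u x * v x - \<phi> n x * \<psi> n x)
          \<le> W1p_norm 1 D (\<lambda>x. (u x - \<phi> n x) * \<psi> n x) + W1p_norm 1 D (\<lambda>x. u x * (v x - \<psi> n x))"
        using W1p_norm_triangle[of 1, simplified, OF H1_mult(1)[OF du H(2)] H1_mult(1)[OF W(1) dv]] by simp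
      also have "\<dots> \<le> 3 * (?a n * W1p_norm 2 D (\<psi> n)) + 3 * (W1p_norm 2 D u * ?b n)"
        by (intro add_mono H1_mult(3) du dv H W)
      also have "W1p_norm 2 D (\<psi> n) \<le> W1p_norm 2 D v + ?b n"
        using H1_norm_triangle[OF W(2) H1_diff(1)[OF H1_0_D[OF H(2)] W(2)], of n]
          W1p_norm_minus[of 2 v "\<psi> n"] W(2) H1_0_D[OF H(2)[of n]] by simp
      finally show ?thesis by (simp add: mult_left_mono)
    qed
    then show "\<forall>\<^sub>F n in sequentially. norm (W1p_norm 1 D (\<lambda>x. u x * v x - \<phi> n x * \<psi> n x))
        \<le> 3 * (?a n * (W1p_norm 2 D v + ?b n)) + 3 * (W1p_norm 2 D u * ?b n)" by simp
  qed
  then show ?thesis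
    unfolding W1p_0_def using H1_mult(1)[OF W(1) v] test_functions_mult[OF \<phi>(1) \<psi>(1)]
    by (auto intro!: exI[of _ "\<lambda>n x. \<phi> n x * \<psi> n x"])
qed

subsection \<open>The Poincare inequality\<close>

text \<open>For a test function, integrate the derivative of \<open>x\<^sub>i \<phi>\<^sup>2\<close>.\<close>

lemma Poincare:
  obtains C where "0 < C" "\<And>u. u \<in> H1_0 D \<Longrightarrow> l2_norm M u \<le> C * l2_norm M (weak_grad D u)"
proof -
  obtain R where R: "\<And>x. x \<in> D \<Longrightarrow> norm x \<le> R" using D_bounded by (auto simp: bounded_iff)
  \<comment> \<open>The factor 2 stems from differentiating the square;
    \<open>\<bar>R\<bar> + 1\<close> bounds a coordinate on \<open>D\<close> and is positive
    whatever the sign of \<open>R\<close>.\<close>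
  define C where "C = 2 * (\<bar>R\<bar> + 1)"
  have C: "0 < C" by (simp add: C_def)
  \<comment> \<open>An arbitrary coordinate direction, available because index types are
    inhabited.\<close>
  obtain i :: 'd where True by simp
  have test: "l2_norm M \<phi> \<le> C * l2_norm M (weak_grad D \<phi>)" if \<phi>: "\<phi> \<in> test_functions D" for \<phi>
  proof -
    note s = test_functions_smooth[OF \<phi>]
    have W: "\<phi> \<in> W1p 2 D" and G: "AE x in M. weak_grad D \<phi> x = (\<chi> i. partial_deriv i \<phi> x)"
      using test_function_W1p[of 2, OF _ \<phi>] by simp_all
    note S = H1_D[OF W]
    let ?h = "\<lambda>x. x $ i * (\<phi> x * partial_deriv i \<phi> x)"
    have th: "?h \<in> test_functions D"
      by (intro test_functions_smooth_mult[OF test_functions_mult] smooth_coord \<phi> test_functions_partial_deriv)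
    have "partial_deriv i (\<lambda>x. x $ i * (\<phi> x * \<phi> x)) = (\<lambda>x. 2 * ?h x + (norm (\<phi> x))\<^sup>2)"
    proof -
      have "((\<lambda>x::real^'d. x $ i) has_derivative (\<lambda>h. h $ i)) (at x)" for x
        by (rule bounded_linear_imp_has_derivative[OF bounded_linear_vec_nth])
      then have "partial_deriv i (\<lambda>x::real^'d. x $ i) = (\<lambda>x. 1)"
        by (intro ext, subst partial_deriv_eq) (assumption, simp)
      then show ?thesis
        by (subst partial_deriv_mult, (auto intro!: smooth_differentiable smooth_coord smooth_mult s)[2],
            subst partial_deriv_mult, (auto intro!: smooth_differentiable s)[2])
          (simp add: fun_eq_iff power2_eq_square algebra_simps)
    qed
    moreover have "(LINT x|M. partial_deriv i (\<lambda>x. x $ i * (\<phi> x * \<phi> x)) x) = 0"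
      by (intro integral_partial_deriv D_open test_functions_smooth_mult test_functions_mult \<phi> smooth_coord)
    moreover have "integrable M ?h" by (rule test_function_integrable[OF D_open th])
    ultimately have "(l2_norm M \<phi>)\<^sup>2 = - 2 * (LINT x|M. ?h x)"
      using S(1) by (simp add: l2_norm_power2 square_integrable_def)
    also have "\<dots> \<le> 2 * norm (LINT x|M. ?h x)" by simp
    also have "norm (LINT x|M. ?h x) \<le> (\<bar>R\<bar> + 1) * (l2_norm M \<phi> * l2_norm M (weak_grad D \<phi>))"
    proof (rule l2_norm_bilinear_bound[OF S(1,2)])
      show "?h \<in> borel_measurable M" by (intro borel_M test_functions_borel[OF th])
      have "AE x in M. x \<in> D" by (rule AE_I2) (simp add: space_restrict_space)
      then show "AE x in M. norm (?h x) \<le> (\<bar>R\<bar> + 1) * (norm (\<phi> x) * norm (weak_grad D \<phi> x))"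
        using G
      proof eventually_elim
        case (elim x)
        have "\<bar>x $ i\<bar> \<le> \<bar>R\<bar> + 1" using R[OF elim(1)] component_le_norm_cart[of x i] by linarith
        moreover have "\<bar>partial_deriv i \<phi> x\<bar> \<le> norm (weak_grad D \<phi> x)"
          unfolding elim(2) using component_le_norm_cart[of "\<chi> i. partial_deriv i \<phi> x" i] by simp
        ultimately show ?case by (auto simp: abs_mult intro!: mult_mono)
      qed
    qed simp
    finally have "(l2_norm M \<phi>)\<^sup>2 \<le> C * (l2_norm M \<phi> * l2_norm M (weak_grad D \<phi>))"
      by (simp only: C_def mult.assoc)
    then have "l2_norm M \<phi> * l2_norm M \<phi> \<le> l2_norm M \<phi> * (C * l2_norm M (weak_grad D \<phi>))"
      by (simp add: power2_eq_square algebra_simps)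
    then show ?thesis using C
      by (cases "l2_norm M \<phi> = 0") (auto simp: mult_le_cancel_left less_le)
  qed
  show thesis
  proof (rule that[OF C])
    fix u assume u: "u \<in> H1_0 D"
    note U = H1_0_D[OF u]
    show "l2_norm M u \<le> C * l2_norm M (weak_grad D u)"
    \<comment> \<open>Both sides are continuous in the Sobolev norm, so the inequality extends from
      test functions with an arbitrarily small error. Replacing \<open>u\<close> by
      \<open>\<phi>\<close> costs one unit on the left and \<open>C\<close> units on the right,
      hence the tolerance \<open>e / (1 + C)\<close>.\<close>
    proof (rule field_le_epsilon)
      fix e :: real assume e: "0 < e"
      have C1: "0 < 1 + C" using C by simp
      obtain \<phi> where \<phi>: "\<phi> \<in> test_functions D" "W1p_norm 2 D (\<lambda>x. u x - \<phi> x) < e / (1 + C)"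
        using W1p_0_approx[of 2 u "e / (1 + C)"] u e C1 by auto
      have W: "\<phi> \<in> W1p 2 D" using test_function_W1p(1)[of 2, OF _ \<phi>(1)] by simp
      have d: "W1p_norm 2 D (\<lambda>x. \<phi> x - u x) = W1p_norm 2 D (\<lambda>x. u x - \<phi> x)"
        using W1p_norm_minus[of 2 \<phi> u] W U by simp
      have "l2_norm M u \<le> l2_norm M (\<lambda>x. u x - \<phi> x) + l2_norm M \<phi>"
        using l2_norm_triangle[OF H1_D(1)[OF H1_diff(1)[OF U W]] H1_D(1)[OF W]] by simp
      also have "\<dots> \<le> W1p_norm 2 D (\<lambda>x. u x - \<phi> x) + C * l2_norm M (weak_grad D \<phi>)"
        by (intro add_mono l2_norm_le_H1_norm test \<phi>)
      also have "l2_norm M (weak_grad D \<phi>) \<le> l2_norm M (weak_grad D u) + W1p_norm 2 D (\<lambda>x. u x - \<phi> x)"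
        using l2_norm_triangle[OF H1_D(2)[OF U] square_integrable_diff[OF H1_D(2)[OF W] H1_D(2)[OF U]]]
          l2_norm_weak_grad_diff[OF W U] l2_norm_le_H1_norm(2)[of "\<lambda>x. \<phi> x - u x"] d by simp
      finally have "l2_norm M u \<le> C * l2_norm M (weak_grad D u) + (1 + C) * W1p_norm 2 D (\<lambda>x. u x - \<phi> x)"
        using C by (simp add: algebra_simps)
      also have "(1 + C) * W1p_norm 2 D (\<lambda>x. u x - \<phi> x) \<le> e"
        using \<phi>(2) C1 by (simp add: pos_less_divide_eq mult.commute)
      finally show "l2_norm M u \<le> C * l2_norm M (weak_grad D u) + e" by simp
    qed
  qed
qed

lemma H1_norm_le_gradient:
  obtains C where "0 < C" "\<And>u. u \<in> H1_0 D \<Longrightarrow> W1p_norm 2 D u \<le> C * l2_norm M (weak_grad D u)"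
proof -
  obtain C where C: "0 < C" "\<And>u. u \<in> H1_0 D \<Longrightarrow> l2_norm M u \<le> C * l2_norm M (weak_grad D u)"
    using Poincare by metis
  show thesis
  proof (rule that[of "C + 1"])
    show "W1p_norm 2 D u \<le> (C + 1) * l2_norm M (weak_grad D u)" if "u \<in> H1_0 D" for u
      using H1_norm_le[of u] C(2)[OF that] by (simp add: algebra_simps)
  qed (use C in simp)
qed

end

section \<open>Bochner integrals in Sobolev spaces\<close>

text \<open>Level sets of a simple function are measurable without any structure on its value type,
  so \<open>f\<close> may be an arbitrary function of the value. It is applied with point
  evaluations, norms and functionals.\<close>

lemma simple_function_integral_sum:
  fixes f :: "'b \<Rightarrow> real"
  assumes P: "finite_measure P" and s: "simple_function P s"
  shows "integrable P (\<lambda>w. f (s w))"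
    "(\<integral>w. f (s w) \<partial>P) = (\<Sum>c\<in>s ` space P. measure P {w \<in> space P. s w = c} * f c)"
proof -
  interpret finite_measure P by fact
  have fin: "finite (s ` space P)" using s by (rule simple_functionD)
  have sets: "{w \<in> space P. s w = c} \<in> sets P" for c
    using simple_functionD(2)[OF s, of "{c}"] by (simp add: vimage_def Int_def conj_commute)
  have eq: "f (s w) = (\<Sum>c\<in>s ` space P. indicator {w \<in> space P. s w = c} w * f c)" if "w \<in> space P" for w
  proof -
    have "(\<Sum>c\<in>s ` space P. indicator {w \<in> space P. s w = c} w * f c) = (\<Sum>c\<in>s ` space P. if c = s w then f c else 0)"
      using that by (intro sum.cong) (auto simp: indicator_def)
    also have "\<dots> = f (s w)" using fin that by (simp add: sum.delta)
    finally show ?thesis by simp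
  qed
  have i: "integrable P (\<lambda>w. indicator {w \<in> space P. s w = c} w * f c)" for c
    using sets by (intro integrable_mult_left integrable_real_indicator) (auto simp: less_top[symmetric])
  have "integrable P (\<lambda>w. \<Sum>c\<in>s ` space P. indicator {w \<in> space P. s w = c} w * f c)"
    by (intro Bochner_Integration.integrable_sum i)
  then show "integrable P (\<lambda>w. f (s w))"
    by (rule Bochner_Integration.integrable_cong[THEN iffD2, rotated -1]) (simp_all add: eq)
  have "(\<integral>w. f (s w) \<partial>P) = (\<integral>w. (\<Sum>c\<in>s ` space P. indicator {w \<in> space P. s w = c} w * f c) \<partial>P)"
    by (intro Bochner_Integration.integral_cong) (simp_all add: eq)
  also have "\<dots> = (\<Sum>c\<in>s ` space P. \<integral>w. indicator {w \<in> space P. s w = c} w * f c \<partial>P)"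
    by (intro Bochner_Integration.integral_sum i)
  also have "\<dots> = (\<Sum>c\<in>s ` space P. measure P {w \<in> space P. s w = c} * f c)"
    using sets by (intro sum.cong) auto
  finally show "(\<integral>w. f (s w) \<partial>P) = (\<Sum>c\<in>s ` space P. measure P {w \<in> space P. s w = c} * f c)" .
qed

text \<open>Turns a finite net into a simple function that picks a nearby net point. The default
  \<open>undefined\<close> is reached only by points away from the whole net, and these are cut off
  by \<open>G\<close> wherever the selection is used.\<close>

fun select_near :: "real \<Rightarrow> 'w::metric_space list \<Rightarrow> 'w \<Rightarrow> 'w" where
  "select_near e [] w = undefined"
| "select_near e (x # xs) w = (if dist w x < e then x else select_near e xs w)"

lemma select_near_simple:
  assumes "sets P = sets borel"
  shows "simple_function P (select_near e xs)"
proof (induction xs)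
  case Nil
  then show ?case by simp
next
  case (Cons x xs)
  have "{w \<in> space P. dist w x < e} = ball x e"
    using sets_eq_imp_space_eq[OF assms] by (auto simp: dist_commute)
  then have "{w \<in> space P. dist w x < e} \<in> sets P" by (simp add: assms)
  then have "simple_function P (\<lambda>w. if dist w x < e then x else select_near e xs w)"
    by (intro simple_function_If Cons) auto
  then show ?case by simp
qed

lemma select_near_props:
  "x \<in> set xs \<Longrightarrow> dist w x < e \<Longrightarrow> select_near e xs w \<in> set xs \<and> dist w (select_near e xs w) < e"
  by (induction xs) auto

text \<open>The net points have to lie in \<open>G\<close> itself, since the field is controlled
  only there. Balls around points of \<open>G\<close> still cover the closure, and compactness of
  the closure gives a finite subcover.\<close>

lemma bounded_finite_net:
  fixes G :: "'w::euclidean_space set"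
  assumes "bounded G" "0 < e"
  shows "\<exists>xs. set xs \<subseteq> G \<and> (\<forall>w\<in>G. \<exists>x\<in>set xs. dist w x < e)"
proof -
  have "closure G \<subseteq> (\<Union>x\<in>G. ball x e)"
  proof
    fix w assume "w \<in> closure G"
    then obtain x where "x \<in> G" "dist x w < e" using assms(2) closure_approachable by blast
    then show "w \<in> (\<Union>x\<in>G. ball x e)" by auto
  qed
  moreover have "compact (closure G)" using assms(1) by (simp add: compact_closure)
  ultimately obtain C where C: "C \<subseteq> G" "finite C" "closure G \<subseteq> (\<Union>x\<in>C. ball x e)"
    using compactE_image[of "closure G" G "\<lambda>x. ball x e"] by (metis open_ball)
  obtain xs where "set xs = C" using finite_list[OF C(2)] by blast
  moreover have "\<exists>x\<in>C. dist w x < e" if "w \<in> G" for w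
  proof -
    have "w \<in> (\<Union>x\<in>C. ball x e)" using that C(3) closure_subset by blast
    then show ?thesis by (auto simp: dist_commute)
  qed
  ultimately show ?thesis using C(1) by (intro exI[of _ xs]) simp
qed

context bounded_open_set
begin

context
  fixes p :: nat
  assumes p: "p \<in> {1, 2}"
begin

text \<open>The dual space as a predicate: linearity and boundedness are asked for on
  \<open>W1p\<close> only, because that space is a set of functions and not a type.\<close>

definition bounded_functional :: "((real^'d \<Rightarrow> real) \<Rightarrow> real) \<Rightarrow> bool" where
  "bounded_functional l \<longleftrightarrow>
     (\<forall>u\<in>W1p (real p) D. \<forall>v\<in>W1p (real p) D. l (\<lambda>x. u x + v x) = l u + l v)
     \<and> (\<forall>c. \<forall>u\<in>W1p (real p) D. l (\<lambda>x. c * u x) = c * l u)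
     \<and> (\<exists>K>0. \<forall>u\<in>W1p (real p) D. \<bar>l u\<bar> \<le> K * W1p_norm (real p) D u)"

lemma bounded_functionalI:
  assumes "\<And>u v. u \<in> W1p (real p) D \<Longrightarrow> v \<in> W1p (real p) D \<Longrightarrow> l (\<lambda>x. u x + v x) = l u + l v"
    "\<And>c u. u \<in> W1p (real p) D \<Longrightarrow> l (\<lambda>x. c * u x) = c * l u"
    "\<And>u. u \<in> W1p (real p) D \<Longrightarrow> \<bar>l u\<bar> \<le> K * W1p_norm (real p) D u"
  shows "bounded_functional l"
proof -
  have "\<bar>l u\<bar> \<le> (\<bar>K\<bar> + 1) * W1p_norm (real p) D u" if "u \<in> W1p (real p) D" for u
  proof -
    have "K * W1p_norm (real p) D u \<le> (\<bar>K\<bar> + 1) * W1p_norm (real p) D u" by (intro mult_right_mono) auto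
    then show ?thesis using assms(3)[OF that] by linarith
  qed
  moreover have "0 < \<bar>K\<bar> + 1" by simp
  ultimately show ?thesis unfolding bounded_functional_def using assms(1,2) by blast
qed

lemma bounded_functionalD:
  assumes "bounded_functional l"
  shows "u \<in> W1p (real p) D \<Longrightarrow> v \<in> W1p (real p) D \<Longrightarrow> l (\<lambda>x. u x + v x) = l u + l v"
    "u \<in> W1p (real p) D \<Longrightarrow> l (\<lambda>x. c * u x) = c * l u"
  using assms by (auto simp: bounded_functional_def)

lemma bounded_functional_bound:
  assumes "bounded_functional l"
  obtains K where "0 < K" "\<And>u. u \<in> W1p (real p) D \<Longrightarrow> \<bar>l u\<bar> \<le> K * W1p_norm (real p) D u"
  using assms by (auto simp: bounded_functional_def)

lemma bounded_functional_diff: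
  assumes "bounded_functional l" "u \<in> W1p (real p) D" "v \<in> W1p (real p) D"
  shows "l (\<lambda>x. u x - v x) = l u - l v"
  using bounded_functionalD(1)[OF assms(1,2) W1p_cmult(1)[OF p assms(3), of "-1"]]
    bounded_functionalD(2)[OF assms(1,3), of "-1"] by simp

lemma finite_combination:
  assumes "finite I" "\<And>c. c \<in> I \<Longrightarrow> k c \<in> W1p (real p) D"
  shows "(\<lambda>x. \<Sum>c\<in>I. a c * k c x) \<in> W1p (real p) D"
    "bounded_functional l \<Longrightarrow> l (\<lambda>x. \<Sum>c\<in>I. a c * k c x) = (\<Sum>c\<in>I. a c * l (k c))"
    "W1p_norm (real p) D (\<lambda>x. \<Sum>c\<in>I. a c * k c x) \<le> (\<Sum>c\<in>I. \<bar>a c\<bar> * W1p_norm (real p) D (k c))"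
proof -
  have "(\<lambda>x. \<Sum>c\<in>I. a c * k c x) \<in> W1p (real p) D \<and>
    (bounded_functional l \<longrightarrow> l (\<lambda>x. \<Sum>c\<in>I. a c * k c x) = (\<Sum>c\<in>I. a c * l (k c))) \<and>
    W1p_norm (real p) D (\<lambda>x. \<Sum>c\<in>I. a c * k c x) \<le> (\<Sum>c\<in>I. \<bar>a c\<bar> * W1p_norm (real p) D (k c))"
    using assms
  proof (induction I rule: finite_induct)
    case empty
    have "bounded_functional l \<Longrightarrow> l (\<lambda>x. 0) = 0"
      using bounded_functionalD(2)[of l "\<lambda>x. 0" 0] W1p_zero[OF p] by simp
    then show ?case using W1p_zero[OF p] by simp
  next
    case (insert c I)
    have 1: "(\<lambda>x. a c * k c x) \<in> W1p (real p) D" using insert by (intro W1p_cmult[OF p]) simp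
    have 2: "(\<lambda>x. \<Sum>c\<in>I. a c * k c x) \<in> W1p (real p) D" using insert by simp
    have 3: "l (\<lambda>x. a c * k c x + (\<Sum>c\<in>I. a c * k c x)) = a c * l (k c) + (\<Sum>c\<in>I. a c * l (k c))"
      if l: "bounded_functional l"
      using insert l bounded_functionalD(1)[OF l 1 2] bounded_functionalD(2)[OF l, of "k c" "a c"] by simp
    show ?case
      using insert W1p_add(1)[OF p 1 2] W1p_norm_triangle[OF p 1 2] W1p_norm_cmult[OF p, of "k c" "a c"] 3 by auto
  qed
  then show "(\<lambda>x. \<Sum>c\<in>I. a c * k c x) \<in> W1p (real p) D"
    "bounded_functional l \<Longrightarrow> l (\<lambda>x. \<Sum>c\<in>I. a c * k c x) = (\<Sum>c\<in>I. a c * l (k c))"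
    "W1p_norm (real p) D (\<lambda>x. \<Sum>c\<in>I. a c * k c x) \<le> (\<Sum>c\<in>I. \<bar>a c\<bar> * W1p_norm (real p) D (k c))"
    by auto
qed

lemma finite_combination_W1p_0:
  assumes "finite I" "\<And>c. c \<in> I \<Longrightarrow> k c \<in> W1p_0 (real p) D"
  shows "(\<lambda>x. \<Sum>c\<in>I. a c * k c x) \<in> W1p_0 (real p) D"
  using assms
proof (induction I rule: finite_induct)
  case empty
  then show ?case by (simp add: W1p_0_zero[OF p])
next
  case (insert c I)
  then have "(\<lambda>x. a c * k c x + (\<Sum>c\<in>I. a c * k c x)) \<in> W1p_0 (real p) D"
    by (intro W1p_0_add[OF p] W1p_0_cmult[OF p]) auto
  then show ?case using insert by simp
qed

text \<open>The pointwise integral of a simple field is a finite linear combination of its values,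
  weighted by the measures of the level sets; hence it stays in either space, commutes with
  functionals and obeys the triangle inequality.\<close>

lemma simple_mean:
  assumes P: "finite_measure P" and s: "simple_function P s"
  shows "(\<And>w. w \<in> space P \<Longrightarrow> s w \<in> W1p (real p) D) \<Longrightarrow> (\<lambda>x. \<integral>w. s w x \<partial>P) \<in> W1p (real p) D"
    "(\<And>w. w \<in> space P \<Longrightarrow> s w \<in> W1p_0 (real p) D) \<Longrightarrow> (\<lambda>x. \<integral>w. s w x \<partial>P) \<in> W1p_0 (real p) D"
    "(\<And>w. w \<in> space P \<Longrightarrow> s w \<in> W1p (real p) D) \<Longrightarrow> bounded_functional l \<Longrightarrow>
       l (\<lambda>x. \<integral>w. s w x \<partial>P) = (\<integral>w. l (s w) \<partial>P)"
    "(\<And>w. w \<in> space P \<Longrightarrow> s w \<in> W1p (real p) D) \<Longrightarrow>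
       W1p_norm (real p) D (\<lambda>x. \<integral>w. s w x \<partial>P) \<le> (\<integral>w. W1p_norm (real p) D (s w) \<partial>P)"
proof -
  have fin: "finite (s ` space P)" using s by (rule simple_functionD)
  have eq: "(\<lambda>x. \<integral>w. s w x \<partial>P) = (\<lambda>x. \<Sum>c\<in>s ` space P. measure P {w \<in> space P. s w = c} * c x)"
    by (rule ext) (rule simple_function_integral_sum(2)[OF P s])
  show "(\<lambda>x. \<integral>w. s w x \<partial>P) \<in> W1p (real p) D" if "\<And>w. w \<in> space P \<Longrightarrow> s w \<in> W1p (real p) D"
    unfolding eq using fin that by (intro finite_combination) auto
  show "(\<lambda>x. \<integral>w. s w x \<partial>P) \<in> W1p_0 (real p) D" if "\<And>w. w \<in> space P \<Longrightarrow> s w \<in> W1p_0 (real p) D"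
    unfolding eq using fin that by (intro finite_combination_W1p_0) auto
  show "l (\<lambda>x. \<integral>w. s w x \<partial>P) = (\<integral>w. l (s w) \<partial>P)"
    if "\<And>w. w \<in> space P \<Longrightarrow> s w \<in> W1p (real p) D" "bounded_functional l"
    unfolding eq simple_function_integral_sum(2)[OF P s]
    using fin that by (intro finite_combination) auto
  show "W1p_norm (real p) D (\<lambda>x. \<integral>w. s w x \<partial>P) \<le> (\<integral>w. W1p_norm (real p) D (s w) \<partial>P)"
    if "\<And>w. w \<in> space P \<Longrightarrow> s w \<in> W1p (real p) D"
    unfolding eq simple_function_integral_sum(2)[OF P s]
    using finite_combination(3)[OF fin, of "\<lambda>c. c" "\<lambda>c. measure P {w \<in> space P. s w = c}"] that by auto
qed

text \<open>The auxiliary \<open>h\<close> is needed since \<open>l (v w)\<close> is only almost everywhere equal to a measurable function.\<close>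

lemma functional_of_integral:
  assumes P: "finite_measure P" and m: "has_W1p_integral (real p) D P v m"
    and l: "bounded_functional l" and h: "integrable P h" "AE w in P. h w = l (v w)"
  shows "l m = (\<integral>w. h w \<partial>P)"
proof -
  obtain s where s: "\<And>n::nat. simple_function P (s n)" "\<And>n w. w \<in> space P \<Longrightarrow> s n w \<in> W1p (real p) D"
      "(\<lambda>n. \<integral>\<^sup>+w. ennreal (W1p_norm (real p) D (\<lambda>x. v w x - s n w x)) \<partial>P) \<longlonglongrightarrow> 0"
      "(\<lambda>n. W1p_norm (real p) D (\<lambda>x. m x - (\<integral>w. s n w x \<partial>P))) \<longlonglongrightarrow> 0"
    and mW: "m \<in> W1p (real p) D" and vW: "AE w in P. v w \<in> W1p (real p) D"
    using m unfolding has_W1p_integral_def by blast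
  obtain K where K: "0 < K" "\<And>u. u \<in> W1p (real p) D \<Longrightarrow> \<bar>l u\<bar> \<le> K * W1p_norm (real p) D u"
    using bounded_functional_bound[OF l] by blast
  define mn where "mn n = (\<lambda>x. \<integral>w. s n w x \<partial>P)" for n
  have mnW: "mn n \<in> W1p (real p) D" for n unfolding mn_def by (rule simple_mean(1)[OF P s(1,2)])
  have lmn: "l (mn n) = (\<integral>w. l (s n w) \<partial>P)" for n unfolding mn_def by (rule simple_mean(3)[OF P s(1,2) l])
  have "(\<lambda>n. l m - l (mn n)) \<longlonglongrightarrow> 0"
  proof (rule Lim_null_comparison)
    show "(\<lambda>n. K * W1p_norm (real p) D (\<lambda>x. m x - mn n x)) \<longlonglongrightarrow> 0"
      using tendsto_mult_left[OF s(4), of K] by (simp add: mn_def)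
    show "\<forall>\<^sub>F n in sequentially. norm (l m - l (mn n)) \<le> K * W1p_norm (real p) D (\<lambda>x. m x - mn n x)"
      using K(2)[OF W1p_diff(1)[OF p mW mnW]] bounded_functional_diff[OF l mW mnW] by simp
  qed
  moreover have "(\<lambda>n. l (mn n) - (\<integral>w. h w \<partial>P)) \<longlonglongrightarrow> 0"
  proof -
    have ils: "integrable P (\<lambda>w. l (s n w))" for n by (rule simple_function_integral_sum(1)[OF P s(1)])
    \<comment> \<open>Division by \<open>K\<close> makes the integrand at most the Sobolev distance
      of \<open>v w\<close> and \<open>s n w\<close>, almost everywhere, so it compares directly
      with the nonnegative integral that is known to vanish in the limit.\<close>
    have "(\<lambda>n. (\<integral>w. \<bar>l (s n w) - h w\<bar> / K \<partial>P)) \<longlonglongrightarrow> 0"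
    proof -
      have "ennreal (\<integral>w. \<bar>l (s n w) - h w\<bar> / K \<partial>P)
          \<le> (\<integral>\<^sup>+w. ennreal (W1p_norm (real p) D (\<lambda>x. v w x - s n w x)) \<partial>P)" for n
      proof -
        have "ennreal (\<integral>w. \<bar>l (s n w) - h w\<bar> / K \<partial>P) = (\<integral>\<^sup>+w. ennreal (\<bar>l (s n w) - h w\<bar> / K) \<partial>P)"
          using ils[of n] h(1) K(1) by (intro nn_integral_eq_integral[symmetric]) auto
        also have "\<dots> \<le> (\<integral>\<^sup>+w. ennreal (W1p_norm (real p) D (\<lambda>x. v w x - s n w x)) \<partial>P)"
        proof (rule nn_integral_mono_AE)
          show "AE w in P. ennreal (\<bar>l (s n w) - h w\<bar> / K) \<le> ennreal (W1p_norm (real p) D (\<lambda>x. v w x - s n w x))"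
            using vW h(2) AE_space
          proof eventually_elim
            case (elim w)
            have "\<bar>l (v w) - l (s n w)\<bar> \<le> K * W1p_norm (real p) D (\<lambda>x. v w x - s n w x)"
              using K(2)[OF W1p_diff(1)[OF p elim(1) s(2)[OF elim(3)]]]
                bounded_functional_diff[OF l elim(1) s(2)[OF elim(3)]] by simp
            then show ?case using elim(2) K(1)
              by (intro ennreal_leI) (simp add: pos_divide_le_eq abs_minus_commute mult.commute)
          qed
        qed
        finally show ?thesis .
      qed
      then have "(\<lambda>n. ennreal (\<integral>w. \<bar>l (s n w) - h w\<bar> / K \<partial>P)) \<longlonglongrightarrow> 0"
        using s(3) by (intro tendsto_sandwich[OF _ _ tendsto_const s(3)]) auto
      then show ?thesis
        by (subst (asm) ennreal_0[symmetric], subst (asm) tendsto_ennreal_iff)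
          (use K(1) in \<open>auto intro!: always_eventually integral_nonneg_AE\<close>)
    qed
    from tendsto_mult_left[OF this, of K]
    have "(\<lambda>n. (\<integral>w. \<bar>l (s n w) - h w\<bar> \<partial>P)) \<longlonglongrightarrow> 0" using K(1) by simp
    then show ?thesis
    proof (rule Lim_null_comparison[rotated])
      have "norm (l (mn n) - (\<integral>w. h w \<partial>P)) \<le> (\<integral>w. \<bar>l (s n w) - h w\<bar> \<partial>P)" for n
      proof -
        have "l (mn n) - (\<integral>w. h w \<partial>P) = (\<integral>w. l (s n w) - h w \<partial>P)"
          using ils[of n] h(1) by (simp add: lmn)
        then show ?thesis using integral_norm_bound[of P "\<lambda>w. l (s n w) - h w"] by simp
      qed
      then show "\<forall>\<^sub>F n in sequentially. norm (l (mn n) - (\<integral>w. h w \<partial>P)) \<le> (\<integral>w. \<bar>l (s n w) - h w\<bar> \<partial>P)" by simp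
    qed
  qed
  ultimately have "(\<lambda>n. (l m - l (mn n)) + (l (mn n) - (\<integral>w. h w \<partial>P))) \<longlonglongrightarrow> 0 + 0" by (rule tendsto_add)
  then have "(\<lambda>n::nat. l m - (\<integral>w. h w \<partial>P)) \<longlonglongrightarrow> 0" by simp
  then show ?thesis by (simp add: LIMSEQ_const_iff)
qed

text \<open>An explicit substitute for the Hahn-Banach theorem: the duality map, which pairs with
  the sign for \<open>p = 1\<close> and with the function itself for \<open>p = 2\<close>, in the
  function and in the gradient. The two parts are bounded separately, which costs the factor
  2.\<close>

lemma norming_functional:
  assumes d: "d \<in> W1p (real p) D"
  obtains l where "bounded_functional l" "l d = W1p_norm (real p) D d ^ p"
    "\<And>u. u \<in> W1p (real p) D \<Longrightarrow> \<bar>l u\<bar> \<le> 2 * W1p_norm (real p) D d ^ (p - 1) * W1p_norm (real p) D u"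
proof -
  note W = W1p_D
  define k where "k x = (if p = 1 then sgn (d x) else d x)" for x
  define g where "g x = (if p = 1 then sgn (weak_grad D d x) else weak_grad D d x)" for x
  have dm: "d \<in> borel_measurable M" "weak_grad D d \<in> borel_measurable M"
    using W[OF d] Lp_measurable by auto
  have sgn_borel: "(sgn :: 'b::euclidean_space \<Rightarrow> 'b) \<in> borel_measurable borel"
    unfolding sgn_div_norm[abs_def] by measurable
  have km: "k \<in> borel_measurable M" and gm: "g \<in> borel_measurable M"
    unfolding k_def[abs_def] g_def[abs_def] using dm measurable_compose[OF dm(1) sgn_borel] measurable_compose[OF dm(2) sgn_borel]
    by (cases "p = 1"; simp)+
  define l where "l u = (LINT x|M. u x * k x) + (LINT x|M. weak_grad D u x \<bullet> g x)" for u
  \<comment> \<open>One estimate for the function part and the gradient part. The second factor is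
    bounded by 1 if \<open>p = 1\<close>, and lies in L^2 with norm at most that of \<open>d\<close>
    if \<open>p = 2\<close>.\<close>
  have bil: "integrable M (\<lambda>x. a x \<bullet> b x) \<and> norm (LINT x|M. a x \<bullet> b x) \<le> W1p_norm (real p) D d ^ (p - 1) * lp_norm p a"
    if a: "a \<in> Lp (real p) D" and b: "b \<in> borel_measurable M"
      and b1: "p = 1 \<Longrightarrow> \<forall>x. norm (b x) \<le> 1"
      and b2: "p = 2 \<Longrightarrow> square_integrable M b \<and> l2_norm M b \<le> W1p_norm 2 D d"
    for a b :: "real^'d \<Rightarrow> 'b::euclidean_space"
  proof -
    have am: "a \<in> borel_measurable M" using a by (rule Lp_measurable)
    have m: "(\<lambda>x. a x \<bullet> b x) \<in> borel_measurable M" using am b by measurable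
    show ?thesis
    proof (cases "p = 1")
      case True
      have ia: "integrable M a" using a True by (simp add: Lp1_iff)
      have le: "\<bar>a x \<bullet> b x\<bar> \<le> norm (a x)" for x
        using Cauchy_Schwarz_ineq2[of "a x" "b x"] b1[OF True] mult_left_le[of "norm (b x)" "norm (a x)"] by force
      have i: "integrable M (\<lambda>x. a x \<bullet> b x)"
        by (rule Bochner_Integration.integrable_bound[OF ia m]) (simp add: le)
      have "norm (LINT x|M. a x \<bullet> b x) \<le> (LINT x|M. norm (a x \<bullet> b x))" by (rule integral_norm_bound)
      also have "\<dots> \<le> (LINT x|M. norm (a x))" using i ia le by (intro integral_mono) auto
      finally show ?thesis using i True by (simp add: lp_norm_1[simplified])
    next
      case False
      then have p2: "p = 2" using p by simp
      have sa: "square_integrable M a" using a p2 by (simp add: Lp2_iff)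
      have sb: "square_integrable M b" "l2_norm M b \<le> W1p_norm 2 D d" using b2[OF p2] by auto
      have "AE x in M. norm (a x \<bullet> b x) \<le> 1 * (norm (a x) * norm (b x))"
        using Cauchy_Schwarz_ineq2 by auto
      from integrable_square_integrable_bound[OF sa sb(1) m this] l2_norm_bilinear_bound[OF sa sb(1) m _ this]
      have "integrable M (\<lambda>x. a x \<bullet> b x)" "norm (LINT x|M. a x \<bullet> b x) \<le> l2_norm M a * l2_norm M b" by auto
      moreover have "l2_norm M a * l2_norm M b \<le> l2_norm M a * W1p_norm 2 D d"
        using sb(2) by (intro mult_left_mono) auto
      ultimately show ?thesis using p2 by (simp add: lp_norm_2 mult.commute)
    qed
  qed
  have kb: "integrable M (\<lambda>x. a x * k x)" "norm (LINT x|M. a x * k x) \<le> W1p_norm (real p) D d ^ (p - 1) * lp_norm p a"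
    if "a \<in> Lp (real p) D" for a :: "real^'d \<Rightarrow> real"
  proof -
    have "integrable M (\<lambda>x. a x \<bullet> k x) \<and> norm (LINT x|M. a x \<bullet> k x) \<le> W1p_norm (real p) D d ^ (p - 1) * lp_norm p a"
    proof (rule bil[OF that km])
      show "\<forall>x. norm (k x) \<le> 1" if "p = 1" using that by (simp add: k_def sgn_real_def)
      show "square_integrable M k \<and> l2_norm M k \<le> W1p_norm 2 D d" if p2: "p = 2"
        using d p2 H1_D(1)[of d] l2_norm_le_H1_norm(1)[of d] by (simp add: k_def[abs_def])
    qed
    then show "integrable M (\<lambda>x. a x * k x)" "norm (LINT x|M. a x * k x) \<le> W1p_norm (real p) D d ^ (p - 1) * lp_norm p a"
      by simp_all
  qed
  have gb: "integrable M (\<lambda>x. a x \<bullet> g x)" "norm (LINT x|M. a x \<bullet> g x) \<le> W1p_norm (real p) D d ^ (p - 1) * lp_norm p a"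
    if "a \<in> Lp (real p) D" for a
  proof -
    have "integrable M (\<lambda>x. a x \<bullet> g x) \<and> norm (LINT x|M. a x \<bullet> g x) \<le> W1p_norm (real p) D d ^ (p - 1) * lp_norm p a"
    proof (rule bil[OF that gm])
      show "\<forall>x. norm (g x) \<le> 1" if "p = 1" using that by (simp add: g_def norm_sgn)
      show "square_integrable M g \<and> l2_norm M g \<le> W1p_norm 2 D d" if p2: "p = 2"
        using d p2 H1_D(2)[of d] l2_norm_le_H1_norm(2)[of d] by (simp add: g_def[abs_def])
    qed
    then show "integrable M (\<lambda>x. a x \<bullet> g x)" "norm (LINT x|M. a x \<bullet> g x) \<le> W1p_norm (real p) D d ^ (p - 1) * lp_norm p a"
      by simp_all
  qed
  have bnd: "\<bar>l u\<bar> \<le> 2 * W1p_norm (real p) D d ^ (p - 1) * W1p_norm (real p) D u" if u: "u \<in> W1p (real p) D" for u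
  proof -
    have "\<bar>l u\<bar> \<le> norm (LINT x|M. u x * k x) + norm (LINT x|M. weak_grad D u x \<bullet> g x)"
      unfolding l_def by simp
    also have "\<dots> \<le> W1p_norm (real p) D d ^ (p - 1) * W1p_norm (real p) D u + W1p_norm (real p) D d ^ (p - 1) * W1p_norm (real p) D u"
      by (intro add_mono order_trans[OF kb(2)] order_trans[OF gb(2)] mult_left_mono lp_norm_le_W1p_norm[OF p])
        (auto intro: W[OF u])
    finally show ?thesis by (simp only: mult_2 distrib_right)
  qed
  have "bounded_functional l"
  proof (rule bounded_functionalI[OF _ _ bnd])
    fix u v assume u: "u \<in> W1p (real p) D" and v: "v \<in> W1p (real p) D"
    note uv = W1p_add[OF p u v]
    have "(LINT x|M. weak_grad D (\<lambda>x. u x + v x) x \<bullet> g x) = (LINT x|M. (weak_grad D u x + weak_grad D v x) \<bullet> g x)"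
    proof (rule integral_cong_AE)
      show "AE x in M. weak_grad D (\<lambda>x. u x + v x) x \<bullet> g x = (weak_grad D u x + weak_grad D v x) \<bullet> g x"
        using uv(2) by eventually_elim simp
      show "(\<lambda>x. weak_grad D (\<lambda>x. u x + v x) x \<bullet> g x) \<in> borel_measurable M"
        using borel_measurable_integrable[OF gb(1)[OF W(2)[OF uv(1)]]] .
      show "(\<lambda>x. (weak_grad D u x + weak_grad D v x) \<bullet> g x) \<in> borel_measurable M"
        using borel_measurable_integrable[OF gb(1)[OF Lp_add[OF p W(2)[OF u] W(2)[OF v]]]] .
    qed
    then show "l (\<lambda>x. u x + v x) = l u + l v"
      using kb(1)[OF W(1)[OF u]] kb(1)[OF W(1)[OF v]] gb(1)[OF W(2)[OF u]] gb(1)[OF W(2)[OF v]]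
      by (simp add: l_def distrib_right inner_add_left)
  next
    fix c u assume u: "u \<in> W1p (real p) D"
    note cu = W1p_cmult[OF p u, of c]
    have "(LINT x|M. weak_grad D (\<lambda>x. c * u x) x \<bullet> g x) = (LINT x|M. c * (weak_grad D u x \<bullet> g x))"
    proof (rule integral_cong_AE)
      show "AE x in M. weak_grad D (\<lambda>x. c * u x) x \<bullet> g x = c * (weak_grad D u x \<bullet> g x)"
        using cu(2) by eventually_elim simp
      show "(\<lambda>x. weak_grad D (\<lambda>x. c * u x) x \<bullet> g x) \<in> borel_measurable M"
        using borel_measurable_integrable[OF gb(1)[OF W(2)[OF cu(1)]]] .
      show "(\<lambda>x. c * (weak_grad D u x \<bullet> g x)) \<in> borel_measurable M"
        using borel_measurable_integrable[OF gb(1)[OF W(2)[OF u]]] by measurable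
    qed
    then show "l (\<lambda>x. c * u x) = c * l u"
      by (simp add: l_def mult.assoc distrib_left)
  qed
  moreover have "l d = W1p_norm (real p) D d ^ p"
  proof -
    have "d x * k x = norm (d x) ^ p" for x
      using p by (auto simp: k_def power2_eq_square abs_sgn mult.commute)
    moreover have "weak_grad D d x \<bullet> g x = norm (weak_grad D d x) ^ p" for x
      using p by (auto simp: g_def power2_norm_eq_inner sgn_div_norm power2_eq_square[symmetric] field_simps
          dot_square_norm simp del: power2_norm_eq_inner)
        (simp add: power2_eq_square)
    ultimately show ?thesis unfolding l_def W1p_norm_power[OF p] by simp
  qed
  ultimately show thesis using that bnd by blast
qed

subsection \<open>Fields that depend continuously on the parameter\<close>

text \<open>Continuity is relative to a Borel set \<open>G\<close> of full measure, as the field may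
  be arbitrary on a null set of parameters. Boundedness of \<open>G\<close> provides finite nets,
  boundedness of the field provides domination, and sequences suffice in a metric space.\<close>

definition continuous_field ::
    "'w::euclidean_space measure \<Rightarrow> 'w set \<Rightarrow> ('w \<Rightarrow> real^'d \<Rightarrow> real) \<Rightarrow> bool" where
  "continuous_field P G v \<longleftrightarrow> finite_measure P \<and> sets P = sets borel \<and> G \<in> sets borel \<and> bounded G
     \<and> (AE w in P. w \<in> G) \<and> (\<forall>w\<in>G. v w \<in> W1p_0 (real p) D)
     \<and> (\<exists>B. \<forall>w\<in>G. W1p_norm (real p) D (v w) \<le> B)
     \<and> (\<forall>w\<in>G. \<forall>c. (\<forall>n::nat. c n \<in> G) \<and> c \<longlonglongrightarrow> w \<longrightarrow>
           (\<lambda>n. W1p_norm (real p) D (\<lambda>x. v (c n) x - v w x)) \<longlonglongrightarrow> 0)"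

text \<open>Stands in for measurability of the field. A scalar quantity that is Lipschitz in the
  field for the Sobolev distance is continuous on \<open>G\<close>, and becomes Borel measurable
  once multiplied by the indicator of \<open>G\<close>.\<close>

lemma continuous_field_measurable:
  assumes v: "continuous_field P G v"
  shows "bounded_functional l \<Longrightarrow> integrable P (\<lambda>w. indicator G w * l (v w))"
    and "a \<in> W1p (real p) D \<Longrightarrow>
      (\<lambda>w. indicator G w * W1p_norm (real p) D (\<lambda>x. v w x - a x)) \<in> borel_measurable P"
proof -
  interpret finite_measure P using v by (simp add: continuous_field_def)
  have G: "G \<in> sets borel" and sP: "sets P = sets borel" using v by (simp_all add: continuous_field_def)
  have W: "v w \<in> W1p (real p) D" if "w \<in> G" for w using v that W1p_0_D[OF p] by (auto simp: continuous_field_def)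
  obtain B where B: "\<And>w. w \<in> G \<Longrightarrow> W1p_norm (real p) D (v w) \<le> B" using v unfolding continuous_field_def by blast
  have cont: "(\<lambda>n. W1p_norm (real p) D (\<lambda>x. v (c n) x - v w x)) \<longlonglongrightarrow> 0"
    if "w \<in> G" "\<And>n. c n \<in> G" "c \<longlonglongrightarrow> w" for c w using v that by (auto simp: continuous_field_def)
  have meas: "(\<lambda>w. indicator G w * F w) \<in> borel_measurable P"
    if F: "\<And>w w'. w \<in> G \<Longrightarrow> w' \<in> G \<Longrightarrow> \<bar>F w' - F w\<bar> \<le> K * W1p_norm (real p) D (\<lambda>x. v w' x - v w x)" for F :: "_ \<Rightarrow> real" and K
  proof -
    have "continuous_on G F"
    proof (subst continuous_on_sequentially, intro allI ballI impI)
      fix c a assume a: "a \<in> G" and c: "(\<forall>n. c n \<in> G) \<and> c \<longlonglongrightarrow> a"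
      have "(\<lambda>n. F (c n) - F a) \<longlonglongrightarrow> 0"
      proof (rule Lim_null_comparison)
        show "\<forall>\<^sub>F n in sequentially. norm (F (c n) - F a) \<le> K * W1p_norm (real p) D (\<lambda>x. v (c n) x - v a x)"
          using F a c by simp
        show "(\<lambda>n. K * W1p_norm (real p) D (\<lambda>x. v (c n) x - v a x)) \<longlonglongrightarrow> 0"
          using tendsto_mult_left[OF cont[OF a], of c K] c by simp
      qed
      then show "(F \<circ> c) \<longlonglongrightarrow> F a" by (simp add: Lim_null[symmetric] comp_def)
    qed
    then have "(\<lambda>w. indicator G w *\<^sub>R F w) \<in> borel_measurable borel"
      by (rule borel_measurable_continuous_on_indicator[OF G])
    then show ?thesis by (simp add: measurable_cong_sets[OF sP refl])
  qed
  show "(\<lambda>w. indicator G w * W1p_norm (real p) D (\<lambda>x. v w x - a x)) \<in> borel_measurable P"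
    if a: "a \<in> W1p (real p) D"
  proof (rule meas[of _ 1])
    fix w w' assume w: "w \<in> G" "w' \<in> G"
    show "\<bar>W1p_norm (real p) D (\<lambda>x. v w' x - a x) - W1p_norm (real p) D (\<lambda>x. v w x - a x)\<bar>
        \<le> 1 * W1p_norm (real p) D (\<lambda>x. v w' x - v w x)"
      using W1p_norm_triangle_diff[OF p W[OF w(1)] W[OF w(2)] a] W1p_norm_triangle_diff[OF p W[OF w(2)] W[OF w(1)] a]
        W1p_norm_minus[OF p W[OF w(1)] W[OF w(2)]] by linarith
  qed
  show "integrable P (\<lambda>w. indicator G w * l (v w))" if l: "bounded_functional l"
  proof -
    obtain K where K: "0 < K" "\<And>u. u \<in> W1p (real p) D \<Longrightarrow> \<bar>l u\<bar> \<le> K * W1p_norm (real p) D u"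
      using bounded_functional_bound[OF l] by blast
    have "(\<lambda>w. indicator G w * l (v w)) \<in> borel_measurable P"
    proof (rule meas)
      fix w w' assume w: "w \<in> G" "w' \<in> G"
      show "\<bar>l (v w') - l (v w)\<bar> \<le> K * W1p_norm (real p) D (\<lambda>x. v w' x - v w x)"
        using K(2)[OF W1p_diff(1)[OF p W[OF w(2)] W[OF w(1)]]] bounded_functional_diff[OF l W[OF w(2)] W[OF w(1)]] by simp
    qed
    moreover have "AE w in P. norm (indicator G w * l (v w)) \<le> \<bar>K * B\<bar>"
    proof (rule AE_I2)
      fix w
      show "norm (indicator G w * l (v w)) \<le> \<bar>K * B\<bar>"
      proof (cases "w \<in> G")
        case True
        have "\<bar>l (v w)\<bar> \<le> K * B"
          using K(2)[OF W[OF True]] mult_left_mono[OF B[OF True], of K] K(1) by linarith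
        then show ?thesis using True by simp
      qed simp
    qed
    ultimately show ?thesis by (intro integrable_const_bound)
  qed
qed

text \<open>The simple functions take the value of the field at a net point within 1/(n+1). Their
  error tends to zero pointwise by continuity and is dominated by a constant, so it vanishes in the
  mean; the integrals are then Cauchy and completeness of \<open>W1p_0\<close> supplies the
  limit.\<close>

lemma continuous_field_has_integral:
  assumes v: "continuous_field P G v"
  shows "\<exists>m\<in>W1p_0 (real p) D. has_W1p_integral (real p) D P v m"
proof -
  let ?N = "W1p_norm (real p) D"
  interpret finite_measure P using v by (simp add: continuous_field_def)
  have fP: "finite_measure P" by unfold_locales
  have G: "G \<in> sets borel" "bounded G" and sP: "sets P = sets borel" and AEG: "AE w in P. w \<in> G"
    using v by (simp_all add: continuous_field_def)
  have spP: "space P = UNIV" using sets_eq_imp_space_eq[OF sP] by simp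
  have W0: "v w \<in> W1p_0 (real p) D" if "w \<in> G" for w using v that by (auto simp: continuous_field_def)
  note W = W1p_0_D[OF p W0]
  obtain B where B: "\<And>w. w \<in> G \<Longrightarrow> ?N (v w) \<le> B" using v unfolding continuous_field_def by blast
  have cont: "(\<lambda>n. ?N (\<lambda>x. v (c n) x - v w x)) \<longlonglongrightarrow> 0"
    if "w \<in> G" "\<And>n. c n \<in> G" "c \<longlonglongrightarrow> w" for c w using v that by (auto simp: continuous_field_def)
  have "\<forall>n::nat. \<exists>xs. set xs \<subseteq> G \<and> (\<forall>w\<in>G. \<exists>x\<in>set xs. dist w x < inverse (real (Suc n)))"
    using bounded_finite_net[OF G(2)] by simp
  then obtain xs where xs: "\<And>n. set (xs n) \<subseteq> G" "\<And>n w. w \<in> G \<Longrightarrow> \<exists>x\<in>set (xs n). dist w x < inverse (real (Suc n))"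
    by metis
  define c where "c n = select_near (inverse (real (Suc n))) (xs n)" for n
  have c_near: "c n w \<in> set (xs n)" "dist w (c n w) < inverse (real (Suc n))" if "w \<in> G" for n w
    using xs(2)[OF that, of n] select_near_props unfolding c_def by blast+
  have cG: "c n w \<in> G" if "w \<in> G" for n w using c_near(1)[OF that] xs(1) by blast
  have c_lim: "(\<lambda>n. c n w) \<longlonglongrightarrow> w" if "w \<in> G" for w
  proof (rule metric_tendsto_imp_tendsto[OF LIMSEQ_inverse_real_of_nat])
    show "\<forall>\<^sub>F n in sequentially. dist (c n w) w \<le> dist (inverse (real (Suc n))) 0"
      using c_near(2)[OF that] by (auto simp: dist_commute less_imp_le intro!: always_eventually)
  qed
  have c_simple: "simple_function P (c n)" for n unfolding c_def by (rule select_near_simple[OF sP])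
  define s where "s n w = (if w \<in> G then v (c n w) else (\<lambda>x. 0))" for n w
  have s_simple: "simple_function P (s n)" for n
    unfolding s_def using G(1) by (intro simple_function_If simple_function_compose1[OF c_simple]) (auto simp: sP spP)
  have s0: "s n w \<in> W1p_0 (real p) D" for n w unfolding s_def using W0 cG W1p_0_zero[OF p] by auto
  note sW = W1p_0_D[OF p s0]
  \<comment> \<open>On \<open>G\<close>, hence almost everywhere, this is the distance between the
    field and its simple approximation. The cut-off makes it measurable, which the distance off
    \<open>G\<close> need not be.\<close>
  define f where "f n w = indicator G w * ?N (\<lambda>x. v w x - v (c n w) x)" for n w
  have f_nonneg: "0 \<le> f n w" for n w by (simp add: f_def)
  have f_meas: "f n \<in> borel_measurable P" for n
  proof -
    \<comment> \<open>The selected point \<open>c n w\<close> varies with \<open>w\<close> but takes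
      finitely many values. Splitting by that value leaves distances to fixed functions, which are
      measurable.\<close>
    have "f n w = (\<Sum>a\<in>set (xs n). indicator {w \<in> space P. c n w = a} w * (indicator G w * ?N (\<lambda>x. v w x - v a x)))" for w
    proof (cases "w \<in> G")
      case True
      have "(\<Sum>a\<in>set (xs n). indicator {w \<in> space P. c n w = a} w * (indicator G w * ?N (\<lambda>x. v w x - v a x)))
          = (\<Sum>a\<in>set (xs n). if a = c n w then ?N (\<lambda>x. v w x - v a x) else 0)"
        using True by (intro sum.cong) (auto simp: spP)
      then show ?thesis using True c_near(1)[OF True] by (simp add: f_def)
    qed (simp add: f_def)
    moreover have "(\<lambda>w. \<Sum>a\<in>set (xs n). indicator {w \<in> space P. c n w = a} w * (indicator G w * ?N (\<lambda>x. v w x - v a x)))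
        \<in> borel_measurable P"
    proof (rule borel_measurable_sum, rule borel_measurable_times[OF borel_measurable_indicator])
      fix a assume "a \<in> set (xs n)"
      then have "a \<in> G" using xs(1) by blast
      then show "(\<lambda>w. indicator G w * ?N (\<lambda>x. v w x - v a x)) \<in> borel_measurable P"
        by (intro continuous_field_measurable(2)[OF v W])
      show "{w \<in> space P. c n w = a} \<in> sets P"
        using simple_functionD(2)[OF c_simple, of n "{a}"] by (simp add: vimage_def Int_def conj_commute)
    qed
    ultimately show ?thesis by presburger
  qed
  have f_le: "norm (f n w) \<le> 2 * \<bar>B\<bar>" for n w
  proof (cases "w \<in> G")
    case True
    have "?N (\<lambda>x. v w x - v (c n w) x) \<le> ?N (v w) + ?N (v (c n w))"
      using W1p_norm_triangle[OF p W[OF True] W1p_cmult(1)[OF p W[OF cG[OF True]], of "-1"]]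
        W1p_norm_cmult[OF p W[OF cG[OF True]], of "-1"] by simp
    then show ?thesis using B[OF True] B[OF cG[OF True, of n]] True by (simp add: f_def)
  qed (simp add: f_def)
  have f_int: "integrable P (f n)" for n
    by (rule integrable_const_bound[OF AE_I2 f_meas]) (rule f_le)
  have "(\<lambda>n. \<integral>w. f n w \<partial>P) \<longlonglongrightarrow> (\<integral>w. 0 \<partial>P)"
  proof (rule integral_dominated_convergence[where w="\<lambda>w. 2 * \<bar>B\<bar>"])
    show "AE w in P. (\<lambda>n. f n w) \<longlonglongrightarrow> 0"
      using AEG
    proof eventually_elim
      case (elim w)
      have "(\<lambda>n. ?N (\<lambda>x. v (c n w) x - v w x)) \<longlonglongrightarrow> 0"
        using elim by (intro cont cG c_lim)
      moreover have "f n w = ?N (\<lambda>x. v (c n w) x - v w x)" for n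
        using elim W1p_norm_minus[OF p W[OF elim] W[OF cG[OF elim]]] by (simp add: f_def)
      ultimately show ?case by simp
    qed
  qed (use f_meas f_le in auto)
  then have f_lim: "(\<lambda>n. \<integral>w. f n w \<partial>P) \<longlonglongrightarrow> 0" by simp
  define mn where "mn n = (\<lambda>x. \<integral>w. s n w x \<partial>P)" for n
  have mn0: "mn n \<in> W1p_0 (real p) D" for n unfolding mn_def by (rule simple_mean(2)[OF fP s_simple s0])
  have mn_diff: "?N (\<lambda>x. mn i x - mn j x) \<le> (\<integral>w. f i w \<partial>P) + (\<integral>w. f j w \<partial>P)" for i j
  proof -
    have sd: "simple_function P (\<lambda>w x. s i w x - s j w x)"
      by (rule simple_function_compose2[OF s_simple s_simple])
    have eq: "(\<lambda>x. mn i x - mn j x) = (\<lambda>x. \<integral>w. (s i w x - s j w x) \<partial>P)"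
      unfolding mn_def using simple_function_integral_sum(1)[OF fP s_simple, of "\<lambda>h. h x" for x]
      by (intro ext Bochner_Integration.integral_diff[symmetric])
    have "?N (\<lambda>x. mn i x - mn j x) \<le> (\<integral>w. ?N (\<lambda>x. s i w x - s j w x) \<partial>P)"
      unfolding eq by (rule simple_mean(4)[OF fP sd]) (rule W1p_diff(1)[OF p sW sW])
    also have "\<dots> \<le> (\<integral>w. f i w + f j w \<partial>P)"
    proof (rule integral_mono)
      show "integrable P (\<lambda>w. ?N (\<lambda>x. s i w x - s j w x))" by (rule simple_function_integral_sum(1)[OF fP sd])
      show "integrable P (\<lambda>w. f i w + f j w)" using f_int by simp
      show "?N (\<lambda>x. s i w x - s j w x) \<le> f i w + f j w" for w
      proof (cases "w \<in> G")
        case True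
        then show ?thesis
          using W1p_norm_triangle_diff[OF p W[OF cG[OF True]] W[OF True] W[OF cG[OF True]], of i j]
            W1p_norm_minus[OF p W[OF True] W[OF cG[OF True, of i]]] by (simp add: s_def f_def)
      qed (simp add: s_def f_def W1p_zero[OF p])
    qed
    finally show ?thesis using f_int by simp
  qed
  have "\<exists>m\<in>W1p_0 (real p) D. (\<lambda>n. ?N (\<lambda>x. m x - mn n x)) \<longlonglongrightarrow> 0"
  proof (rule W1p_0_complete[OF p mn0])
    fix e :: real assume e: "0 < e"
    then have "\<forall>\<^sub>F n in sequentially. (\<integral>w. f n w \<partial>P) < e / 2" using order_tendstoD(2)[OF f_lim, of "e / 2"] by simp
    then obtain N where "\<And>n. N \<le> n \<Longrightarrow> (\<integral>w. f n w \<partial>P) < e / 2" by (auto simp: eventually_sequentially)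
    then have "?N (\<lambda>x. mn i x - mn j x) < e" if "N \<le> i" "N \<le> j" for i j
      using mn_diff[of i j] that by (smt (verit) field_sum_of_halves)
    then show "\<exists>N. \<forall>m\<ge>N. \<forall>n\<ge>N. ?N (\<lambda>x. mn m x - mn n x) < e" by blast
  qed
  then obtain m where m: "m \<in> W1p_0 (real p) D" "(\<lambda>n. ?N (\<lambda>x. m x - mn n x)) \<longlonglongrightarrow> 0" by blast
  have vf: "?N (\<lambda>x. v w x - s n w x) = f n w" if "w \<in> G" for n w using that by (simp add: s_def f_def)
  have "has_W1p_integral (real p) D P v m"
    unfolding has_W1p_integral_def
  proof (intro conjI exI[of _ s] allI ballI)
    show "m \<in> W1p (real p) D" by (rule W1p_0_D[OF p m(1)])
    show "AE w in P. v w \<in> W1p (real p) D" using AEG by eventually_elim (rule W)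
    show "simple_function P (s n)" "s n w \<in> W1p (real p) D" for n w by (rule s_simple, rule sW)
    show "emeasure P {w \<in> space P. s n w \<noteq> (\<lambda>x. 0)} \<noteq> \<infinity>" for n by simp
    show "AE w in P. (\<lambda>n. ?N (\<lambda>x. v w x - s n w x)) \<longlonglongrightarrow> 0"
      using AEG
    proof eventually_elim
      case (elim w)
      have "(\<lambda>n. ?N (\<lambda>x. v (c n w) x - v w x)) \<longlonglongrightarrow> 0"
        using elim by (intro cont cG c_lim)
      then show ?case using elim W1p_norm_minus[OF p W[OF elim] W[OF cG[OF elim]]] by (simp add: s_def)
    qed
    show "(\<lambda>n. ?N (\<lambda>x. m x - (\<integral>w. s n w x \<partial>P))) \<longlonglongrightarrow> 0" using m(2) by (simp add: mn_def)
    have "(\<integral>\<^sup>+w. ennreal (?N (\<lambda>x. v w x - s n w x)) \<partial>P) = ennreal (\<integral>w. f n w \<partial>P)" for n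
    proof -
      have "(\<integral>\<^sup>+w. ennreal (?N (\<lambda>x. v w x - s n w x)) \<partial>P) = (\<integral>\<^sup>+w. ennreal (f n w) \<partial>P)"
        by (rule nn_integral_cong_AE) (use AEG vf in \<open>auto elim!: eventually_mono\<close>)
      also have "\<dots> = ennreal (\<integral>w. f n w \<partial>P)"
        by (rule nn_integral_eq_integral[OF f_int]) (simp add: f_nonneg)
      finally show ?thesis .
    qed
    moreover have "(\<lambda>n. ennreal (\<integral>w. f n w \<partial>P)) \<longlonglongrightarrow> ennreal 0" by (rule tendsto_ennrealI[OF f_lim])
    ultimately show "(\<lambda>n. \<integral>\<^sup>+w. ennreal (?N (\<lambda>x. v w x - s n w x)) \<partial>P) \<longlonglongrightarrow> 0" by simp
  qed
  then show ?thesis using m(1) by blast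
qed

text \<open>\<open>W1p_integral\<close> is an arbitrary choice among all integrals. Any two have the
  same image under every bounded functional, so the norming functional of their difference shows
  that their distance is zero; thus the chosen one inherits the zero boundary values of the one
  constructed.\<close>

theorem continuous_field_integral:
  assumes v: "continuous_field P G v"
  shows "W1p_integrable (real p) D P v" "W1p_integral (real p) D P v \<in> W1p_0 (real p) D"
    "bounded_functional l \<Longrightarrow> l (W1p_integral (real p) D P v) = (\<integral>w. indicator G w * l (v w) \<partial>P)"
proof -
  have fP: "finite_measure P" and AEG: "AE w in P. w \<in> G" using v by (simp_all add: continuous_field_def)
  obtain m where m: "m \<in> W1p_0 (real p) D" "has_W1p_integral (real p) D P v m"
    using continuous_field_has_integral[OF v] by blast
  then show "W1p_integrable (real p) D P v" by (auto simp: W1p_integrable_def)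
  let ?m = "W1p_integral (real p) D P v"
  have m': "has_W1p_integral (real p) D P v ?m"
    unfolding W1p_integral_def using m(2) by (rule someI[of "has_W1p_integral (real p) D P v"])
  have fi: "l k = (\<integral>w. indicator G w * l (v w) \<partial>P)"
    if "bounded_functional l" "has_W1p_integral (real p) D P v k" for l k
    by (rule functional_of_integral[OF fP that(2,1) continuous_field_measurable(1)[OF v that(1)]])
      (use AEG in \<open>auto elim!: eventually_mono\<close>)
  show "bounded_functional l \<Longrightarrow> l ?m = (\<integral>w. indicator G w * l (v w) \<partial>P)"
    using fi m' by blast
  have mW: "m \<in> W1p (real p) D" by (rule W1p_0_D[OF p m(1)])
  have m'W: "?m \<in> W1p (real p) D" using m' by (simp add: has_W1p_integral_def)
  obtain l where l: "bounded_functional l"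
      "l (\<lambda>x. ?m x - m x) = W1p_norm (real p) D (\<lambda>x. ?m x - m x) ^ p"
    using norming_functional[OF W1p_diff(1)[OF p m'W mW]] by blast
  have "l (\<lambda>x. ?m x - m x) = 0"
    unfolding bounded_functional_diff[OF l(1) m'W mW] using fi[OF l(1) m'] fi[OF l(1) m(2)] by simp
  then have "W1p_norm (real p) D (\<lambda>x. ?m x - m x) = 0" using l(2) by simp
  then show "?m \<in> W1p_0 (real p) D" using m(1)
    by (intro W1p_0_closed[OF p m'W]) (auto intro!: bexI[of _ m])
qed

end

end

section \<open>Laws of the parameters\<close>

lemma parameter_box_cbox: "parameter_box = cbox (\<chi> i. -1) (\<chi> i. 1)"
  by (auto simp: parameter_box_def mem_box_cart)

lemma parameter_box_measurable [measurable]: "parameter_box \<in> sets borel"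
  and parameter_box_bounded: "bounded parameter_box"
  and parameter_box_compact: "compact parameter_box"
  by (simp_all add: parameter_box_cbox)

text \<open>Tonelli's theorem over the canonical basis, reindexed by coordinates: the basis vectors
  are the \<open>axis k 1\<close>, and \<open>axis_index\<close> recovers \<open>k\<close>.\<close>

lemma nn_integral_lborel_prod_cart:
  fixes g :: "'k::finite \<Rightarrow> real \<Rightarrow> ennreal"
  assumes "\<And>k. g k \<in> borel_measurable borel"
  shows "(\<integral>\<^sup>+t. (\<Prod>k\<in>UNIV. g k (t $ k)) \<partial>(lborel :: (real^'k) measure)) = (\<Prod>k\<in>UNIV. \<integral>\<^sup>+s. g k s \<partial>lborel)"
proof -
  have B: "(Basis :: (real^'k) set) = (\<lambda>k. axis k 1) ` UNIV" by (auto simp: Basis_vec_def)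
  have inj: "inj (\<lambda>k::'k. axis k (1::real))" by (auto simp: inj_on_def axis_eq_axis)
  have idx: "axis_index (axis k (1::real)) = k" for k :: 'k
    unfolding axis_index_def by (rule some_equality) (auto simp: axis_eq_axis)
  have "(\<integral>\<^sup>+t. (\<Prod>b\<in>Basis. g (axis_index b) (t \<bullet> b)) \<partial>(lborel :: (real^'k) measure))
      = (\<Prod>b\<in>(Basis :: (real^'k) set). \<integral>\<^sup>+s. g (axis_index b) s \<partial>lborel)"
    by (rule nn_integral_lborel_prod) (auto simp: assms)
  then show ?thesis
    unfolding B by (simp add: prod.reindex[OF inj] idx cart_eq_inner_axis[symmetric])
qed

context
  fixes \<rho> :: "'k::finite \<Rightarrow> real \<Rightarrow> real"
  assumes \<rho>: "iid_centred_densities \<rho>"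
begin

text \<open>Outside [-1, 1] nothing is known about the sign or the integrability of
  \<open>\<rho> k\<close>. Clipping makes it a probability density on the whole line, so that the
  law becomes a product density.\<close>

definition clipped_density :: "'k \<Rightarrow> real \<Rightarrow> real" where
  "clipped_density k s = indicator {-1..1} s * \<rho> k s"

lemma clipped_density_props:
  shows "clipped_density k \<in> borel_measurable borel" "0 \<le> clipped_density k s"
    "integrable lborel (clipped_density k)" "(\<integral>s. clipped_density k s \<partial>lborel) = 1"
    "integrable lborel (\<lambda>s. s * clipped_density k s)" "(\<integral>s. s * clipped_density k s \<partial>lborel) = 0"
proof -
  have r: "\<rho> k \<in> borel_measurable borel" "\<forall>t\<in>{-1..1}. 0 \<le> \<rho> k t" "set_integrable lborel {-1..1} (\<rho> k)"
    "(LBINT t:{-1..1}. \<rho> k t) = 1" "(LBINT t:{-1..1}. t * \<rho> k t) = 0"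
    using \<rho> unfolding iid_centred_densities_def by blast+
  show m: "clipped_density k \<in> borel_measurable borel"
    unfolding clipped_density_def[abs_def] using r(1) by measurable
  show "0 \<le> clipped_density k s" using r(2) by (auto simp: clipped_density_def indicator_def)
  show i: "integrable lborel (clipped_density k)"
    using r(3) by (simp add: set_integrable_def clipped_density_def[abs_def])
  show "(\<integral>s. clipped_density k s \<partial>lborel) = 1"
    using r(4) by (simp add: set_lebesgue_integral_def clipped_density_def)
  show "integrable lborel (\<lambda>s. s * clipped_density k s)"
  proof (rule Bochner_Integration.integrable_bound[OF i])
    show "(\<lambda>s. s * clipped_density k s) \<in> borel_measurable lborel" using m by measurable
    show "AE s in lborel. norm (s * clipped_density k s) \<le> norm (clipped_density k s)"
      by (intro AE_I2) (auto simp: clipped_density_def indicator_def abs_mult mult_left_le_one_le)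
  qed
  have "(\<integral>s. s * clipped_density k s \<partial>lborel) = (\<integral>s. indicator {-1..1} s *\<^sub>R (s * \<rho> k s) \<partial>lborel)"
    by (intro Bochner_Integration.integral_cong) (auto simp: clipped_density_def)
  then show "(\<integral>s. s * clipped_density k s \<partial>lborel) = 0"
    using r(5) by (simp add: set_lebesgue_integral_def)
qed

lemma parameter_law_eq:
  "parameter_law \<rho> = density lborel (\<lambda>t. \<Prod>k\<in>UNIV. ennreal (clipped_density k (t $ k)))"
proof -
  have "indicator parameter_box t * (\<Prod>k\<in>UNIV. \<rho> k (t $ k)) = (\<Prod>k\<in>UNIV. clipped_density k (t $ k))" for t
  proof (cases "t \<in> parameter_box")
    case True
    then show ?thesis by (auto simp: clipped_density_def parameter_box_def intro!: prod.cong)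
  next
    case False
    then obtain k where "t $ k \<notin> {-1..1}" by (auto simp: parameter_box_def)
    then have "clipped_density k (t $ k) = 0" by (simp add: clipped_density_def)
    then have "(\<Prod>k\<in>UNIV. clipped_density k (t $ k)) = 0" by (intro prod_zero) auto
    then show ?thesis using False by simp
  qed
  then show ?thesis
    unfolding parameter_law_def by (simp add: prod_ennreal clipped_density_props(2))
qed

lemma sets_parameter_law [simp, measurable_cong]: "sets (parameter_law \<rho>) = sets borel"
  by (simp add: parameter_law_def)

lemma space_parameter_law [simp]: "space (parameter_law \<rho>) = UNIV"
  by (simp add: parameter_law_def)

text \<open>The factors belonging to the other coordinates integrate to 1. The case of a constant
  function gives total mass 1, and the positive and negative parts of the coordinate give its
  mean.\<close>

lemma nn_integral_parameter_law_coord: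
  assumes h [measurable]: "h \<in> borel_measurable borel"
  shows "(\<integral>\<^sup>+t. h (t $ k) \<partial>parameter_law \<rho>) = (\<integral>\<^sup>+s. h s * ennreal (clipped_density k s) \<partial>lborel)"
proof -
  note [measurable] = clipped_density_props(1)
  define g where "g j s = ennreal (clipped_density j s) * (if j = k then h s else 1)" for j s
  have nth [measurable]: "(\<lambda>t::real^'k. t $ j) \<in> borel_measurable borel" for j
    by (intro borel_measurable_continuous_onI continuous_intros)
  have one: "(\<integral>\<^sup>+s. ennreal (clipped_density j s) \<partial>lborel) = 1" for j
    using nn_integral_eq_integral[OF clipped_density_props(3)[of j]] clipped_density_props(2,4)[of j] by simp
  have "(\<integral>\<^sup>+t. h (t $ k) \<partial>parameter_law \<rho>)
      = (\<integral>\<^sup>+t. (\<Prod>j\<in>UNIV. ennreal (clipped_density j (t $ j))) * h (t $ k) \<partial>lborel)"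
    unfolding parameter_law_eq by (subst nn_integral_density) (auto simp: measurable_lborel1)
  also have "\<dots> = (\<integral>\<^sup>+t. (\<Prod>j\<in>UNIV. g j (t $ j)) \<partial>lborel)"
    by (simp add: g_def prod.distrib)
  also have "\<dots> = (\<Prod>j\<in>UNIV. \<integral>\<^sup>+s. g j s \<partial>lborel)"
    by (rule nn_integral_lborel_prod_cart) (simp add: g_def)
  also have "\<dots> = (\<Prod>j\<in>UNIV. if j = k then (\<integral>\<^sup>+s. g k s \<partial>lborel) else 1)"
  proof (rule prod.cong)
    fix j
    show "(\<integral>\<^sup>+s. g j s \<partial>lborel) = (if j = k then (\<integral>\<^sup>+s. g k s \<partial>lborel) else 1)"
      by (cases "j = k", simp) (simp add: g_def one)
  qed simp
  also have "\<dots> = (\<integral>\<^sup>+s. h s * ennreal (clipped_density k s) \<partial>lborel)"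
  proof -
    have "g k = (\<lambda>s. h s * ennreal (clipped_density k s))" by (rule ext) (simp add: g_def mult.commute)
    then show ?thesis by simp
  qed
  finally show ?thesis .
qed

lemma prob_space_parameter_law: "prob_space (parameter_law \<rho>)"
proof
  have "(\<integral>\<^sup>+s. ennreal (clipped_density k s) \<partial>lborel) = 1" for k
    using nn_integral_eq_integral[OF clipped_density_props(3)[of k]] clipped_density_props(2,4)[of k] by simp
  then show "emeasure (parameter_law \<rho>) (space (parameter_law \<rho>)) = 1"
    using nn_integral_parameter_law_coord[of "\<lambda>_. 1"] by simp
qed

lemma AE_parameter_box: "AE t in parameter_law \<rho>. t \<in> parameter_box"
proof -
  have [measurable]: "(\<lambda>t::real^'k. t $ j) \<in> borel_measurable borel" for j
    by (intro borel_measurable_continuous_onI continuous_intros)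
  have [measurable]: "\<rho> k \<in> borel_measurable borel" for k using \<rho> by (simp add: iid_centred_densities_def)
  show ?thesis
    unfolding parameter_law_def
    by (subst AE_density) (auto simp: indicator_def measurable_lborel1 intro!: AE_I2)
qed

text \<open>The coordinate is bounded on the box, hence integrable. Its integral is split into
  positive and negative parts, so that the one-dimensional reduction for nonnegative functions
  applies to each.\<close>

lemma parameter_law_centred:
  "integrable (parameter_law \<rho>) (\<lambda>t. t $ k)" "(\<integral>t. t $ k \<partial>parameter_law \<rho>) = 0"
proof -
  interpret prob_space "parameter_law \<rho>" by (rule prob_space_parameter_law)
  show i: "integrable (parameter_law \<rho>) (\<lambda>t. t $ k)"
  proof (rule integrable_const_bound[where B=1])
    show "AE t in parameter_law \<rho>. norm (t $ k) \<le> 1"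
      using AE_parameter_box by eventually_elim (auto simp: parameter_box_def abs_le_iff)
    have "(\<lambda>t::real^'k. t $ k) \<in> borel_measurable borel"
      by (intro borel_measurable_continuous_onI continuous_intros)
    then show "(\<lambda>t. t $ k) \<in> borel_measurable (parameter_law \<rho>)" by simp
  qed
  have e: "ennreal s * ennreal (clipped_density k s) = ennreal (s * clipped_density k s)" for s
    by (simp add: ennreal_mult'' clipped_density_props(2))
  have e': "ennreal (- s) * ennreal (clipped_density k s) = ennreal (- (s * clipped_density k s))" for s
    using ennreal_mult''[of "clipped_density k s" "- s"] by (simp add: clipped_density_props(2))
  have "(\<integral>t. t $ k \<partial>parameter_law \<rho>) = (\<integral>s. s * clipped_density k s \<partial>lborel)"
    unfolding real_lebesgue_integral_def[OF i] real_lebesgue_integral_def[OF clipped_density_props(5)]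
    using nn_integral_parameter_law_coord[of "\<lambda>s. ennreal s" k] nn_integral_parameter_law_coord[of "\<lambda>s. ennreal (- s)" k]
    by (simp add: e e')
  then show "(\<integral>t. t $ k \<partial>parameter_law \<rho>) = 0" by (simp add: clipped_density_props(6))
qed

end

section \<open>Change of variables\<close>

subsection \<open>A measure bound for preimages\<close>

text \<open>Padding with the empty set allows finite families. Each member is listed under one index
  only, which keeps the interiors disjoint.\<close>

lemma disjoint_interior_enumeration:
  assumes "countable \<D>" and disj: "pairwise (\<lambda>A B. interior A \<inter> interior B = {}) \<D>"
  shows "\<exists>A :: nat \<Rightarrow> 'a::topological_space set.
    (\<Union>n. A n) = \<Union>\<D> \<and> (\<forall>n. A n \<in> \<D> \<or> A n = {}) \<and> disjoint_family (\<lambda>n. interior (A n))"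
proof -
  define A where "A n = (if n \<in> to_nat_on \<D> ` \<D> then from_nat_into \<D> n else {})" for n
  have 1: "A (to_nat_on \<D> K) = K" if "K \<in> \<D>" for K
    using that assms(1) by (simp add: A_def)
  have 2: "A n \<in> \<D> \<or> A n = {}" for n
    using assms(1) by (auto simp: A_def)
  have "(\<Union>n. A n) = \<Union>\<D>"
  proof
    show "(\<Union>n. A n) \<subseteq> \<Union>\<D>" using 2 by (metis UN_least Union_upper empty_subsetI)
    show "\<Union>\<D> \<subseteq> (\<Union>n. A n)" using 1 by blast
  qed
  moreover have "disjoint_family (\<lambda>n. interior (A n))"
    unfolding disjoint_family_on_def
  proof (intro ballI impI)
    fix m n :: nat assume "m \<noteq> n"
    show "interior (A m) \<inter> interior (A n) = {}"
    proof (cases "m \<in> to_nat_on \<D> ` \<D> \<and> n \<in> to_nat_on \<D> ` \<D>")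
      case True
      then obtain K L where KL: "K \<in> \<D>" "L \<in> \<D>" "m = to_nat_on \<D> K" "n = to_nat_on \<D> L" by blast
      then have "K \<noteq> L" using \<open>m \<noteq> n\<close> by blast
      then show ?thesis using disj KL 1 by (simp add: pairwise_def)
    next
      case False
      then show ?thesis by (auto simp: A_def)
    qed
  qed
  ultimately show ?thesis using 2 by (intro exI[of _ A]) simp
qed

lemma emeasure_cube:
  fixes u v :: "real^'d"
  assumes "\<And>i. v $ i - u $ i = s" "0 \<le> s"
  shows "emeasure lebesgue (cbox u v) = ennreal (s ^ CARD('d))"
proof -
  have "u \<in> cbox u v"
  proof -
    have "u $ i \<le> v $ i" for i using assms(1)[of i] assms(2) by linarith
    then show ?thesis by (simp add: mem_box_cart)
  qed
  then have ne: "cbox u v \<noteq> {}" by blast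
  have "emeasure lebesgue (cbox u v) = emeasure lborel (cbox u v)" by simp
  also have "\<dots> = ennreal (measure lborel (cbox u v))"
    by (rule emeasure_eq_ennreal_measure) (simp add: emeasure_lborel_cbox_eq)
  also have "measure lborel (cbox u v) = s ^ CARD('d)"
    by (simp add: content_cbox_cart[OF ne] assms(1))
  finally show ?thesis .
qed

text \<open>A cube of side s has l^1 diameter at most d s, so its preimage lies within L d s of any
  of its points, hence in a cube of side 2 L d s. The constant is the ratio of the volumes of the
  two cubes; the \<open>itself\<close> argument carries the dimension.\<close>

definition preimage_const :: "'d::finite itself \<Rightarrow> real \<Rightarrow> real" where
  "preimage_const _ L = (2 * L * real CARD('d)) ^ CARD('d)"

context
  fixes D :: "(real^'d) set" and W :: "real^'d \<Rightarrow> real^'d" and L :: real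
  assumes D: "open D" and Wc: "continuous_on D W" and WU: "open (W ` D)" "bounded (W ` D)" and L: "0 \<le> L"
    and lip: "\<And>a b x y. cbox a b \<subseteq> W ` D \<Longrightarrow> x \<in> D \<Longrightarrow> y \<in> D \<Longrightarrow> W x \<in> cbox a b \<Longrightarrow> W y \<in> cbox a b
        \<Longrightarrow> norm (x - y) \<le> L * norm (W x - W y)"
begin

lemma preimage_open: "open E \<Longrightarrow> open {x \<in> D. W x \<in> E}"
  using continuous_open_preimage[OF Wc D] by (simp add: vimage_def Int_def)

text \<open>The image of \<open>W\<close> need not be convex, so the inverse is known to be
  Lipschitz only inside boxes contained in it. For a cube this already confines the preimage to a
  cube around any one of its points.\<close>

lemma emeasure_preimage_cube:
  assumes K: "cbox u v \<subseteq> W ` D" and side: "\<And>i. v $ i - u $ i = s" "0 \<le> s"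
  shows "emeasure lebesgue {x \<in> D. W x \<in> cbox u v} \<le> ennreal (preimage_const TYPE('d) L) * emeasure lebesgue (cbox u v)"
proof (cases "{x \<in> D. W x \<in> cbox u v} = {}")
  case True
  then show ?thesis by (simp only: True emeasure_empty zero_le)
next
  case False
  then obtain x0 where x0: "x0 \<in> D" "W x0 \<in> cbox u v" by blast
  define r where "r = L * (real CARD('d) * s)"
  have r0: "0 \<le> r" using L side(2) by (simp add: r_def)
  have "{x \<in> D. W x \<in> cbox u v} \<subseteq> cbox (x0 - (\<chi> i. r)) (x0 + (\<chi> i. r))"
  proof clarify
    fix x assume x: "x \<in> D" "W x \<in> cbox u v"
    have "norm (W x - W x0) \<le> (\<Sum>i\<in>UNIV. \<bar>(W x - W x0) $ i\<bar>)" by (rule norm_le_l1_cart)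
    also have "\<dots> \<le> (\<Sum>i\<in>(UNIV :: 'd set). s)"
    proof (rule sum_mono)
      fix i
      have "u $ i \<le> W x $ i" "W x $ i \<le> v $ i" "u $ i \<le> W x0 $ i" "W x0 $ i \<le> v $ i"
        using x(2) x0(2) by (auto simp: mem_box_cart)
      then show "\<bar>(W x - W x0) $ i\<bar> \<le> s" using side(1)[of i] by simp
    qed
    finally have "norm (W x - W x0) \<le> real CARD('d) * s" by simp
    then have "norm (x - x0) \<le> r"
      using lip[OF K x(1) x0(1) x(2) x0(2)] L unfolding r_def by (meson mult_left_mono order_trans)
    then have "\<bar>x $ i - x0 $ i\<bar> \<le> r" for i using component_le_norm_cart[of "x - x0" i] by simp
    then have "x0 $ i - r \<le> x $ i \<and> x $ i \<le> x0 $ i + r" for i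
      by (metis abs_le_iff add.commute diff_le_eq le_diff_eq minus_diff_eq)
    then show "x \<in> cbox (x0 - (\<chi> i. r)) (x0 + (\<chi> i. r))" by (simp add: mem_box_cart)
  qed
  then have "emeasure lebesgue {x \<in> D. W x \<in> cbox u v} \<le> emeasure lebesgue (cbox (x0 - (\<chi> i. r)) (x0 + (\<chi> i. r)))"
    by (rule emeasure_mono) simp
  also have "\<dots> = ennreal ((2 * r) ^ CARD('d))" using r0 by (intro emeasure_cube) auto
  also have "(2 * r) ^ CARD('d) = (preimage_const TYPE('d) L) * s ^ CARD('d)"
    by (simp add: r_def preimage_const_def power_mult_distrib algebra_simps)
  also have "ennreal \<dots> = ennreal (preimage_const TYPE('d) L) * ennreal (s ^ CARD('d))"
    using L by (intro ennreal_mult) (simp_all add: preimage_const_def side)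
  also have "ennreal (s ^ CARD('d)) = emeasure lebesgue (cbox u v)"
    by (rule emeasure_cube[OF side, symmetric])
  finally show ?thesis .
qed

text \<open>The open set is tiled by dyadic cubes with disjoint interiors that lie inside it. The
  preimages are summed by subadditivity, the cubes themselves by additivity.\<close>

lemma emeasure_preimage_open:
  assumes E: "open E" "E \<subseteq> W ` D"
  shows "emeasure lebesgue {x \<in> D. W x \<in> E} \<le> ennreal (preimage_const TYPE('d) L) * emeasure lebesgue E"
proof -
  obtain R where R: "0 < R" "\<And>y. y \<in> W ` D \<Longrightarrow> norm y \<le> R"
    using WU(2) unfolding bounded_pos by blast
  \<comment> \<open>An enclosing box with equal sides, so that its dyadic pieces are cubes.\<close>
  let ?a = "(\<chi> i. - R) :: real^'d" and ?b = "(\<chi> i. R) :: real^'d"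
  have Eab: "E \<subseteq> cbox ?a ?b"
  proof
    fix y assume "y \<in> E"
    then have "\<bar>y $ i\<bar> \<le> R" for i using R(2)[of y] E(2) component_le_norm_cart[of y i] by force
    then show "y \<in> cbox ?a ?b" by (simp add: mem_box_cart abs_le_iff minus_le_iff)
  qed
  have "0 \<in> box ?a ?b" using R(1) by (simp add: mem_box_cart)
  then have ne: "box ?a ?b \<noteq> {}" by blast
  \<comment> \<open>The gauge is \<open>E\<close> itself at the points of \<open>E\<close>, which
    forces every piece of the covering to lie in \<open>E\<close>.\<close>
  have g: "gauge (\<lambda>x. if x \<in> E then E else UNIV)" using E(1) by (auto simp: gauge_def)
  obtain \<D> where \<D>: "countable \<D>" "\<Union>\<D> \<subseteq> cbox ?a ?b"
      "\<And>K. K \<in> \<D> \<Longrightarrow> interior K \<noteq> {} \<and> (\<exists>c d. K = cbox c d)"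
      "pairwise (\<lambda>A B. interior A \<inter> interior B = {}) \<D>"
      "\<And>K. K \<in> \<D> \<Longrightarrow> \<exists>x \<in> E \<inter> K. K \<subseteq> (if x \<in> E then E else UNIV)"
      "\<And>u v. cbox u v \<in> \<D> \<Longrightarrow> \<exists>n. \<forall>i \<in> Basis. v \<bullet> i - u \<bullet> i = (?b \<bullet> i - ?a \<bullet> i) / 2^n"
      "E \<subseteq> \<Union>\<D>"
  proof (rule covering_lemma[OF Eab ne g], goal_cases)
    case (1 \<D>)
    show ?case by (rule 1(1)[OF 1(2-8)])
  qed
  have KE: "K \<subseteq> E" if "K \<in> \<D>" for K using \<D>(5)[OF that] by auto
  obtain A :: "nat \<Rightarrow> (real^'d) set" where "(\<Union>n. A n) = \<Union>\<D> \<and> (\<forall>n. A n \<in> \<D> \<or> A n = {}) \<and> disjoint_family (\<lambda>n. interior (A n))"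
    using disjoint_interior_enumeration[OF \<D>(1,4)] by blast
  then have A: "(\<Union>n. A n) = \<Union>\<D>" "\<And>n. A n \<in> \<D> \<or> A n = {}" "disjoint_family (\<lambda>n. interior (A n))"
    by simp_all
  have eqE: "E = (\<Union>n. A n)" using \<D>(7) KE A(1) by auto
  have cube: "\<exists>u v. K = cbox u v \<and> emeasure lebesgue {x \<in> D. W x \<in> cbox u v} \<le> ennreal (preimage_const TYPE('d) L) * emeasure lebesgue (cbox u v)"
    if K: "K \<in> \<D>" for K
  proof -
    obtain u v where uv: "K = cbox u v" using \<D>(3)[OF K] by blast
    obtain n where n: "\<And>i. i \<in> Basis \<Longrightarrow> v \<bullet> i - u \<bullet> i = (?b \<bullet> i - ?a \<bullet> i) / 2^n"
      using \<D>(6) K uv by blast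
    have "v $ i - u $ i = 2 * R / 2^n" for i
      using n[of "axis i 1"] by (simp add: cart_eq_inner_axis[symmetric] axis_in_Basis_iff)
    moreover have "0 \<le> 2 * R / 2^n" using R(1) by simp
    ultimately have "emeasure lebesgue {x \<in> D. W x \<in> cbox u v} \<le> ennreal (preimage_const TYPE('d) L) * emeasure lebesgue (cbox u v)"
      using KE[OF K] E(2) uv by (intro emeasure_preimage_cube) auto
    then show ?thesis using uv by blast
  qed
  \<comment> \<open>The preimages are those of closed cubes, which cover; the bound uses the open
    interiors, which are disjoint. The passage is free because faces of cubes have measure
    zero.\<close>
  have An: "closed (A n)" "emeasure lebesgue {x \<in> D. W x \<in> A n} \<le> ennreal (preimage_const TYPE('d) L) * emeasure lebesgue (interior (A n))" for n
  proof -
    have "closed (A n) \<and> emeasure lebesgue {x \<in> D. W x \<in> A n} \<le> ennreal (preimage_const TYPE('d) L) * emeasure lebesgue (interior (A n))"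
    proof (cases "A n = {}")
      case False
      then have "A n \<in> \<D>" using A(2) by blast
      from cube[OF this] obtain u v where uv: "A n = cbox u v"
        "emeasure lebesgue {x \<in> D. W x \<in> cbox u v} \<le> ennreal (preimage_const TYPE('d) L) * emeasure lebesgue (cbox u v)" by blast
      have "emeasure lebesgue (cbox u v) = emeasure lebesgue (box u v)"
        by (simp add: emeasure_lborel_cbox_eq emeasure_lborel_box_eq)
      then show ?thesis using uv by (simp add: interior_cbox closed_cbox)
    qed simp
    then show "closed (A n)" "emeasure lebesgue {x \<in> D. W x \<in> A n} \<le> ennreal (preimage_const TYPE('d) L) * emeasure lebesgue (interior (A n))"
      by auto
  qed
  have meas: "{x \<in> D. W x \<in> A n} \<in> sets lebesgue" for n
  proof -
    have "{x \<in> D. W x \<in> A n} = D - {x \<in> D. W x \<in> - A n}" by auto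
    moreover have "open {x \<in> D. W x \<in> - A n}" using preimage_open[of "- A n"] An(1)[of n] by blast
    ultimately show ?thesis using D by (simp only: sets_completionI_sets sets_lborel borel_open sets.Diff)
  qed
  have "emeasure lebesgue {x \<in> D. W x \<in> E} = emeasure lebesgue (\<Union>n. {x \<in> D. W x \<in> A n})"
    by (rule arg_cong[of _ _ "emeasure lebesgue"]) (auto simp: eqE)
  also have "\<dots> \<le> (\<Sum>n. emeasure lebesgue {x \<in> D. W x \<in> A n})"
    by (rule emeasure_subadditive_countably) (use meas in auto)
  also have "\<dots> \<le> (\<Sum>n. ennreal (preimage_const TYPE('d) L) * emeasure lebesgue (interior (A n)))"
    by (intro suminf_le An) auto
  also have "\<dots> = ennreal (preimage_const TYPE('d) L) * (\<Sum>n. emeasure lebesgue (interior (A n)))" by simp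
  also have "(\<Sum>n. emeasure lebesgue (interior (A n))) = emeasure lebesgue (\<Union>n. interior (A n))"
    by (rule suminf_emeasure) (use A(3) in \<open>auto intro!: sets_completionI_sets\<close>)
  also have "\<dots> \<le> emeasure lebesgue E"
    using eqE interior_subset E(1) by (intro emeasure_mono) (auto intro!: sets_completionI_sets)
  finally show ?thesis by (simp add: mult_left_mono)
qed

text \<open>A null set lies in open sets of arbitrarily small measure; cut down to the image, these
  have preimages of small measure by the open case. It is the condition under which composition
  respects equality almost everywhere.\<close>

lemma preimage_null:
  assumes N: "N \<in> null_sets lebesgue" "N \<subseteq> W ` D"
  shows "{x \<in> D. W x \<in> N} \<in> null_sets lebesgue"
proof -
  have "negligible {x \<in> D. W x \<in> N}"
  proof (rule negligible_outer_le[THEN iffD2], intro allI impI)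
    fix e :: real assume e: "0 < e"
    \<comment> \<open>The added 1 avoids a division by zero, since \<open>L = 0\<close> is allowed
      here and makes the constant vanish.\<close>
    define d where "d = e / ((preimage_const TYPE('d) L) + 1)"
    have c: "0 \<le> (preimage_const TYPE('d) L)" using L by (simp add: preimage_const_def)
    have d: "0 < d" using e c by (simp add: d_def add_nonneg_pos)
    obtain T where T: "open T" "N \<subseteq> T" "T - N \<in> lmeasurable" "emeasure lebesgue (T - N) < ennreal d"
      using sets_lebesgue_outer_open[of N d] N(1) d by blast
    let ?T = "T \<inter> W ` D"
    have oT: "open ?T" using T(1) WU(1) by blast
    have "emeasure lebesgue ?T \<le> emeasure lebesgue T"
      using T(1) by (intro emeasure_mono) (auto intro!: sets_completionI_sets)
    also have "\<dots> = emeasure lebesgue (T - N)"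
      using emeasure_Diff_null_set[OF N(1), of T] T(1) by (auto intro!: sets_completionI_sets)
    also have "\<dots> \<le> ennreal d" using T(4) by simp
    finally have Td: "emeasure lebesgue ?T \<le> ennreal d" .
    have "emeasure lebesgue {x \<in> D. W x \<in> ?T} \<le> ennreal (preimage_const TYPE('d) L) * emeasure lebesgue ?T"
      by (rule emeasure_preimage_open[OF oT]) blast
    also have "\<dots> \<le> ennreal (preimage_const TYPE('d) L) * ennreal d" by (intro mult_left_mono Td) simp
    also have "\<dots> = ennreal ((preimage_const TYPE('d) L) * d)" using c d by (simp add: ennreal_mult)
    also have "\<dots> \<le> ennreal e"
    proof (rule ennreal_leI)
      have "(preimage_const TYPE('d) L) * d \<le> ((preimage_const TYPE('d) L) + 1) * d" using d by simp
      also have "\<dots> = e" using c by (simp add: d_def add_nonneg_eq_0_iff)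
      finally show "(preimage_const TYPE('d) L) * d \<le> e" .
    qed
    finally have le: "emeasure lebesgue {x \<in> D. W x \<in> ?T} \<le> ennreal e" .
    have m: "{x \<in> D. W x \<in> ?T} \<in> sets lebesgue" using preimage_open[OF oT] by (auto intro!: sets_completionI_sets)
    have fin: "{x \<in> D. W x \<in> ?T} \<in> lmeasurable"
      using m le by (intro fmeasurableI) (auto intro: le_less_trans)
    show "\<exists>S'. {x \<in> D. W x \<in> N} \<subseteq> S' \<and> S' \<in> lmeasurable \<and> measure lebesgue S' \<le> e"
    proof (intro exI conjI)
      show "{x \<in> D. W x \<in> N} \<subseteq> {x \<in> D. W x \<in> ?T}" using T(2) by auto
      show "measure lebesgue {x \<in> D. W x \<in> ?T} \<le> e"
        using le e fin by (simp add: emeasure_eq_measure2 ennreal_le_iff)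
    qed (rule fin)
  qed
  then show ?thesis by (simp add: negligible_iff_null_sets)
qed

lemma preimage_borel: "B \<in> sets borel \<Longrightarrow> {x \<in> D. W x \<in> B} \<in> sets borel"
proof -
  assume B: "B \<in> sets borel"
  have "W \<in> borel_measurable (restrict_space borel D)" by (rule borel_measurable_continuous_on_restrict[OF Wc])
  from measurable_sets[OF this B] have "W -` B \<inter> D \<in> sets (restrict_space borel D)" by (simp add: space_restrict_space)
  then have "W -` B \<inter> D \<in> sets borel" using D by (subst (asm) sets_restrict_space_iff) auto
  moreover have "W -` B \<inter> D = {x \<in> D. W x \<in> B}" by auto
  ultimately show ?thesis by simp
qed

text \<open>A Lebesgue set is a Borel set together with a subset of a null set; continuity handles
  the first and \<open>preimage_null\<close> the second. The estimate then follows by outer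
  regularity.\<close>

lemma preimage_lebesgue:
  assumes E: "E \<in> sets lebesgue" "E \<subseteq> W ` D"
  shows "{x \<in> D. W x \<in> E} \<in> sets lebesgue"
    "emeasure lebesgue {x \<in> D. W x \<in> E} \<le> ennreal (preimage_const TYPE('d) L) * emeasure lebesgue E"
proof -
  obtain B N N' where BN: "B \<in> sets borel" "E = B \<union> N" "N \<subseteq> N'" "N' \<in> null_sets lborel"
    using E(1) by (elim sets_completionE) auto
  have "N \<in> null_sets lebesgue" using BN(3,4) null_sets_completion_subset null_sets_completionI by metis
  moreover have "N \<subseteq> W ` D" using BN(2) E(2) by blast
  ultimately have "{x \<in> D. W x \<in> N} \<in> null_sets lebesgue" by (rule preimage_null)
  moreover have "{x \<in> D. W x \<in> B} \<in> sets lebesgue" by (rule sets_completionI_sets) (simp add: preimage_borel BN)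
  moreover have "{x \<in> D. W x \<in> E} = {x \<in> D. W x \<in> B} \<union> {x \<in> D. W x \<in> N}" using BN(2) by auto
  ultimately show m: "{x \<in> D. W x \<in> E} \<in> sets lebesgue" by auto
  have c: "0 \<le> (preimage_const TYPE('d) L)" using L by (simp add: preimage_const_def)
  have fE: "emeasure lebesgue E < \<infinity>"
  proof -
    have "E \<in> lmeasurable" using E bounded_subset[OF WU(2)] by (intro bounded_set_imp_lmeasurable)
    then show ?thesis unfolding fmeasurable_def infinity_ennreal_def by blast
  qed
  show "emeasure lebesgue {x \<in> D. W x \<in> E} \<le> ennreal (preimage_const TYPE('d) L) * emeasure lebesgue E"
  proof (rule ennreal_le_epsilon)
    fix e :: real assume e: "0 < e"
    define d where "d = e / ((preimage_const TYPE('d) L) + 1)"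
    have d: "0 < d" using e c by (simp add: d_def add_nonneg_pos)
    obtain T where T: "open T" "E \<subseteq> T" "T - E \<in> lmeasurable" "emeasure lebesgue (T - E) < ennreal d"
      using sets_lebesgue_outer_open[of E d] E(1) d by blast
    let ?T = "T \<inter> W ` D"
    have oT: "open ?T" using T(1) WU(1) by blast
    have "emeasure lebesgue ?T \<le> emeasure lebesgue (E \<union> (T - E))"
      using T E(1) by (intro emeasure_mono) auto
    also have "\<dots> \<le> emeasure lebesgue E + emeasure lebesgue (T - E)"
      using T(3) E(1) by (intro emeasure_subadditive) auto
    also have "\<dots> \<le> emeasure lebesgue E + ennreal d" using T(4) by (intro add_left_mono) simp
    finally have Td: "emeasure lebesgue ?T \<le> emeasure lebesgue E + ennreal d" .
    have "emeasure lebesgue {x \<in> D. W x \<in> E} \<le> emeasure lebesgue {x \<in> D. W x \<in> ?T}"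
      using preimage_open[OF oT] T(2) by (intro emeasure_mono) (auto intro!: sets_completionI_sets)
    also have "\<dots> \<le> ennreal (preimage_const TYPE('d) L) * emeasure lebesgue ?T"
      by (rule emeasure_preimage_open[OF oT]) blast
    also have "\<dots> \<le> ennreal (preimage_const TYPE('d) L) * (emeasure lebesgue E + ennreal d)" by (intro mult_left_mono Td) simp
    also have "\<dots> = ennreal (preimage_const TYPE('d) L) * emeasure lebesgue E + ennreal ((preimage_const TYPE('d) L) * d)"
      using c d by (simp add: ennreal_mult distrib_left)
    also have "\<dots> \<le> ennreal (preimage_const TYPE('d) L) * emeasure lebesgue E + ennreal e"
    proof (intro add_left_mono ennreal_leI)
      have "(preimage_const TYPE('d) L) * d \<le> ((preimage_const TYPE('d) L) + 1) * d" using d by simp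
      also have "\<dots> = e" using c by (simp add: d_def add_nonneg_eq_0_iff)
      finally show "(preimage_const TYPE('d) L) * d \<le> e" .
    qed
    finally show "emeasure lebesgue {x \<in> D. W x \<in> E} \<le> ennreal (preimage_const TYPE('d) L) * emeasure lebesgue E + ennreal e" .
  qed
qed

lemma measurable_lebesgue_map: "W \<in> measurable (lebesgue_on D) (lebesgue_on (W ` D))"
proof (rule measurableI)
  show "W x \<in> space (lebesgue_on (W ` D))" if "x \<in> space (lebesgue_on D)" for x
    using that by (simp add: space_restrict_space)
  fix A assume "A \<in> sets (lebesgue_on (W ` D))"
  then have A: "A \<in> sets lebesgue" "A \<subseteq> W ` D"
    using WU(1) by (auto simp: sets_restrict_space_iff)
  have "W -` A \<inter> space (lebesgue_on D) = {x \<in> D. W x \<in> A}" by (auto simp: space_restrict_space)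
  then show "W -` A \<inter> space (lebesgue_on D) \<in> sets (lebesgue_on D)"
    using preimage_lebesgue(1)[OF A] D by (simp add: sets_restrict_space_iff)
qed

text \<open>The bound on sets says that the image of Lebesgue measure under \<open>W\<close> is
  dominated by a multiple of Lebesgue measure; integrals of nonnegative functions inherit the
  domination. Only an inequality is required, so the Jacobian does not enter.\<close>

lemma nn_integral_map_le:
  assumes h: "h \<in> borel_measurable (lebesgue_on (W ` D))"
  shows "(\<integral>\<^sup>+x. h (W x) \<partial>lebesgue_on D) \<le> ennreal (preimage_const TYPE('d) L) * (\<integral>\<^sup>+y. h y \<partial>lebesgue_on (W ` D))"
proof -
  let ?U = "lebesgue_on (W ` D)" and ?\<nu> = "distr (lebesgue_on D) (lebesgue_on (W ` D)) W"
  have "?\<nu> \<le> scale_measure (ennreal (preimage_const TYPE('d) L)) ?U"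
  proof (subst le_measure, simp, intro ballI)
    fix A assume "A \<in> sets ?\<nu>"
    then have As: "A \<in> sets ?U" by simp
    then have A: "A \<in> sets lebesgue" "A \<subseteq> W ` D"
      using WU(1) by (auto simp: sets_restrict_space_iff)
    have "emeasure ?\<nu> A = emeasure (lebesgue_on D) {x \<in> D. W x \<in> A}"
      using As by (subst emeasure_distr[OF measurable_lebesgue_map]) (auto simp: space_restrict_space intro!: arg_cong2[of _ _ _ _ emeasure])
    also have "\<dots> = emeasure lebesgue {x \<in> D. W x \<in> A}"
      using D by (intro emeasure_restrict_space) auto
    also have "\<dots> \<le> ennreal (preimage_const TYPE('d) L) * emeasure lebesgue A" by (rule preimage_lebesgue(2)[OF A])
    also have "emeasure lebesgue A = emeasure ?U A"
      using A WU(1) by (intro emeasure_restrict_space[symmetric]) auto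
    finally show "emeasure ?\<nu> A \<le> emeasure (scale_measure (ennreal (preimage_const TYPE('d) L)) ?U) A" by simp
  qed
  then have "(\<integral>\<^sup>+y. h y \<partial>?\<nu>) \<le> (\<integral>\<^sup>+y. h y \<partial>scale_measure (ennreal (preimage_const TYPE('d) L)) ?U)"
    by (intro nn_integral_mono_measure) auto
  then show ?thesis
    using h measurable_lebesgue_map by (simp add: nn_integral_distr nn_integral_scale_measure)
qed

lemma AE_map:
  assumes "AE y in lebesgue_on (W ` D). P y"
  shows "AE x in lebesgue_on D. P (W x)"
proof -
  obtain N where N: "{y \<in> space (lebesgue_on (W ` D)). \<not> P y} \<subseteq> N" "N \<in> null_sets (lebesgue_on (W ` D))"
    using assms by (auto elim!: AE_E simp: null_sets_def)
  then have "N \<in> null_sets lebesgue" "N \<subseteq> W ` D"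
    using WU(1) by (auto simp: null_sets_restrict_space)
  then have "{x \<in> D. W x \<in> N} \<in> null_sets lebesgue" by (rule preimage_null)
  then have "AE x in lebesgue. x \<notin> {x \<in> D. W x \<in> N}" by (rule AE_not_in)
  then have "AE x in lebesgue. x \<in> D \<longrightarrow> P (W x)"
    by eventually_elim (use N(1) in \<open>auto simp: space_restrict_space\<close>)
  then show ?thesis using D by (subst AE_restrict_space_iff) auto
qed

end

subsection \<open>Matrices\<close>

text \<open>The Leibniz formula: d! permutations, each contributing a product of d entries bounded
  by \<open>L\<close>.\<close>

lemma det_abs_le:
  fixes A :: "real^'d^'d"
  assumes "\<And>h. norm (A *v h) \<le> L * norm h"
  shows "\<bar>det A\<bar> \<le> fact CARD('d) * L ^ CARD('d)"
proof -
  have e: "\<bar>A $ i $ j\<bar> \<le> L" for i j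
  proof -
    have "A $ i $ j = (A *v axis j 1) $ i" by (simp add: matrix_vector_mult_basis column_def)
    also have "\<bar>\<dots>\<bar> \<le> norm (A *v axis j 1)" by (rule component_le_norm_cart)
    also have "\<dots> \<le> L" using assms[of "axis j 1"] by simp
    finally show ?thesis .
  qed
  have "\<bar>det A\<bar> \<le> (\<Sum>p | p permutes (UNIV :: 'd set). \<bar>of_int (sign p) * (\<Prod>i\<in>UNIV. A $ i $ p i)\<bar>)"
    unfolding det_def by (rule sum_abs)
  also have "\<dots> \<le> (\<Sum>p | p permutes (UNIV :: 'd set). L ^ CARD('d))"
  proof (rule sum_mono)
    fix p :: "'d \<Rightarrow> 'd" assume "p \<in> {p. p permutes UNIV}"
    have "\<bar>of_int (sign p) * (\<Prod>i\<in>UNIV. A $ i $ p i)\<bar> = (\<Prod>i\<in>UNIV. \<bar>A $ i $ p i\<bar>)"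
      by (simp add: abs_mult abs_prod sign_def)
    also have "\<dots> \<le> (\<Prod>i\<in>(UNIV :: 'd set). L)" by (intro prod_mono) (simp add: e)
    finally show "\<bar>of_int (sign p) * (\<Prod>i\<in>UNIV. A $ i $ p i)\<bar> \<le> L ^ CARD('d)" by simp
  qed
  also have "\<dots> = fact CARD('d) * L ^ CARD('d)" by (simp add: card_permutations)
  finally show ?thesis .
qed

text \<open>The geometric factor of \<open>transported_coeff\<close>. It is separated from the
  scalar coefficient because both parts of the diffusion coefficient share it.\<close>

definition pullback_matrix :: "real^'d^'d \<Rightarrow> real^'d^'d" where
  "pullback_matrix J = det J *\<^sub>R matrix_inv (transpose J ** J)"

lemma matrix_inv_props:
  fixes A :: "real^'d^'d"
  assumes "invertible A"
  shows "A ** matrix_inv A = mat 1" "matrix_inv A ** A = mat 1"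
proof -
  have "A ** matrix_inv A = mat 1 \<and> matrix_inv A ** A = mat 1"
    unfolding matrix_inv_def by (rule someI_ex) (use assms in \<open>simp add: invertible_def\<close>)
  then show "A ** matrix_inv A = mat 1" "matrix_inv A ** A = mat 1" by auto
qed

context
  fixes J :: "real^'d^'d" and L :: real
  assumes L: "0 < L" and upper: "\<And>h. norm (J *v h) \<le> L * norm h"
    and lower: "\<And>h. norm h \<le> L * norm (J *v h)" and det: "0 < det J"
begin

text \<open>The lower bound comes from the inverse: its operator norm is at most \<open>L\<close> as
  well, so its determinant is bounded by the same constant, and the two determinants multiply to
  1.\<close>

lemma det_bounds: "det J \<le> fact CARD('d) * L ^ CARD('d)" "1 / (fact CARD('d) * L ^ CARD('d)) \<le> det J"
proof -
  let ?c = "fact CARD('d) * L ^ CARD('d)"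
  have c: "0 < ?c" using L by simp
  show "det J \<le> ?c" using det_abs_le[of J L, OF upper] by linarith
  have inv: "invertible J" using det by (simp add: invertible_det_nz)
  have "norm (matrix_inv J *v h) \<le> L * norm h" for h
    using lower[of "matrix_inv J *v h"] by (simp add: matrix_vector_mul_assoc matrix_inv_props[OF inv])
  then have "\<bar>det (matrix_inv J)\<bar> \<le> ?c" by (rule det_abs_le)
  moreover have "det J * det (matrix_inv J) = 1"
    using det_mul[of J "matrix_inv J"] by (simp add: matrix_inv_props[OF inv])
  ultimately have "1 \<le> det J * ?c"
    using det by (metis abs_le_D1 less_imp_le mult_left_mono)
  then show "1 / ?c \<le> det J" using c by (simp add: pos_divide_le_eq)
qed

text \<open>With \<eta> the inverse Gram matrix applied to \<xi>, the form \<xi> \<bullet> \<eta>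
  equals the squared norm of \<open>J *v\<close> \<eta>. Upper and lower bounds on \<open>J\<close>
  and its transpose then compare this with the norms of \<xi> and \<eta>.\<close>

lemma gram_inverse:
  defines "A \<equiv> transpose J ** J"
  shows "A *v (matrix_inv A *v \<xi>) = \<xi>" "norm (matrix_inv A *v \<xi>) \<le> L\<^sup>2 * norm \<xi>"
    "(norm \<xi>)\<^sup>2 \<le> L\<^sup>2 * (\<xi> \<bullet> (matrix_inv A *v \<xi>))"
proof -
  have "det A = det J * det J" by (simp add: A_def det_mul)
  then have inv: "invertible A" using det by (simp add: invertible_det_nz)
  let ?\<eta> = "matrix_inv A *v \<xi>"
  show e: "A *v ?\<eta> = \<xi>" by (simp add: matrix_vector_mul_assoc matrix_inv_props[OF inv])
  have adj: "(transpose J *v x) \<bullet> y = x \<bullet> (J *v y)" for x y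
    by (simp add: dot_lmul_matrix[symmetric] inner_commute transpose_matrix_vector)
  have q: "\<xi> \<bullet> ?\<eta> = (norm (J *v ?\<eta>))\<^sup>2"
    by (subst e[symmetric]) (simp only: A_def matrix_vector_mul_assoc[symmetric] adj power2_norm_eq_inner)
  have "norm (transpose J *v x) \<le> L * norm x" for x
  proof -
    have "(norm (transpose J *v x))\<^sup>2 = x \<bullet> (J *v (transpose J *v x))" by (simp only: power2_norm_eq_inner adj)
    also have "\<dots> \<le> norm x * norm (J *v (transpose J *v x))" by (rule norm_cauchy_schwarz)
    also have "\<dots> \<le> norm x * (L * norm (transpose J *v x))" by (intro mult_left_mono upper) simp
    finally have "norm (transpose J *v x) * norm (transpose J *v x) \<le> (L * norm x) * norm (transpose J *v x)"
      by (simp add: power2_eq_square algebra_simps)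
    then show ?thesis using L by (cases "norm (transpose J *v x) = 0") (auto simp: mult_le_cancel_right less_le)
  qed
  then have "norm \<xi> \<le> L * norm (J *v ?\<eta>)"
    by (subst e[symmetric]) (simp add: A_def matrix_vector_mul_assoc[symmetric])
  then have "(norm \<xi>)\<^sup>2 \<le> (L * norm (J *v ?\<eta>))\<^sup>2" by (intro power_mono) auto
  then show "(norm \<xi>)\<^sup>2 \<le> L\<^sup>2 * (\<xi> \<bullet> ?\<eta>)" by (simp add: q power_mult_distrib)
  have "(norm ?\<eta>)\<^sup>2 \<le> (L * norm (J *v ?\<eta>))\<^sup>2" using lower by (intro power_mono) auto
  also have "\<dots> = L\<^sup>2 * (\<xi> \<bullet> ?\<eta>)" by (simp add: q power_mult_distrib)
  also have "\<dots> \<le> L\<^sup>2 * (norm \<xi> * norm ?\<eta>)" by (intro mult_left_mono norm_cauchy_schwarz) simp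
  finally have "norm ?\<eta> * norm ?\<eta> \<le> (L\<^sup>2 * norm \<xi>) * norm ?\<eta>" by (simp add: power2_eq_square algebra_simps)
  then show "norm ?\<eta> \<le> L\<^sup>2 * norm \<xi>"
    by (cases "norm ?\<eta> = 0") (auto simp: mult_le_cancel_right less_le)
qed

text \<open>The two determinant bounds are reciprocal and both bounds of the Gram matrix involve
  \<open>L^2\<close>, so a single constant serves as continuity bound and, inverted, as ellipticity
  bound.\<close>

lemma pullback_matrix_bounds:
  shows "norm (pullback_matrix J *v \<xi>) \<le> (fact CARD('d) * L ^ CARD('d) * L\<^sup>2) * norm \<xi>"
    "(norm \<xi>)\<^sup>2 \<le> (fact CARD('d) * L ^ CARD('d) * L\<^sup>2) * (\<xi> \<bullet> (pullback_matrix J *v \<xi>))"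
proof -
  let ?c = "fact CARD('d) * L ^ CARD('d)" and ?\<eta> = "matrix_inv (transpose J ** J) *v \<xi>"
  have c: "0 < ?c" using L by simp
  have B: "pullback_matrix J *v \<xi> = det J *\<^sub>R ?\<eta>"
    by (simp add: pullback_matrix_def scaleR_matrix_vector_assoc)
  have "norm (pullback_matrix J *v \<xi>) = det J * norm ?\<eta>" using det by (simp add: B)
  also have "\<dots> \<le> ?c * (L\<^sup>2 * norm \<xi>)"
    using det det_bounds(1) gram_inverse(2) by (intro mult_mono) auto
  finally show "norm (pullback_matrix J *v \<xi>) \<le> (?c * L\<^sup>2) * norm \<xi>" by (simp add: mult.assoc)
  have nn: "0 \<le> L\<^sup>2 * (\<xi> \<bullet> ?\<eta>)" using gram_inverse(3)[of \<xi>] zero_le_power2 order_trans by blast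
  have "1 \<le> ?c * det J" using det_bounds(2) c by (simp add: pos_divide_le_eq mult.commute)
  then have "1 * (L\<^sup>2 * (\<xi> \<bullet> ?\<eta>)) \<le> (?c * det J) * (L\<^sup>2 * (\<xi> \<bullet> ?\<eta>))" using nn by (rule mult_right_mono)
  then have "(norm \<xi>)\<^sup>2 \<le> (?c * det J) * (L\<^sup>2 * (\<xi> \<bullet> ?\<eta>))" using gram_inverse(3)[of \<xi>] by linarith
  then show "(norm \<xi>)\<^sup>2 \<le> (?c * L\<^sup>2) * (\<xi> \<bullet> (pullback_matrix J *v \<xi>))" by (simp add: B algebra_simps)
qed

end

lemma tendsto_matrix_entries:
  fixes J :: "nat \<Rightarrow> real^'n^'m"
  assumes "\<And>i j. (\<lambda>n. J n $ i $ j) \<longlonglongrightarrow> K $ i $ j"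
  shows "J \<longlonglongrightarrow> K"
  by (intro vec_tendstoI assms)

lemma tendsto_det:
  fixes J :: "nat \<Rightarrow> real^'d^'d"
  assumes "J \<longlonglongrightarrow> K"
  shows "(\<lambda>n. det (J n)) \<longlonglongrightarrow> det K"
  unfolding det_def by (intro tendsto_intros tendsto_vec_nth assms)

lemma tendsto_matrix_vector_mult:
  fixes J :: "nat \<Rightarrow> real^'n^'m"
  assumes "J \<longlonglongrightarrow> K" "x \<longlonglongrightarrow> y"
  shows "(\<lambda>n. J n *v x n) \<longlonglongrightarrow> K *v y"
  by (rule vec_tendstoI) (auto simp: matrix_vector_mult_def intro!: tendsto_sum tendsto_mult tendsto_vec_nth assms)

text \<open>\<open>A\<^sub>n\<^sup>-\<^sup>1 \<xi> - A\<^sup>-\<^sup>1 \<xi> = A\<^sub>n\<^sup>-\<^sup>1 (A - A\<^sub>n) A\<^sup>-\<^sup>1 \<xi>\<close>, and the inverses are uniformly bounded.\<close>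

lemma tendsto_pullback_matrix:
  fixes J :: "nat \<Rightarrow> real^'d^'d"
  assumes J: "J \<longlonglongrightarrow> K" and L: "0 < L"
    and Jn: "\<And>n h. norm (J n *v h) \<le> L * norm h" "\<And>n h. norm h \<le> L * norm (J n *v h)" "\<And>n. 0 < det (J n)"
    and K: "\<And>h. norm (K *v h) \<le> L * norm h" "\<And>h. norm h \<le> L * norm (K *v h)" "0 < det K"
  shows "(\<lambda>n. pullback_matrix (J n) *v \<xi>) \<longlonglongrightarrow> pullback_matrix K *v \<xi>"
proof -
  let ?A = "\<lambda>n. transpose (J n) ** J n" and ?B = "transpose K ** K"
  let ?\<eta> = "matrix_inv ?B *v \<xi>"
  have tr: "(\<lambda>n. transpose (J n)) \<longlonglongrightarrow> transpose K"
    by (rule tendsto_matrix_entries) (auto simp: transpose_def intro!: tendsto_vec_nth J)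
  have "(\<lambda>n. ?A n *v ?\<eta>) \<longlonglongrightarrow> ?B *v ?\<eta>"
    unfolding matrix_vector_mul_assoc[symmetric]
    by (intro tendsto_matrix_vector_mult tr J tendsto_const)
  then have "(\<lambda>n. ?B *v ?\<eta> - ?A n *v ?\<eta>) \<longlonglongrightarrow> ?B *v ?\<eta> - ?B *v ?\<eta>" by (intro tendsto_diff tendsto_const)
  then have d: "(\<lambda>n. norm (?B *v ?\<eta> - ?A n *v ?\<eta>)) \<longlonglongrightarrow> 0" by (simp add: tendsto_norm_zero)
  have "(\<lambda>n. matrix_inv (?A n) *v \<xi> - ?\<eta>) \<longlonglongrightarrow> 0"
  proof (rule Lim_null_comparison)
    show "(\<lambda>n. L\<^sup>2 * norm (?B *v ?\<eta> - ?A n *v ?\<eta>)) \<longlonglongrightarrow> 0" using tendsto_mult_left[OF d, of "L\<^sup>2"] by simp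
    have "norm (matrix_inv (?A n) *v \<xi> - ?\<eta>) \<le> L\<^sup>2 * norm (?B *v ?\<eta> - ?A n *v ?\<eta>)" for n
    proof -
      have "det (?A n) = det (J n) * det (J n)" by (simp add: det_mul)
      then have inv: "invertible (?A n)" using Jn(3)[of n] by (simp add: invertible_det_nz)
      have "matrix_inv (?A n) *v (?B *v ?\<eta> - ?A n *v ?\<eta>) = matrix_inv (?A n) *v \<xi> - ?\<eta>"
        unfolding gram_inverse(1)[OF L K] matrix_vector_mult_diff_distrib
        by (simp add: matrix_vector_mul_assoc[of "matrix_inv (?A n)"] matrix_inv_props[OF inv])
      then show ?thesis using gram_inverse(2)[OF L Jn, of n "?B *v ?\<eta> - ?A n *v ?\<eta>"] by simp
    qed
    then show "\<forall>\<^sub>F n in sequentially. norm (matrix_inv (?A n) *v \<xi> - ?\<eta>) \<le> L\<^sup>2 * norm (?B *v ?\<eta> - ?A n *v ?\<eta>)" by simp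
  qed
  then have "(\<lambda>n. matrix_inv (?A n) *v \<xi>) \<longlonglongrightarrow> ?\<eta>" by (simp add: Lim_null[symmetric])
  then have "(\<lambda>n. det (J n) *\<^sub>R (matrix_inv (?A n) *v \<xi>)) \<longlonglongrightarrow> det K *\<^sub>R ?\<eta>"
    by (intro tendsto_scaleR tendsto_det J)
  then show ?thesis by (simp add: pullback_matrix_def scaleR_matrix_vector_assoc)
qed

lemma transported_coeff_eq:
  "transported_coeff W a X = a (W X) *\<^sub>R pullback_matrix (jacobian W (at X))"
  by (simp add: transported_coeff_def pullback_matrix_def Let_def)

subsection \<open>Diffeomorphisms\<close>

text \<open>A supremum of reals says something only if the set is bounded above; continuity up to
  the compact closure ensures that. The supremum of \<open>g\<close> itself is nonnegative, so the
  derivative alone is below the bound.\<close>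

lemma C1_norm_bound:
  fixes U :: "(real^'d) set" and g :: "real^'d \<Rightarrow> real^'d"
  assumes U: "open U" "bounded U" and g: "g \<in> C1_closure U" and le: "C1_norm U g \<le> L" and x: "x \<in> U"
  shows "norm (frechet_derivative g (at x) h) \<le> L * norm h"
proof -
  obtain g' :: "real^'d \<Rightarrow> ((real^'d) \<Rightarrow>\<^sub>L (real^'d))" where g': "continuous_on (closure U) g"
      "continuous_on (closure U) g'" "\<And>x. x \<in> U \<Longrightarrow> (g has_derivative blinfun_apply (g' x)) (at x)"
    using g by (auto simp: C1_closure_def)
  have fd: "frechet_derivative g (at x) = blinfun_apply (g' x)" if "x \<in> U" for x
    using frechet_derivative_at[OF g'(3)[OF that]] by simp
  have c: "compact (closure U)" using U(2) by (simp add: compact_closure)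
  have bdd: "bdd_above ((\<lambda>x. norm (k x)) ` U)" if "continuous_on (closure U) k" for k :: "real^'d \<Rightarrow> 'c::real_normed_vector"
  proof -
    have "bounded (k ` closure U)" by (intro compact_imp_bounded compact_continuous_image that c)
    then obtain B where "\<And>y. y \<in> k ` closure U \<Longrightarrow> norm y \<le> B" by (auto simp: bounded_iff)
    then show ?thesis using closure_subset by (intro bdd_aboveI2[of _ _ B]) auto
  qed
  have on: "onorm (frechet_derivative g (at x)) = norm (g' x)" if "x \<in> U" for x
    by (simp add: fd[OF that] norm_blinfun.rep_eq)
  have "bdd_above ((\<lambda>x. onorm (frechet_derivative g (at x))) ` U)"
    using bdd[OF g'(2)] by (simp add: on cong: image_cong)
  from cSUP_upper[OF x this] have 1: "onorm (frechet_derivative g (at x)) \<le> (SUP x\<in>U. onorm (frechet_derivative g (at x)))" .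
  have "0 \<le> norm (g x)" by simp
  also have "\<dots> \<le> (SUP x\<in>U. norm (g x))" by (rule cSUP_upper[OF x bdd[OF g'(1)]])
  finally have "onorm (frechet_derivative g (at x)) \<le> L" using 1 le by (simp add: C1_norm_def)
  moreover have "norm (frechet_derivative g (at x) h) \<le> onorm (frechet_derivative g (at x)) * norm h"
    by (rule onorm) (simp add: fd[OF x] blinfun.bounded_linear_right)
  ultimately show ?thesis by (meson mult_right_mono norm_ge_zero order_trans)
qed

definition good_map :: "(real^'d) set \<Rightarrow> real \<Rightarrow> (real^'d \<Rightarrow> real^'d) \<Rightarrow> bool" where
  "good_map D L W \<longleftrightarrow> C1_diffeo_closure D W \<and> (\<forall>X\<in>D. 0 < det (jacobian W (at X)))
     \<and> C1_norm D W \<le> L \<and> C1_norm (W ` D) (inv_into (closure D) W) \<le> L"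

context bounded_open_set
begin

context
  fixes W :: "real^'d \<Rightarrow> real^'d" and L :: real
  assumes W: "good_map D L W" and L: "0 < L"
begin

lemma good_map_basic:
  shows "inj_on W (closure D)" "continuous_on (closure D) W" "continuous_on D W" "open (W ` D)" "bounded (W ` D)"
    "\<And>X. X \<in> D \<Longrightarrow> 0 < det (jacobian W (at X))"
    "\<And>X. X \<in> D \<Longrightarrow> (W has_derivative (\<lambda>h. jacobian W (at X) *v h)) (at X)"
proof -
  show inj: "inj_on W (closure D)" and det: "\<And>X. X \<in> D \<Longrightarrow> 0 < det (jacobian W (at X))"
    using W by (auto simp: good_map_def C1_diffeo_closure_def)
  have C1: "W \<in> C1_closure D" using W by (auto simp: good_map_def C1_diffeo_closure_def)
  then show c: "continuous_on (closure D) W" by (auto simp: C1_closure_def)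
  show cD: "continuous_on D W" by (rule continuous_on_subset[OF c closure_subset])
  show "open (W ` D)"
    by (rule invariance_of_domain[OF cD D_open inj_on_subset[OF inj closure_subset]])
  have "bounded (W ` closure D)"
    using D_bounded by (intro compact_imp_bounded compact_continuous_image c) (simp add: compact_closure)
  then show "bounded (W ` D)" using closure_subset bounded_subset by (metis image_mono)
  show "(W has_derivative (\<lambda>h. jacobian W (at X) *v h)) (at X)" if "X \<in> D" for X
    using C1 that unfolding jacobian_works[symmetric] differentiable_def by (auto simp: C1_closure_def)
qed

text \<open>The lower bound is the chain rule for the inverse composed with \<open>W\<close>: the
  derivative of the inverse undoes the Jacobian and has norm at most \<open>L\<close>.\<close>

lemma good_map_jacobian_bounds:
  assumes X: "X \<in> D"
  shows "norm (jacobian W (at X) *v h) \<le> L * norm h" "norm h \<le> L * norm (jacobian W (at X) *v h)"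
proof -
  let ?G = "inv_into (closure D) W"
  have C1: "W \<in> C1_closure D" "?G \<in> C1_closure (W ` D)" and n: "C1_norm D W \<le> L" "C1_norm (W ` D) ?G \<le> L"
    using W by (auto simp: good_map_def C1_diffeo_closure_def)
  have dW: "(W has_derivative (\<lambda>h. jacobian W (at X) *v h)) (at X)" by (rule good_map_basic(7)[OF X])
  show "norm (jacobian W (at X) *v h) \<le> L * norm h"
    using C1_norm_bound[OF D_open D_bounded C1(1) n(1) X, of h] frechet_derivative_at[OF dW] by simp
  have "?G differentiable (at (W X))"
    using C1(2) X unfolding differentiable_def by (auto simp: C1_closure_def)
  then have dG: "(?G has_derivative frechet_derivative ?G (at (W X))) (at (W X))"
    by (simp add: frechet_derivative_works)
  have "((\<lambda>x. ?G (W x)) has_derivative (\<lambda>h. frechet_derivative ?G (at (W X)) (jacobian W (at X) *v h))) (at X)"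
    by (rule has_derivative_compose[OF dW dG])
  then have "((\<lambda>x. x) has_derivative (\<lambda>h. frechet_derivative ?G (at (W X)) (jacobian W (at X) *v h))) (at X)"
    by (rule has_derivative_transform_within_open[OF _ D_open X])
      (use good_map_basic(1) closure_subset in \<open>auto intro: inv_into_f_f\<close>)
  then have "(\<lambda>h. frechet_derivative ?G (at (W X)) (jacobian W (at X) *v h)) = (\<lambda>h. h)"
    by (rule has_derivative_unique) simp
  then have "h = frechet_derivative ?G (at (W X)) (jacobian W (at X) *v h)" by metis
  moreover have "norm (frechet_derivative ?G (at (W X)) (jacobian W (at X) *v h)) \<le> L * norm (jacobian W (at X) *v h)"
    using X by (intro C1_norm_bound[OF good_map_basic(4,5) C1(2) n(2)]) simp
  ultimately show "norm h \<le> L * norm (jacobian W (at X) *v h)" by simp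
qed

text \<open>The mean value inequality for the inverse, which requires a convex set on which it is
  differentiable; a box inside the image is one.\<close>

lemma good_map_inverse_lipschitz:
  assumes ab: "cbox a b \<subseteq> W ` D" and xy: "x \<in> D" "y \<in> D" "W x \<in> cbox a b" "W y \<in> cbox a b"
  shows "norm (x - y) \<le> L * norm (W x - W y)"
proof -
  let ?G = "inv_into (closure D) W"
  have C1: "?G \<in> C1_closure (W ` D)" and n: "C1_norm (W ` D) ?G \<le> L"
    using W by (auto simp: good_map_def C1_diffeo_closure_def)
  have G: "?G (W z) = z" if "z \<in> D" for z using good_map_basic(1) closure_subset that by (auto intro: inv_into_f_f)
  have "norm (?G (W x) - ?G (W y)) \<le> L * norm (W x - W y)"
  proof (rule differentiable_bound[OF convex_box(1)])
    fix z assume "z \<in> cbox a b"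
    then have z: "z \<in> W ` D" using ab by blast
    then have "?G differentiable (at z)"
      using C1 unfolding differentiable_def by (auto simp: C1_closure_def)
    then show "(?G has_derivative frechet_derivative ?G (at z)) (at z within cbox a b)"
      by (rule has_derivative_at_withinI[OF frechet_derivative_works[THEN iffD1]])
    show "onorm (frechet_derivative ?G (at z)) \<le> L"
      using C1_norm_bound[OF good_map_basic(4,5) C1 n z] L by (intro onorm_le) auto
  qed (use xy in auto)
  then show ?thesis using xy by (simp add: G)
qed

lemma good_map_pullback:
  shows "W \<in> measurable M (lebesgue_on (W ` D))"
    and "h \<in> borel_measurable (lebesgue_on (W ` D)) \<Longrightarrow>
      (\<integral>\<^sup>+x. h (W x) \<partial>M) \<le> ennreal (preimage_const TYPE('d) L) * (\<integral>\<^sup>+y. h y \<partial>lebesgue_on (W ` D))"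
    and "AE y in lebesgue_on (W ` D). P y \<Longrightarrow> AE x in M. P (W x)"
proof -
  note o = D_open good_map_basic(3,4,5) less_imp_le[OF L]
  show "W \<in> measurable M (lebesgue_on (W ` D))"
    by (rule measurable_lebesgue_map[OF o]) (rule good_map_inverse_lipschitz)
  show "h \<in> borel_measurable (lebesgue_on (W ` D)) \<Longrightarrow>
      (\<integral>\<^sup>+x. h (W x) \<partial>M) \<le> ennreal (preimage_const TYPE('d) L) * (\<integral>\<^sup>+y. h y \<partial>lebesgue_on (W ` D))"
    by (rule nn_integral_map_le[OF o good_map_inverse_lipschitz])
  show "AE y in lebesgue_on (W ` D). P y \<Longrightarrow> AE x in M. P (W x)"
    by (rule AE_map[OF o good_map_inverse_lipschitz])
qed

end

end

subsection \<open>Analytic functions are continuous\<close>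

text \<open>Absolute convergence at the diagonal point (t, ..., t) gives a summable majorant. For a
  small increment \<open>h\<close> every nonconstant monomial is smaller than its majorant by a
  factor \<open>norm h / t\<close>, so the value changes by at most that factor times the sum
  \<open>S\<close>.\<close>

lemma real_analytic_continuous:
  assumes "real_analytic_on U g" "open U"
  shows "continuous_on U g"
proof (subst continuous_on_eq_continuous_at[OF assms(2)], intro ballI)
  fix x assume "x \<in> U"
  then obtain r c where r: "0 < r" and c: "\<And>h. h \<in> ball 0 r \<Longrightarrow>
      ((\<lambda>\<alpha>. c \<alpha> * (\<Prod>i\<in>UNIV. (h $ i) ^ \<alpha> i)) has_sum g (x + h)) UNIV"
    using assms(1) unfolding real_analytic_on_def by blast
  \<comment> \<open>The diagonal point has l^1 norm \<open>r / 2\<close>, so it lies in the ball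
    where the series converges.\<close>
  define t where "t = r / (2 * real CARD('a))"
  have t: "0 < t" using r by (simp add: t_def)
  let ?o = "(\<lambda>_. 0) :: 'a \<Rightarrow> nat" and ?T = "(\<chi> i. t) :: real^'a"
  have T: "?T \<in> ball 0 r"
  proof -
    have "norm ?T \<le> (\<Sum>i\<in>UNIV. \<bar>?T $ i\<bar>)" by (rule norm_le_l1_cart)
    also have "\<dots> = r / 2" using t r by (simp add: t_def)
    finally show ?thesis using r by simp
  qed
  define m where "m \<alpha> = \<bar>c \<alpha>\<bar> * (\<Prod>i\<in>UNIV. t ^ \<alpha> i)" for \<alpha> :: "'a \<Rightarrow> nat"
  have "(\<lambda>\<alpha>. c \<alpha> * (\<Prod>i\<in>UNIV. (?T $ i) ^ \<alpha> i)) summable_on UNIV"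
    using c[OF T] by (rule has_sum_imp_summable)
  then have "(\<lambda>\<alpha>. norm (c \<alpha> * (\<Prod>i\<in>UNIV. (?T $ i) ^ \<alpha> i))) summable_on UNIV"
    by (rule summable_on_iff_abs_summable_on_real[THEN iffD1])
  moreover have "norm (c \<alpha> * (\<Prod>i\<in>UNIV. (?T $ i) ^ \<alpha> i)) = m \<alpha>" for \<alpha>
    using t by (simp add: m_def abs_mult abs_prod)
  ultimately have m: "m summable_on UNIV" by simp
  have m0: "0 \<le> m \<alpha>" for \<alpha> using t by (simp add: m_def prod_nonneg)
  define S where "S = (\<Sum>\<^sub>\<infinity>\<alpha>\<in>UNIV. m \<alpha>)"
  have key: "\<bar>g (x + h) - g x\<bar> \<le> (norm h / t) * S" if h: "norm h \<le> t" "norm h < r" for h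
  proof -
    have hs: "((\<lambda>\<alpha>. c \<alpha> * (\<Prod>i\<in>UNIV. (h $ i) ^ \<alpha> i)) has_sum g (x + h)) UNIV" by (rule c) (use h in simp)
    have "((\<lambda>\<alpha>. c \<alpha> * (\<Prod>i\<in>UNIV. ((0::real^'a) $ i) ^ \<alpha> i)) has_sum g (x + 0)) UNIV" by (rule c) (use r in simp)
    from has_sum_add[OF hs has_sum_uminusI[OF this]]
    have d: "((\<lambda>\<alpha>. c \<alpha> * (\<Prod>i\<in>UNIV. (h $ i) ^ \<alpha> i) - c \<alpha> * (\<Prod>i\<in>UNIV. ((0::real^'a) $ i) ^ \<alpha> i)) has_sum (g (x + h) - g x)) UNIV"
      (is "(?F has_sum _) _") by simp
    have le: "norm (?F \<alpha>) \<le> (norm h / t) * m \<alpha>" for \<alpha>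
    proof (cases "\<alpha> = ?o")
      case True
      then show ?thesis using m0[of \<alpha>] t by simp
    next
      case False
      \<comment> \<open>One power of the j-th coordinate of \<open>h\<close> is estimated by
        \<open>norm h\<close> and yields the small factor; all remaining powers are estimated by
        powers of \<open>t\<close>.\<close>
      then obtain j where j: "\<alpha> j \<noteq> 0" by (auto simp: fun_eq_iff)
      have z: "(\<Prod>i\<in>UNIV. (0::real) ^ \<alpha> i) = 0" using j by (intro prod_zero) (auto intro!: bexI[of _ j])
      have hi: "\<bar>h $ i\<bar> \<le> (norm h / t) * t" for i using component_le_norm_cart[of h i] t by simp
      have "\<bar>\<Prod>i\<in>UNIV. (h $ i) ^ \<alpha> i\<bar> = (\<Prod>i\<in>UNIV. \<bar>h $ i\<bar> ^ \<alpha> i)" by (simp add: abs_prod power_abs)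
      also have "\<dots> = \<bar>h $ j\<bar> ^ \<alpha> j * (\<Prod>i\<in>UNIV - {j}. \<bar>h $ i\<bar> ^ \<alpha> i)" by (simp add: prod.remove)
      also have "\<dots> \<le> ((norm h / t) * t ^ \<alpha> j) * (\<Prod>i\<in>UNIV - {j}. t ^ \<alpha> i)"
      proof (intro mult_mono prod_mono conjI prod_nonneg)
        have "\<bar>h $ j\<bar> ^ \<alpha> j = \<bar>h $ j\<bar> * \<bar>h $ j\<bar> ^ (\<alpha> j - 1)" using j by (simp add: power_eq_if)
        also have "\<dots> \<le> ((norm h / t) * t) * t ^ (\<alpha> j - 1)"
          using hi[of j] h(1) t component_le_norm_cart[of h j] by (intro mult_mono power_mono) auto
        also have "\<dots> = (norm h / t) * t ^ \<alpha> j" using j t by (simp add: power_eq_if)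
        finally show "\<bar>h $ j\<bar> ^ \<alpha> j \<le> (norm h / t) * t ^ \<alpha> j" .
        show "\<bar>h $ i\<bar> ^ \<alpha> i \<le> t ^ \<alpha> i" for i
          using h(1) component_le_norm_cart[of h i] by (intro power_mono) auto
      qed (use t in auto)
      also have "\<dots> = (norm h / t) * (\<Prod>i\<in>UNIV. t ^ \<alpha> i)" by (simp add: prod.remove[of UNIV j])
      finally have "\<bar>c \<alpha>\<bar> * \<bar>\<Prod>i\<in>UNIV. (h $ i) ^ \<alpha> i\<bar> \<le> \<bar>c \<alpha>\<bar> * ((norm h / t) * (\<Prod>i\<in>UNIV. t ^ \<alpha> i))"
        by (intro mult_left_mono) auto
      then show ?thesis by (simp add: z m_def abs_mult algebra_simps)
    qed
    have bs: "(\<lambda>\<alpha>. (norm h / t) * m \<alpha>) summable_on UNIV" using m by (rule summable_on_cmult_right)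
    have "norm (g (x + h) - g x) \<le> (\<Sum>\<^sub>\<infinity>\<alpha>\<in>UNIV. (norm h / t) * m \<alpha>)"
      by (rule norm_infsum_le[OF d has_sum_infsum[OF bs]]) (rule le)
    also have "\<dots> = (norm h / t) * S" unfolding S_def by (rule infsum_cmult_right) (rule m)
    finally show ?thesis by simp
  qed
  have "((\<lambda>h. g (x + h) - g x) \<longlongrightarrow> 0) (at 0)"
  proof (rule Lim_null_comparison)
    have "((\<lambda>h::real^'a. (norm h / t) * S) \<longlongrightarrow> (norm (0::real^'a) / t) * S) (at 0)"
      using t by (intro tendsto_intros) auto
    then show "((\<lambda>h::real^'a. (norm h / t) * S) \<longlongrightarrow> 0) (at 0)" by simp
    show "\<forall>\<^sub>F h in at 0. norm (g (x + h) - g x) \<le> (norm h / t) * S"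
      unfolding eventually_at using t r key by (intro exI[of _ "min t r"]) auto
  qed
  then have "((\<lambda>h. g (x + h)) \<longlongrightarrow> g x) (at 0)" by (simp add: Lim_null[symmetric])
  then show "continuous (at x) g" by (simp add: continuous_at LIM_offset_zero_iff)
qed

subsection \<open>Continuity of composition\<close>

lemma square_integrable_DCT:
  fixes h :: "nat \<Rightarrow> 'a \<Rightarrow> 'b::euclidean_space"
  assumes "\<And>n. h n \<in> borel_measurable M" "square_integrable M w"
    and "AE x in M. (\<lambda>n. h n x) \<longlonglongrightarrow> 0" "\<And>n. AE x in M. norm (h n x) \<le> norm (w x)"
  shows "(\<lambda>n. l2_norm M (h n)) \<longlonglongrightarrow> 0"
proof -
  have "(\<lambda>n. LINT x|M. (norm (h n x))\<^sup>2) \<longlonglongrightarrow> (LINT x|M. 0)"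
  proof (rule integral_dominated_convergence[where w="\<lambda>x. (norm (w x))\<^sup>2"])
    show "integrable M (\<lambda>x. (norm (w x))\<^sup>2)" by (rule square_integrable_norm2[OF assms(2)])
    show "AE x in M. (\<lambda>n. (norm (h n x))\<^sup>2) \<longlonglongrightarrow> 0"
      using assms(3)
    proof eventually_elim
      case (elim x)
      then have "(\<lambda>n. (norm (h n x))\<^sup>2) \<longlonglongrightarrow> (norm (0::'b))\<^sup>2" by (intro tendsto_intros)
      then show ?case by simp
    qed
    show "AE x in M. norm ((norm (h n x))\<^sup>2) \<le> (norm (w x))\<^sup>2" for n
      using assms(4)[of n] by eventually_elim (simp add: power_mono)
  qed (use assms(1) in simp_all)
  then have "(\<lambda>n. sqrt (LINT x|M. (norm (h n x))\<^sup>2)) \<longlonglongrightarrow> sqrt 0" by (intro tendsto_real_sqrt) simp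
  then show ?thesis by (simp add: l2_norm_def)
qed

definition clamp_real :: "real \<Rightarrow> real \<Rightarrow> real" where
  "clamp_real K t = max (- K) (min K t)"

lemma clamp_real_props:
  assumes "0 \<le> K"
  shows "\<bar>clamp_real K t\<bar> \<le> K" "\<bar>t - clamp_real K t\<bar> \<le> \<bar>t\<bar>" "\<bar>t\<bar> \<le> K \<Longrightarrow> clamp_real K t = t"
    "continuous_on UNIV (clamp_real K)"
proof -
  show "continuous_on UNIV (clamp_real K)" unfolding clamp_real_def[abs_def] by (intro continuous_intros)
qed (use assms in \<open>auto simp: clamp_real_def max_def min_def\<close>)

text \<open>First \<open>g\<close> is truncated, then its pointwise continuous approximants are
  truncated at the same level, which makes dominated convergence applicable. Boundedness of the
  result matters later, when it is composed with varying maps.\<close>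

lemma L2_approx_continuous:
  fixes g :: "real^'d \<Rightarrow> real"
  assumes H: "H \<in> lmeasurable" and g: "square_integrable (lebesgue_on H) g" and e: "0 < e"
  shows "\<exists>k B. continuous_on UNIV k \<and> (\<forall>x. \<bar>k x\<bar> \<le> B) \<and> l2_norm (lebesgue_on H) (\<lambda>x. g x - k x) < e"
proof -
  let ?M = "lebesgue_on H"
  have fin: "finite_measure ?M" by (rule finite_measure_lebesgue_on[OF H])
  have gm: "g \<in> borel_measurable ?M" by (rule square_integrable_measurable[OF g])
  have clm [measurable]: "clamp_real K \<in> borel_measurable borel" for K
    unfolding clamp_real_def[abs_def] by measurable
  have "(\<lambda>n. l2_norm ?M (\<lambda>x. g x - clamp_real (real n) (g x))) \<longlonglongrightarrow> 0"
  proof (rule square_integrable_DCT[OF _ g])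
    show "(\<lambda>x. g x - clamp_real (real n) (g x)) \<in> borel_measurable ?M" for n using gm by measurable
    show "AE x in ?M. (\<lambda>n. g x - clamp_real (real n) (g x)) \<longlonglongrightarrow> 0"
    proof (rule AE_I2)
      fix x
      obtain N :: nat where N: "\<bar>g x\<bar> \<le> real N" using real_arch_simple by blast
      show "(\<lambda>n. g x - clamp_real (real n) (g x)) \<longlonglongrightarrow> 0"
      proof (rule tendsto_eventually)
        show "\<forall>\<^sub>F n in sequentially. g x - clamp_real (real n) (g x) = 0"
          using eventually_ge_at_top[of N]
        proof eventually_elim
          case (elim n)
          then have "\<bar>g x\<bar> \<le> real n" using N by (meson of_nat_mono order_trans)
          then show ?case using clamp_real_props(3)[of "real n" "g x"] by simp
        qed
      qed
    qed
    show "AE x in ?M. norm (g x - clamp_real (real n) (g x)) \<le> norm (g x)" for n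
      using clamp_real_props(2)[of "real n"] by simp
  qed
  from order_tendstoD(2)[OF this, of "e/2"] e obtain n where
    n: "l2_norm ?M (\<lambda>x. g x - clamp_real (real n) (g x)) < e / 2"
    by (auto simp: eventually_sequentially)
  let ?c = "clamp_real (real n)"
  have "g measurable_on H" using gm H by (subst measurable_on_iff_borel_measurable) (auto simp: fmeasurable_def)
  then obtain N k where k: "negligible N" "\<And>j. continuous_on UNIV (k j)"
      "\<And>x. x \<notin> N \<Longrightarrow> (\<lambda>j. k j x) \<longlonglongrightarrow> (if x \<in> H then g x else 0)"
    unfolding measurable_on_def by blast
  have kc: "continuous_on UNIV (\<lambda>x. ?c (k j x))" for j
    by (rule continuous_on_compose2[OF clamp_real_props(4) k(2)]) auto
  have kcm: "(\<lambda>x. ?c (k j x)) \<in> borel_measurable ?M" for j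
    by (rule borel_lebesgue_on[OF borel_measurable_continuous_onI[OF kc]])
  have gcm: "(\<lambda>x. ?c (g x)) \<in> borel_measurable ?M" using gm by measurable
  have AEk: "AE x in ?M. (\<lambda>j. ?c (g x) - ?c (k j x)) \<longlonglongrightarrow> 0"
  proof -
    have "AE x in lebesgue. x \<notin> N" using k(1) by (intro AE_not_in) (simp add: negligible_iff_null_sets)
    then have "AE x in lebesgue. x \<in> H \<longrightarrow> (\<lambda>j. ?c (g x) - ?c (k j x)) \<longlonglongrightarrow> 0"
    proof eventually_elim
      case (elim x)
      show ?case
      proof
        assume "x \<in> H"
        then have "(\<lambda>j. k j x) \<longlonglongrightarrow> g x" using k(3)[OF elim] by simp
        moreover have "isCont ?c (g x)" using clamp_real_props(4)[of "real n"] by (simp add: continuous_on_eq_continuous_at)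
        ultimately have "(\<lambda>j. ?c (k j x)) \<longlonglongrightarrow> ?c (g x)" by (rule isCont_tendsto_compose[rotated])
        then have "(\<lambda>j. ?c (g x) - ?c (k j x)) \<longlonglongrightarrow> ?c (g x) - ?c (g x)" by (intro tendsto_intros)
        then show "(\<lambda>j. ?c (g x) - ?c (k j x)) \<longlonglongrightarrow> 0" by simp
      qed
    qed
    then show ?thesis using H by (subst AE_restrict_space_iff) (auto simp: fmeasurable_def)
  qed
  have "(\<lambda>j. l2_norm ?M (\<lambda>x. ?c (g x) - ?c (k j x))) \<longlonglongrightarrow> 0"
  proof (rule square_integrable_DCT[OF _ _ AEk])
    show "(\<lambda>x. ?c (g x) - ?c (k j x)) \<in> borel_measurable ?M" for j using gcm kcm by measurable
    show "square_integrable ?M (\<lambda>x. 2 * real n)" by (rule square_integrable_bounded[OF fin, where c="2 * real n"]) auto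
    show "AE x in ?M. norm (?c (g x) - ?c (k j x)) \<le> norm (2 * real n)" for j
    proof (rule AE_I2)
      fix x
      show "norm (?c (g x) - ?c (k j x)) \<le> norm (2 * real n)"
        using clamp_real_props(1)[of "real n" "g x"] clamp_real_props(1)[of "real n" "k j x"] by simp
    qed
  qed
  from order_tendstoD(2)[OF this, of "e/2"] e obtain j where
    j: "l2_norm ?M (\<lambda>x. ?c (g x) - ?c (k j x)) < e / 2"
    by (auto simp: eventually_sequentially)
  have sb: "square_integrable ?M h" if "h \<in> borel_measurable ?M" "\<And>x. \<bar>h x\<bar> \<le> real n" for h :: "real^'d \<Rightarrow> real"
    by (rule square_integrable_bounded[OF fin that(1), where c="real n"]) (use that(2) in simp)
  have s: "square_integrable ?M (\<lambda>x. ?c (g x))" "square_integrable ?M (\<lambda>x. ?c (k j x))"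
    by (intro sb gcm kcm; simp add: clamp_real_props)+
  have "l2_norm ?M (\<lambda>x. g x - ?c (k j x)) \<le> l2_norm ?M (\<lambda>x. g x - ?c (g x)) + l2_norm ?M (\<lambda>x. ?c (g x) - ?c (k j x))"
    using l2_norm_triangle[OF square_integrable_diff[OF g s(1)] square_integrable_diff[OF s]] by simp
  then have "l2_norm ?M (\<lambda>x. g x - ?c (k j x)) < e" using n j by linarith
  then show ?thesis using kc[of j] clamp_real_props(1)[of "real n"]
    by (intro exI[of _ "\<lambda>x. ?c (k j x)"] exI[of _ "real n"]) simp
qed

text \<open>Truncate \<open>g\<close>: the bounded part is controlled by the convergence of \<open>h n\<close>, the rest by \<open>K\<close>.\<close>

lemma l2_norm_bounded_mult_tendsto:
  fixes h :: "nat \<Rightarrow> 'a \<Rightarrow> real" and g :: "'a \<Rightarrow> 'b::euclidean_space"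
  assumes h: "\<And>n. square_integrable M (h n)" "(\<lambda>n. l2_norm M (h n)) \<longlonglongrightarrow> 0" "\<And>n. AE x in M. \<bar>h n x\<bar> \<le> K"
    and g: "square_integrable M g"
  shows "(\<lambda>n. l2_norm M (\<lambda>x. h n x *\<^sub>R g x)) \<longlonglongrightarrow> 0"
proof (rule LIMSEQ_I)
  fix e :: real assume e: "0 < e"
  define K' where "K' = \<bar>K\<bar> + 1"
  have K': "0 < K'" by (simp add: K'_def)
  have hm: "h n \<in> borel_measurable M" for n by (rule square_integrable_measurable[OF h(1)])
  have gm: "g \<in> borel_measurable M" by (rule square_integrable_measurable[OF g])
  define G where "G j x = (if norm (g x) \<le> real j then g x else 0)" for j x
  have Gm: "G j \<in> borel_measurable M" for j unfolding G_def using gm by measurable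
  have "(\<lambda>j. l2_norm M (\<lambda>x. g x - G j x)) \<longlonglongrightarrow> 0"
  proof (rule square_integrable_DCT[OF _ g])
    show "(\<lambda>x. g x - G j x) \<in> borel_measurable M" for j using gm Gm by measurable
    show "AE x in M. norm (g x - G j x) \<le> norm (g x)" for j by (simp add: G_def)
    show "AE x in M. (\<lambda>j. g x - G j x) \<longlonglongrightarrow> 0"
    proof (rule AE_I2)
      fix x
      obtain N :: nat where N: "norm (g x) \<le> real N" using real_arch_simple by blast
      show "(\<lambda>j. g x - G j x) \<longlonglongrightarrow> 0"
      proof (rule tendsto_eventually)
        show "\<forall>\<^sub>F j in sequentially. g x - G j x = 0"
          using eventually_ge_at_top[of N]
        proof eventually_elim
          case (elim j)
          then have "norm (g x) \<le> real j" using N by (meson of_nat_mono order_trans)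
          then show ?case by (simp add: G_def)
        qed
      qed
    qed
  qed
  from order_tendstoD(2)[OF this, of "e / (2 * K')"] e K' obtain j where
    j: "l2_norm M (\<lambda>x. g x - G j x) < e / (2 * K')"
    by (auto simp: eventually_sequentially)
  have gG: "square_integrable M (\<lambda>x. g x - G j x)"
    by (rule square_integrable_bound[OF g, where c=1]) (use gm Gm in \<open>auto simp: G_def\<close>)
  have "(\<lambda>n. real j * l2_norm M (h n)) \<longlonglongrightarrow> real j * 0" by (intro tendsto_intros h)
  then have "\<forall>\<^sub>F n in sequentially. real j * l2_norm M (h n) < e / 2" using order_tendstoD(2)[of _ 0 _ "e/2"] e by simp
  then obtain N where N: "\<And>n. N \<le> n \<Longrightarrow> real j * l2_norm M (h n) < e / 2" by (auto simp: eventually_sequentially)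
  have "l2_norm M (\<lambda>x. h n x *\<^sub>R g x) < e" if "N \<le> n" for n
  proof -
    have b1: "AE x in M. norm (h n x *\<^sub>R G j x) \<le> real j * norm (h n x)"
    proof (rule AE_I2)
      fix x
      have "norm (G j x) * norm (h n x) \<le> real j * norm (h n x)" by (intro mult_right_mono) (auto simp: G_def)
      then show "norm (h n x *\<^sub>R G j x) \<le> real j * norm (h n x)" by (simp add: mult.commute)
    qed
    have b2: "AE x in M. norm (h n x *\<^sub>R (g x - G j x)) \<le> K' * norm (g x - G j x)"
      using h(3)[of n] by eventually_elim (auto simp: K'_def intro!: mult_right_mono)
    have m1: "(\<lambda>x. h n x *\<^sub>R G j x) \<in> borel_measurable M" and m2: "(\<lambda>x. h n x *\<^sub>R (g x - G j x)) \<in> borel_measurable M"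
      using hm Gm gm by measurable
    have s1: "square_integrable M (\<lambda>x. h n x *\<^sub>R G j x)" by (rule square_integrable_bound[OF h(1) m1 b1])
    have s2: "square_integrable M (\<lambda>x. h n x *\<^sub>R (g x - G j x))" by (rule square_integrable_bound[OF gG m2 b2])
    have "l2_norm M (\<lambda>x. h n x *\<^sub>R g x) \<le> l2_norm M (\<lambda>x. h n x *\<^sub>R G j x) + l2_norm M (\<lambda>x. h n x *\<^sub>R (g x - G j x))"
      using l2_norm_triangle[OF s1 s2] by (simp add: scaleR_right_diff_distrib)
    also have "\<dots> \<le> real j * l2_norm M (h n) + K' * l2_norm M (\<lambda>x. g x - G j x)"
      using K' by (intro add_mono l2_norm_mono[OF h(1) m1 _ b1] l2_norm_mono[OF gG m2 _ b2]) auto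
    also have "K' * l2_norm M (\<lambda>x. g x - G j x) < e / 2"
      using j K' by (simp add: field_simps)
    finally show ?thesis using N[OF that] by simp
  qed
  then show "\<exists>N. \<forall>n\<ge>N. norm (l2_norm M (\<lambda>x. h n x *\<^sub>R g x) - 0) < e" by auto
qed

section \<open>Elliptic problems on the reference domain\<close>

text \<open>\<open>Z\<close> consists of parameters whose map has distortion at most
  \<open>L\<close>, so all estimates below are uniform on it. The Jacobians converge jointly in
  parameter and point: a constant parameter sequence gives continuity in \<open>X\<close> and hence
  measurability of the transported data.\<close>

locale transport = bounded_open_set D for D :: "(real^'d) set" +
  fixes V :: "real^'m \<Rightarrow> real^'d \<Rightarrow> real^'d" and Z :: "(real^'m) set" and H :: "(real^'d) set" and L :: real
  assumes L: "0 < L"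
    and H: "H \<in> lmeasurable"
    and good: "\<And>z. z \<in> Z \<Longrightarrow> good_map D L (V z)"
    and image: "\<And>z. z \<in> Z \<Longrightarrow> V z ` D \<subseteq> H"
    and V_tendsto: "\<And>zn z X. (\<And>n::nat. zn n \<in> Z) \<Longrightarrow> z \<in> Z \<Longrightarrow> zn \<longlonglongrightarrow> z \<Longrightarrow> X \<in> D \<Longrightarrow>
      (\<lambda>n. V (zn n) X) \<longlonglongrightarrow> V z X"
    and J_tendsto: "\<And>zn z Xn X. (\<And>n::nat. zn n \<in> Z) \<Longrightarrow> z \<in> Z \<Longrightarrow> zn \<longlonglongrightarrow> z \<Longrightarrow>
      (\<And>n. Xn n \<in> D) \<Longrightarrow> X \<in> D \<Longrightarrow> Xn \<longlonglongrightarrow> X \<Longrightarrow>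
      (\<lambda>n. jacobian (V (zn n)) (at (Xn n))) \<longlonglongrightarrow> jacobian (V z) (at X)"
begin

text \<open>The uniform constants of the transport: \<open>Q\<close> is the norm bound for
  composition with \<open>V z\<close> in L^2, the root of the preimage constant; \<open>Det\<close>
  bounds the Jacobian determinant; \<open>Lam\<close> bounds the geometric factor from above and its
  reciprocal bounds it from below.\<close>

definition Q :: real where "Q = sqrt ((2 * L * real CARD('d)) ^ CARD('d))"
definition Det :: real where "Det = fact CARD('d) * L ^ CARD('d)"
definition Lam :: real where "Lam = fact CARD('d) * L ^ CARD('d) * L\<^sup>2"

lemma Q_nonneg: "0 \<le> Q" and Det_pos: "0 < Det" and Lam_pos: "0 < Lam"
  using L by (simp_all add: Q_def Det_def Lam_def)

lemma H_sets: "H \<in> sets lebesgue"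
  using H by (simp add: fmeasurable_def)

lemma AE_M_D: "AE x in M. x \<in> D"
  by (rule AE_I2) (simp add: space_restrict_space)

lemma compose_measurable:
  assumes z: "z \<in> Z" and k: "k \<in> borel_measurable (lebesgue_on H)"
  shows "(\<lambda>X. k (V z X)) \<in> borel_measurable M"
proof -
  have "k \<in> borel_measurable (lebesgue_on (V z ` D))"
    using k image[OF z] by (rule measurable_restrict_mono)
  with good_map_pullback(1)[OF good[OF z] L] show ?thesis by (rule measurable_compose)
qed

lemma AE_compose:
  assumes z: "z \<in> Z" and P: "AE y in lebesgue_on H. P y"
  shows "AE X in M. P (V z X)"
proof (rule good_map_pullback(3)[OF good[OF z] L])
  have o: "V z ` D \<in> sets lebesgue" by (rule sets_completionI_sets) (use good_map_basic(4)[OF good[OF z] L] in simp)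
  have "AE y in lebesgue. y \<in> H \<longrightarrow> P y" using P H_sets by (subst (asm) AE_restrict_space_iff) auto
  then have "AE y in lebesgue. y \<in> V z ` D \<longrightarrow> P y" by eventually_elim (use image[OF z] in blast)
  then show "AE y in lebesgue_on (V z ` D). P y" using o by (subst AE_restrict_space_iff) auto
qed

lemma compose_square_integrable:
  fixes k :: "real^'d \<Rightarrow> real"
  assumes z: "z \<in> Z" and k: "square_integrable (lebesgue_on H) k"
  shows "square_integrable M (\<lambda>X. k (V z X))" "l2_norm M (\<lambda>X. k (V z X)) \<le> Q * l2_norm (lebesgue_on H) k"
proof -
  have km: "k \<in> borel_measurable (lebesgue_on H)" by (rule square_integrable_measurable[OF k])
  have m: "(\<lambda>X. k (V z X)) \<in> borel_measurable M" by (rule compose_measurable[OF z km])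
  have km': "k \<in> borel_measurable (lebesgue_on (V z ` D))" using km image[OF z] by (rule measurable_restrict_mono)
  have o: "V z ` D \<in> sets lebesgue" by (rule sets_completionI_sets) (use good_map_basic(4)[OF good[OF z] L] in simp)
  let ?C = "(2 * L * real CARD('d)) ^ CARD('d)"
  have "(\<integral>\<^sup>+X. ennreal ((norm (k (V z X)))\<^sup>2) \<partial>M) \<le> ennreal ?C * (\<integral>\<^sup>+y. ennreal ((norm (k y))\<^sup>2) \<partial>lebesgue_on (V z ` D))"
    using good_map_pullback(2)[OF good[OF z] L, where h="\<lambda>y. ennreal ((norm (k y))\<^sup>2)"] km'
    unfolding preimage_const_def
    by simp
  also have "(\<integral>\<^sup>+y. ennreal ((norm (k y))\<^sup>2) \<partial>lebesgue_on (V z ` D)) \<le> (\<integral>\<^sup>+y. ennreal ((norm (k y))\<^sup>2) \<partial>lebesgue_on H)"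
  proof -
    have "y \<in> V z ` D \<Longrightarrow> y \<in> H" for y using image[OF z] by blast
    then have "indicator (V z ` D) y \<le> (indicator H y :: ennreal)" for y by (auto simp: indicator_def)
    then show ?thesis
      using o H_sets by (subst (1 2) nn_integral_restrict_space) (auto intro!: nn_integral_mono mult_left_mono)
  qed
  also have "(\<integral>\<^sup>+y. ennreal ((norm (k y))\<^sup>2) \<partial>lebesgue_on H) = ennreal ((l2_norm (lebesgue_on H) k)\<^sup>2)"
    unfolding l2_norm_power2 by (rule nn_integral_eq_integral[OF square_integrable_norm2[OF k]]) simp
  finally have le: "(\<integral>\<^sup>+X. ennreal ((norm (k (V z X)))\<^sup>2) \<partial>M) \<le> ennreal (?C * (l2_norm (lebesgue_on H) k)\<^sup>2)"
    using L by (simp add: ennreal_mult mult_left_mono)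
  then have "integrable M (\<lambda>X. (norm (k (V z X)))\<^sup>2)"
    using m by (intro integrableI_bounded) (auto intro: le_less_trans)
  then show s: "square_integrable M (\<lambda>X. k (V z X))" using m by (simp add: square_integrable_def)
  have "ennreal ((l2_norm M (\<lambda>X. k (V z X)))\<^sup>2) \<le> ennreal (?C * (l2_norm (lebesgue_on H) k)\<^sup>2)"
    using le nn_integral_eq_integral[OF square_integrable_norm2[OF s]] by (simp add: l2_norm_power2)
  then have "(l2_norm M (\<lambda>X. k (V z X)))\<^sup>2 \<le> (Q * l2_norm (lebesgue_on H) k)\<^sup>2"
    using L by (simp add: Q_def power_mult_distrib)
  then show "l2_norm M (\<lambda>X. k (V z X)) \<le> Q * l2_norm (lebesgue_on H) k"
    by (rule power2_le_imp_le) (simp add: Q_nonneg)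
qed

text \<open>A bounded continuous function \<open>k\<close> close to \<open>g\<close> in L^2 splits
  the difference into three parts. Composition with \<open>k\<close> converges by dominated
  convergence, and the error of replacing \<open>g\<close> by \<open>k\<close> grows at most by
  \<open>Q\<close>, uniformly along the sequence of maps.\<close>

lemma compose_tendsto:
  fixes g :: "real^'d \<Rightarrow> real"
  assumes g: "square_integrable (lebesgue_on H) g" and zn: "\<And>n::nat. zn n \<in> Z" and z: "z \<in> Z" and lim: "zn \<longlonglongrightarrow> z"
  shows "(\<lambda>n. l2_norm M (\<lambda>X. g (V (zn n) X) - g (V z X))) \<longlonglongrightarrow> 0"
proof (rule LIMSEQ_I)
  fix e :: real assume e: "0 < e"
  \<comment> \<open>The tolerance for \<open>k\<close> is chosen so that \<open>Q * d\<close> stays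
    below \<open>e / 3\<close>; adding 1 to \<open>Q\<close> avoids a division by zero.\<close>
  define d where "d = e / (3 * (Q + 1))"
  have d: "0 < d" "Q * d < e / 3" using e Q_nonneg by (auto simp: d_def field_simps)
  obtain k B where k: "continuous_on UNIV k" "\<And>x. \<bar>k x\<bar> \<le> B" "l2_norm (lebesgue_on H) (\<lambda>x. g x - k x) < d"
    using L2_approx_continuous[OF H g d(1)] by blast
  have ks: "square_integrable (lebesgue_on H) k"
    by (rule square_integrable_bounded[OF finite_measure_lebesgue_on[OF H] borel_lebesgue_on[OF borel_measurable_continuous_onI[OF k(1)]], where c=B])
      (use k(2) in simp)
  note gk = square_integrable_diff[OF g ks]
  have kb: "l2_norm M (\<lambda>X. g (V y X) - k (V y X)) < e / 3" if "y \<in> Z" for y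
  proof -
    have "l2_norm M (\<lambda>X. g (V y X) - k (V y X)) \<le> Q * l2_norm (lebesgue_on H) (\<lambda>x. g x - k x)"
      by (rule compose_square_integrable(2)[OF that gk])
    also have "\<dots> \<le> Q * d" using k(3) Q_nonneg by (intro mult_left_mono) auto
    finally show ?thesis using d(2) by simp
  qed
  have "(\<lambda>n. l2_norm M (\<lambda>X. k (V (zn n) X) - k (V z X))) \<longlonglongrightarrow> 0"
  proof (rule square_integrable_DCT)
    show "(\<lambda>X. k (V (zn n) X) - k (V z X)) \<in> borel_measurable M" for n
      using compose_measurable[OF zn square_integrable_measurable[OF ks]] compose_measurable[OF z square_integrable_measurable[OF ks]]
      by measurable
    show "square_integrable M (\<lambda>x. 2 * B)" by (rule square_integrable_bounded[OF finite_M, where c="norm (2 * B)"]) auto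
    show "AE X in M. norm (k (V (zn n) X) - k (V z X)) \<le> norm (2 * B)" for n
    proof (rule AE_I2)
      show "norm (k (V (zn n) X) - k (V z X)) \<le> norm (2 * B)" for X
        using k(2)[of "V (zn n) X"] k(2)[of "V z X"] by simp
    qed
    show "AE X in M. (\<lambda>n. k (V (zn n) X) - k (V z X)) \<longlonglongrightarrow> 0"
      using AE_M_D
    proof eventually_elim
      case (elim X)
      have "isCont k (V z X)" using k(1) by (simp add: continuous_on_eq_continuous_at)
      from isCont_tendsto_compose[OF this V_tendsto[OF zn z lim elim]]
      have "(\<lambda>n. k (V (zn n) X) - k (V z X)) \<longlonglongrightarrow> k (V z X) - k (V z X)" by (intro tendsto_intros)
      then show ?case by simp
    qed
  qed
  then have "\<forall>\<^sub>F n in sequentially. l2_norm M (\<lambda>X. k (V (zn n) X) - k (V z X)) < e / 3"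
    using order_tendstoD(2)[of _ 0 _ "e/3"] e by simp
  then obtain N where N: "\<And>n. N \<le> n \<Longrightarrow> l2_norm M (\<lambda>X. k (V (zn n) X) - k (V z X)) < e / 3"
    by (auto simp: eventually_sequentially)
  have "l2_norm M (\<lambda>X. g (V (zn n) X) - g (V z X)) < e" if "N \<le> n" for n
  proof -
    note s1 = compose_square_integrable(1)[OF zn[of n] gk] and s3 = compose_square_integrable(1)[OF z gk]
    note s2 = square_integrable_diff[OF compose_square_integrable(1)[OF zn[of n] ks] compose_square_integrable(1)[OF z ks]]
    have "l2_norm M (\<lambda>X. g (V (zn n) X) - g (V z X))
        = l2_norm M (\<lambda>X. (g (V (zn n) X) - k (V (zn n) X)) + (k (V (zn n) X) - k (V z X)) + (-1) *\<^sub>R (g (V z X) - k (V z X)))"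
      by simp
    also have "\<dots> \<le> l2_norm M (\<lambda>X. g (V (zn n) X) - k (V (zn n) X)) + l2_norm M (\<lambda>X. k (V (zn n) X) - k (V z X))
        + l2_norm M (\<lambda>X. (-1) *\<^sub>R (g (V z X) - k (V z X)))"
      by (intro order_trans[OF l2_norm_triangle] add_mono l2_norm_triangle order_refl square_integrable_add square_integrable_scaleR s1 s2 s3)
    also have "\<dots> < e" using kb[OF zn[of n]] kb[OF z] N[OF that] l2_norm_scaleR[of M "-1" "\<lambda>X. g (V z X) - k (V z X)"] by simp
    finally show ?thesis .
  qed
  then show "\<exists>N. \<forall>n\<ge>N. norm (l2_norm M (\<lambda>X. g (V (zn n) X) - g (V z X)) - 0) < e" by auto
qed

definition Bm :: "real^'m \<Rightarrow> real^'d \<Rightarrow> real^'d^'d" where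
  "Bm z X = pullback_matrix (jacobian (V z) (at X))"

lemma Bm_bounds:
  assumes "z \<in> Z" "X \<in> D"
  shows "norm (Bm z X *v \<xi>) \<le> Lam * norm \<xi>" "(norm \<xi>)\<^sup>2 \<le> Lam * (\<xi> \<bullet> (Bm z X *v \<xi>))"
    "0 < det (jacobian (V z) (at X))" "det (jacobian (V z) (at X)) \<le> Det"
  unfolding Bm_def Lam_def Det_def
  using pullback_matrix_bounds[OF L good_map_jacobian_bounds[OF good[OF assms(1)] L assms(2)] good_map_basic(6)[OF good[OF assms(1)] L assms(2)], of \<xi>]
    det_bounds(1)[OF L good_map_jacobian_bounds[OF good[OF assms(1)] L assms(2)] good_map_basic(6)[OF good[OF assms(1)] L assms(2)]]
    good_map_basic(6)[OF good[OF assms(1)] L assms(2)] by auto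

lemma Bm_tendsto:
  assumes "\<And>n::nat. zn n \<in> Z" "z \<in> Z" "zn \<longlonglongrightarrow> z" "\<And>n. Xn n \<in> D" "X \<in> D" "Xn \<longlonglongrightarrow> X"
  shows "(\<lambda>n. Bm (zn n) (Xn n) *v \<xi>) \<longlonglongrightarrow> Bm z X *v \<xi>"
    "(\<lambda>n. det (jacobian (V (zn n)) (at (Xn n)))) \<longlonglongrightarrow> det (jacobian (V z) (at X))"
proof -
  note b = good_map_jacobian_bounds[OF good L] good_map_basic(6)[OF good L]
  show "(\<lambda>n. Bm (zn n) (Xn n) *v \<xi>) \<longlonglongrightarrow> Bm z X *v \<xi>"
    unfolding Bm_def by (rule tendsto_pullback_matrix[OF J_tendsto[OF assms] L]) (intro b assms)+
  show "(\<lambda>n. det (jacobian (V (zn n)) (at (Xn n)))) \<longlonglongrightarrow> det (jacobian (V z) (at X))"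
    by (rule tendsto_det[OF J_tendsto[OF assms]])
qed

lemma continuous_on_D_measurable:
  fixes h :: "real^'d \<Rightarrow> 'b::euclidean_space"
  assumes "\<And>Xn X. (\<And>n::nat. Xn n \<in> D) \<Longrightarrow> X \<in> D \<Longrightarrow> Xn \<longlonglongrightarrow> X \<Longrightarrow> (\<lambda>n. h (Xn n)) \<longlonglongrightarrow> h X"
  shows "h \<in> borel_measurable M"
proof -
  have "continuous_on D h" unfolding continuous_on_sequentially comp_def using assms by blast
  then show ?thesis by (rule continuous_imp_measurable_on_sets_lebesgue) simp
qed

lemma det_measurable: "z \<in> Z \<Longrightarrow> (\<lambda>X. det (jacobian (V z) (at X))) \<in> borel_measurable M"
  by (rule continuous_on_D_measurable) (rule Bm_tendsto(2)[where zn="\<lambda>_. z"]; auto)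

text \<open>Only the columns of the matrix have to be measurable: they are continuous in
  \<open>X\<close>, and the product is their combination with the components of
  \<open>w\<close>.\<close>

lemma Bm_measurable:
  assumes z: "z \<in> Z" and w: "w \<in> borel_measurable M"
  shows "(\<lambda>X. Bm z X *v w X) \<in> borel_measurable M"
proof -
  have e: "(\<lambda>X. Bm z X *v axis j 1) \<in> borel_measurable M" for j
    by (rule continuous_on_D_measurable) (rule Bm_tendsto(1)[where zn="\<lambda>_. z"]; use z in auto)
  have wj: "(\<lambda>X. w X $ j) \<in> borel_measurable M" for j
    by (rule measurable_compose[OF w]) (intro borel_measurable_continuous_onI continuous_intros)
  have "(\<lambda>X. \<Sum>j\<in>UNIV. w X $ j *\<^sub>R (Bm z X *v axis j 1)) \<in> borel_measurable M"
    using e wj by measurable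
  moreover have "Bm z X *v w X = (\<Sum>j\<in>UNIV. w X $ j *\<^sub>R (Bm z X *v axis j 1))" for X
    by (subst matrix_mult_sum) (simp add: matrix_vector_mult_basis scalar_mult_eq_scaleR)
  ultimately show ?thesis by simp
qed

text \<open>The scalar coefficient is kept as an argument of its own, so that the full coefficient,
  its deterministic part, its random part and the single modes all fall under the same
  bounds.\<close>

definition flux :: "(real^'d \<Rightarrow> real) \<Rightarrow> real^'m \<Rightarrow> (real^'d \<Rightarrow> real^'d) \<Rightarrow> real^'d \<Rightarrow> real^'d" where
  "flux a z w X = a X *\<^sub>R (Bm z X *v w X)"

lemma flux_square_integrable:
  assumes z: "z \<in> Z" and a: "a \<in> borel_measurable M" "AE X in M. \<bar>a X\<bar> \<le> \<beta>" "0 \<le> \<beta>" and w: "square_integrable M w"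
  shows "square_integrable M (flux a z w)" "l2_norm M (flux a z w) \<le> (\<beta> * Lam) * l2_norm M w"
proof -
  have m: "flux a z w \<in> borel_measurable M"
    unfolding flux_def[abs_def] using a(1) Bm_measurable[OF z square_integrable_measurable[OF w]] by measurable
  have b: "AE X in M. norm (flux a z w X) \<le> (\<beta> * Lam) * norm (w X)"
    using a(2) AE_M_D
  proof eventually_elim
    case (elim X)
    have "\<bar>a X\<bar> * norm (Bm z X *v w X) \<le> \<beta> * (Lam * norm (w X))"
      using elim Bm_bounds(1)[OF z elim(2)] a(3) by (intro mult_mono) auto
    then show ?case by (simp add: flux_def mult.assoc)
  qed
  show "square_integrable M (flux a z w)" by (rule square_integrable_bound[OF w m b])
  show "l2_norm M (flux a z w) \<le> (\<beta> * Lam) * l2_norm M w"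
    by (rule l2_norm_mono[OF w m _ b]) (use a(3) Lam_pos in simp)
qed

lemma inner_integrable:
  fixes v w :: "real^'d \<Rightarrow> 'b::euclidean_space"
  assumes "square_integrable M v" "square_integrable M w"
  shows "integrable M (\<lambda>X. v X \<bullet> w X)" "\<bar>LINT X|M. v X \<bullet> w X\<bar> \<le> l2_norm M v * l2_norm M w"
proof -
  have m: "(\<lambda>X. v X \<bullet> w X) \<in> borel_measurable M"
    using assms[THEN square_integrable_measurable] by measurable
  have b: "AE x in M. norm (v x \<bullet> w x) \<le> 1 * (norm (v x) * norm (w x))"
    using Cauchy_Schwarz_ineq2 by auto
  show "integrable M (\<lambda>X. v X \<bullet> w X)" by (rule integrable_square_integrable_bound[OF assms m b])
  show "\<bar>LINT X|M. v X \<bullet> w X\<bar> \<le> l2_norm M v * l2_norm M w"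
    using l2_norm_bilinear_bound[OF assms m _ b] by simp
qed

definition Cg :: real where
  "Cg = (SOME C. 0 < C \<and> (\<forall>u\<in>H1_0 D. W1p_norm 2 D u \<le> C * l2_norm M (weak_grad D u)))"

lemma Cg: "0 < Cg" "u \<in> H1_0 D \<Longrightarrow> W1p_norm 2 D u \<le> Cg * l2_norm M (weak_grad D u)"
proof -
  obtain C where "0 < C" "\<And>u. u \<in> H1_0 D \<Longrightarrow> W1p_norm 2 D u \<le> C * l2_norm M (weak_grad D u)"
    using H1_norm_le_gradient by metis
  then have "0 < Cg \<and> (\<forall>u\<in>H1_0 D. W1p_norm 2 D u \<le> Cg * l2_norm M (weak_grad D u))"
    unfolding Cg_def by (intro someI[of "\<lambda>C. 0 < C \<and> (\<forall>u\<in>H1_0 D. W1p_norm 2 D u \<le> C * l2_norm M (weak_grad D u))"]) blast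
  then show "0 < Cg" "u \<in> H1_0 D \<Longrightarrow> W1p_norm 2 D u \<le> Cg * l2_norm M (weak_grad D u)" by auto
qed

text \<open>Coercivity with constant \<open>\<alpha> / Lam\<close>, division by the gradient norm,
  and the Poincare inequality. It asks only for a bound on the energy of \<open>d\<close> itself, so
  it serves for solutions, for differences of solutions and for the average of such
  differences.\<close>

lemma energy_bound:
  assumes z: "z \<in> Z" and a: "a \<in> borel_measurable M" "AE X in M. \<alpha> \<le> a X \<and> a X \<le> \<beta>" "0 < \<alpha>"
    and d: "d \<in> H1_0 D" and le: "(LINT X|M. flux a z (weak_grad D d) X \<bullet> weak_grad D d X) \<le> r * l2_norm M (weak_grad D d)"
    and r: "0 \<le> r"
  shows "W1p_norm 2 D d \<le> Cg * (Lam / \<alpha> * r)"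
proof -
  note G = H1_D(2)[OF H1_0_D[OF d]]
  let ?l = "l2_norm M (weak_grad D d)"
  have a': "AE X in M. \<bar>a X\<bar> \<le> \<bar>\<beta>\<bar>" using a(2) by eventually_elim (use a(3) in linarith)
  have "(\<alpha> / Lam) * ?l\<^sup>2 = (LINT X|M. (\<alpha> / Lam) * (norm (weak_grad D d X))\<^sup>2)" by (simp add: l2_norm_power2)
  also have "\<dots> \<le> (LINT X|M. flux a z (weak_grad D d) X \<bullet> weak_grad D d X)"
  proof (rule integral_mono_AE)
    show "integrable M (\<lambda>X. (\<alpha> / Lam) * (norm (weak_grad D d X))\<^sup>2)" using square_integrable_norm2[OF G] by simp
    show "integrable M (\<lambda>X. flux a z (weak_grad D d) X \<bullet> weak_grad D d X)"
      by (rule inner_integrable(1)[OF flux_square_integrable(1)[OF z a(1) a' _ G] G]) simp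
    show "AE X in M. (\<alpha> / Lam) * (norm (weak_grad D d X))\<^sup>2 \<le> flux a z (weak_grad D d) X \<bullet> weak_grad D d X"
      using a(2) AE_M_D
    proof eventually_elim
      case (elim X)
      let ?w = "weak_grad D d X"
      have q: "(norm ?w)\<^sup>2 \<le> Lam * (?w \<bullet> (Bm z X *v ?w))" by (rule Bm_bounds(2)[OF z elim(2)])
      then have nn: "0 \<le> ?w \<bullet> (Bm z X *v ?w)" using Lam_pos zero_le_mult_iff[of Lam] by (smt (verit) zero_le_power2)
      have "(\<alpha> / Lam) * (norm ?w)\<^sup>2 \<le> (\<alpha> / Lam) * (Lam * (?w \<bullet> (Bm z X *v ?w)))"
        using q a(3) Lam_pos by (intro mult_left_mono) auto
      also have "\<dots> = \<alpha> * (?w \<bullet> (Bm z X *v ?w))" using Lam_pos by simp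
      also have "\<dots> \<le> a X * (?w \<bullet> (Bm z X *v ?w))" using elim nn by (intro mult_right_mono) auto
      finally show ?case by (simp add: flux_def inner_commute)
    qed
  qed
  also note le
  finally have "(\<alpha> / Lam * ?l) * ?l \<le> r * ?l" by (simp add: power2_eq_square algebra_simps)
  then have "\<alpha> / Lam * ?l \<le> r"
  proof (cases "?l = 0")
    case False
    then have "0 < ?l" using l2_norm_nonneg[of M "weak_grad D d"] by linarith
    with \<open>(\<alpha> / Lam * ?l) * ?l \<le> r * ?l\<close> show ?thesis by (rule mult_right_le_imp_le)
  qed (use r in simp)
  then have "?l \<le> Lam / \<alpha> * r" using Lam_pos a(3) by (simp add: field_simps)
  then have "Cg * ?l \<le> Cg * (Lam / \<alpha> * r)" using Cg(1) by (intro mult_left_mono) auto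
  with Cg(2)[OF d] show ?thesis by linarith
qed

end

lemma l2_norm_sum_tendsto:
  fixes h :: "'k \<Rightarrow> nat \<Rightarrow> 'a \<Rightarrow> 'b::euclidean_space"
  assumes "finite I" "\<And>k n. k \<in> I \<Longrightarrow> square_integrable M (h k n)" "\<And>k. k \<in> I \<Longrightarrow> (\<lambda>n. l2_norm M (h k n)) \<longlonglongrightarrow> 0"
  shows "(\<lambda>n. l2_norm M (\<lambda>x. \<Sum>k\<in>I. h k n x)) \<longlonglongrightarrow> 0 \<and> (\<forall>n. square_integrable M (\<lambda>x. \<Sum>k\<in>I. h k n x))"
  using assms
proof (induction I rule: finite_induct)
  case empty
  then show ?case by (simp add: l2_norm_def square_integrable_def)
next
  case (insert k I)
  have s: "square_integrable M (h k n)" "square_integrable M (\<lambda>x. \<Sum>k\<in>I. h k n x)" for n using insert by auto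
  have "(\<lambda>n. l2_norm M (\<lambda>x. h k n x + (\<Sum>k\<in>I. h k n x))) \<longlonglongrightarrow> 0"
  proof (rule Lim_null_comparison)
    have "(\<lambda>n. l2_norm M (h k n) + l2_norm M (\<lambda>x. \<Sum>k\<in>I. h k n x)) \<longlonglongrightarrow> 0 + 0"
      using insert by (intro tendsto_add) auto
    then show "(\<lambda>n. l2_norm M (h k n) + l2_norm M (\<lambda>x. \<Sum>k\<in>I. h k n x)) \<longlonglongrightarrow> 0" by simp
    show "\<forall>\<^sub>F n in sequentially. norm (l2_norm M (\<lambda>x. h k n x + (\<Sum>k\<in>I. h k n x)))
        \<le> l2_norm M (h k n) + l2_norm M (\<lambda>x. \<Sum>k\<in>I. h k n x)"
      using l2_norm_triangle[OF s] by simp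
  qed
  then show ?case using insert(1,2) square_integrable_add[OF s] by simp
qed

section \<open>Differences, products and moments of continuous fields\<close>

context bounded_open_set
begin

lemmas continuous_field_2 = continuous_field_def[of 2, simplified]
lemmas continuous_field_1 = continuous_field_def[of 1, OF insertI1, unfolded of_nat_1]

lemma H1_norm_diff_le:
  assumes "u \<in> W1p 2 D" "v \<in> W1p 2 D"
  shows "W1p_norm 2 D (\<lambda>x. u x - v x) \<le> W1p_norm 2 D u + W1p_norm 2 D v"
  using H1_norm_triangle[OF assms(1) H1_cmult(1)[OF assms(2), of "-1"]] W1p_norm_cmult[of 2 v "-1"] assms by simp

lemma continuous_field_diff:
  assumes u: "continuous_field 2 P G u" and v: "continuous_field 2 P G v"
  shows "continuous_field 2 P G (\<lambda>w x. u w x - v w x)"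
proof -
  obtain B where B: "\<forall>w\<in>G. W1p_norm 2 D (u w) \<le> B" using u unfolding continuous_field_2 by blast
  obtain C where C: "\<forall>w\<in>G. W1p_norm 2 D (v w) \<le> C" using v unfolding continuous_field_2 by blast
  have U: "u w \<in> H1_0 D" "v w \<in> H1_0 D" if "w \<in> G" for w using u v that unfolding continuous_field_2 by blast+
  note W = H1_0_D[OF U(1)] H1_0_D[OF U(2)]
  show ?thesis
    unfolding continuous_field_2
  proof (intro conjI ballI allI impI)
    show "finite_measure P" "sets P = sets borel" "G \<in> sets borel" "bounded G" "AE w in P. w \<in> G"
      using u unfolding continuous_field_2 by blast+
    show "(\<lambda>x. u w x - v w x) \<in> H1_0 D" if "w \<in> G" for w by (rule H1_0_diff[OF U[OF that]])
    show "\<exists>B. \<forall>w\<in>G. W1p_norm 2 D (\<lambda>x. u w x - v w x) \<le> B"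
    proof (intro exI ballI)
      fix w assume w: "w \<in> G"
      show "W1p_norm 2 D (\<lambda>x. u w x - v w x) \<le> B + C"
        using H1_norm_diff_le[OF W(1)[OF w] W(2)[OF w]] B C w by (meson add_mono order_trans)
    qed
    fix w c assume w: "w \<in> G" and c: "(\<forall>n::nat. c n \<in> G) \<and> c \<longlonglongrightarrow> w"
    show "(\<lambda>n. W1p_norm 2 D (\<lambda>x. u (c n) x - v (c n) x - (u w x - v w x))) \<longlonglongrightarrow> 0"
    proof (rule Lim_null_comparison)
      have "(\<lambda>n. W1p_norm 2 D (\<lambda>x. u (c n) x - u w x)) \<longlonglongrightarrow> 0" "(\<lambda>n. W1p_norm 2 D (\<lambda>x. v (c n) x - v w x)) \<longlonglongrightarrow> 0"
        using u v w c unfolding continuous_field_2 by blast+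
      from tendsto_add[OF this]
      show "(\<lambda>n. W1p_norm 2 D (\<lambda>x. u (c n) x - u w x) + W1p_norm 2 D (\<lambda>x. v (c n) x - v w x)) \<longlonglongrightarrow> 0" by simp
      have "W1p_norm 2 D (\<lambda>x. u (c n) x - v (c n) x - (u w x - v w x))
          \<le> W1p_norm 2 D (\<lambda>x. u (c n) x - u w x) + W1p_norm 2 D (\<lambda>x. v (c n) x - v w x)" for n
      proof -
        have "(\<lambda>x. u (c n) x - v (c n) x - (u w x - v w x)) = (\<lambda>x. (u (c n) x - u w x) - (v (c n) x - v w x))" by auto
        then show ?thesis
          using H1_norm_diff_le[OF H1_diff(1)[OF W(1) W(1)[OF w]] H1_diff(1)[OF W(2) W(2)[OF w]], of "c n" "c n"] c
          by simp
      qed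
      then show "\<forall>\<^sub>F n in sequentially. norm (W1p_norm 2 D (\<lambda>x. u (c n) x - v (c n) x - (u w x - v w x)))
          \<le> W1p_norm 2 D (\<lambda>x. u (c n) x - u w x) + W1p_norm 2 D (\<lambda>x. v (c n) x - v w x)" by simp
    qed
  qed
qed

lemma continuous_field_const:
  assumes u: "continuous_field 2 P G u" and m: "m \<in> H1_0 D"
  shows "continuous_field 2 P G (\<lambda>w. m)"
  using u m W1p_zero(2)[of 2] unfolding continuous_field_2 by auto

text \<open>The product estimate of \<open>H1_mult\<close> moves from exponent 2 to exponent 1;
  continuity follows by changing one factor at a time, with the uniform bounds for the
  other.\<close>

lemma continuous_field_mult:
  assumes u: "continuous_field 2 P G u" and v: "continuous_field 2 P G v"
  shows "continuous_field 1 P G (\<lambda>w x. u w x * v w x)"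
proof -
  let ?N = "W1p_norm 2 D"
  obtain B where B: "\<forall>w\<in>G. ?N (u w) \<le> B" using u unfolding continuous_field_2 by blast
  obtain C where C: "\<forall>w\<in>G. ?N (v w) \<le> C" using v unfolding continuous_field_2 by blast
  have U: "u w \<in> H1_0 D" "v w \<in> H1_0 D" if "w \<in> G" for w using u v that unfolding continuous_field_2 by blast+
  note W = H1_0_D[OF U(1)] H1_0_D[OF U(2)]
  show ?thesis
    unfolding continuous_field_1
  proof (intro conjI ballI allI impI)
    show "finite_measure P" "sets P = sets borel" "G \<in> sets borel" "bounded G" "AE w in P. w \<in> G"
      using u unfolding continuous_field_2 by blast+
    show "(\<lambda>x. u w x * v w x) \<in> W1p_0 1 D" if "w \<in> G" for w by (rule H1_0_mult[OF U[OF that]])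
    show "\<exists>B. \<forall>w\<in>G. W1p_norm 1 D (\<lambda>x. u w x * v w x) \<le> B"
    proof (intro exI ballI)
      fix w assume w: "w \<in> G"
      have "W1p_norm 1 D (\<lambda>x. u w x * v w x) \<le> 3 * (?N (u w) * ?N (v w))" by (rule H1_mult(3)[OF W(1)[OF w] U(2)[OF w]])
      also have "\<dots> \<le> 3 * (\<bar>B\<bar> * \<bar>C\<bar>)" using B C w by (intro mult_left_mono mult_mono) (auto intro: order_trans[OF _ abs_ge_self])
      finally show "W1p_norm 1 D (\<lambda>x. u w x * v w x) \<le> 3 * (\<bar>B\<bar> * \<bar>C\<bar>)" .
    qed
    fix w c assume w: "w \<in> G" and c: "(\<forall>n::nat. c n \<in> G) \<and> c \<longlonglongrightarrow> w"
    have cn: "c n \<in> G" for n using c by blast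
    let ?a = "\<lambda>n. ?N (\<lambda>x. u (c n) x - u w x)" and ?b = "\<lambda>n. ?N (\<lambda>x. v (c n) x - v w x)"
    show "(\<lambda>n. W1p_norm 1 D (\<lambda>x. u (c n) x * v (c n) x - u w x * v w x)) \<longlonglongrightarrow> 0"
    proof (rule Lim_null_comparison)
      have "?a \<longlonglongrightarrow> 0" "?b \<longlonglongrightarrow> 0"
        using u v w c unfolding continuous_field_2 by blast+
      then have "(\<lambda>n. 3 * (?a n * C) + 3 * (?N (u w) * ?b n)) \<longlonglongrightarrow> 3 * (0 * C) + 3 * (?N (u w) * 0)"
        by (intro tendsto_intros)
      then show "(\<lambda>n. 3 * (?a n * C) + 3 * (?N (u w) * ?b n)) \<longlonglongrightarrow> 0" by simp
      have "W1p_norm 1 D (\<lambda>x. u (c n) x * v (c n) x - u w x * v w x) \<le> 3 * (?a n * C) + 3 * (?N (u w) * ?b n)" for n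
      proof -
        have du: "(\<lambda>x. u (c n) x - u w x) \<in> W1p 2 D" by (rule H1_diff(1)[OF W(1)[OF cn] W(1)[OF w]])
        have dv: "(\<lambda>x. v (c n) x - v w x) \<in> H1_0 D" by (rule H1_0_diff[OF U(2)[OF cn] U(2)[OF w]])
        have "(\<lambda>x. u (c n) x * v (c n) x - u w x * v w x) = (\<lambda>x. (u (c n) x - u w x) * v (c n) x + u w x * (v (c n) x - v w x))"
          by (auto simp: algebra_simps)
        then have "W1p_norm 1 D (\<lambda>x. u (c n) x * v (c n) x - u w x * v w x)
            \<le> W1p_norm 1 D (\<lambda>x. (u (c n) x - u w x) * v (c n) x) + W1p_norm 1 D (\<lambda>x. u w x * (v (c n) x - v w x))"
          using W1p_norm_triangle[of 1, simplified, OF H1_mult(1)[OF du U(2)[OF cn]] H1_mult(1)[OF W(1)[OF w] dv]] by simp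
        also have "\<dots> \<le> 3 * (?a n * ?N (v (c n))) + 3 * (?N (u w) * ?b n)"
          by (intro add_mono H1_mult(3) du dv U(2)[OF cn] W(1)[OF w])
        also have "\<dots> \<le> 3 * (?a n * C) + 3 * (?N (u w) * ?b n)"
          using C cn by (intro add_right_mono mult_left_mono) auto
        finally show ?thesis .
      qed
      then show "\<forall>\<^sub>F n in sequentially. norm (W1p_norm 1 D (\<lambda>x. u (c n) x * v (c n) x - u w x * v w x))
          \<le> 3 * (?a n * C) + 3 * (?N (u w) * ?b n)" by simp
    qed
  qed
qed

text \<open>The mean lies in \<open>H1_0\<close>, so subtracting it, as a constant field, keeps the
  field continuous in \<open>H1_0\<close>; squaring then gives a continuous field in W^{1,1} with
  zero boundary values. Hence mean and variance exist.\<close>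

lemma continuous_field_mean:
  assumes v: "continuous_field 2 P G v"
  shows "has_mean_and_variance D P v" "mean_field D P v \<in> H1_0 D"
    "continuous_field 2 P G (\<lambda>w x. v w x - mean_field D P v x)" "continuous_field 1 P G (sq_deviation D P v)"
proof -
  have p: "(1::nat) \<in> {1, 2}" "(2::nat) \<in> {1, 2}" by auto
  show m: "mean_field D P v \<in> H1_0 D"
    using continuous_field_integral(2)[OF p(2) v] by (simp add: mean_field_def)
  show d: "continuous_field 2 P G (\<lambda>w x. v w x - mean_field D P v x)"
    by (rule continuous_field_diff[OF v continuous_field_const[OF v m]])
  have "sq_deviation D P v = (\<lambda>w x. (v w x - mean_field D P v x) * (v w x - mean_field D P v x))"
    by (intro ext) (simp add: sq_deviation_def power2_eq_square)
  then show s: "continuous_field 1 P G (sq_deviation D P v)" using continuous_field_mult[OF d d] by simp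
  show "has_mean_and_variance D P v"
    using continuous_field_integral(1)[OF p(2) v] continuous_field_integral(1)[OF p(1) s]
    by (simp add: has_mean_and_variance_def)
qed

text \<open>With one factor frozen, a functional on W^{1,1} becomes a functional on H^1. In this way
  the estimate for means also controls the mixed term of the variance.\<close>

lemma bounded_functional_mult:
  assumes l: "bounded_functional 1 l" and b: "b \<in> H1_0 D"
  shows "bounded_functional 2 (\<lambda>g. l (\<lambda>x. g x * b x))"
proof -
  have p1: "(1::nat) \<in> {1, 2}" and p2: "(2::nat) \<in> {1, 2}" by auto
  note add = bounded_functionalD(1)[OF p1 l, unfolded of_nat_1] and mult = bounded_functionalD(2)[OF p1 l, unfolded of_nat_1]
  obtain K where K: "0 < K" "\<And>u. u \<in> W1p 1 D \<Longrightarrow> \<bar>l u\<bar> \<le> K * W1p_norm 1 D u"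
    using l unfolding bounded_functional_def[OF p1, unfolded of_nat_1] by blast
  show ?thesis
  proof (rule bounded_functionalI[OF p2, simplified])
    fix u v assume uv: "u \<in> W1p 2 D" "v \<in> W1p 2 D"
    show "l (\<lambda>x. (u x + v x) * b x) = l (\<lambda>x. u x * b x) + l (\<lambda>x. v x * b x)"
      using add[OF H1_mult(1)[OF uv(1) b] H1_mult(1)[OF uv(2) b]] by (simp add: distrib_right)
  next
    fix c u assume u: "u \<in> W1p 2 D"
    show "l (\<lambda>x. c * u x * b x) = c * l (\<lambda>x. u x * b x)"
      using mult[OF H1_mult(1)[OF u b], of c] by (simp add: mult.assoc)
  next
    fix u assume u: "u \<in> W1p 2 D"
    have "\<bar>l (\<lambda>x. u x * b x)\<bar> \<le> K * W1p_norm 1 D (\<lambda>x. u x * b x)" by (rule K(2)[OF H1_mult(1)[OF u b]])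
    also have "\<dots> \<le> K * (3 * (W1p_norm 2 D u * W1p_norm 2 D b))"
      using K(1) by (intro mult_left_mono H1_mult(3) u b) auto
    finally show "\<bar>l (\<lambda>x. u x * b x)\<bar> \<le> (3 * K * W1p_norm 2 D b) * W1p_norm 2 D u" by (simp add: algebra_simps)
  qed
qed

end

section \<open>The perturbed boundary value problem at fixed parameters\<close>

locale perturbation = transport D V Z H L
  for D :: "(real^'d) set" and V :: "real^'m \<Rightarrow> real^'d \<Rightarrow> real^'d" and Z H L +
  fixes as :: "real^'d \<Rightarrow> real" and alo ahi :: real
    and lam :: "'n::finite \<Rightarrow> real" and \<psi> :: "'n \<Rightarrow> real^'d \<Rightarrow> real" and K\<psi> :: "'n \<Rightarrow> real"
    and f :: "real^'d \<Rightarrow> real"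
  assumes alo: "0 < alo" and as_meas: "as \<in> borel_measurable (lebesgue_on H)"
    and as_bounds: "\<And>x. x \<in> H \<Longrightarrow> alo \<le> as x \<and> as x \<le> ahi"
    and \<psi>_meas: "\<And>k. \<psi> k \<in> borel_measurable (lebesgue_on H)"
    and \<psi>_bound: "\<And>k. AE x in lebesgue_on H. \<bar>\<psi> k x\<bar> \<le> K\<psi> k"
    and f: "square_integrable (lebesgue_on H) f"
begin

definition ar :: "real^'n \<Rightarrow> real^'d \<Rightarrow> real" where
  "ar = kl_expansion (\<lambda>x. 0) lam \<psi>"

lemma ar_eq: "ar y x = (\<Sum>k\<in>UNIV. sqrt (lam k) * y $ k * \<psi> k x)"
  by (simp add: ar_def kl_expansion_def)

definition coef :: "real \<Rightarrow> real^'n \<Rightarrow> real^'m \<Rightarrow> real^'d \<Rightarrow> real" where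
  "coef \<epsilon> y z X = as (V z X) + \<epsilon> * ar y (V z X)"

text \<open>At \<epsilon> = 0 this is the unperturbed problem for every \<open>y\<close>, so both
  solutions are covered by the same lemmas.\<close>

definition wsol :: "real \<Rightarrow> real^'n \<Rightarrow> real^'m \<Rightarrow> (real^'d \<Rightarrow> real) \<Rightarrow> bool" where
  "wsol \<epsilon> y z u \<longleftrightarrow> weak_dirichlet_solution D
     (\<lambda>X. transported_coeff (V z) as X + \<epsilon> *\<^sub>R transported_coeff (V z) (ar y) X) (transported_load (V z) f) u"

text \<open>The quantitative information on the random part: its pullback to \<open>D\<close> is
  bounded by 1. The bounds of the individual modes enter only through integrability, so the
  constants of the estimates come from this bound.\<close>

definition good_pt :: "real^'n \<Rightarrow> real^'m \<Rightarrow> bool" where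
  "good_pt y z \<longleftrightarrow> z \<in> Z \<and> (AE X in M. \<bar>ar y (V z X)\<bar> \<le> 1)"

abbreviation F :: "real^'m \<Rightarrow> real^'d \<Rightarrow> real" where "F z \<equiv> transported_load (V z) f"

lemma wsolD:
  assumes "wsol \<epsilon> y z u"
  shows "u \<in> H1_0 D" "v \<in> H1_0 D \<Longrightarrow>
    (LINT X|M. flux (coef \<epsilon> y z) z (weak_grad D u) X \<bullet> weak_grad D v X) = (LINT X|M. F z X * v X)"
proof -
  have "(transported_coeff (V z) as X + \<epsilon> *\<^sub>R transported_coeff (V z) (ar y) X) *v w
      = coef \<epsilon> y z X *\<^sub>R (Bm z X *v w)" for X w
  proof -
    have "transported_coeff (V z) as X + \<epsilon> *\<^sub>R transported_coeff (V z) (ar y) X = coef \<epsilon> y z X *\<^sub>R Bm z X"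
      by (simp add: transported_coeff_eq Bm_def coef_def scaleR_left_distrib)
    then show ?thesis by (simp add: scaleR_matrix_vector_assoc)
  qed
  then show "u \<in> H1_0 D" "v \<in> H1_0 D \<Longrightarrow>
    (LINT X|M. flux (coef \<epsilon> y z) z (weak_grad D u) X \<bullet> weak_grad D v X) = (LINT X|M. F z X * v X)"
    using assms unfolding wsol_def weak_dirichlet_solution_def flux_def by auto
qed

lemma ar_measurable: "ar y \<in> borel_measurable (lebesgue_on H)"
  unfolding ar_eq[abs_def] using \<psi>_meas by measurable

lemma as_AE: "z \<in> Z \<Longrightarrow> AE X in M. alo \<le> as (V z X) \<and> as (V z X) \<le> ahi"
  using AE_M_D
proof eventually_elim
  case (elim X)
  then have "V z X \<in> H" using image[of z] by blast
  then show ?case by (rule as_bounds)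
qed

lemma coef_measurable: "z \<in> Z \<Longrightarrow> coef \<epsilon> y z \<in> borel_measurable M"
  unfolding coef_def[abs_def] using compose_measurable[OF _ as_meas] compose_measurable[OF _ ar_measurable] by measurable

text \<open>Leaves room for a perturbation of size \<open>alo / 2\<close> above \<open>ahi\<close>.
  The absolute value makes it nonnegative even if \<open>H\<close> is empty and \<open>ahi\<close>
  is unrestricted.\<close>

definition beta :: real where "beta = \<bar>ahi\<bar> + alo"

lemma beta: "0 \<le> beta" using alo by (simp add: beta_def)

text \<open>The smallness of \<epsilon> is fixed here: a perturbation of at most
  \<open>alo / 2\<close> leaves half of the ellipticity.\<close>

lemma coef_bounds:
  assumes "good_pt y z" "0 \<le> \<epsilon>" "\<epsilon> \<le> alo / 2"
  shows "AE X in M. alo / 2 \<le> coef \<epsilon> y z X \<and> coef \<epsilon> y z X \<le> beta" "AE X in M. \<bar>coef \<epsilon> y z X\<bar> \<le> beta"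
proof -
  have z: "z \<in> Z" and r: "AE X in M. \<bar>ar y (V z X)\<bar> \<le> 1" using assms(1) by (auto simp: good_pt_def)
  show *: "AE X in M. alo / 2 \<le> coef \<epsilon> y z X \<and> coef \<epsilon> y z X \<le> beta"
    using as_AE[OF z] r
  proof eventually_elim
    case (elim X)
    have "\<bar>\<epsilon> * ar y (V z X)\<bar> \<le> \<epsilon> * 1" unfolding abs_mult using elim(2) assms(2) by (intro mult_mono) auto
    then show ?case using elim(1) assms(3) alo unfolding coef_def beta_def by linarith
  qed
  show "AE X in M. \<bar>coef \<epsilon> y z X\<bar> \<le> beta"
    using * by eventually_elim (use alo in linarith)
qed

lemma F_eq: "F z X = f (V z X) * det (jacobian (V z) (at X))"
  by (simp add: transported_load_def)

definition Fb :: real where "Fb = Det * (Q * l2_norm (lebesgue_on H) f)"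

lemma Fb: "0 \<le> Fb" using Det_pos Q_nonneg by (simp add: Fb_def)

lemma F_bound:
  assumes z: "z \<in> Z"
  shows "square_integrable M (F z)" "l2_norm M (F z) \<le> Fb"
proof -
  note c = compose_square_integrable[OF z f]
  have m: "F z \<in> borel_measurable M"
    unfolding F_eq[abs_def] using det_measurable[OF z] square_integrable_measurable[OF c(1)] by measurable
  have b: "AE X in M. norm (F z X) \<le> Det * norm (f (V z X))"
    using AE_M_D
  proof eventually_elim
    case (elim X)
    have "\<bar>det (jacobian (V z) (at X))\<bar> \<le> Det" using Bm_bounds(3,4)[OF z elim] by simp
    then have "\<bar>det (jacobian (V z) (at X))\<bar> * \<bar>f (V z X)\<bar> \<le> Det * \<bar>f (V z X)\<bar>" by (intro mult_right_mono) auto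
    then show ?case unfolding F_eq by (simp add: abs_mult mult.commute)
  qed
  show "square_integrable M (F z)" by (rule square_integrable_bound[OF c(1) m b])
  have "l2_norm M (F z) \<le> Det * l2_norm M (\<lambda>X. f (V z X))" using Det_pos by (intro l2_norm_mono[OF c(1) m _ b]) simp
  also have "\<dots> \<le> Fb" unfolding Fb_def using c(2) Det_pos by (intro mult_left_mono) auto
  finally show "l2_norm M (F z) \<le> Fb" .
qed

text \<open>The difference is split into a change of the composition, which tends to zero in L^2 and
  is multiplied by a bounded determinant, and a change of the determinant against the fixed limit
  composition, where dominated convergence applies.\<close>

lemma F_tendsto:
  assumes zn: "\<And>n::nat. zn n \<in> Z" and z: "z \<in> Z" and lim: "zn \<longlonglongrightarrow> z"
  shows "(\<lambda>n. l2_norm M (\<lambda>X. F (zn n) X - F z X)) \<longlonglongrightarrow> 0"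
proof (rule Lim_null_comparison)
  let ?d = "\<lambda>z X. det (jacobian (V z) (at X))"
  let ?a = "\<lambda>n X. f (V (zn n) X) - f (V z X)" and ?b = "\<lambda>n X. f (V z X) * (?d (zn n) X - ?d z X)"
  have sf: "square_integrable M (\<lambda>X. f (V z X))" "square_integrable M (?a n)" for n
    by (intro square_integrable_diff compose_square_integrable(1)[OF _ f] zn z)+
  have dm: "?d (zn n) \<in> borel_measurable M" "?d z \<in> borel_measurable M" for n using det_measurable zn z by auto
  have fm: "(\<lambda>X. f (V z X)) \<in> borel_measurable M" "(\<lambda>X. ?a n X) \<in> borel_measurable M" for n
    using sf square_integrable_measurable by auto
  have am: "(\<lambda>X. ?a n X * ?d (zn n) X) \<in> borel_measurable M" for n using fm(2)[of n] dm(1)[of n] by measurable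
  have bm: "?b n \<in> borel_measurable M" for n using fm(1) dm by measurable
  have ab: "AE X in M. norm (?a n X * ?d (zn n) X) \<le> Det * norm (?a n X)" for n
    using AE_M_D
  proof eventually_elim
    case (elim X)
    have "\<bar>?d (zn n) X\<bar> \<le> Det" using Bm_bounds(3,4)[OF zn elim, of n] by simp
    then have "\<bar>?d (zn n) X\<bar> * \<bar>?a n X\<bar> \<le> Det * \<bar>?a n X\<bar>" by (intro mult_right_mono) auto
    then show ?case by (simp add: abs_mult mult.commute)
  qed
  have bb: "AE X in M. norm (?b n X) \<le> norm ((2 * Det) * f (V z X))" for n
    using AE_M_D
  proof eventually_elim
    case (elim X)
    have "\<bar>?d (zn n) X - ?d z X\<bar> \<le> 2 * Det"
      using Bm_bounds(3,4)[OF zn elim, of n] Bm_bounds(3,4)[OF z elim] by linarith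
    then have "\<bar>f (V z X)\<bar> * \<bar>?d (zn n) X - ?d z X\<bar> \<le> \<bar>f (V z X)\<bar> * (2 * Det)" by (intro mult_left_mono) auto
    then show ?case using Det_pos by (simp add: abs_mult mult.commute)
  qed
  have s2: "square_integrable M (\<lambda>X. (2 * Det) * f (V z X))" by (rule square_integrable_mult[OF sf(1)])
  have "(\<lambda>n. l2_norm M (?b n)) \<longlonglongrightarrow> 0"
  proof (rule square_integrable_DCT[OF bm s2 _ bb])
    show "AE X in M. (\<lambda>n. ?b n X) \<longlonglongrightarrow> 0"
      using AE_M_D
    proof eventually_elim
      case (elim X)
      have "(\<lambda>n. ?d (zn n) X) \<longlonglongrightarrow> ?d z X" by (rule Bm_tendsto(2)[OF zn z lim]) (use elim in auto)
      then have "(\<lambda>n. ?b n X) \<longlonglongrightarrow> f (V z X) * (?d z X - ?d z X)" by (intro tendsto_intros)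
      then show ?case by simp
    qed
  qed
  moreover have "(\<lambda>n. Det * l2_norm M (?a n)) \<longlonglongrightarrow> 0"
    using tendsto_mult_left[OF compose_tendsto[OF f zn z lim], of Det] by simp
  ultimately have "(\<lambda>n. Det * l2_norm M (?a n) + l2_norm M (?b n)) \<longlonglongrightarrow> 0 + 0" by (intro tendsto_add)
  then show "(\<lambda>n. Det * l2_norm M (?a n) + l2_norm M (?b n)) \<longlonglongrightarrow> 0" by simp
  have "l2_norm M (\<lambda>X. F (zn n) X - F z X) \<le> Det * l2_norm M (?a n) + l2_norm M (?b n)" for n
  proof -
    have sb: "square_integrable M (?b n)" by (rule square_integrable_bound[OF s2 bm, where c=1]) (use bb[of n] in simp)
    have "(\<lambda>X. F (zn n) X - F z X) = (\<lambda>X. ?a n X * ?d (zn n) X + ?b n X)" by (auto simp: F_eq algebra_simps)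
    then have "l2_norm M (\<lambda>X. F (zn n) X - F z X) \<le> l2_norm M (\<lambda>X. ?a n X * ?d (zn n) X) + l2_norm M (?b n)"
      using l2_norm_triangle[OF square_integrable_bound[OF sf(2) am ab] sb] by simp
    also have "l2_norm M (\<lambda>X. ?a n X * ?d (zn n) X) \<le> Det * l2_norm M (?a n)"
      using Det_pos by (intro l2_norm_mono[OF sf(2) am _ ab]) simp
    finally show ?thesis by simp
  qed
  then show "\<forall>\<^sub>F n in sequentially. norm (l2_norm M (\<lambda>X. F (zn n) X - F z X)) \<le> Det * l2_norm M (?a n) + l2_norm M (?b n)"
    by simp
qed

section \<open>A priori bounds and comparison of solutions\<close>

lemma load_functional_le:
  assumes "square_integrable M k" "d \<in> H1_0 D"
  shows "\<bar>LINT X|M. k X * d X\<bar> \<le> (Cg * l2_norm M k) * l2_norm M (weak_grad D d)"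
proof -
  have "\<bar>LINT X|M. k X * d X\<bar> \<le> l2_norm M k * l2_norm M d"
    using inner_integrable(2)[OF assms(1) H1_D(1)[OF H1_0_D[OF assms(2)]]] by simp
  also have "\<dots> \<le> l2_norm M k * (Cg * l2_norm M (weak_grad D d))"
    using Cg(2)[OF assms(2)] l2_norm_le_H1_norm(1)[of d] by (intro mult_left_mono) auto
  finally show ?thesis by (simp add: mult.commute mult.left_commute)
qed

text \<open>The constant of \<open>energy_bound\<close> for ellipticity \<open>alo / 2\<close>. The
  constants built on it, \<open>Bu\<close> for solutions, \<open>C1\<close> for the first-order
  error and \<open>C2\<close> for the averaged error, depend neither on the parameters nor on
  \<epsilon>.\<close>

definition Ce :: real where "Ce = Cg * (Lam / (alo / 2))"

lemma Ce: "0 < Ce" using Cg(1) Lam_pos alo by (simp add: Ce_def)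

definition Bu :: real where "Bu = Ce * (Cg * Fb)"

lemma Bu: "0 \<le> Bu" using Ce Cg(1) Fb by (simp add: Bu_def)

lemma sol_bound:
  assumes g: "good_pt y z" and \<epsilon>: "0 \<le> \<epsilon>" "\<epsilon> \<le> alo / 2" and u: "wsol \<epsilon> y z u"
  shows "W1p_norm 2 D u \<le> Bu"
proof -
  have z: "z \<in> Z" using g by (simp add: good_pt_def)
  have "W1p_norm 2 D u \<le> Cg * (Lam / (alo / 2) * (Cg * Fb))"
  proof (rule energy_bound[OF z coef_measurable[OF z] coef_bounds(1)[OF g \<epsilon>] _ wsolD(1)[OF u]])
    have "(LINT X|M. flux (coef \<epsilon> y z) z (weak_grad D u) X \<bullet> weak_grad D u X) = (LINT X|M. F z X * u X)"
      by (rule wsolD(2)[OF u wsolD(1)[OF u]])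
    also have "\<dots> \<le> (Cg * l2_norm M (F z)) * l2_norm M (weak_grad D u)"
      using load_functional_le[OF F_bound(1)[OF z] wsolD(1)[OF u]] by linarith
    also have "\<dots> \<le> (Cg * Fb) * l2_norm M (weak_grad D u)"
      using F_bound(2)[OF z] Cg(1) by (intro mult_right_mono mult_left_mono) auto
    finally show "(LINT X|M. flux (coef \<epsilon> y z) z (weak_grad D u) X \<bullet> weak_grad D u X) \<le> (Cg * Fb) * l2_norm M (weak_grad D u)" .
  qed (use alo Cg(1) Fb in auto)
  then show ?thesis by (simp add: Bu_def Ce_def mult.assoc)
qed

lemma flux_diff:
  assumes z: "z \<in> Z" and a: "a \<in> borel_measurable M" "AE X in M. \<bar>a X\<bar> \<le> b"
    and u: "u \<in> W1p 2 D" "v \<in> W1p 2 D" and w: "square_integrable M w"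
  shows "(LINT X|M. flux a z (weak_grad D (\<lambda>x. u x - v x)) X \<bullet> w X)
    = (LINT X|M. flux a z (weak_grad D u) X \<bullet> w X) - (LINT X|M. flux a z (weak_grad D v) X \<bullet> w X)"
proof -
  have b: "AE X in M. \<bar>a X\<bar> \<le> \<bar>b\<bar>" using a(2) by eventually_elim linarith
  have fs: "integrable M (\<lambda>X. flux a z (weak_grad D k) X \<bullet> w X)" if "k \<in> W1p 2 D" for k
    by (rule inner_integrable(1)[OF flux_square_integrable(1)[OF z a(1) b _ H1_D(2)[OF that]] w]) simp
  have "(LINT X|M. flux a z (weak_grad D (\<lambda>x. u x - v x)) X \<bullet> w X)
      = (LINT X|M. flux a z (weak_grad D u) X \<bullet> w X - flux a z (weak_grad D v) X \<bullet> w X)"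
  proof (rule integral_cong_AE)
    show "(\<lambda>X. flux a z (weak_grad D (\<lambda>x. u x - v x)) X \<bullet> w X) \<in> borel_measurable M"
      by (rule borel_measurable_integrable[OF fs[OF H1_diff(1)[OF u]]])
    show "(\<lambda>X. flux a z (weak_grad D u) X \<bullet> w X - flux a z (weak_grad D v) X \<bullet> w X) \<in> borel_measurable M"
      by (rule borel_measurable_integrable[OF Bochner_Integration.integrable_diff[OF fs[OF u(1)] fs[OF u(2)]]])
    show "AE X in M. flux a z (weak_grad D (\<lambda>x. u x - v x)) X \<bullet> w X = flux a z (weak_grad D u) X \<bullet> w X - flux a z (weak_grad D v) X \<bullet> w X"
      using H1_diff(2)[OF u]
      by eventually_elim (simp add: flux_def matrix_vector_mult_diff_distrib scaleR_right_diff_distrib inner_diff_left)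
  qed
  then show ?thesis using fs[OF u(1)] fs[OF u(2)] by simp
qed

text \<open>All problems live on the same domain, so the second solution can be inserted into the
  first equation and the difference used as test function. The residual is the difference of the
  loads and of the two fluxes of the one function \<open>u2\<close>; thus coefficients have to
  converge only against a fixed gradient. Different values of \<epsilon> are allowed, so it yields
  both the continuity in the parameters and the first-order estimate.\<close>

lemma sol_compare:
  assumes g: "good_pt y1 z1" "good_pt y2 z2"
    and \<epsilon>: "0 \<le> \<epsilon>1" "\<epsilon>1 \<le> alo / 2" "0 \<le> \<epsilon>2" "\<epsilon>2 \<le> alo / 2"
    and u: "wsol \<epsilon>1 y1 z1 u1" "wsol \<epsilon>2 y2 z2 u2"
  shows "W1p_norm 2 D (\<lambda>x. u1 x - u2 x) \<le> Ce * (Cg * l2_norm M (\<lambda>X. F z1 X - F z2 X)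
    + l2_norm M (\<lambda>X. flux (coef \<epsilon>2 y2 z2) z2 (weak_grad D u2) X - flux (coef \<epsilon>1 y1 z1) z1 (weak_grad D u2) X))"
proof -
  have z: "z1 \<in> Z" "z2 \<in> Z" using g by (auto simp: good_pt_def)
  let ?d = "\<lambda>x. u1 x - u2 x" and ?a1 = "coef \<epsilon>1 y1 z1" and ?a2 = "coef \<epsilon>2 y2 z2"
  note H = wsolD(1)[OF u(1)] wsolD(1)[OF u(2)]
  note W = H1_0_D[OF H(1)] H1_0_D[OF H(2)]
  have d: "?d \<in> H1_0 D" by (rule H1_0_diff[OF H])
  note Gd = H1_D(2)[OF H1_0_D[OF d]]
  let ?e = "\<lambda>X. flux ?a2 z2 (weak_grad D u2) X - flux ?a1 z1 (weak_grad D u2) X"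
  have f2: "square_integrable M (flux ?a2 z2 (weak_grad D u2))" "square_integrable M (flux ?a1 z1 (weak_grad D u2))"
    using flux_square_integrable(1)[OF z(2) coef_measurable[OF z(2)] coef_bounds(2)[OF g(2) \<epsilon>(3,4)] beta H1_D(2)[OF W(2)]]
      flux_square_integrable(1)[OF z(1) coef_measurable[OF z(1)] coef_bounds(2)[OF g(1) \<epsilon>(1,2)] beta H1_D(2)[OF W(2)]] by auto
  have e: "square_integrable M ?e" by (rule square_integrable_diff[OF f2])
  have dF: "square_integrable M (\<lambda>X. F z1 X - F z2 X)" by (rule square_integrable_diff[OF F_bound(1)[OF z(1)] F_bound(1)[OF z(2)]])
  have Fd: "integrable M (\<lambda>X. F z X * ?d X)" if "z \<in> Z" for z
    using inner_integrable(1)[OF F_bound(1)[OF that] H1_D(1)[OF H1_0_D[OF d]]] by simp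
  have "W1p_norm 2 D ?d \<le> Cg * (Lam / (alo / 2) * (Cg * l2_norm M (\<lambda>X. F z1 X - F z2 X) + l2_norm M ?e))"
  proof (rule energy_bound[OF z(1) coef_measurable[OF z(1)] coef_bounds(1)[OF g(1) \<epsilon>(1,2)] _ d])
    have "(LINT X|M. flux ?a1 z1 (weak_grad D ?d) X \<bullet> weak_grad D ?d X)
        = (LINT X|M. flux ?a1 z1 (weak_grad D u1) X \<bullet> weak_grad D ?d X) - (LINT X|M. flux ?a1 z1 (weak_grad D u2) X \<bullet> weak_grad D ?d X)"
      by (rule flux_diff[OF z(1) coef_measurable[OF z(1)] coef_bounds(2)[OF g(1) \<epsilon>(1,2)] W Gd])
    also have "\<dots> = (LINT X|M. (F z1 X - F z2 X) * ?d X) + (LINT X|M. ?e X \<bullet> weak_grad D ?d X)"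
      using wsolD(2)[OF u(1) d] wsolD(2)[OF u(2) d] Fd[OF z(1)] Fd[OF z(2)]
        inner_integrable(1)[OF f2(1) Gd] inner_integrable(1)[OF f2(2) Gd]
      by (simp add: left_diff_distrib inner_diff_left)
    also have "\<dots> \<le> (Cg * l2_norm M (\<lambda>X. F z1 X - F z2 X)) * l2_norm M (weak_grad D ?d) + l2_norm M ?e * l2_norm M (weak_grad D ?d)"
      using load_functional_le[OF dF d] inner_integrable(2)[OF e Gd] by linarith
    finally show "(LINT X|M. flux ?a1 z1 (weak_grad D ?d) X \<bullet> weak_grad D ?d X)
        \<le> (Cg * l2_norm M (\<lambda>X. F z1 X - F z2 X) + l2_norm M ?e) * l2_norm M (weak_grad D ?d)"
      by (simp add: distrib_right)
  qed (use alo Cg(1) in auto)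
  then show ?thesis by (simp add: Ce_def mult.assoc)
qed

definition C1 :: real where "C1 = Ce * (Lam * Bu)"

lemma C1: "0 \<le> C1" using Ce Lam_pos Bu by (simp add: C1_def)

text \<open>At one and the same parameter the loads cancel in \<open>sol_compare\<close>, and the
  fluxes of \<open>u0\<close> differ by \<epsilon> times the flux with coefficient
  \<open>ar\<close>, which is at most 1 in size.\<close>

lemma sol_perturbation:
  assumes g: "good_pt y z" and \<epsilon>: "0 \<le> \<epsilon>" "\<epsilon> \<le> alo / 2" and u: "wsol \<epsilon> y z u" "wsol 0 y z u0"
  shows "W1p_norm 2 D (\<lambda>x. u x - u0 x) \<le> C1 * \<epsilon>"
proof -
  have z: "z \<in> Z" and r: "AE X in M. \<bar>ar y (V z X)\<bar> \<le> 1" using g by (auto simp: good_pt_def)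
  note W = H1_0_D[OF wsolD(1)[OF u(2)]]
  have rm: "(\<lambda>X. - \<epsilon> * ar y (V z X)) \<in> borel_measurable M" using compose_measurable[OF z ar_measurable[of y]] by measurable
  have rb: "AE X in M. \<bar>- \<epsilon> * ar y (V z X)\<bar> \<le> \<epsilon>"
    using r
  proof eventually_elim
    case (elim X)
    then have "\<epsilon> * \<bar>ar y (V z X)\<bar> \<le> \<epsilon> * 1" using \<epsilon> by (intro mult_left_mono) auto
    then show ?case using \<epsilon> by (simp add: abs_mult)
  qed
  have "W1p_norm 2 D (\<lambda>x. u x - u0 x) \<le> Ce * (Cg * l2_norm M (\<lambda>X. F z X - F z X)
    + l2_norm M (\<lambda>X. flux (coef 0 y z) z (weak_grad D u0) X - flux (coef \<epsilon> y z) z (weak_grad D u0) X))"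
    by (rule sol_compare[OF g g \<epsilon> _ _ u]) (use alo in auto)
  also have "(\<lambda>X. flux (coef 0 y z) z (weak_grad D u0) X - flux (coef \<epsilon> y z) z (weak_grad D u0) X)
      = flux (\<lambda>X. - \<epsilon> * ar y (V z X)) z (weak_grad D u0)"
    by (rule ext) (simp add: flux_def coef_def scaleR_left_distrib)
  also have "l2_norm M (\<lambda>X. F z X - F z X) = 0" by (simp add: l2_norm_def)
  also have "l2_norm M (flux (\<lambda>X. - \<epsilon> * ar y (V z X)) z (weak_grad D u0)) \<le> (\<epsilon> * Lam) * l2_norm M (weak_grad D u0)"
    by (rule flux_square_integrable(2)[OF z rm rb \<epsilon>(1) H1_D(2)[OF W]])
  also have "\<dots> \<le> (\<epsilon> * Lam) * Bu"
    using sol_bound[OF g _ _ u(2)] l2_norm_le_H1_norm(2)[of u0] alo \<epsilon>(1) Lam_pos by (intro mult_left_mono) auto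
  finally have "W1p_norm 2 D (\<lambda>x. u x - u0 x) \<le> Ce * ((\<epsilon> * Lam) * Bu)" using Ce by (simp add: mult_left_mono)
  then show ?thesis by (simp add: C1_def algebra_simps)
qed


section \<open>Continuous dependence on the parameters\<close>

text \<open>Each mode changes in two ways: through the composition, which converges in L^2 for
  merely measurable modes, and through its coefficient, which multiplies a fixed function.\<close>

lemma ar_difference_tendsto:
  assumes zn: "\<And>n::nat. zn n \<in> Z" and z: "z \<in> Z" and lim: "zn \<longlonglongrightarrow> z" "yn \<longlonglongrightarrow> y"
  shows "(\<lambda>n. l2_norm M (\<lambda>X. ar (yn n) (V (zn n) X) - ar y (V z X))) \<longlonglongrightarrow> 0"
    "square_integrable M (\<lambda>X. ar (yn n) (V (zn n) X) - ar y (V z X))"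
proof -
  have fH: "finite_measure (lebesgue_on H)" by (rule finite_measure_lebesgue_on[OF H])
  have \<psi>s: "square_integrable (lebesgue_on H) (\<psi> k)" for k
    by (rule square_integrable_bounded[OF fH \<psi>_meas, where c="K\<psi> k"]) (use \<psi>_bound[of k] in simp)
  let ?h = "\<lambda>k n X. sqrt (lam k) * ((yn n $ k) * (\<psi> k (V (zn n) X) - \<psi> k (V z X)) + (yn n $ k - y $ k) * \<psi> k (V z X))"
  have s1: "square_integrable M (\<lambda>X. \<psi> k (V (zn n) X) - \<psi> k (V z X))" for k n
    by (intro square_integrable_diff compose_square_integrable(1)[OF _ \<psi>s] zn z)
  have s2: "square_integrable M (\<lambda>X. \<psi> k (V z X))" for k by (rule compose_square_integrable(1)[OF z \<psi>s])
  have hs: "square_integrable M (?h k n)" for k n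
    by (intro square_integrable_mult square_integrable_add s1 s2)
  have "(\<lambda>n. l2_norm M (?h k n)) \<longlonglongrightarrow> 0" for k
  proof (rule Lim_null_comparison)
    let ?A = "\<lambda>n. l2_norm M (\<lambda>X. \<psi> k (V (zn n) X) - \<psi> k (V z X))" and ?B = "l2_norm M (\<lambda>X. \<psi> k (V z X))"
    have yk: "(\<lambda>n. yn n $ k) \<longlonglongrightarrow> y $ k" by (rule tendsto_vec_nth[OF lim(2)])
    have "(\<lambda>n. \<bar>sqrt (lam k)\<bar> * (\<bar>yn n $ k\<bar> * ?A n + \<bar>yn n $ k - y $ k\<bar> * ?B)) \<longlonglongrightarrow> \<bar>sqrt (lam k)\<bar> * (\<bar>y $ k\<bar> * 0 + \<bar>y $ k - y $ k\<bar> * ?B)"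
      by (intro tendsto_intros yk compose_tendsto[OF \<psi>s zn z lim(1)])
    then show "(\<lambda>n. \<bar>sqrt (lam k)\<bar> * (\<bar>yn n $ k\<bar> * ?A n + \<bar>yn n $ k - y $ k\<bar> * ?B)) \<longlonglongrightarrow> 0" by simp
    have "l2_norm M (?h k n) \<le> \<bar>sqrt (lam k)\<bar> * (\<bar>yn n $ k\<bar> * ?A n + \<bar>yn n $ k - y $ k\<bar> * ?B)" for n
    proof -
      have "l2_norm M (?h k n) = \<bar>sqrt (lam k)\<bar> * l2_norm M (\<lambda>X. (yn n $ k) * (\<psi> k (V (zn n) X) - \<psi> k (V z X)) + (yn n $ k - y $ k) * \<psi> k (V z X))"
        using l2_norm_scaleR[of M "sqrt (lam k)" "\<lambda>X. (yn n $ k) * (\<psi> k (V (zn n) X) - \<psi> k (V z X)) + (yn n $ k - y $ k) * \<psi> k (V z X)"] by simp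
      also have "\<dots> \<le> \<bar>sqrt (lam k)\<bar> * (l2_norm M (\<lambda>X. (yn n $ k) * (\<psi> k (V (zn n) X) - \<psi> k (V z X))) + l2_norm M (\<lambda>X. (yn n $ k - y $ k) * \<psi> k (V z X)))"
        by (intro mult_left_mono l2_norm_triangle square_integrable_mult s1 s2) simp
      also have "\<dots> = \<bar>sqrt (lam k)\<bar> * (\<bar>yn n $ k\<bar> * ?A n + \<bar>yn n $ k - y $ k\<bar> * ?B)"
        using l2_norm_scaleR[of M "yn n $ k" "\<lambda>X. \<psi> k (V (zn n) X) - \<psi> k (V z X)"]
          l2_norm_scaleR[of M "yn n $ k - y $ k" "\<lambda>X. \<psi> k (V z X)"] by simp
      finally show ?thesis .
    qed
    then show "\<forall>\<^sub>F n in sequentially. norm (l2_norm M (?h k n)) \<le> \<bar>sqrt (lam k)\<bar> * (\<bar>yn n $ k\<bar> * ?A n + \<bar>yn n $ k - y $ k\<bar> * ?B)"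
      by simp
  qed
  then have *: "(\<lambda>n. l2_norm M (\<lambda>X. \<Sum>k\<in>UNIV. ?h k n X)) \<longlonglongrightarrow> 0 \<and> (\<forall>n. square_integrable M (\<lambda>X. \<Sum>k\<in>UNIV. ?h k n X))"
    by (intro l2_norm_sum_tendsto hs) auto
  have eq: "(\<lambda>X. ar (yn n) (V (zn n) X) - ar y (V z X)) = (\<lambda>X. \<Sum>k\<in>UNIV. ?h k n X)" for n
    by (auto simp: ar_eq sum_subtractf[symmetric] algebra_simps intro!: sum.cong)
  show "(\<lambda>n. l2_norm M (\<lambda>X. ar (yn n) (V (zn n) X) - ar y (V z X))) \<longlonglongrightarrow> 0" using * by (simp only: eq)
  show "square_integrable M (\<lambda>X. ar (yn n) (V (zn n) X) - ar y (V z X))" using * by (simp only: eq)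
qed

lemma coef_difference_tendsto:
  assumes zn: "\<And>n::nat. zn n \<in> Z" and z: "z \<in> Z" and lim: "zn \<longlonglongrightarrow> z" "yn \<longlonglongrightarrow> y"
  shows "(\<lambda>n. l2_norm M (\<lambda>X. coef \<epsilon> y z X - coef \<epsilon> (yn n) (zn n) X)) \<longlonglongrightarrow> 0"
    "square_integrable M (\<lambda>X. coef \<epsilon> y z X - coef \<epsilon> (yn n) (zn n) X)"
proof -
  have fH: "finite_measure (lebesgue_on H)" by (rule finite_measure_lebesgue_on[OF H])
  have as: "square_integrable (lebesgue_on H) as"
  proof (rule square_integrable_bounded[OF fH as_meas, where c="\<bar>ahi\<bar>"], rule AE_I2)
    fix x assume "x \<in> space (lebesgue_on H)"
    then have "alo \<le> as x \<and> as x \<le> ahi" using as_bounds by (simp add: space_restrict_space)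
    then show "norm (as x) \<le> \<bar>ahi\<bar>" using alo by simp
  qed
  have s: "square_integrable M (\<lambda>X. as (V (zn n) X) - as (V z X))" for n
    by (intro square_integrable_diff compose_square_integrable(1)[OF _ as] zn z)
  note r = ar_difference_tendsto[OF zn z lim]
  have eq: "(\<lambda>X. coef \<epsilon> y z X - coef \<epsilon> (yn n) (zn n) X)
      = (\<lambda>X. (-1) *\<^sub>R (as (V (zn n) X) - as (V z X)) + (- \<epsilon>) *\<^sub>R (ar (yn n) (V (zn n) X) - ar y (V z X)))" for n
    by (auto simp: coef_def algebra_simps)
  show "square_integrable M (\<lambda>X. coef \<epsilon> y z X - coef \<epsilon> (yn n) (zn n) X)"
    unfolding eq by (intro square_integrable_add square_integrable_scaleR s r(2))
  show "(\<lambda>n. l2_norm M (\<lambda>X. coef \<epsilon> y z X - coef \<epsilon> (yn n) (zn n) X)) \<longlonglongrightarrow> 0"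
  proof (rule Lim_null_comparison)
    let ?a = "\<lambda>n. l2_norm M (\<lambda>X. as (V (zn n) X) - as (V z X))"
    let ?r = "\<lambda>n. l2_norm M (\<lambda>X. ar (yn n) (V (zn n) X) - ar y (V z X))"
    have "(\<lambda>n. ?a n + \<bar>\<epsilon>\<bar> * ?r n) \<longlonglongrightarrow> 0 + \<bar>\<epsilon>\<bar> * 0"
      by (intro tendsto_intros compose_tendsto[OF as zn z lim(1)] r(1))
    then show "(\<lambda>n. ?a n + \<bar>\<epsilon>\<bar> * ?r n) \<longlonglongrightarrow> 0" by simp
    have "l2_norm M (\<lambda>X. coef \<epsilon> y z X - coef \<epsilon> (yn n) (zn n) X) \<le> ?a n + \<bar>\<epsilon>\<bar> * ?r n" for n
    proof -
      have "l2_norm M (\<lambda>X. coef \<epsilon> y z X - coef \<epsilon> (yn n) (zn n) X)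
          \<le> l2_norm M (\<lambda>X. (-1) *\<^sub>R (as (V (zn n) X) - as (V z X))) + l2_norm M (\<lambda>X. (- \<epsilon>) *\<^sub>R (ar (yn n) (V (zn n) X) - ar y (V z X)))"
        unfolding eq by (intro l2_norm_triangle square_integrable_scaleR s r(2))
      then show ?thesis by (simp only: l2_norm_scaleR) simp
    qed
    then show "\<forall>\<^sub>F n in sequentially. norm (l2_norm M (\<lambda>X. coef \<epsilon> y z X - coef \<epsilon> (yn n) (zn n) X)) \<le> ?a n + \<bar>\<epsilon>\<bar> * ?r n"
      by simp
  qed
qed

text \<open>The scalar coefficients converge only in L^2 while \<open>w\<close> is merely square
  integrable, so their uniform bound is essential: it makes the product with \<open>w\<close> tend
  to zero. The matrices converge pointwise and are bounded, and dominated convergence handles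
  them.\<close>

lemma flux_difference_tendsto:
  assumes g: "\<And>n::nat. good_pt (yn n) (zn n)" "good_pt y z" and lim: "zn \<longlonglongrightarrow> z" "yn \<longlonglongrightarrow> y"
    and \<epsilon>: "0 \<le> \<epsilon>" "\<epsilon> \<le> alo / 2" and w: "square_integrable M w"
  shows "(\<lambda>n. l2_norm M (\<lambda>X. flux (coef \<epsilon> y z) z w X - flux (coef \<epsilon> (yn n) (zn n)) (zn n) w X)) \<longlonglongrightarrow> 0"
proof -
  have zn: "zn n \<in> Z" and z: "z \<in> Z" for n using g by (auto simp: good_pt_def)
  let ?a = "coef \<epsilon> y z" and ?an = "\<lambda>n. coef \<epsilon> (yn n) (zn n)"
  have am: "?a \<in> borel_measurable M" "?an n \<in> borel_measurable M" for n
    using coef_measurable[OF z] coef_measurable[OF zn] by auto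
  have wm: "w \<in> borel_measurable M" by (rule square_integrable_measurable[OF w])
  note ab = coef_bounds(2)[OF g(2) \<epsilon>] and anb = coef_bounds(2)[OF g(1) \<epsilon>]
  have dKb: "AE X in M. \<bar>?a X - ?an n X\<bar> \<le> 2 * beta" for n
    using ab anb[of n] by eventually_elim linarith
  have t1: "(\<lambda>n. l2_norm M (\<lambda>X. (?a X - ?an n X) *\<^sub>R w X)) \<longlonglongrightarrow> 0"
    by (rule l2_norm_bounded_mult_tendsto[OF coef_difference_tendsto(2)[OF zn z lim] coef_difference_tendsto(1)[OF zn z lim] dKb w])
  have s1: "square_integrable M (\<lambda>X. (?a X - ?an n X) *\<^sub>R w X)" for n
    by (rule square_integrable_bound[OF w, where c="2 * beta"])
      (use am wm dKb[of n] in \<open>auto intro: mult_right_mono elim!: eventually_mono\<close>)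
  let ?p = "\<lambda>n X. Bm (zn n) X *v ((?a X - ?an n X) *\<^sub>R w X)" and ?q = "\<lambda>n X. ?a X *\<^sub>R (Bm z X *v w X - Bm (zn n) X *v w X)"
  have pm: "?p n \<in> borel_measurable M" for n by (rule Bm_measurable[OF zn square_integrable_measurable[OF s1]])
  have pb: "AE X in M. norm (?p n X) \<le> Lam * norm ((?a X - ?an n X) *\<^sub>R w X)" for n
    using AE_M_D by eventually_elim (rule Bm_bounds(1)[OF zn])
  have qm: "?q n \<in> borel_measurable M" for n
    using am(1) Bm_measurable[OF z wm] Bm_measurable[OF zn wm] by measurable
  have qb: "AE X in M. norm (?q n X) \<le> norm ((beta * (2 * Lam)) *\<^sub>R w X)" for n
    using AE_M_D ab
  proof eventually_elim
    case (elim X)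
    have "norm (Bm z X *v w X - Bm (zn n) X *v w X) \<le> norm (Bm z X *v w X) + norm (Bm (zn n) X *v w X)"
      by (rule norm_triangle_ineq4)
    also have "\<dots> \<le> (2 * Lam) * norm (w X)"
      using Bm_bounds(1)[OF z elim(1), of "w X"] Bm_bounds(1)[OF zn elim(1), of n "w X"] by simp
    finally have "\<bar>?a X\<bar> * norm (Bm z X *v w X - Bm (zn n) X *v w X) \<le> beta * ((2 * Lam) * norm (w X))"
      using elim(2) beta by (intro mult_mono) auto
    then show ?case using beta Lam_pos by (simp add: mult.assoc)
  qed
  have t2: "(\<lambda>n. l2_norm M (?q n)) \<longlonglongrightarrow> 0"
  proof (rule square_integrable_DCT[OF qm square_integrable_scaleR[OF w] _ qb])
    show "AE X in M. (\<lambda>n. ?q n X) \<longlonglongrightarrow> 0"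
      using AE_M_D
    proof eventually_elim
      case (elim X)
      have "(\<lambda>n. Bm (zn n) X *v w X) \<longlonglongrightarrow> Bm z X *v w X"
        by (rule Bm_tendsto(1)[OF zn z lim(1)]) (use elim in auto)
      then have "(\<lambda>n. ?q n X) \<longlonglongrightarrow> ?a X *\<^sub>R (Bm z X *v w X - Bm z X *v w X)" by (intro tendsto_intros)
      then show ?case by simp
    qed
  qed
  have sp: "square_integrable M (?p n)" for n by (rule square_integrable_bound[OF s1 pm pb])
  have sq: "square_integrable M (?q n)" for n
    by (rule square_integrable_bound[OF square_integrable_scaleR[OF w] qm, where c=1]) (use qb[of n] in simp)
  show ?thesis
  proof (rule Lim_null_comparison)
    have "(\<lambda>n. Lam * l2_norm M (\<lambda>X. (?a X - ?an n X) *\<^sub>R w X) + l2_norm M (?q n)) \<longlonglongrightarrow> Lam * 0 + 0"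
      by (intro tendsto_intros t1 t2)
    then show "(\<lambda>n. Lam * l2_norm M (\<lambda>X. (?a X - ?an n X) *\<^sub>R w X) + l2_norm M (?q n)) \<longlonglongrightarrow> 0" by simp
    have "l2_norm M (\<lambda>X. flux ?a z w X - flux (?an n) (zn n) w X)
        \<le> Lam * l2_norm M (\<lambda>X. (?a X - ?an n X) *\<^sub>R w X) + l2_norm M (?q n)" for n
    proof -
      have "(\<lambda>X. flux ?a z w X - flux (?an n) (zn n) w X) = (\<lambda>X. ?p n X + ?q n X)"
        by (rule ext) (simp add: flux_def matrix_vector_mult_scaleR algebra_simps)
      then have "l2_norm M (\<lambda>X. flux ?a z w X - flux (?an n) (zn n) w X) \<le> l2_norm M (?p n) + l2_norm M (?q n)"
        using l2_norm_triangle[OF sp sq] by simp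
      also have "l2_norm M (?p n) \<le> Lam * l2_norm M (\<lambda>X. (?a X - ?an n X) *\<^sub>R w X)"
        using Lam_pos by (intro l2_norm_mono[OF s1 pm _ pb]) simp
      finally show ?thesis by simp
    qed
    then show "\<forall>\<^sub>F n in sequentially. norm (l2_norm M (\<lambda>X. flux ?a z w X - flux (?an n) (zn n) w X))
        \<le> Lam * l2_norm M (\<lambda>X. (?a X - ?an n X) *\<^sub>R w X) + l2_norm M (?q n)" by simp
  qed
qed

text \<open>The limit solution takes the role of \<open>u2\<close> in \<open>sol_compare\<close>, so
  loads and fluxes are compared against its fixed gradient. The set \<open>G\<close> is left free;
  it is later chosen to suit two families of solutions at once.\<close>

lemma solution_field:
  fixes u :: "real^'n \<Rightarrow> real^'m \<Rightarrow> real^'d \<Rightarrow> real"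
  assumes P: "finite_measure P" "sets P = sets borel" and G: "G \<in> sets borel" "bounded G" "AE w in P. w \<in> G"
    and u: "\<And>y z. (y, z) \<in> G \<Longrightarrow> good_pt y z \<and> wsol \<epsilon> y z (u y z)" and \<epsilon>: "0 \<le> \<epsilon>" "\<epsilon> \<le> alo / 2"
  shows "continuous_field 2 P G (\<lambda>(y, z). u y z)"
  unfolding continuous_field_2
proof (intro conjI ballI allI impI P G)
  fix w assume w: "w \<in> G"
  obtain y z where yz: "w = (y, z)" by (cases w)
  note u0 = u[OF w[unfolded yz]]
  show "(case w of (y, z) \<Rightarrow> u y z) \<in> H1_0 D" using u0 wsolD(1) by (auto simp: yz)
  fix c assume c: "(\<forall>n::nat. c n \<in> G) \<and> c \<longlonglongrightarrow> w"
  define yn zn where "yn n = fst (c n)" and "zn n = snd (c n)" for n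
  have cn: "c n = (yn n, zn n)" for n by (simp add: yn_def zn_def)
  have "(yn n, zn n) \<in> G" for n using c cn[of n] by metis
  note un = u[OF this]
  have lim: "zn \<longlonglongrightarrow> z" "yn \<longlonglongrightarrow> y"
    using c tendsto_fst[of c w] tendsto_snd[of c w] by (auto simp: yn_def[abs_def] zn_def[abs_def] yz)
  have z: "zn n \<in> Z" "z \<in> Z" for n using un u0 by (auto simp: good_pt_def)
  have uW: "u y z \<in> W1p 2 D" using u0 wsolD(1) H1_0_D by blast
  show "(\<lambda>n. W1p_norm 2 D (\<lambda>x. (case c n of (y, z) \<Rightarrow> u y z) x - (case w of (y, z) \<Rightarrow> u y z) x)) \<longlonglongrightarrow> 0"
  proof (rule Lim_null_comparison)
    let ?F = "\<lambda>n. l2_norm M (\<lambda>X. F (zn n) X - F z X)"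
    let ?E = "\<lambda>n. l2_norm M (\<lambda>X. flux (coef \<epsilon> y z) z (weak_grad D (u y z)) X - flux (coef \<epsilon> (yn n) (zn n)) (zn n) (weak_grad D (u y z)) X)"
    have "(\<lambda>n. Ce * (Cg * ?F n + ?E n)) \<longlonglongrightarrow> Ce * (Cg * 0 + 0)"
      using un u0 by (intro tendsto_intros F_tendsto z lim flux_difference_tendsto \<epsilon> H1_D(2)[OF uW]) auto
    then show "(\<lambda>n. Ce * (Cg * ?F n + ?E n)) \<longlonglongrightarrow> 0" by simp
    have "W1p_norm 2 D (\<lambda>x. u (yn n) (zn n) x - u y z x) \<le> Ce * (Cg * ?F n + ?E n)" for n
      using un[of n] u0 by (intro sol_compare \<epsilon>) auto
    then show "\<forall>\<^sub>F n in sequentially. norm (W1p_norm 2 D (\<lambda>x. (case c n of (y, z) \<Rightarrow> u y z) x - (case w of (y, z) \<Rightarrow> u y z) x))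
        \<le> Ce * (Cg * ?F n + ?E n)" by (simp add: cn yz)
  qed
next
  show "\<exists>B. \<forall>w\<in>G. W1p_norm 2 D (case w of (y, z) \<Rightarrow> u y z) \<le> B"
  proof (intro exI[of _ Bu] ballI)
    fix w assume w: "w \<in> G"
    obtain y z where yz: "w = (y, z)" by (cases w)
    have "W1p_norm 2 D (u y z) \<le> Bu" by (rule sol_bound[OF _ \<epsilon>]) (use u[OF w[unfolded yz]] in auto)
    then show "W1p_norm 2 D (case w of (y, z) \<Rightarrow> u y z) \<le> Bu" by (simp add: yz)
  qed
qed

subsection \<open>The average over the coefficient\<close>

definition C2 :: real where "C2 = Ce * (Lam * C1)"

lemma C2: "0 \<le> C2" using Ce Lam_pos C1 by (simp add: C2_def)

text \<open>Since \<open>ar\<close> is linear in \<open>y\<close> and \<open>y\<close> is centred, the term of first order in \<open>\<epsilon>\<close> vanishes in the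
  equation for the average, so no corrector is needed.\<close>

lemma section_mean:
  assumes PX: "prob_space PX" "\<And>k. integrable PX (\<lambda>y. y $ k)" "\<And>k. (\<integral>y. y $ k \<partial>PX) = 0"
    and \<epsilon>: "0 \<le> \<epsilon>" "\<epsilon> \<le> alo / 2"
    and z: "z \<in> Z"
    and u: "\<And>y. y \<in> G \<Longrightarrow> good_pt y z \<and> wsol \<epsilon> y z (u y) \<and> wsol 0 y z u0"
    and u0: "u0 \<in> W1p 2 D"
    and field: "continuous_field 2 PX G (\<lambda>y x. u y x - u0 x)"
  shows "\<exists>W\<in>H1_0 D. W1p_norm 2 D W \<le> C2 * \<epsilon>\<^sup>2 \<and>
    (\<forall>l. bounded_functional 2 l \<longrightarrow> (\<integral>y. indicator G y * l (\<lambda>x. u y x - u0 x) \<partial>PX) = l W)"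
proof -
  interpret prob_space PX by (rule PX(1))
  have p2: "(2::nat) \<in> {1, 2}" by simp
  define W where "W = W1p_integral 2 D PX (\<lambda>y x. u y x - u0 x)"
  have W0: "W \<in> H1_0 D" using continuous_field_integral(2)[OF p2 field] by (simp add: W_def)
  have Wl: "l W = (\<integral>y. indicator G y * l (\<lambda>x. u y x - u0 x) \<partial>PX)" if "bounded_functional 2 l" for l
    using continuous_field_integral(3)[OF p2 field that] by (simp add: W_def)
  have AEG: "AE y in PX. y \<in> G" using field unfolding continuous_field_2 by blast
  let ?g = "weak_grad D W"
  have gs: "square_integrable M ?g" by (rule H1_D(2)[OF H1_0_D[OF W0]])
  \<comment> \<open>The deterministic coefficient does not involve \<open>y\<close>; hence the
    energy form below is one functional for all \<open>y\<close> and commutes with the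
    average.\<close>
  define a0 where "a0 X = as (V z X)" for X
  have a0m: "a0 \<in> borel_measurable M" unfolding a0_def[abs_def] by (rule compose_measurable[OF z as_meas])
  have a0b: "AE X in M. alo / 2 \<le> a0 X \<and> a0 X \<le> beta"
    using as_AE[OF z] by eventually_elim (use alo in \<open>unfold a0_def beta_def, linarith\<close>)
  then have a0b': "AE X in M. \<bar>a0 X\<bar> \<le> beta" by eventually_elim (use alo in linarith)
  \<comment> \<open>The unperturbed energy form tested with the average \<open>W\<close> itself.
    Averaging it over \<open>y\<close> gives the energy of \<open>W\<close>, to which
    \<open>energy_bound\<close> applies.\<close>
  define l1 where "l1 v = (LINT X|M. flux a0 z (weak_grad D v) X \<bullet> ?g X)" for v
  have fi: "integrable M (\<lambda>X. flux a0 z (weak_grad D v) X \<bullet> ?g X)" if "v \<in> W1p 2 D" for v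
    by (rule inner_integrable(1)[OF flux_square_integrable(1)[OF z a0m a0b' beta H1_D(2)[OF that]] gs])
  have l1: "bounded_functional 2 l1"
  proof (rule bounded_functionalI[OF p2, simplified])
    fix u v assume uv: "u \<in> W1p 2 D" "v \<in> W1p 2 D"
    have "l1 (\<lambda>x. u x + v x) = (LINT X|M. flux a0 z (weak_grad D u) X \<bullet> ?g X + flux a0 z (weak_grad D v) X \<bullet> ?g X)"
      unfolding l1_def
    proof (rule integral_cong_AE)
      show "(\<lambda>X. flux a0 z (weak_grad D (\<lambda>x. u x + v x)) X \<bullet> ?g X) \<in> borel_measurable M"
        by (rule borel_measurable_integrable[OF fi[OF H1_add(1)[OF uv]]])
      show "(\<lambda>X. flux a0 z (weak_grad D u) X \<bullet> ?g X + flux a0 z (weak_grad D v) X \<bullet> ?g X) \<in> borel_measurable M"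
        by (rule borel_measurable_integrable[OF Bochner_Integration.integrable_add[OF fi[OF uv(1)] fi[OF uv(2)]]])
      show "AE X in M. flux a0 z (weak_grad D (\<lambda>x. u x + v x)) X \<bullet> ?g X
          = flux a0 z (weak_grad D u) X \<bullet> ?g X + flux a0 z (weak_grad D v) X \<bullet> ?g X"
        using H1_add(2)[OF uv]
        by eventually_elim (simp add: flux_def matrix_vector_right_distrib scaleR_right_distrib inner_add_left)
    qed
    then show "l1 (\<lambda>x. u x + v x) = l1 u + l1 v" using fi[OF uv(1)] fi[OF uv(2)] by (simp add: l1_def)
  next
    fix c u assume u: "u \<in> W1p 2 D"
    have "l1 (\<lambda>x. c * u x) = (LINT X|M. c * (flux a0 z (weak_grad D u) X \<bullet> ?g X))"
      unfolding l1_def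
    proof (rule integral_cong_AE)
      show "(\<lambda>X. flux a0 z (weak_grad D (\<lambda>x. c * u x)) X \<bullet> ?g X) \<in> borel_measurable M"
        by (rule borel_measurable_integrable[OF fi[OF H1_cmult(1)[OF u]]])
      show "(\<lambda>X. c * (flux a0 z (weak_grad D u) X \<bullet> ?g X)) \<in> borel_measurable M"
        using borel_measurable_integrable[OF fi[OF u]] by measurable
      show "AE X in M. flux a0 z (weak_grad D (\<lambda>x. c * u x)) X \<bullet> ?g X = c * (flux a0 z (weak_grad D u) X \<bullet> ?g X)"
        using H1_cmult(2)[OF u, of c] by eventually_elim (simp add: flux_def matrix_vector_mult_scaleR)
    qed
    then show "l1 (\<lambda>x. c * u x) = c * l1 u" by (simp add: l1_def)
  next
    fix u assume u: "u \<in> W1p 2 D"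
    have "\<bar>l1 u\<bar> \<le> l2_norm M (flux a0 z (weak_grad D u)) * l2_norm M ?g"
      unfolding l1_def by (rule inner_integrable(2)[OF flux_square_integrable(1)[OF z a0m a0b' beta H1_D(2)[OF u]] gs])
    also have "\<dots> \<le> ((beta * Lam) * W1p_norm 2 D u) * l2_norm M ?g"
      using flux_square_integrable(2)[OF z a0m a0b' beta H1_D(2)[OF u]] l2_norm_le_H1_norm(2)[of u] beta Lam_pos
      by (intro mult_right_mono order_trans[OF flux_square_integrable(2)[OF z a0m a0b' beta H1_D(2)[OF u]]] mult_left_mono) auto
    finally show "\<bar>l1 u\<bar> \<le> (beta * Lam * l2_norm M ?g) * W1p_norm 2 D u" by (simp add: algebra_simps)
  qed
  \<comment> \<open>Contributions of the single modes to the first-order term. Since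
    \<open>u0\<close> and the test function are fixed, that term is a linear function of
    \<open>y\<close> with these coefficients, and its mean vanishes.\<close>
  define q where "q k = (LINT X|M. flux (\<lambda>X. \<psi> k (V z X)) z (weak_grad D u0) X \<bullet> ?g X)" for k
  have \<psi>z: "(\<lambda>X. \<psi> k (V z X)) \<in> borel_measurable M" "AE X in M. \<bar>\<psi> k (V z X)\<bar> \<le> \<bar>K\<psi> k\<bar>" for k
    using compose_measurable[OF z \<psi>_meas[of k]] AE_compose[OF z \<psi>_bound[of k]] by (auto elim!: eventually_mono)
  have qi: "integrable M (\<lambda>X. flux (\<lambda>X. \<psi> k (V z X)) z (weak_grad D u0) X \<bullet> ?g X)" for k
    by (rule inner_integrable(1)[OF flux_square_integrable(1)[OF z \<psi>z _ H1_D(2)[OF u0]] gs]) simp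
  define S where "S y = (\<Sum>k\<in>UNIV. sqrt (lam k) * q k * y $ k)" for y :: "real^'n"
  have Si: "integrable PX S" "(\<integral>y. S y \<partial>PX) = 0"
    using PX(2,3) unfolding S_def[abs_def] by (auto simp: Bochner_Integration.integral_sum)
  \<comment> \<open>With the linear term moved to the left, what remains is \<epsilon> times the
    flux of \<open>w\<close> with coefficient \<open>ar\<close>. As \<open>w\<close> is itself of
    order \<epsilon>, the right side is of second order for each \<open>y\<close>.\<close>
  have est: "\<bar>l1 (\<lambda>x. u y x - u0 x) + \<epsilon> * S y\<bar> \<le> \<epsilon>\<^sup>2 * (Lam * C1) * l2_norm M ?g" if y: "y \<in> G" for y
  proof -
    have g: "good_pt y z" and s: "wsol \<epsilon> y z (u y)" "wsol 0 y z u0" using u[OF y] by auto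
    note uW = H1_0_D[OF wsolD(1)[OF s(1)]]
    have arith: "l1w + \<epsilon> * s = - \<epsilon> * Iw" if "l1u + \<epsilon> * Iu = l10" "l1w = l1u - l10" "Iw = Iu - I0" "I0 = s"
      for l1u Iu l10 l1w Iw I0 s :: real
    proof -
      have "Iu = Iw + s" using that by simp
      then show ?thesis using that(1,2) by (auto simp: algebra_simps)
    qed
    let ?r = "\<lambda>X. ar y (V z X)" and ?w = "\<lambda>x. u y x - u0 x"
    have rm: "?r \<in> borel_measurable M" by (rule compose_measurable[OF z ar_measurable])
    have rb: "AE X in M. \<bar>?r X\<bar> \<le> 1" using g by (simp add: good_pt_def)
    have ri: "integrable M (\<lambda>X. flux ?r z (weak_grad D v) X \<bullet> ?g X)" if "v \<in> W1p 2 D" for v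
      by (rule inner_integrable(1)[OF flux_square_integrable(1)[OF z rm rb _ H1_D(2)[OF that]] gs]) simp
    have "(LINT X|M. flux (coef \<epsilon> y z) z (weak_grad D (u y)) X \<bullet> ?g X) = (LINT X|M. flux (coef 0 y z) z (weak_grad D u0) X \<bullet> ?g X)"
      using wsolD(2)[OF s(1) W0] wsolD(2)[OF s(2) W0] by simp
    moreover have "(\<lambda>X. flux (coef \<epsilon> y z) z (weak_grad D (u y)) X \<bullet> ?g X)
        = (\<lambda>X. flux a0 z (weak_grad D (u y)) X \<bullet> ?g X + \<epsilon> * (flux ?r z (weak_grad D (u y)) X \<bullet> ?g X))"
      by (rule ext) (simp add: flux_def coef_def a0_def scaleR_left_distrib inner_add_left)
    moreover have "flux (coef 0 y z) z (weak_grad D u0) = flux a0 z (weak_grad D u0)"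
      by (rule ext) (simp add: flux_def coef_def a0_def)
    ultimately have "l1 (u y) + \<epsilon> * (LINT X|M. flux ?r z (weak_grad D (u y)) X \<bullet> ?g X) = l1 u0"
      using fi[OF uW] ri[OF uW] by (simp add: l1_def)
    moreover have "l1 ?w = l1 (u y) - l1 u0"
      unfolding l1_def by (rule flux_diff[OF z a0m a0b' uW u0 gs])
    moreover have "(LINT X|M. flux ?r z (weak_grad D ?w) X \<bullet> ?g X)
        = (LINT X|M. flux ?r z (weak_grad D (u y)) X \<bullet> ?g X) - (LINT X|M. flux ?r z (weak_grad D u0) X \<bullet> ?g X)"
      by (rule flux_diff[OF z rm rb uW u0 gs])
    moreover have "(LINT X|M. flux ?r z (weak_grad D u0) X \<bullet> ?g X) = S y"
    proof -
      have "flux ?r z (weak_grad D u0) X \<bullet> ?g X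
          = (\<Sum>k\<in>UNIV. (sqrt (lam k) * y $ k) * (flux (\<lambda>X. \<psi> k (V z X)) z (weak_grad D u0) X \<bullet> ?g X))" for X
        by (simp add: flux_def ar_eq sum_distrib_right mult.assoc)
      then have "(LINT X|M. flux ?r z (weak_grad D u0) X \<bullet> ?g X) = (\<Sum>k\<in>UNIV. (sqrt (lam k) * y $ k) * q k)"
        unfolding q_def using qi by (simp add: Bochner_Integration.integral_sum)
      then show ?thesis by (simp add: S_def algebra_simps)
    qed
    ultimately have "l1 ?w + \<epsilon> * S y = - \<epsilon> * (LINT X|M. flux ?r z (weak_grad D ?w) X \<bullet> ?g X)"
      by (rule arith)
    moreover have "\<bar>LINT X|M. flux ?r z (weak_grad D ?w) X \<bullet> ?g X\<bar> \<le> (Lam * (C1 * \<epsilon>)) * l2_norm M ?g"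
    proof -
      have wW: "?w \<in> W1p 2 D" by (rule H1_diff(1)[OF uW u0])
      have "\<bar>LINT X|M. flux ?r z (weak_grad D ?w) X \<bullet> ?g X\<bar> \<le> l2_norm M (flux ?r z (weak_grad D ?w)) * l2_norm M ?g"
        by (rule inner_integrable(2)[OF flux_square_integrable(1)[OF z rm rb _ H1_D(2)[OF wW]] gs]) simp
      also have "\<dots> \<le> (Lam * (C1 * \<epsilon>)) * l2_norm M ?g"
      proof (rule mult_right_mono)
        have "l2_norm M (flux ?r z (weak_grad D ?w)) \<le> Lam * l2_norm M (weak_grad D ?w)"
          using flux_square_integrable(2)[OF z rm rb _ H1_D(2)[OF wW]] by simp
        also have "\<dots> \<le> Lam * (C1 * \<epsilon>)"
          using sol_perturbation[OF g \<epsilon> s] l2_norm_le_H1_norm(2)[of ?w] Lam_pos by (intro mult_left_mono) auto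
        finally show "l2_norm M (flux ?r z (weak_grad D ?w)) \<le> Lam * (C1 * \<epsilon>)" .
      qed simp
      finally show ?thesis .
    qed
    ultimately have "\<bar>l1 ?w + \<epsilon> * S y\<bar> \<le> \<epsilon> * ((Lam * (C1 * \<epsilon>)) * l2_norm M ?g)"
      using \<epsilon>(1) by (simp add: abs_mult mult_left_mono)
    then show ?thesis by (simp add: power2_eq_square algebra_simps)
  qed
  have fl: "integrable PX (\<lambda>y. indicator G y * l1 (\<lambda>x. u y x - u0 x))"
    by (rule continuous_field_measurable(1)[OF p2 field l1])
  \<comment> \<open>Adding the linear term does not change the integral, but it makes the integrand
    small pointwise.\<close>
  have "l1 W = (\<integral>y. indicator G y * l1 (\<lambda>x. u y x - u0 x) + \<epsilon> * S y \<partial>PX)"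
    using Wl[OF l1] fl Si by simp
  also have "\<dots> \<le> (\<integral>y. \<epsilon>\<^sup>2 * (Lam * C1) * l2_norm M ?g \<partial>PX)"
  proof (rule integral_mono_AE)
    show "integrable PX (\<lambda>y. indicator G y * l1 (\<lambda>x. u y x - u0 x) + \<epsilon> * S y)" using fl Si by simp
    show "AE y in PX. indicator G y * l1 (\<lambda>x. u y x - u0 x) + \<epsilon> * S y \<le> \<epsilon>\<^sup>2 * (Lam * C1) * l2_norm M ?g"
      using AEG
    proof eventually_elim
      case (elim y)
      then show ?case using est[OF elim] by simp
    qed
  qed simp
  also have "\<dots> = (\<epsilon>\<^sup>2 * (Lam * C1)) * l2_norm M ?g" by (simp add: prob_space)
  finally have "W1p_norm 2 D W \<le> Cg * (Lam / (alo / 2) * (\<epsilon>\<^sup>2 * (Lam * C1)))"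
    unfolding l1_def by (intro energy_bound[OF z a0m a0b _ W0]) (use alo Lam_pos C1 in auto)
  then have "W1p_norm 2 D W \<le> C2 * \<epsilon>\<^sup>2" by (simp add: C2_def Ce_def mult.assoc mult.commute mult.left_commute)
  then show ?thesis using W0 Wl by (intro bexI[of _ W]) auto
qed

end

section \<open>Mean and variance\<close>

text \<open>The property need not be measurable, but the exceptions lie in a measurable null set,
  whose complement serves as \<open>G\<close>.\<close>

lemma AE_obtain_set:
  assumes "AE w in P. Q w"
  obtains G where "G \<in> sets P" "AE w in P. w \<in> G" "\<And>w. w \<in> G \<Longrightarrow> Q w"
proof -
  obtain N where N: "{w \<in> space P. \<not> Q w} \<subseteq> N" "emeasure P N = 0" "N \<in> sets P" using AE_E[OF assms] by blast
  have "AE w in P. w \<notin> N" using N(2,3) AE_not_in[of N P] by (auto simp: null_sets_def)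
  then have "AE w in P. w \<in> space P - N" using AE_space by eventually_elim auto
  with N show thesis by (intro that[of "space P - N"]) auto
qed

locale averaged_perturbation = perturbation D V Z H L as alo ahi lam \<psi> K\<psi> f + XY: pair_prob_space PX PY
  for D :: "(real^'d) set" and V :: "real^'m \<Rightarrow> real^'d \<Rightarrow> real^'d" and Z H L
    and as :: "real^'d \<Rightarrow> real" and alo ahi :: real
    and lam :: "'n::finite \<Rightarrow> real" and \<psi> :: "'n \<Rightarrow> real^'d \<Rightarrow> real" and K\<psi> :: "'n \<Rightarrow> real"
    and f :: "real^'d \<Rightarrow> real"
    and PX :: "(real^'n) measure" and PY :: "(real^'m) measure" +
  assumes sets_PX: "sets PX = sets borel" and sets_PY: "sets PY = sets borel"
    and centred: "\<And>k. integrable PX (\<lambda>y. y $ k)" "\<And>k. (\<integral>y. y $ k \<partial>PX) = 0"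
begin

abbreviation P where "P \<equiv> PX \<Otimes>\<^sub>M PY"

lemma sets_P: "sets P = sets borel"
  using sets_pair_measure_cong[OF sets_PX sets_PY] unfolding borel_prod .

lemma section_field:
  assumes v: "continuous_field 2 P G v" and AEz: "AE y in PX. (y, z) \<in> G"
  shows "continuous_field 2 PX {y. (y, z) \<in> G} (\<lambda>y. v (y, z))"
proof -
  note v' = v[unfolded continuous_field_2]
  show ?thesis
    unfolding continuous_field_2
  proof (intro conjI ballI allI impI)
    have cont: "(\<lambda>n. W1p_norm 2 D (\<lambda>x. v (c n) x - v w x)) \<longlonglongrightarrow> 0"
      if "w \<in> G" "\<And>n::nat. c n \<in> G" "c \<longlonglongrightarrow> w" for w c using v' that by blast
    show "finite_measure PX" by (rule XY.M1.finite_measure_axioms)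
    show "sets PX = sets borel" by (rule sets_PX)
    have "G \<in> sets P" using v' by (simp add: sets_P)
    from sets_Pair2[OF this, of z] show "{y. (y, z) \<in> G} \<in> sets borel" by (simp add: sets_PX vimage_def)
    have "{y. (y, z) \<in> G} \<subseteq> fst ` G" by force
    moreover have "bounded (fst ` G)" using v' by (intro bounded_fst) blast
    ultimately show "bounded {y. (y, z) \<in> G}" by (rule bounded_subset[rotated])
    show "AE y in PX. y \<in> {y. (y, z) \<in> G}" using AEz by simp
    show "v (y, z) \<in> H1_0 D" if "y \<in> {y. (y, z) \<in> G}" for y using v' that by blast
    show "\<exists>B. \<forall>y\<in>{y. (y, z) \<in> G}. W1p_norm 2 D (v (y, z)) \<le> B" using v' by blast
    fix y c assume y: "y \<in> {y. (y, z) \<in> G}" and c: "(\<forall>n::nat. c n \<in> {y. (y, z) \<in> G}) \<and> c \<longlonglongrightarrow> y"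
    have "(\<lambda>n. (c n, z)) \<longlonglongrightarrow> (y, z)" using c by (intro tendsto_Pair) auto
    then show "(\<lambda>n. W1p_norm 2 D (\<lambda>x. v (c n, z) x - v (y, z) x)) \<longlonglongrightarrow> 0"
      using y c by (intro cont) auto
  qed
qed

text \<open>The functional may depend on \<open>z\<close>, which is needed for the mixed term of the variance.\<close>

lemma mean_first_order:
  assumes field: "continuous_field 2 P G (\<lambda>(y, z) x. u y z x - u0 z x)"
    and u: "\<And>y z. (y, z) \<in> G \<Longrightarrow> good_pt y z \<and> wsol \<epsilon> y z (u y z) \<and> wsol 0 y z (u0 z)"
    and \<epsilon>: "0 \<le> \<epsilon>" "\<epsilon> \<le> alo / 2"
    and l: "\<And>y z. (y, z) \<in> G \<Longrightarrow> bounded_functional 2 (l z)"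
      "\<And>y z g. (y, z) \<in> G \<Longrightarrow> g \<in> W1p 2 D \<Longrightarrow> \<bar>l z g\<bar> \<le> K * W1p_norm 2 D g"
    and K: "0 \<le> K"
    and int: "integrable P (\<lambda>(y, z). indicator G (y, z) * l z (\<lambda>x. u y z x - u0 z x))"
  shows "\<bar>\<integral>w. (case w of (y, z) \<Rightarrow> indicator G (y, z) * l z (\<lambda>x. u y z x - u0 z x)) \<partial>P\<bar> \<le> K * (C2 * \<epsilon>\<^sup>2)"
proof -
  let ?h = "\<lambda>y z. indicator G (y, z) * l z (\<lambda>x. u y z x - u0 z x)"
  have GP: "G \<in> sets P" and AEG: "AE w in P. w \<in> G"
    using field unfolding continuous_field_2 by (auto simp: sets_P)
  have spP: "space P = UNIV" using sets_eq_imp_space_eq[OF sets_P] by simp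
  \<comment> \<open>The average is taken over \<open>y\<close> first, so almost every section at
    fixed \<open>z\<close> must have full measure; measurability of \<open>G\<close> permits
    exchanging the two quantifiers.\<close>
  have "AE y in PX. AE z in PY. (y, z) \<in> G" using XY.AE_pair[OF AEG] by simp
  then have AEz: "AE z in PY. AE y in PX. (y, z) \<in> G"
    by (subst (asm) XY.AE_commute) (use GP spP in auto)
  have in_le: "AE z in PY. \<bar>\<integral>y. ?h y z \<partial>PX\<bar> \<le> K * (C2 * \<epsilon>\<^sup>2)"
    using AEz
  proof eventually_elim
    case (elim z)
    let ?G = "{y. (y, z) \<in> G}"
    show ?case
    proof (cases "?G = {}")
      case True
      then have "(\<lambda>y. ?h y z) = (\<lambda>y. 0)" by auto
      then have "(\<integral>y. ?h y z \<partial>PX) = 0" by (simp only: Bochner_Integration.integral_zero)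
      then show ?thesis using K C2 by simp
    next
      case False
      \<comment> \<open>A point of the section certifies that \<open>z\<close> lies in
        \<open>Z\<close> and that \<open>l z\<close> is a bounded functional, both of which concern
        \<open>z\<close> alone.\<close>
      then obtain y0 where y0: "(y0, z) \<in> G" by blast
      have sf: "continuous_field 2 PX ?G (\<lambda>y x. u y z x - u0 z x)" using section_field[OF field elim] by simp
      obtain W where W: "W \<in> H1_0 D" "W1p_norm 2 D W \<le> C2 * \<epsilon>\<^sup>2"
        "\<And>l. bounded_functional 2 l \<Longrightarrow> (\<integral>y. indicator ?G y * l (\<lambda>x. u y z x - u0 z x) \<partial>PX) = l W"
      proof -
        have "z \<in> Z" "u0 z \<in> W1p 2 D" using u[OF y0] wsolD(1) H1_0_D by (auto simp: good_pt_def)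
        then have "\<exists>W\<in>H1_0 D. W1p_norm 2 D W \<le> C2 * \<epsilon>\<^sup>2 \<and>
            (\<forall>l. bounded_functional 2 l \<longrightarrow> (\<integral>y. indicator ?G y * l (\<lambda>x. u y z x - u0 z x) \<partial>PX) = l W)"
          by (intro section_mean[OF XY.M1.prob_space_axioms centred \<epsilon> _ _ _ sf]) (use u in auto)
        then show thesis using that by blast
      qed
      have "(\<integral>y. ?h y z \<partial>PX) = (\<integral>y. indicator ?G y * l z (\<lambda>x. u y z x - u0 z x) \<partial>PX)"
        by (intro Bochner_Integration.integral_cong) (auto simp: indicator_def)
      also have "\<dots> = l z W" by (rule W(3)[OF l(1)[OF y0]])
      finally have "\<bar>\<integral>y. ?h y z \<partial>PX\<bar> \<le> K * W1p_norm 2 D W" using l(2)[OF y0 H1_0_D[OF W(1)]] by simp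
      also have "\<dots> \<le> K * (C2 * \<epsilon>\<^sup>2)" using W(2) K by (rule mult_left_mono)
      finally show ?thesis .
    qed
  qed
  have i2: "integrable PY (\<lambda>z. \<integral>y. ?h y z \<partial>PX)" by (rule XY.integrable_snd[OF int])
  have "(\<integral>w. (case w of (y, z) \<Rightarrow> ?h y z) \<partial>P) = (\<integral>z. (\<integral>y. ?h y z \<partial>PX) \<partial>PY)"
    by (rule XY.integral_snd[OF int, symmetric])
  also have "\<bar>\<dots>\<bar> \<le> (\<integral>z. \<bar>\<integral>y. ?h y z \<partial>PX\<bar> \<partial>PY)" by (rule integral_abs_bound)
  also have "\<dots> \<le> (\<integral>z. K * (C2 * \<epsilon>\<^sup>2) \<partial>PY)" by (rule integral_mono_AE) (use i2 in_le in auto)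
  also have "\<dots> = K * (C2 * \<epsilon>\<^sup>2)" by (simp add: XY.M2.prob_space)
  finally show ?thesis .
qed


lemma solution_fields:
  assumes G: "G \<in> sets borel" "bounded G" "AE w in P. w \<in> G"
    and u: "\<And>y z. (y, z) \<in> G \<Longrightarrow> good_pt y z \<and> wsol \<epsilon> y z (u y z) \<and> wsol 0 y z (u0 z)"
    and \<epsilon>: "0 \<le> \<epsilon>" "\<epsilon> \<le> alo / 2"
  shows "continuous_field 2 P G (\<lambda>(y, z). u y z)" "continuous_field 2 P G (\<lambda>(y, z). u0 z)"
  using u alo by (intro solution_field[OF XY.P.finite_measure_axioms sets_P G _ \<epsilon>] solution_field[OF XY.P.finite_measure_axioms sets_P G _ order_refl]; simp)+

lemma obtain_good_set:
  assumes "bounded Bd" "AE w in P. w \<in> Bd"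
    and "AE (y, z) in P. good_pt y z \<and> wsol \<epsilon> y z (u y z) \<and> wsol 0 y z (u0 z)"
  obtains G where "G \<in> sets borel" "bounded G" "AE w in P. w \<in> G"
    "\<And>y z. (y, z) \<in> G \<Longrightarrow> good_pt y z \<and> wsol \<epsilon> y z (u y z) \<and> wsol 0 y z (u0 z)"
proof -
  have "AE w in P. w \<in> Bd \<and> (case w of (y, z) \<Rightarrow> good_pt y z \<and> wsol \<epsilon> y z (u y z) \<and> wsol 0 y z (u0 z))"
    using assms(2,3) by eventually_elim auto
  then obtain G where G: "G \<in> sets P" "AE w in P. w \<in> G"
    "\<And>w. w \<in> G \<Longrightarrow> w \<in> Bd \<and> (case w of (y, z) \<Rightarrow> good_pt y z \<and> wsol \<epsilon> y z (u y z) \<and> wsol 0 y z (u0 z))"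
    by (rule AE_obtain_set) blast
  have "G \<subseteq> Bd" using G(3) by blast
  then have "bounded G" using assms(1) bounded_subset by blast
  moreover have "\<And>y z. (y, z) \<in> G \<Longrightarrow> good_pt y z \<and> wsol \<epsilon> y z (u y z) \<and> wsol 0 y z (u0 z)" using G(3) by fastforce
  ultimately show thesis using G(1,2) sets_P by (intro that) auto
qed

text \<open>The basic factor 6 is 2 from the norming functional times 3 from the product estimate.
  The mixed term contributes 12; the term with the mean error contributes 24, its norm being at most
  2 \<open>C2\<close> \<epsilon>^2; together they give 36. The square of the fluctuation contributes
  the last summand.\<close>

definition Cvar :: "(real^'d \<Rightarrow> real) \<Rightarrow> real" where
  "Cvar m = 36 * (C2 * (Bu + W1p_norm 2 D m)) + 6 * (C1 + 2 * C2)\<^sup>2"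

text \<open>Both estimates apply the norming functional of the quantity to be bounded, so that a
  field enters only through a scalar function on the parameters, to which Fubini's theorem
  applies.\<close>

lemma averaged_estimates:
  assumes G: "G \<in> sets borel" "bounded G" "AE w in P. w \<in> G"
    and u: "\<And>y z. (y, z) \<in> G \<Longrightarrow> good_pt y z \<and> wsol \<epsilon> y z (u y z) \<and> wsol 0 y z (u0 z)"
    and \<epsilon>: "0 \<le> \<epsilon>" "\<epsilon> \<le> alo / 2" "\<epsilon> \<le> 1"
  defines "U \<equiv> (\<lambda>(y, z). u y z)" and "U0 \<equiv> (\<lambda>(y, z). u0 z)"
  shows "W1p_norm 2 D (\<lambda>x. mean_field D P U x - mean_field D P U0 x) \<le> 2 * C2 * \<epsilon>\<^sup>2"
    and "(\<lambda>x. variance_field D P U x - variance_field D P U0 x) \<in> W1p_0 1 D"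
    and "W1p_norm 1 D (\<lambda>x. variance_field D P U x - variance_field D P U0 x) \<le> Cvar (mean_field D P U0) * \<epsilon>\<^sup>2"
proof -
  have p1: "(1::nat) \<in> {1, 2}" and p2: "(2::nat) \<in> {1, 2}" by auto
  let ?N = "W1p_norm 2 D" and ?N1 = "W1p_norm 1 D" and ?I = "\<lambda>w. indicator G w :: real"
  define m where "m = mean_field D P U"
  define m0 where "m0 = mean_field D P U0"
  define h where "h x = m x - m0 x" for x
  have UF: "continuous_field 2 P G U" "continuous_field 2 P G U0"
    unfolding U_def U0_def by (rule solution_fields[OF G u \<epsilon>(1,2)], assumption)+
  note mv = continuous_field_mean[OF UF(1), folded m_def] and mv0 = continuous_field_mean[OF UF(2), folded m0_def]
  have h: "h \<in> H1_0 D" unfolding h_def[abs_def] by (rule H1_0_diff[OF mv(2) mv0(2)])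
  define w where "w p x = U p x - U0 p x" for p x
  have wF: "continuous_field 2 P G w" unfolding w_def[abs_def] by (rule continuous_field_diff[OF UF])
  have w_eq: "w = (\<lambda>(y, z) x. u y z x - u0 z x)" by (intro ext) (auto simp: w_def U_def U0_def split: prod.split)
  have W: "U p \<in> W1p 2 D" "U0 p \<in> W1p 2 D" "w p \<in> W1p 2 D" if "p \<in> G" for p
    using UF wF that H1_0_D unfolding continuous_field_2 by blast+
  have wN: "?N (w p) \<le> C1 * \<epsilon>" and U0N: "?N (U0 p) \<le> Bu" if "p \<in> G" for p
  proof -
    obtain y z where p: "p = (y, z)" by (cases p)
    note g = u[OF that[unfolded p]]
    show "?N (w p) \<le> C1 * \<epsilon>" using sol_perturbation[OF _ \<epsilon>(1,2), of y z] g by (simp add: w_eq p)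
    show "?N (U0 p) \<le> Bu" using sol_bound[of y z 0] g alo by (simp add: U0_def p)
  qed
  have first: "\<bar>\<integral>p. ?I p * l (snd p) (w p) \<partial>P\<bar> \<le> K * (C2 * \<epsilon>\<^sup>2)"
    if l: "\<And>p. p \<in> G \<Longrightarrow> bounded_functional 2 (l (snd p))"
      "\<And>p g. p \<in> G \<Longrightarrow> g \<in> W1p 2 D \<Longrightarrow> \<bar>l (snd p) g\<bar> \<le> K * ?N g"
      and K: "0 \<le> K" and int: "integrable P (\<lambda>p. ?I p * l (snd p) (w p))" for l K
  proof -
    have e: "(\<lambda>p. ?I p * l (snd p) (w p)) = (\<lambda>(y, z). indicator G (y, z) * l z (\<lambda>x. u y z x - u0 z x))"
      by (auto simp: w_eq)
    show ?thesis
      unfolding e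
    proof (rule mean_first_order[OF wF[unfolded w_eq] u \<epsilon>(1,2) _ _ K int[unfolded e]])
      show "bounded_functional 2 (l z)" if "(y, z) \<in> G" for y z using l(1)[OF that] by simp
      show "\<bar>l z g\<bar> \<le> K * ?N g" if "(y, z) \<in> G" "g \<in> W1p 2 D" for y z g using l(2)[OF that] by simp
    qed
  qed
  show mean: "?N (\<lambda>x. mean_field D P U x - mean_field D P U0 x) \<le> 2 * C2 * \<epsilon>\<^sup>2"
  proof -
    have hW: "h \<in> W1p (real 2) D" using H1_0_D[OF h] by simp
    obtain l where l: "bounded_functional 2 l" "l h = ?N h ^ 2"
      "\<And>g. g \<in> W1p 2 D \<Longrightarrow> \<bar>l g\<bar> \<le> 2 * ?N h ^ 1 * ?N g"
      using norming_functional[OF p2 hW] by auto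
    note int = continuous_field_measurable(1)[OF p2 _ l(1)]
    have "l h = l m - l m0"
      unfolding h_def[abs_def] using bounded_functional_diff[OF p2 l(1)] H1_0_D[OF mv(2)] H1_0_D[OF mv0(2)] by simp
    also have "\<dots> = (\<integral>p. ?I p * l (U p) \<partial>P) - (\<integral>p. ?I p * l (U0 p) \<partial>P)"
      using continuous_field_integral(3)[OF p2 UF(1) l(1)] continuous_field_integral(3)[OF p2 UF(2) l(1)]
      by (simp add: m_def m0_def mean_field_def)
    also have "\<dots> = (\<integral>p. ?I p * l (U p) - ?I p * l (U0 p) \<partial>P)"
      by (rule Bochner_Integration.integral_diff[OF int[OF UF(1)] int[OF UF(2)], symmetric])
    also have "\<dots> = (\<integral>p. ?I p * l (w p) \<partial>P)"
    proof (rule Bochner_Integration.integral_cong[OF refl])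
      show "?I p * l (U p) - ?I p * l (U0 p) = ?I p * l (w p)" for p
        using bounded_functional_diff[OF p2 l(1)] W[of p] by (cases "p \<in> G") (auto simp: w_def[abs_def])
    qed
    also have "\<dots> \<le> (2 * ?N h) * (C2 * \<epsilon>\<^sup>2)"
      using first[of "\<lambda>z. l" "2 * ?N h"] l int[OF wF] by simp
    \<comment> \<open>The norming functional of \<open>h\<close> takes the value
      \<open>?N h ^ 2\<close> and has size \<open>2 * ?N h\<close>, so one factor cancels and a
      factor 2 remains.\<close>
    finally have "?N h * ?N h \<le> ?N h * (2 * C2 * \<epsilon>\<^sup>2)" using l(2) by (simp add: power2_eq_square algebra_simps)
    then have "?N h \<le> 2 * C2 * \<epsilon>\<^sup>2"
      using C2 by (cases "?N h = 0") (auto simp: order.strict_iff_order)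
    then show ?thesis by (simp add: h_def[abs_def] m_def m0_def)
  qed
  then have hN: "?N h \<le> 2 * C2 * \<epsilon>\<^sup>2" by (simp add: h_def[abs_def] m_def m0_def)
  define B where "B = Bu + ?N m0"
  have B: "0 \<le> B" using Bu by (simp add: B_def)
  define b where "b p x = U0 p x - m0 x" for p x
  have bF: "continuous_field 2 P G b" using mv0(3) by (simp add: b_def[abs_def])
  have hF: "continuous_field 2 P G (\<lambda>p. h)" by (rule continuous_field_const[OF wF h])
  define \<delta> where "\<delta> p x = w p x - h x" for p x
  have \<delta>F: "continuous_field 2 P G \<delta>" unfolding \<delta>_def[abs_def] by (rule continuous_field_diff[OF wF hF])
  have b0: "b p \<in> H1_0 D" and \<delta>0: "\<delta> p \<in> H1_0 D" if "p \<in> G" for p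
    using bF \<delta>F that unfolding continuous_field_2 by blast+
  have bN: "?N (b p) \<le> B" if "p \<in> G" for p
    using H1_norm_diff_le[OF W(2)[OF that] H1_0_D[OF mv0(2)]] U0N[OF that] by (simp add: b_def[abs_def] B_def)
  \<comment> \<open>The mean error is of order \<epsilon>^2 while the pointwise error is of order
    \<epsilon>; bounding the former by the latter gives the fluctuation \<open>\<delta>\<close> a
    bound of order \<epsilon>.\<close>
  have \<epsilon>2: "\<epsilon>\<^sup>2 \<le> \<epsilon>" using \<epsilon> by (simp add: power2_eq_square mult_left_le)
  have \<delta>N: "?N (\<delta> p) \<le> (C1 + 2 * C2) * \<epsilon>" if "p \<in> G" for p
  proof -
    have "?N (\<delta> p) \<le> ?N (w p) + ?N h" unfolding \<delta>_def[abs_def] by (rule H1_norm_diff_le[OF W(3)[OF that] H1_0_D[OF h]])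
    also have "\<dots> \<le> C1 * \<epsilon> + 2 * C2 * \<epsilon>" using wN[OF that] hN \<epsilon>2 C2 mult_left_mono[OF \<epsilon>2, of "2 * C2"] by simp
    finally show ?thesis by (simp add: algebra_simps)
  qed
  let ?v = "\<lambda>x. variance_field D P U x - variance_field D P U0 x"
  have var0: "variance_field D P U \<in> W1p_0 1 D" "variance_field D P U0 \<in> W1p_0 1 D"
    using continuous_field_integral(2)[OF p1 mv(4)] continuous_field_integral(2)[OF p1 mv0(4)]
    by (simp_all add: variance_field_def)
  show v0: "?v \<in> W1p_0 1 D" using W1p_0_diff[OF p1, of "variance_field D P U" "variance_field D P U0"] var0 by simp
  show "?N1 ?v \<le> Cvar (mean_field D P U0) * \<epsilon>\<^sup>2"
  proof -
    have vW: "?v \<in> W1p (real 1) D" using W11_0_D[OF v0] by simp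
    obtain l where l: "bounded_functional 1 l" "l ?v = ?N1 ?v"
      "\<And>g. g \<in> W1p 1 D \<Longrightarrow> \<bar>l g\<bar> \<le> 2 * ?N1 g"
      using norming_functional[OF p1 vW] by auto
    note int = continuous_field_measurable(1)[OF p1 _ l(1)]
    note add = bounded_functionalD(1)[OF p1 l(1), unfolded of_nat_1] and mult = bounded_functionalD(2)[OF p1 l(1), unfolded of_nat_1]
      and diff = bounded_functional_diff[OF p1 l(1), unfolded of_nat_1]
    have lm: "\<bar>l (\<lambda>x. f x * g x)\<bar> \<le> 6 * (?N f * ?N g)" if "f \<in> W1p 2 D" "g \<in> H1_0 D" for f g
      using l(3)[OF H1_mult(1)[OF that]] H1_mult(3)[OF that] by linarith
    define s where "s = sq_deviation D P U"
    define s0 where "s0 = sq_deviation D P U0"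
    define A where "A p = l (\<lambda>x. w p x * b p x)" for p
    \<comment> \<open>The part of the integrand that is already of second order for each parameter:
      the square of the fluctuation and the product with the mean error. The remaining part
      \<open>A\<close> is of first order and becomes small only after averaging.\<close>
    define R where "R p = l (\<lambda>x. \<delta> p x * \<delta> p x) - 2 * l (\<lambda>x. h x * b p x)" for p
    have iA: "integrable P (\<lambda>p. ?I p * A p)" unfolding A_def by (rule int[OF continuous_field_mult[OF wF bF]])
    have iR: "integrable P (\<lambda>p. ?I p * R p)"
      using int[OF continuous_field_mult[OF \<delta>F \<delta>F]] int[OF continuous_field_mult[OF hF bF]]
      unfolding R_def right_diff_distrib mult.left_commute[of _ 2] by (intro Bochner_Integration.integrable_diff integrable_mult_right)
    have lin: "l (s p) - l (s0 p) = 2 * A p + R p" if p: "p \<in> G" for p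
    proof -
      let ?a = "\<lambda>x. w p x * b p x" and ?d = "\<lambda>x. \<delta> p x * \<delta> p x" and ?c = "\<lambda>x. h x * b p x"
      have aW: "?a \<in> W1p 1 D" "?d \<in> W1p 1 D" "?c \<in> W1p 1 D"
        by (intro H1_mult(1) W(3)[OF p] b0[OF p] \<delta>0[OF p] H1_0_D h)+
      have sW: "s p \<in> W1p 1 D" "s0 p \<in> W1p 1 D"
        using mv(4) mv0(4) p W11_0_D unfolding s_def s0_def continuous_field_1 by blast+
      have "l (s p) - l (s0 p) = l (\<lambda>x. s p x - s0 p x)" by (rule diff[OF sW, symmetric])
      \<comment> \<open>The new deviation is \<open>b p + \<delta> p\<close> and the old one is
        \<open>b p\<close>; expanding the square and using \<open>\<delta> p = w p - h\<close>
        separates the term that has to be averaged.\<close>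
      also have "(\<lambda>x. s p x - s0 p x) = (\<lambda>x. 2 * ?a x + (?d x + (-2) * ?c x))"
        unfolding s_def s0_def sq_deviation_def m_def[symmetric] m0_def[symmetric]
        by (rule ext) (simp add: w_def b_def \<delta>_def h_def power2_eq_square algebra_simps)
      also have "l \<dots> = 2 * l ?a + (l ?d + (-2) * l ?c)"
        using aW by (simp only: add mult W11_add(1) W11_cmult(1))
      finally show ?thesis by (simp add: A_def R_def)
    qed
    have "l ?v = l (variance_field D P U) - l (variance_field D P U0)" by (rule diff[OF W11_0_D[OF var0(1)] W11_0_D[OF var0(2)]])
    also have "\<dots> = (\<integral>p. ?I p * l (s p) \<partial>P) - (\<integral>p. ?I p * l (s0 p) \<partial>P)"
      using continuous_field_integral(3)[OF p1 mv(4) l(1)] continuous_field_integral(3)[OF p1 mv0(4) l(1)]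
      by (simp add: s_def s0_def variance_field_def)
    also have "\<dots> = (\<integral>p. ?I p * l (s p) - ?I p * l (s0 p) \<partial>P)"
      unfolding s_def s0_def by (rule Bochner_Integration.integral_diff[OF int[OF mv(4)] int[OF mv0(4)], symmetric])
    also have "\<dots> = (\<integral>p. 2 * (?I p * A p) + ?I p * R p \<partial>P)"
    proof (rule Bochner_Integration.integral_cong[OF refl])
      show "?I p * l (s p) - ?I p * l (s0 p) = 2 * (?I p * A p) + ?I p * R p" for p
        using lin[of p] by (cases "p \<in> G") auto
    qed
    also have "\<dots> = 2 * (\<integral>p. ?I p * A p \<partial>P) + (\<integral>p. ?I p * R p \<partial>P)" using iA iR by simp
    also have "(\<integral>p. ?I p * A p \<partial>P) \<le> (6 * B) * (C2 * \<epsilon>\<^sup>2)"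
    proof -
      have bs: "b p = (\<lambda>x. u0 (snd p) x - m0 x)" for p by (auto simp: b_def U0_def case_prod_unfold)
      \<comment> \<open>Since \<open>b\<close> depends on the parameter through \<open>z\<close>
        only, multiplication by it can be absorbed into the functional, which then varies with
        \<open>z\<close> and stays fixed along \<open>y\<close>.\<close>
      have "\<bar>\<integral>p. ?I p * (\<lambda>z g. l (\<lambda>x. g x * (u0 z x - m0 x))) (snd p) (w p) \<partial>P\<bar> \<le> (6 * B) * (C2 * \<epsilon>\<^sup>2)"
      proof (rule first)
        fix p assume p: "p \<in> G"
        note bp = b0[OF p, unfolded bs]
        show "bounded_functional 2 (\<lambda>g. l (\<lambda>x. g x * (u0 (snd p) x - m0 x)))" by (rule bounded_functional_mult[OF l(1) bp])
        fix g assume g: "g \<in> W1p 2 D"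
        have "\<bar>l (\<lambda>x. g x * (u0 (snd p) x - m0 x))\<bar> \<le> 6 * (?N g * ?N (b p))" using lm[OF g bp] by (simp add: bs)
        also have "\<dots> \<le> 6 * (?N g * B)" using bN[OF p] by (intro mult_left_mono) auto
        finally show "\<bar>l (\<lambda>x. g x * (u0 (snd p) x - m0 x))\<bar> \<le> 6 * B * ?N g" by (simp add: algebra_simps)
      next
        show "0 \<le> 6 * B" using B by simp
        show "integrable P (\<lambda>p. ?I p * l (\<lambda>x. w p x * (u0 (snd p) x - m0 x)))" using iA by (simp add: A_def bs)
      qed
      then show ?thesis by (simp add: A_def bs)
    qed
    also have "(\<integral>p. ?I p * R p \<partial>P) \<le> (\<integral>p. 6 * ((C1 + 2 * C2)\<^sup>2 * \<epsilon>\<^sup>2) + 24 * (C2 * B * \<epsilon>\<^sup>2) \<partial>P)"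
    proof (rule integral_mono_AE[OF iR])
      show "AE p in P. ?I p * R p \<le> 6 * ((C1 + 2 * C2)\<^sup>2 * \<epsilon>\<^sup>2) + 24 * (C2 * B * \<epsilon>\<^sup>2)"
        using G(3)
      proof eventually_elim
        case (elim p)
        have "l (\<lambda>x. \<delta> p x * \<delta> p x) \<le> 6 * (?N (\<delta> p) * ?N (\<delta> p))" using lm[OF H1_0_D[OF \<delta>0[OF elim]] \<delta>0[OF elim]] by linarith
        also have "\<dots> \<le> 6 * (((C1 + 2 * C2) * \<epsilon>) * ((C1 + 2 * C2) * \<epsilon>))"
          using \<delta>N[OF elim] C1 C2 \<epsilon>(1) by (intro mult_left_mono mult_mono) auto
        finally have 1: "l (\<lambda>x. \<delta> p x * \<delta> p x) \<le> 6 * ((C1 + 2 * C2)\<^sup>2 * \<epsilon>\<^sup>2)" by (simp add: power2_eq_square algebra_simps)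
        have "- l (\<lambda>x. h x * b p x) \<le> 6 * (?N h * ?N (b p))" using lm[OF H1_0_D[OF h] b0[OF elim]] by linarith
        also have "\<dots> \<le> 6 * ((2 * C2 * \<epsilon>\<^sup>2) * B)"
          using hN bN[OF elim] C2 by (intro mult_left_mono mult_mono) auto
        finally show ?case using 1 elim by (simp add: R_def algebra_simps)
      qed
    qed simp
    also have "\<dots> = 6 * ((C1 + 2 * C2)\<^sup>2 * \<epsilon>\<^sup>2) + 24 * (C2 * B * \<epsilon>\<^sup>2)" by (simp add: XY.P.prob_space)
    finally have "l ?v \<le> 2 * ((6 * B) * (C2 * \<epsilon>\<^sup>2)) + (6 * ((C1 + 2 * C2)\<^sup>2 * \<epsilon>\<^sup>2) + 24 * (C2 * B * \<epsilon>\<^sup>2))" by simp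
    also have "\<dots> = Cvar m0 * \<epsilon>\<^sup>2" by (simp add: Cvar_def B_def algebra_simps)
    finally show ?thesis by (simp add: l(2) m0_def)
  qed
qed


lemma Cvar_nonneg: "0 \<le> Cvar m"
  using Bu C2 by (simp add: Cvar_def)

text \<open>The exceptional null set depends on \<epsilon> and on the family \<open>u\<close>, so a
  new \<open>G\<close> is chosen for each; the constants are fixed beforehand. The means do not
  refer to \<open>G\<close>, which keeps the statements for different sets compatible.\<close>

lemma mean_variance_perturbation:
  assumes box: "bounded Bd" "AE w in P. w \<in> Bd"
    and good_u0: "AE (y, z) in P. good_pt y z \<and> wsol 0 y z (u0 z)"
  shows "has_mean_and_variance D P (\<lambda>(y, z). u0 z) \<and>
    (\<exists>\<epsilon>0>0. \<exists>C>0. \<forall>\<epsilon>. 0 < \<epsilon> \<and> \<epsilon> \<le> \<epsilon>0 \<longrightarrow>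
       (\<forall>u :: real^'n \<Rightarrow> real^'m \<Rightarrow> real^'d \<Rightarrow> real.
          (AE (y, z) in P. wsol \<epsilon> y z (u y z)) \<longrightarrow>
          (let Ediff = (\<lambda>X. mean_field D P (\<lambda>(y, z). u y z) X - mean_field D P (\<lambda>(y, z). u0 z) X);
               Vdiff = (\<lambda>X. variance_field D P (\<lambda>(y, z). u y z) X - variance_field D P (\<lambda>(y, z). u0 z) X)
           in has_mean_and_variance D P (\<lambda>(y, z). u y z)
              \<and> Ediff \<in> H1_0 D \<and> W1p_norm 2 D Ediff \<le> C * \<epsilon>\<^sup>2
              \<and> Vdiff \<in> W1p_0 1 D \<and> W1p_norm 1 D Vdiff \<le> C * \<epsilon>\<^sup>2)))"
proof (rule conjI)
  have half: "0 \<le> alo / 2" using alo by simp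
  have "AE (y, z) in P. good_pt y z \<and> wsol 0 y z (u0 z) \<and> wsol 0 y z (u0 z)" using good_u0 by simp
  from obtain_good_set[where u="\<lambda>y z. u0 z", OF box this]
  obtain G where G: "G \<in> sets borel" "bounded G" "AE w in P. w \<in> G"
    "\<And>y z. (y, z) \<in> G \<Longrightarrow> good_pt y z \<and> wsol 0 y z (u0 z) \<and> wsol 0 y z (u0 z)" by blast
  show "has_mean_and_variance D P (\<lambda>(y, z). u0 z)"
    by (rule continuous_field_mean(1)[OF solution_fields(2)[where u="\<lambda>y z. u0 z", OF G order_refl half]])
  let ?m0 = "mean_field D P (\<lambda>(y, z). u0 z)"
  \<comment> \<open>The norm of the unperturbed mean enters through \<open>Cvar\<close>; it is fixed
    because \<open>u0\<close> is. The summand 1 ensures positivity.\<close>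
  define C where "C = 2 * C2 + Cvar ?m0 + 1"
  have C: "0 < C" "2 * C2 \<le> C" "Cvar ?m0 \<le> C" using C2 Cvar_nonneg[of ?m0] by (auto simp: C_def)
  show "\<exists>\<epsilon>0>0. \<exists>C>0. \<forall>\<epsilon>. 0 < \<epsilon> \<and> \<epsilon> \<le> \<epsilon>0 \<longrightarrow>
       (\<forall>u :: real^'n \<Rightarrow> real^'m \<Rightarrow> real^'d \<Rightarrow> real.
          (AE (y, z) in P. wsol \<epsilon> y z (u y z)) \<longrightarrow>
          (let Ediff = (\<lambda>X. mean_field D P (\<lambda>(y, z). u y z) X - mean_field D P (\<lambda>(y, z). u0 z) X);
               Vdiff = (\<lambda>X. variance_field D P (\<lambda>(y, z). u y z) X - variance_field D P (\<lambda>(y, z). u0 z) X)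
           in has_mean_and_variance D P (\<lambda>(y, z). u y z)
              \<and> Ediff \<in> H1_0 D \<and> W1p_norm 2 D Ediff \<le> C * \<epsilon>\<^sup>2
              \<and> Vdiff \<in> W1p_0 1 D \<and> W1p_norm 1 D Vdiff \<le> C * \<epsilon>\<^sup>2))"
  \<comment> \<open>The bound \<open>alo / 2\<close> preserves ellipticity, the bound 1 allows
    \<epsilon>^2 \<le> \<epsilon>.\<close>
  proof (rule exI[of _ "min (alo / 2) 1"], intro exI[of _ C] conjI allI impI)
    show "0 < min (alo / 2) 1" using alo by simp
    show "0 < C" by (rule C(1))
    fix \<epsilon> and u :: "real^'n \<Rightarrow> real^'m \<Rightarrow> real^'d \<Rightarrow> real"
    assume "0 < \<epsilon> \<and> \<epsilon> \<le> min (alo / 2) 1"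
    then have \<epsilon>: "0 \<le> \<epsilon>" "\<epsilon> \<le> alo / 2" "\<epsilon> \<le> 1" by auto
    assume "AE (y, z) in P. wsol \<epsilon> y z (u y z)"
    then have "AE (y, z) in P. good_pt y z \<and> wsol \<epsilon> y z (u y z) \<and> wsol 0 y z (u0 z)"
      using good_u0 by eventually_elim auto
    from obtain_good_set[OF box this]
    obtain G where G: "G \<in> sets borel" "bounded G" "AE w in P. w \<in> G"
      "\<And>y z. (y, z) \<in> G \<Longrightarrow> good_pt y z \<and> wsol \<epsilon> y z (u y z) \<and> wsol 0 y z (u0 z)" by blast
    note sf = solution_fields[OF G \<epsilon>(1,2)]
    note est = averaged_estimates[OF G \<epsilon>]
    have "x \<le> C * \<epsilon>\<^sup>2" if "x \<le> a * \<epsilon>\<^sup>2" "a \<le> C" for x a :: real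
      using mult_right_mono[OF that(2), of "\<epsilon>\<^sup>2"] that(1) by simp
    note le = this[OF est(1) C(2)] this[OF est(3) C(3)]
    have "(\<lambda>X. mean_field D P (\<lambda>(y, z). u y z) X - mean_field D P (\<lambda>(y, z). u0 z) X) \<in> H1_0 D"
      by (intro H1_0_diff continuous_field_mean(2)[OF sf(1)] continuous_field_mean(2)[OF sf(2)])
    with le est(2) continuous_field_mean(1)[OF sf(1)]
    show "let Ediff = (\<lambda>X. mean_field D P (\<lambda>(y, z). u y z) X - mean_field D P (\<lambda>(y, z). u0 z) X);
               Vdiff = (\<lambda>X. variance_field D P (\<lambda>(y, z). u y z) X - variance_field D P (\<lambda>(y, z). u0 z) X)
           in has_mean_and_variance D P (\<lambda>(y, z). u y z)
              \<and> Ediff \<in> H1_0 D \<and> W1p_norm 2 D Ediff \<le> C * \<epsilon>\<^sup>2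
              \<and> Vdiff \<in> W1p_0 1 D \<and> W1p_norm 1 D Vdiff \<le> C * \<epsilon>\<^sup>2"
      unfolding Let_def by blast
  qed
qed

end

section \<open>From the random data to the abstract setting\<close>

text \<open>The cylinder over a null set is null in the product. Working with a measurable null set
  around the exceptions lets the properties \<open>A\<close> and \<open>B\<close> be
  nonmeasurable.\<close>

lemma AE_pair_fst_snd:
  assumes "sigma_finite_measure Q"
  shows "AE y in P. A y \<Longrightarrow> AE (y, z) in P \<Otimes>\<^sub>M Q. A y" and "AE z in Q. B z \<Longrightarrow> AE (y, z) in P \<Otimes>\<^sub>M Q. B z"
proof -
  interpret Q: sigma_finite_measure Q by fact
  show "AE (y, z) in P \<Otimes>\<^sub>M Q. A y" if a: "AE y in P. A y"
  proof -
    obtain N where N: "{y \<in> space P. \<not> A y} \<subseteq> N" "emeasure P N = 0" "N \<in> sets P" using AE_E[OF a] by blast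
    show ?thesis
    proof (rule AE_I)
      show "{w \<in> space (P \<Otimes>\<^sub>M Q). \<not> (case w of (y, z) \<Rightarrow> A y)} \<subseteq> N \<times> space Q" using N(1) by (auto simp: space_pair_measure)
    qed (use N in \<open>auto simp: Q.emeasure_pair_measure_Times\<close>)
  qed
  show "AE (y, z) in P \<Otimes>\<^sub>M Q. B z" if b: "AE z in Q. B z"
  proof -
    obtain N where N: "{y \<in> space Q. \<not> B y} \<subseteq> N" "emeasure Q N = 0" "N \<in> sets Q" using AE_E[OF b] by blast
    show ?thesis
    proof (rule AE_I)
      show "{w \<in> space (P \<Otimes>\<^sub>M Q). \<not> (case w of (y, z) \<Rightarrow> B z)} \<subseteq> space P \<times> N" using N(1) by (auto simp: space_pair_measure)
    qed (use N in \<open>auto simp: Q.emeasure_pair_measure_Times\<close>)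
  qed
qed

lemma Lp_2_square_integrable:
  assumes "f \<in> Lp 2 H"
  shows "square_integrable (lebesgue_on H) f"
proof -
  have "norm (f x) powr 2 = (norm (f x))\<^sup>2" for x using powr_realpow'[of "norm (f x)" 2] by simp
  then show ?thesis using assms by (simp add: Lp_def square_integrable_def)
qed

lemma Linf_AE_bound:
  assumes "u \<in> Linf H"
  shows "\<exists>K. AE x in lebesgue_on H. \<bar>u x\<bar> \<le> K"
proof -
  obtain K where K: "Linf_norm H u < ereal K" using assms less_PInf_Ex_of_nat[of "Linf_norm H u"] by (auto simp: Linf_def)
  have "AE x in lebesgue_on H. \<bar>u x\<bar> \<le> K"
    using esssup_AE[of "\<lambda>x. ereal \<bar>u x\<bar>" "lebesgue_on H"]
  proof eventually_elim
    case (elim x)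
    then have "ereal \<bar>u x\<bar> \<le> ereal K" using K unfolding Linf_norm_def by (rule order_trans[OF _ less_imp_le])
    then show ?case by simp
  qed
  then show ?thesis by blast
qed

lemma kl_expansion_continuous:
  fixes EV :: "real^'d::finite \<Rightarrow> real^'d" and \<phi> :: "'m::finite \<Rightarrow> real^'d \<Rightarrow> real^'d"
  assumes "continuous_on S EV" "\<And>k. continuous_on S (\<phi> k)"
  shows "continuous_on (T \<times> S) (\<lambda>(z, x). kl_expansion EV \<mu> \<phi> z x)"
proof -
  have "continuous_on (T \<times> S) (\<lambda>w. EV (snd w))" "continuous_on (T \<times> S) (\<lambda>w. \<phi> k (snd w))" for k
    by (rule continuous_on_compose2[OF assms(1)] continuous_on_compose2[OF assms(2)]; auto intro!: continuous_intros)+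
  then show ?thesis
    unfolding kl_expansion_def case_prod_unfold by (intro continuous_intros)
qed

text \<open>The hold-all set ranges over all parameters of the box, including exceptional ones for
  which the map is no diffeomorphism, so its openness cannot be drawn from invariance of domain.
  Exhausting \<open>D\<close> by compact sets shows it to be a countable union of compact images of
  a jointly continuous map.\<close>

lemma hold_all_lmeasurable:
  fixes EV :: "real^'d::finite \<Rightarrow> real^'d" and \<phi> :: "'m::finite \<Rightarrow> real^'d \<Rightarrow> real^'d"
  assumes D: "open D" "bounded D" and C1: "EV \<in> C1_closure D" "\<And>k. \<phi> k \<in> C1_closure D"
  shows "hold_all (kl_expansion EV \<mu> \<phi>) D \<in> lmeasurable"
proof -
  let ?g = "\<lambda>(z, x). kl_expansion EV \<mu> \<phi> z x"
  have cont: "continuous_on (parameter_box \<times> closure D) ?g"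
    using C1 by (intro kl_expansion_continuous) (auto simp: C1_closure_def)
  obtain K where K: "\<And>n::nat. compact (K n)" "\<And>n. K n \<subseteq> D" "D = (\<Union>n. K n)"
    using open_Union_compact_subsets[OF D(1)] by metis
  have comp: "compact (?g ` (parameter_box \<times> S))" if "compact S" "S \<subseteq> closure D" for S
    using that by (intro compact_continuous_image continuous_on_subset[OF cont] compact_Times parameter_box_compact) auto
  have eq: "hold_all (kl_expansion EV \<mu> \<phi>) D = ?g ` (parameter_box \<times> D)" by (auto simp: hold_all_def image_iff)
  show ?thesis
  proof (rule bounded_set_imp_lmeasurable)
    have "hold_all (kl_expansion EV \<mu> \<phi>) D \<subseteq> ?g ` (parameter_box \<times> closure D)"
      unfolding eq using closure_subset by (intro image_mono) auto
    moreover have "bounded (?g ` (parameter_box \<times> closure D))"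
      using D(2) by (intro compact_imp_bounded comp) (auto simp: compact_closure)
    ultimately show "bounded (hold_all (kl_expansion EV \<mu> \<phi>) D)" using bounded_subset by blast
    have "hold_all (kl_expansion EV \<mu> \<phi>) D = (\<Union>n. ?g ` (parameter_box \<times> K n))" unfolding eq using K(3) by blast
    moreover have "?g ` (parameter_box \<times> K n) \<in> sets lebesgue" for n
    proof -
      have "K n \<subseteq> closure D" using K(2)[of n] closure_subset[of D] by (rule subset_trans)
      from compact_imp_closed[OF comp[OF K(1) this]]
      show ?thesis by (intro sets_completionI_sets) (simp add: borel_closed)
    qed
    ultimately show "hold_all (kl_expansion EV \<mu> \<phi>) D \<in> sets lebesgue" by auto
  qed
qed

text \<open>The expansion is a finite sum, affine in the parameter, with coefficients whose
  derivatives are continuous; so its Jacobian is jointly continuous in parameter and point, also at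
  parameters where the map is no diffeomorphism.\<close>

lemma kl_expansion_tendsto:
  fixes EV :: "real^'d::finite \<Rightarrow> real^'d" and \<phi> :: "'m::finite \<Rightarrow> real^'d \<Rightarrow> real^'d"
  assumes D: "open D" and C1: "EV \<in> C1_closure D" "\<And>k. \<phi> k \<in> C1_closure D" and z: "zn \<longlonglongrightarrow> z"
  shows "(\<lambda>n. kl_expansion EV \<mu> \<phi> (zn n) X) \<longlonglongrightarrow> kl_expansion EV \<mu> \<phi> z X"
    and "\<And>Xn. (\<And>n. Xn n \<in> D) \<Longrightarrow> X \<in> D \<Longrightarrow> Xn \<longlonglongrightarrow> X \<Longrightarrow>
      (\<lambda>n. jacobian (kl_expansion EV \<mu> \<phi> (zn n)) (at (Xn n))) \<longlonglongrightarrow> jacobian (kl_expansion EV \<mu> \<phi> z) (at X)"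
proof -
  have zk: "(\<lambda>n. zn n $ k) \<longlonglongrightarrow> z $ k" for k by (rule tendsto_vec_nth[OF z])
  show "(\<lambda>n. kl_expansion EV \<mu> \<phi> (zn n) X) \<longlonglongrightarrow> kl_expansion EV \<mu> \<phi> z X"
    unfolding kl_expansion_def by (intro tendsto_intros zk)
  obtain E' :: "real^'d \<Rightarrow> (real^'d) \<Rightarrow>\<^sub>L (real^'d)" where E': "continuous_on (closure D) E'"
    "\<And>x. x \<in> D \<Longrightarrow> (EV has_derivative blinfun_apply (E' x)) (at x)" using C1(1) by (auto simp: C1_closure_def)
  have "\<forall>k. \<exists>g'::real^'d \<Rightarrow> (real^'d) \<Rightarrow>\<^sub>L (real^'d). continuous_on (closure D) g' \<and> (\<forall>x\<in>D. (\<phi> k has_derivative blinfun_apply (g' x)) (at x))"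
    using C1(2) by (auto simp: C1_closure_def)
  then obtain F' :: "'m \<Rightarrow> real^'d \<Rightarrow> (real^'d) \<Rightarrow>\<^sub>L (real^'d)" where F': "\<And>k. continuous_on (closure D) (F' k)"
    "\<And>k x. x \<in> D \<Longrightarrow> (\<phi> k has_derivative blinfun_apply (F' k x)) (at x)" by metis
  let ?T = "\<lambda>z x h. E' x h + (\<Sum>k\<in>UNIV. (sqrt (\<mu> k) * z $ k) *\<^sub>R F' k x h)"
  have J: "jacobian (kl_expansion EV \<mu> \<phi> z) (at x) $ i $ j = ?T z x (axis j 1) $ i" if "x \<in> D" for z x i j
  proof -
    have "(kl_expansion EV \<mu> \<phi> z has_derivative ?T z x) (at x)"
      unfolding kl_expansion_def[abs_def] by (intro derivative_intros E'(2) F'(2) that)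
    from frechet_derivative_at[OF this, symmetric]
    show ?thesis unfolding jacobian_def matrix_def by simp
  qed
  fix Xn :: "nat \<Rightarrow> real^'d"
  assume X: "\<And>n. Xn n \<in> D" "X \<in> D" "Xn \<longlonglongrightarrow> X"
  have cl: "X \<in> closure D" "\<And>n. Xn n \<in> closure D" using X closure_subset by auto
  have t: "(\<lambda>n. E' (Xn n)) \<longlonglongrightarrow> E' X" "(\<lambda>n. F' k (Xn n)) \<longlonglongrightarrow> F' k X" for k
    using continuous_on_tendsto_compose[OF E'(1) X(3) cl(1)] continuous_on_tendsto_compose[OF F'(1) X(3) cl(1)] cl(2) by auto
  show "(\<lambda>n. jacobian (kl_expansion EV \<mu> \<phi> (zn n)) (at (Xn n))) \<longlonglongrightarrow> jacobian (kl_expansion EV \<mu> \<phi> z) (at X)"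
    by (intro vec_tendstoI, unfold J[OF X(1)] J[OF X(2)]) (intro tendsto_intros zk blinfun.tendsto t)
qed

theorem theorem4p3:
  fixes D :: "(real^'d::finite) set"
    and \<rho>X :: "'n::finite \<Rightarrow> real \<Rightarrow> real" and \<rho>Y :: "'m::finite \<Rightarrow> real \<Rightarrow> real"
    and PX :: "(real^'n) measure" and PY :: "(real^'m) measure"
    and EV :: "real^'d \<Rightarrow> real^'d" and \<mu> :: "'m \<Rightarrow> real" and \<phi> :: "'m \<Rightarrow> real^'d \<Rightarrow> real^'d"
    and V :: "real^'m \<Rightarrow> real^'d \<Rightarrow> real^'d" and Cuni :: real
    and as :: "real^'d \<Rightarrow> real" and alo ahi :: real
    and lam :: "'n \<Rightarrow> real" and \<psi> :: "'n \<Rightarrow> real^'d \<Rightarrow> real" and ar :: "real^'n \<Rightarrow> real^'d \<Rightarrow> real"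
    and f :: "real^'d \<Rightarrow> real"
    and u0 :: "real^'m \<Rightarrow> real^'d \<Rightarrow> real"
  assumes domain: "bounded_lipschitz_domain D"
    and densities: "iid_centred_densities \<rho>X" "iid_centred_densities \<rho>Y"
    and laws: "PX = parameter_law \<rho>X" "PY = parameter_law \<rho>Y"
    and V: "V = kl_expansion EV \<mu> \<phi>"
    and V_data: "\<And>k. 0 \<le> \<mu> k" "EV \<in> C1_closure D" "\<And>k. \<phi> k \<in> C1_closure D"
    and V_diffeo: "AE z in PY. C1_diffeo_closure D (V z) \<and> (\<forall>X\<in>D. 0 < det (jacobian (V z) (at X)))"
    and V_uniform: "AE z in PY. C1_norm D (V z) \<le> Cuni
                      \<and> C1_norm (V z ` D) (inv_into (closure D) (V z)) \<le> Cuni"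
    and as_analytic: "\<exists>U. open U \<and> hold_all V D \<subseteq> U \<and> real_analytic_on U as"
    and as_bounds: "0 < alo" "\<And>x. x \<in> hold_all V D \<Longrightarrow> alo \<le> as x \<and> as x \<le> ahi"
    and ar: "ar = kl_expansion (\<lambda>x. 0) lam \<psi>"
    and ar_data: "\<And>k. 0 \<le> lam k" "\<And>k. \<psi> k \<in> Linf (hold_all V D)"
    and ar_bound: "AE (y, z) in PX \<Otimes>\<^sub>M PY. Linf_norm (V z ` D) (ar y) \<le> 1"
    and load: "f \<in> Lp 2 (hold_all V D)"
    and u0: "AE z in PY. weak_dirichlet_solution D (transported_coeff (V z) as)
                            (transported_load (V z) f) (u0 z)"
  shows "has_mean_and_variance D (PX \<Otimes>\<^sub>M PY) (\<lambda>(y, z). u0 z) \<and>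
    (\<exists>\<epsilon>0>0. \<exists>C>0. \<forall>\<epsilon>. 0 < \<epsilon> \<and> \<epsilon> \<le> \<epsilon>0 \<longrightarrow>
       (\<forall>u :: real^'n \<Rightarrow> real^'m \<Rightarrow> real^'d \<Rightarrow> real.
          (AE (y, z) in PX \<Otimes>\<^sub>M PY. weak_dirichlet_solution D
              (\<lambda>X. transported_coeff (V z) as X + \<epsilon> *\<^sub>R transported_coeff (V z) (ar y) X)
              (transported_load (V z) f) (u y z)) \<longrightarrow>
          (let P = PX \<Otimes>\<^sub>M PY;
               Ediff = (\<lambda>X. mean_field D P (\<lambda>(y, z). u y z) X - mean_field D P (\<lambda>(y, z). u0 z) X);
               Vdiff = (\<lambda>X. variance_field D P (\<lambda>(y, z). u y z) X
                            - variance_field D P (\<lambda>(y, z). u0 z) X)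
           in has_mean_and_variance D P (\<lambda>(y, z). u y z)
              \<and> Ediff \<in> H1_0 D \<and> W1p_norm 2 D Ediff \<le> C * \<epsilon>\<^sup>2
              \<and> Vdiff \<in> W1p_0 1 D \<and> W1p_norm 1 D Vdiff \<le> C * \<epsilon>\<^sup>2)))"
proof -
  have D: "open D" "bounded D" using domain by (auto simp: bounded_lipschitz_domain_def)
  interpret bounded_open_set D by unfold_locales (fact D)+
  \<comment> \<open>One constant for the map and its inverse; the maximum with 1 makes it positive
    without any assumption on \<open>Cuni\<close>.\<close>
  define L where "L = max Cuni 1"
  \<comment> \<open>The parameter box is included in the condition so that the images of
    \<open>D\<close> lie in the hold-all set.\<close>
  define Z where "Z = {z \<in> parameter_box. good_map D L (V z)}"
  define H where "H = hold_all V D"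
  obtain K\<psi> where K\<psi>: "\<And>k. AE x in lebesgue_on H. \<bar>\<psi> k x\<bar> \<le> K\<psi> k"
    using Linf_AE_bound[OF ar_data(2)] unfolding H_def by metis
  have Hm: "H \<in> lmeasurable" unfolding H_def V by (rule hold_all_lmeasurable[OF D V_data(2,3)])
  have as_cont: "continuous_on H as"
    using as_analytic real_analytic_continuous continuous_on_subset unfolding H_def by blast
  have PX: "prob_space PX" "sets PX = sets borel" and PY: "prob_space PY" "sets PY = sets borel"
    using prob_space_parameter_law[OF densities(1)] prob_space_parameter_law[OF densities(2)]
      sets_parameter_law[OF densities(1)] sets_parameter_law[OF densities(2)]
    by (simp_all add: laws)
  interpret X: prob_space PX by (rule PX)
  interpret Y: prob_space PY by (rule PY)
  interpret A: averaged_perturbation D V Z H L as alo ahi lam \<psi> K\<psi> f PX PY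
  proof (unfold_locales, unfold Z_def mem_Collect_eq)
    show "0 < L" by (simp add: L_def)
    show "H \<in> lmeasurable" by (rule Hm)
    show "V z ` D \<subseteq> H" if "z \<in> parameter_box \<and> good_map D L (V z)" for z using that by (auto simp: H_def hold_all_def)
    show "(\<lambda>n. V (zn n) X) \<longlonglongrightarrow> V z X" if "zn \<longlonglongrightarrow> z" for zn z X
      unfolding V by (rule kl_expansion_tendsto(1)[OF D(1) V_data(2,3) that])
    show "(\<lambda>n. jacobian (V (zn n)) (at (Xn n))) \<longlonglongrightarrow> jacobian (V z) (at X)"
      if "zn \<longlonglongrightarrow> z" "\<And>n. Xn n \<in> D" "X \<in> D" "Xn \<longlonglongrightarrow> X" for zn z Xn X
      unfolding V by (rule kl_expansion_tendsto(2)[OF D(1) V_data(2,3) that])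
    show "as \<in> borel_measurable (lebesgue_on H)"
      using Hm by (intro continuous_imp_measurable_on_sets_lebesgue as_cont) (simp add: fmeasurable_def)
    show "alo \<le> as x \<and> as x \<le> ahi" if "x \<in> H" for x using as_bounds(2) that by (simp add: H_def)
    show "\<psi> k \<in> borel_measurable (lebesgue_on H)" for k using ar_data(2)[of k] by (simp add: Linf_def H_def)
    show "square_integrable (lebesgue_on H) f" using load unfolding H_def by (rule Lp_2_square_integrable)
    show "integrable PX (\<lambda>y. y $ k)" "(\<integral>y. y $ k \<partial>PX) = 0" for k
      unfolding laws by (rule parameter_law_centred[OF densities(1)])+
  qed (use as_bounds(1) K\<psi> PX(2) PY(2) in auto)
  have Z: "AE z in PY. z \<in> Z"
    using V_diffeo V_uniform AE_parameter_box[OF densities(2), folded laws(2)]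
    by eventually_elim (auto simp: Z_def good_map_def L_def)
  note fst_snd = AE_pair_fst_snd[OF Y.sigma_finite_measure_axioms, where P=PX]
  let ?Bd = "(parameter_box :: (real^'n) set) \<times> (parameter_box :: (real^'m) set)"
  have box: "bounded ?Bd" by (intro bounded_Times parameter_box_bounded)
  have AE_box: "AE w in PX \<Otimes>\<^sub>M PY. w \<in> ?Bd"
    using fst_snd(1)[OF AE_parameter_box[OF densities(1), folded laws(1)]] fst_snd(2)[OF AE_parameter_box[OF densities(2), folded laws(2)]]
    by eventually_elim auto
  have eq0: "A.wsol 0 y z v \<longleftrightarrow> weak_dirichlet_solution D (transported_coeff (V z) as) (transported_load (V z) f) v" for y z v
    by (simp add: A.wsol_def)
  have "AE (y, z) in PX \<Otimes>\<^sub>M PY. A.good_pt y z \<and> A.wsol 0 y z (u0 z)"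
    using fst_snd(2)[OF Z] fst_snd(2)[OF u0] ar_bound
  proof eventually_elim
    case (elim w)
    obtain y z where w: "w = (y, z)" by (cases w)
    have z: "z \<in> Z" and s: "weak_dirichlet_solution D (transported_coeff (V z) as) (transported_load (V z) f) (u0 z)"
      and b: "Linf_norm (V z ` D) (ar y) \<le> 1" using elim by (auto simp: w)
    have "AE x in lebesgue_on (V z ` D). \<bar>ar y x\<bar> \<le> 1"
      using esssup_AE[of "\<lambda>x. ereal \<bar>ar y x\<bar>" "lebesgue_on (V z ` D)"]
    proof eventually_elim
      case (elim x)
      then have "ereal \<bar>ar y x\<bar> \<le> 1" using b unfolding Linf_norm_def by (rule order_trans)
      then show ?case by (simp add: one_ereal_def)
    qed
    from good_map_pullback(3)[OF A.good[OF z] A.L this]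
    have "A.good_pt y z" using z by (simp add: A.good_pt_def A.ar_def ar)
    with s show ?case by (simp add: w eq0)
  qed
  from A.mean_variance_perturbation[OF box AE_box this]
  show ?thesis unfolding A.wsol_def A.ar_def ar Let_def .
qed

end
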